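(* Let $\mathbb K$ be a field and let $\mathfrak R$ be a nc rational function of $x_1,\ldots,x_d$ over $\mathbb K$. Let $s\in\mathbb N$ and $\underline Y=(Y_1,\ldots,Y_d)\in dom_s(\mathfrak R)$. Then there exists a unique (up to unique similarity) minimal nc Fornasini--Marchesini realization $\mathcal R$ of $\mathfrak R$ centred at $\underline Y$, described by some $(L;D,C,\underline{\mathbf A},\underline{\mathbf B})$, such that the following hold. (i) For every $m\in\mathbb N$, $dom_{sm}(\mathfrak R)=\Omega_{sm}(\mathcal R)$, and for every $\underline X=(X_1,\ldots,X_d)\in dom_{sm}(\mathfrak R)$, $$\mathfrak R(\underline X)=I_m\otimes D+(I_m\otimes C)\Big(I_{Lm}-\sum_{k=1}^d (X_k-I_m\otimes Y_k)\mathbf A_k\Big)^{-1}\sum_{k=1}^d (X_k-I_m\otimes Y_k)\mathbf B_k.$$ (ii) For every $n\in\mathbb N$, $dom_n(\mathfrak R)=\{\underline X\in(\mathbb K^{n\times n})^d: I_s\otimes\underline X\in\Omega_{sn}(\mathcal R)\}$, and $I_s\otimes\mathfrak R(\underline X)=\mathcal R(I_s\otimes\underline X)$ for every $\underline X\in dom_n(\mathfrak R)$. (iii) For every stably finite unital $\mathbb K$-algebra $\mathcal A$, $dom_{\mathcal A}^{Mat}(\mathfrak R)=\{\underline{\mathfrak a}\in\mathcal A^d: I_s\otimes\underline{\mathfrak a}\in\Omega_{\mathcal A}(\mathcal R)\}$, and $I_s\otimes\mathfrak R^{\mathcal A}(\underline{\mathfrak a})=\mathcal R^{\mathcal A}(I_s\otimes\underline{\mathfrak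 a})$ for every $\underline{\mathfrak a}\in dom_{\mathcal A}^{Mat}(\mathfrak R)$.
   Context: Rational expressions and functions. Nc rational expressions in $x_1,\ldots,x_d$ over $\mathbb K$ are the formal expressions obtained from nc polynomials in $\mathbb K\langle x_1,\ldots,x_d\rangle$ by successive additions, multiplications and inversions. $dom_n(R)$ is the set of $d$-tuples of $n\times n$ matrices over $\mathbb K$ at which all inverses occurring in $R$ exist; $dom(R)=\coprod_n dom_n(R)$; $R$ is non-degenerate if $dom(R)\neq\emptyset$. Expressions $R_1,R_2$ are equivalent if $R_1(\underline X)=R_2(\underline X)$ for all $\underline X\in dom(R_1)\cap dom(R_2)$. A nc rational function $\mathfrak R$ is an equivalence class of non-degenerate expressions; $dom(\mathfrak R)=\bigcup_{R\in\mathfrak R}dom(R)$, $dom_n(\mathfrak R)$ is its part of $n\times n$ matrices, and $\mathfrak R(\underline X)=R(\underline X)$ for any $R\in\mathfrak R$ with $\underline X\in dom(R)$. Tensor products. $P\otimes Q=[p_{ij}Q]$ (Kronecker), and $I_s\otimes\underline X=(I_s\otimes X_1,\ldots,I_s\otimes X_d)$; similarly over an algebra. Realizations. A nc Fornasini--Marchesini realization $\mathcal R$ centred at $\underline Y\in(\mathbb K^{s\times s})^d$, described by $(L;D,C,\underline{\mathbf A},\underline{\mathbf B})$, consists of an integer $L\in\mathbb N$, linear maps $\mathbf A_1,\ldots,\mathbf A_d:\mathbb K^{s\times s}\to\mathbb K^{L\times L}$, $\mathbf B_1,\ldots,\mathbf B_d:\mathbb K^{s\times s}\to\mathbb K^{L\times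 s}$, and matrices $C\in\mathbb K^{s\times L}$, $D\in\mathbb K^{s\times s}$. A linear map $\mathbf T$ on $\mathbb K^{s\times s}$ is extended to $X=[X_{ij}]_{1\le i,j\le m}\in\mathbb K^{sm\times sm}$ (with $s\times s$ blocks $X_{ij}$) by $(X)\mathbf T=[\mathbf T(X_{ij})]_{i,j}$. For $\underline X\in(\mathbb K^{sm\times sm})^d$ put $\Lambda_{\underline{\mathbf A},\underline Y}(\underline X)=I_{Lm}-\sum_k(X_k-I_m\otimes Y_k)\mathbf A_k$, $\Omega_{sm}(\mathcal R)=\{\underline X\in(\mathbb K^{sm\times sm})^d:\det\Lambda_{\underline{\mathbf A},\underline Y}(\underline X)\ne0\}$, and for $\underline X\in\Omega_{sm}(\mathcal R)$, $\mathcal R(\underline X)=I_m\otimes D+(I_m\otimes C)\Lambda_{\underline{\mathbf A},\underline Y}(\underline X)^{-1}\sum_k(X_k-I_m\otimes Y_k)\mathbf B_k$. $\mathcal R$ is a realization of $\mathfrak R$ if $dom_{sm}(\mathfrak R)\subseteq\Omega_{sm}(\mathcal R)$ and $\mathfrak R(\underline X)=\mathcal R(\underline X)$ for all $\underline X\in dom_{sm}(\mathfrak R)$, $m\in\mathbb N$; it is minimal if $L$ is the smallest integer for which $\mathfrak R$ admits such a realization centred at $\underline Y$. Two realizations $(L_i;D^i,C^i,\underline{\mathbf A}^i,\underline{\mathbf B}^i)$, $i=1,2$, centred at $\underline Y$ are uniquely similar if $L_1=L_2$, $D^1=D^2$ and there is a unique invertible $T\in\mathbb K^{L_1\times L_1}$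 with $C^2=C^1T^{-1}$, $\mathbf B^2_k(\cdot)=T\mathbf B^1_k(\cdot)$, $\mathbf A^2_k(\cdot)=T\mathbf A^1_k(\cdot)T^{-1}$ for all $k$. Algebras. Let $\mathcal A$ be a unital $\mathbb K$-algebra with unit $\mathbf 1_{\mathcal A}$. It is stably finite if for all $m\in\mathbb N$ and $\mathfrak A,\mathfrak B\in\mathcal A^{m\times m}$, $\mathfrak A\mathfrak B=I_m\otimes\mathbf 1_{\mathcal A}$ iff $\mathfrak B\mathfrak A=I_m\otimes\mathbf 1_{\mathcal A}$. A linear $\mathbf T:\mathbb K^{s\times s}\to\mathbb K^{p\times q}$ extends to $\mathbf T^{\mathcal A}:\mathcal A^{s\times s}\to\mathcal A^{p\times q}$ by $(\sum_{i,j}E_{ij}\otimes\mathfrak a_{ij})\mathbf T^{\mathcal A}=\sum_{i,j}\mathbf T(E_{ij})\otimes\mathfrak a_{ij}$, where $E_{ij}$ are the standard matrix units. Put $\Lambda^{\mathcal A}_{\underline{\mathbf A},\underline Y}(\underline{\mathfrak A})=I_L\otimes\mathbf 1_{\mathcal A}-\sum_k(\mathfrak A_k-Y_k\otimes\mathbf 1_{\mathcal A})\mathbf A_k^{\mathcal A}$ for $\underline{\mathfrak A}\in(\mathcal A^{s\times s})^d$; $\Omega_{\mathcal A}(\mathcal R)$ is the set of $\underline{\mathfrak A}$ for which this is invertible in $\mathcal A^{L\times L}$, and then $\mathcal R^{\mathcal A}(\underline{\mathfrak A})=D\otimes\mathbf 1_{\mathcal A}+(C\otimes\mathbf 1_{\mathcal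 A})\Lambda^{\mathcal A}_{\underline{\mathbf A},\underline Y}(\underline{\mathfrak A})^{-1}\sum_k(\mathfrak A_k-Y_k\otimes\mathbf 1_{\mathcal A})\mathbf B_k^{\mathcal A}$. Matrix domain. Matrix-valued nc rational expressions are built from matrices of nc polynomials by sums and products of matrices of compatible sizes, inversion of square matrix-valued expressions, and forming block matrices. $dom^{Mat}_{\mathcal A}(R)$ is the set of $\underline{\mathfrak a}\in\mathcal A^d$ at which all inverses occurring in $R$ exist over $\mathcal A$ (as inverses of square matrices over $\mathcal A$), and $R^{\mathcal A}(\underline{\mathfrak a})$ is then the natural evaluation. $dom^{Mat}_{\mathcal A}(\mathfrak R)$ is the set of $\underline{\mathfrak a}\in\mathcal A^d$ such that $\underline{\mathfrak a}\in dom^{Mat}_{\mathcal A}(R)$ for some $1\times1$ matrix-valued nc rational expression $R$ representing $\mathfrak R$ (i.e. $R$ is non-degenerate and agrees with $\mathfrak R$ on all tuples of matrices over $\mathbb K$ where both are defined); then $\mathfrak R^{\mathcal A}(\underline{\mathfrak a})=R^{\mathcal A}(\underline{\mathfrak a})$. *)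

theory Defs
  imports "Jordan_Normal_Form.Matrix" "Jordan_Normal_Form.Determinant"
begin

text \<open>
  Matrices are those of \<^theory>\<open>Jordan_Normal_Form.Matrix\<close>, so that sizes are ordinary natural
  numbers and entries may come from a noncommutative ring. The variables
  \<open>x\<^sub>1, \<dots>, x\<^sub>d\<close> are the elements of a finite type \<open>'d\<close>; a \<open>d\<close>-tuple is a function on \<open>'d\<close>.
\<close>

section \<open>Matrices\<close>

definition minv :: "'a::ring_1 mat \<Rightarrow> 'a mat" where
  "minv A = (THE B. inverts_mat A B \<and> inverts_mat B A)"

definition kron :: "'a::times mat \<Rightarrow> 'a mat \<Rightarrow> 'a mat" where
  "kron P Q = mat (dim_row P * dim_row Q) (dim_col P * dim_col Q)
     (\<lambda>(i, j). P $$ (i div dim_row Q, j div dim_col Q) * Q $$ (i mod dim_row Q, j mod dim_col Q))"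

definition msum :: "nat \<Rightarrow> nat \<Rightarrow> ('d::finite \<Rightarrow> 'a::comm_monoid_add mat) \<Rightarrow> 'a mat" where
  "msum p q M = mat p q (\<lambda>ij. \<Sum>k\<in>UNIV. M k $$ ij)"

definition tuples :: "nat \<Rightarrow> ('d \<Rightarrow> 'a mat) set" where
  "tuples n = {X. \<forall>k. X k \<in> carrier_mat n n}"

section \<open>Noncommutative rational expressions and functions\<close>

text \<open>Noncommutative polynomials are the inversion-free expressions.\<close>

datatype ('d, 'k) nc_expr =
    Const 'k
  | Var 'd
  | Add "('d, 'k) nc_expr" "('d, 'k) nc_expr"
  | Mul "('d, 'k) nc_expr" "('d, 'k) nc_expr"
  | Inv "('d, 'k) nc_expr"

primrec nc_eval :: "nat \<Rightarrow> ('d \<Rightarrow> 'k::field mat) \<Rightarrow> ('d, 'k) nc_expr \<Rightarrow> 'k mat" where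
  "nc_eval n X (Const c) = c \<cdot>\<^sub>m 1\<^sub>m n"
| "nc_eval n X (Var k) = X k"
| "nc_eval n X (Add e f) = nc_eval n X e + nc_eval n X f"
| "nc_eval n X (Mul e f) = nc_eval n X e * nc_eval n X f"
| "nc_eval n X (Inv e) = minv (nc_eval n X e)"

primrec nc_defined :: "nat \<Rightarrow> ('d \<Rightarrow> 'k::field mat) \<Rightarrow> ('d, 'k) nc_expr \<Rightarrow> bool" where
  "nc_defined n X (Const c) \<longleftrightarrow> True"
| "nc_defined n X (Var k) \<longleftrightarrow> True"
| "nc_defined n X (Add e f) \<longleftrightarrow> nc_defined n X e \<and> nc_defined n X f"
| "nc_defined n X (Mul e f) \<longleftrightarrow> nc_defined n X e \<and> nc_defined n X f"
| "nc_defined n X (Inv e) \<longleftrightarrow> nc_defined n X e \<and> invertible_mat (nc_eval n X e)"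

definition nc_dom :: "nat \<Rightarrow> ('d, 'k::field) nc_expr \<Rightarrow> ('d \<Rightarrow> 'k mat) set" where
  "nc_dom n e = {X \<in> tuples n. nc_defined n X e}"

text \<open>
  The size \<open>0\<close> has to be excluded: the empty matrix is invertible, so every expression is
  defined there.
\<close>

definition nc_nondegenerate :: "('d, 'k::field) nc_expr \<Rightarrow> bool" where
  "nc_nondegenerate e \<longleftrightarrow> (\<exists>n>0. nc_dom n e \<noteq> {})"

definition nc_equiv :: "(('d, 'k::field) nc_expr \<times> ('d, 'k) nc_expr) set" where
  "nc_equiv = {(e, f). nc_nondegenerate e \<and> nc_nondegenerate f \<and>
     (\<forall>n>0. \<forall>X \<in> nc_dom n e \<inter> nc_dom n f. nc_eval n X e = nc_eval n X f)}"

definition nc_rat_functions :: "('d, 'k::field) nc_expr set set" where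
  "nc_rat_functions = Collect nc_nondegenerate // nc_equiv"

definition rat_dom :: "nat \<Rightarrow> ('d, 'k::field) nc_expr set \<Rightarrow> ('d \<Rightarrow> 'k mat) set" where
  "rat_dom n r = (\<Union>e\<in>r. nc_dom n e)"

definition rat_val :: "nat \<Rightarrow> ('d, 'k::field) nc_expr set \<Rightarrow> ('d \<Rightarrow> 'k mat) \<Rightarrow> 'k mat" where
  "rat_val n r X = (THE v. \<exists>e\<in>r. X \<in> nc_dom n e \<and> v = nc_eval n X e)"

section \<open>Fornasini--Marchesini realizations centred at a matrix tuple\<close>

definition linear_mat_map :: "nat \<Rightarrow> nat \<Rightarrow> nat \<Rightarrow> ('k::field mat \<Rightarrow> 'k mat) \<Rightarrow> bool" where
  "linear_mat_map s p q T \<longleftrightarrow>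
     (\<forall>X \<in> carrier_mat s s. T X \<in> carrier_mat p q) \<and>
     (\<forall>X \<in> carrier_mat s s. \<forall>Y \<in> carrier_mat s s. T (X + Y) = T X + T Y) \<and>
     (\<forall>c. \<forall>X \<in> carrier_mat s s. T (c \<cdot>\<^sub>m X) = c \<cdot>\<^sub>m T X)"

record ('d, 'k) fm_realization =
  fm_L :: nat
  fm_D :: "'k mat"
  fm_C :: "'k mat"
  fm_A :: "'d \<Rightarrow> 'k mat \<Rightarrow> 'k mat"
  fm_B :: "'d \<Rightarrow> 'k mat \<Rightarrow> 'k mat"

definition fm_wf :: "nat \<Rightarrow> ('d, 'k::field) fm_realization \<Rightarrow> bool" where
  "fm_wf s R \<longleftrightarrow>
     fm_D R \<in> carrier_mat s s \<and> fm_C R \<in> carrier_mat s (fm_L R) \<and>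
     (\<forall>k. linear_mat_map s (fm_L R) (fm_L R) (fm_A R k)) \<and>
     (\<forall>k. linear_mat_map s (fm_L R) s (fm_B R k))"

text \<open>
  \<open>block_ext s p q m T X\<close> applies \<open>T\<close>, which sends \<open>s \<times> s\<close> to \<open>p \<times> q\<close> matrices, to each of the
  \<open>m \<times> m\<close> blocks of \<open>X\<close>.
\<close>

definition mblock :: "nat \<Rightarrow> 'a mat \<Rightarrow> nat \<Rightarrow> nat \<Rightarrow> 'a mat" where
  "mblock s X i j = mat s s (\<lambda>(a, b). X $$ (i * s + a, j * s + b))"

definition block_ext ::
    "nat \<Rightarrow> nat \<Rightarrow> nat \<Rightarrow> nat \<Rightarrow> ('k mat \<Rightarrow> 'k mat) \<Rightarrow> 'k mat \<Rightarrow> 'k mat" where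
  "block_ext s p q m T X = mat (p * m) (q * m)
     (\<lambda>(i, j). T (mblock s X (i div p) (j div q)) $$ (i mod p, j mod q))"

definition fm_Lambda ::
    "nat \<Rightarrow> nat \<Rightarrow> ('d::finite \<Rightarrow> 'k::field mat) \<Rightarrow> ('d, 'k) fm_realization \<Rightarrow> ('d \<Rightarrow> 'k mat) \<Rightarrow> 'k mat"
  where
  "fm_Lambda s m Y R X = 1\<^sub>m (fm_L R * m) -
     msum (fm_L R * m) (fm_L R * m)
       (\<lambda>k. block_ext s (fm_L R) (fm_L R) m (fm_A R k) (X k - kron (1\<^sub>m m) (Y k)))"

definition fm_Omega ::
    "nat \<Rightarrow> nat \<Rightarrow> ('d::finite \<Rightarrow> 'k::field mat) \<Rightarrow> ('d, 'k) fm_realization \<Rightarrow> ('d \<Rightarrow> 'k mat) set"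
  where
  "fm_Omega s m Y R = {X \<in> tuples (s * m). det (fm_Lambda s m Y R X) \<noteq> 0}"

definition fm_eval ::
    "nat \<Rightarrow> nat \<Rightarrow> ('d::finite \<Rightarrow> 'k::field mat) \<Rightarrow> ('d, 'k) fm_realization \<Rightarrow> ('d \<Rightarrow> 'k mat) \<Rightarrow> 'k mat"
  where
  "fm_eval s m Y R X = kron (1\<^sub>m m) (fm_D R) +
     kron (1\<^sub>m m) (fm_C R) * minv (fm_Lambda s m Y R X) *
     msum (fm_L R * m) (s * m)
       (\<lambda>k. block_ext s (fm_L R) s m (fm_B R k) (X k - kron (1\<^sub>m m) (Y k)))"

definition fm_realizes ::
    "nat \<Rightarrow> ('d::finite \<Rightarrow> 'k::field mat) \<Rightarrow> ('d, 'k) nc_expr set \<Rightarrow> ('d, 'k) fm_realization \<Rightarrow> bool"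
  where
  "fm_realizes s Y r R \<longleftrightarrow> fm_wf s R \<and>
     (\<forall>m>0. rat_dom (s * m) r \<subseteq> fm_Omega s m Y R \<and>
        (\<forall>X \<in> rat_dom (s * m) r. rat_val (s * m) r X = fm_eval s m Y R X))"

definition fm_minimal ::
    "nat \<Rightarrow> ('d::finite \<Rightarrow> 'k::field mat) \<Rightarrow> ('d, 'k) nc_expr set \<Rightarrow> ('d, 'k) fm_realization \<Rightarrow> bool"
  where
  "fm_minimal s Y r R \<longleftrightarrow> fm_realizes s Y r R \<and>
     (\<forall>R'. fm_realizes s Y r R' \<longrightarrow> fm_L R \<le> fm_L R')"

text \<open>
  Linear maps are compared on \<open>s \<times> s\<close> matrices only; their values elsewhere are irrelevant.
\<close>

definition uniquely_similar ::
    "nat \<Rightarrow> ('d, 'k::field) fm_realization \<Rightarrow> ('d, 'k) fm_realization \<Rightarrow> bool" where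
  "uniquely_similar s R1 R2 \<longleftrightarrow> fm_L R1 = fm_L R2 \<and> fm_D R1 = fm_D R2 \<and>
     (\<exists>!T. T \<in> carrier_mat (fm_L R1) (fm_L R1) \<and> invertible_mat T \<and>
        fm_C R2 = fm_C R1 * minv T \<and>
        (\<forall>k. \<forall>X \<in> carrier_mat s s.
           fm_B R2 k X = T * fm_B R1 k X \<and>
           fm_A R2 k X = T * fm_A R1 k X * minv T))"

section \<open>Evaluation over algebras\<close>

locale unital_algebra = vector_space scale
  for scale :: "'k::field \<Rightarrow> 'a::ring_1 \<Rightarrow> 'a" +
  assumes scale_mult_left: "scale c (x * y) = scale c x * y"
    and scale_mult_right: "scale c (x * y) = x * scale c y"

definition stably_finite :: "'a::ring_1 itself \<Rightarrow> bool" where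
  "stably_finite _ \<longleftrightarrow>
     (\<forall>m. \<forall>P \<in> carrier_mat m m. \<forall>Q \<in> carrier_mat m m.
        (P * Q = (1\<^sub>m m :: 'a mat)) \<longleftrightarrow> (Q * P = 1\<^sub>m m))"

definition unit_mat :: "nat \<Rightarrow> nat \<Rightarrow> nat \<Rightarrow> 'k::zero_neq_one mat" where
  "unit_mat s i j = mat s s (\<lambda>(a, b). if a = i \<and> b = j then 1 else 0)"

text \<open>\<open>scalar_mat scale P\<close> is \<open>P \<otimes> 1\<close>, with \<open>1\<close> the unit of the algebra.\<close>

definition scalar_mat :: "('k \<Rightarrow> 'a \<Rightarrow> 'a) \<Rightarrow> 'k mat \<Rightarrow> 'a::ring_1 mat" where
  "scalar_mat scale P = map_mat (\<lambda>c. scale c 1) P"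

definition alg_ext ::
    "('k::field \<Rightarrow> 'a \<Rightarrow> 'a) \<Rightarrow> nat \<Rightarrow> nat \<Rightarrow> nat \<Rightarrow> ('k mat \<Rightarrow> 'k mat) \<Rightarrow> 'a mat \<Rightarrow> 'a::ring_1 mat" where
  "alg_ext scale s p q T M = mat p q
     (\<lambda>uv. \<Sum>i<s. \<Sum>j<s. scale (T (unit_mat s i j) $$ uv) (M $$ (i, j)))"

definition alg_Lambda ::
    "('k::field \<Rightarrow> 'a \<Rightarrow> 'a) \<Rightarrow> nat \<Rightarrow> ('d::finite \<Rightarrow> 'k mat) \<Rightarrow> ('d, 'k) fm_realization \<Rightarrow>
     ('d \<Rightarrow> 'a mat) \<Rightarrow> 'a::ring_1 mat" where
  "alg_Lambda scale s Y R M = 1\<^sub>m (fm_L R) -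
     msum (fm_L R) (fm_L R)
       (\<lambda>k. alg_ext scale s (fm_L R) (fm_L R) (fm_A R k) (M k - scalar_mat scale (Y k)))"

definition alg_Omega ::
    "('k::field \<Rightarrow> 'a \<Rightarrow> 'a) \<Rightarrow> nat \<Rightarrow> ('d::finite \<Rightarrow> 'k mat) \<Rightarrow> ('d, 'k) fm_realization \<Rightarrow>
     ('d \<Rightarrow> 'a::ring_1 mat) set" where
  "alg_Omega scale s Y R = {M \<in> tuples s. invertible_mat (alg_Lambda scale s Y R M)}"

definition alg_eval ::
    "('k::field \<Rightarrow> 'a \<Rightarrow> 'a) \<Rightarrow> nat \<Rightarrow> ('d::finite \<Rightarrow> 'k mat) \<Rightarrow> ('d, 'k) fm_realization \<Rightarrow>
     ('d \<Rightarrow> 'a mat) \<Rightarrow> 'a::ring_1 mat" where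
  "alg_eval scale s Y R M = scalar_mat scale (fm_D R) +
     scalar_mat scale (fm_C R) * minv (alg_Lambda scale s Y R M) *
     msum (fm_L R) s
       (\<lambda>k. alg_ext scale s (fm_L R) s (fm_B R k) (M k - scalar_mat scale (Y k)))"

section \<open>Matrix-valued expressions and the matrix domain\<close>

text \<open>
  Matrices of polynomials and general block matrices arise from \<open>1 \<times> 1\<close> expressions by
  \<open>MRow\<close> (two blocks side by side) and \<open>MCol\<close> (two blocks on top of each other).
\<close>

datatype ('d, 'k) mat_expr =
    MConst 'k
  | MVar 'd
  | MAdd "('d, 'k) mat_expr" "('d, 'k) mat_expr"
  | MMul "('d, 'k) mat_expr" "('d, 'k) mat_expr"
  | MInv "('d, 'k) mat_expr"
  | MRow "('d, 'k) mat_expr" "('d, 'k) mat_expr"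
  | MCol "('d, 'k) mat_expr" "('d, 'k) mat_expr"

inductive has_size :: "('d, 'k) mat_expr \<Rightarrow> nat \<Rightarrow> nat \<Rightarrow> bool" where
  "has_size (MConst c) 1 1"
| "has_size (MVar k) 1 1"
| "has_size e p q \<Longrightarrow> has_size f p q \<Longrightarrow> has_size (MAdd e f) p q"
| "has_size e p q \<Longrightarrow> has_size f q r \<Longrightarrow> has_size (MMul e f) p r"
| "has_size e p p \<Longrightarrow> has_size (MInv e) p p"
| "has_size e p q \<Longrightarrow> has_size f p r \<Longrightarrow> has_size (MRow e f) p (q + r)"
| "has_size e p q \<Longrightarrow> has_size f r q \<Longrightarrow> has_size (MCol e f) (p + r) q"

text \<open>
  An expression of size \<open>p \<times> q\<close> is evaluated at a tuple \<open>X\<close> of \<open>n \<times> n\<close> matrices over a ring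
  \<open>'a\<close> into which \<open>\<iota>\<close> maps the scalars; the value has \<open>p \<times> q\<close> blocks of size \<open>n \<times> n\<close>. This covers
  tuples of \<open>n \<times> n\<close> matrices over the field (\<open>\<iota>\<close> the identity) as well as tuples of elements
  of an algebra (\<open>n = 1\<close> and \<open>\<iota> c\<close> the \<open>c\<close>-fold of the unit).
\<close>

primrec mx_eval ::
    "('k \<Rightarrow> 'a) \<Rightarrow> nat \<Rightarrow> ('d \<Rightarrow> 'a mat) \<Rightarrow> ('d, 'k) mat_expr \<Rightarrow> 'a::ring_1 mat" where
  "mx_eval \<iota> n X (MConst c) = \<iota> c \<cdot>\<^sub>m 1\<^sub>m n"
| "mx_eval \<iota> n X (MVar k) = X k"
| "mx_eval \<iota> n X (MAdd e f) = mx_eval \<iota> n X e + mx_eval \<iota> n X f"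
| "mx_eval \<iota> n X (MMul e f) = mx_eval \<iota> n X e * mx_eval \<iota> n X f"
| "mx_eval \<iota> n X (MInv e) = minv (mx_eval \<iota> n X e)"
| "mx_eval \<iota> n X (MRow e f) =
     four_block_mat (mx_eval \<iota> n X e) (mx_eval \<iota> n X f)
       (0\<^sub>m 0 (dim_col (mx_eval \<iota> n X e))) (0\<^sub>m 0 (dim_col (mx_eval \<iota> n X f)))"
| "mx_eval \<iota> n X (MCol e f) = mx_eval \<iota> n X e @\<^sub>r mx_eval \<iota> n X f"

primrec mx_defined ::
    "('k \<Rightarrow> 'a::ring_1) \<Rightarrow> nat \<Rightarrow> ('d \<Rightarrow> 'a mat) \<Rightarrow> ('d, 'k) mat_expr \<Rightarrow> bool" where
  "mx_defined \<iota> n X (MConst c) \<longleftrightarrow> True"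
| "mx_defined \<iota> n X (MVar k) \<longleftrightarrow> True"
| "mx_defined \<iota> n X (MAdd e f) \<longleftrightarrow> mx_defined \<iota> n X e \<and> mx_defined \<iota> n X f"
| "mx_defined \<iota> n X (MMul e f) \<longleftrightarrow> mx_defined \<iota> n X e \<and> mx_defined \<iota> n X f"
| "mx_defined \<iota> n X (MInv e) \<longleftrightarrow> mx_defined \<iota> n X e \<and> invertible_mat (mx_eval \<iota> n X e)"
| "mx_defined \<iota> n X (MRow e f) \<longleftrightarrow> mx_defined \<iota> n X e \<and> mx_defined \<iota> n X f"
| "mx_defined \<iota> n X (MCol e f) \<longleftrightarrow> mx_defined \<iota> n X e \<and> mx_defined \<iota> n X f"

definition mx_dom :: "nat \<Rightarrow> ('d, 'k::field) mat_expr \<Rightarrow> ('d \<Rightarrow> 'k mat) set" where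
  "mx_dom n e = {X \<in> tuples n. mx_defined (\<lambda>c. c) n X e}"

definition mx_represents :: "('d, 'k::field) mat_expr \<Rightarrow> ('d, 'k) nc_expr set \<Rightarrow> bool" where
  "mx_represents e r \<longleftrightarrow> has_size e 1 1 \<and> (\<exists>n>0. mx_dom n e \<noteq> {}) \<and>
     (\<forall>n>0. \<forall>X \<in> mx_dom n e \<inter> rat_dom n r. mx_eval (\<lambda>c. c) n X e = rat_val n r X)"

definition alg_mx_defined ::
    "('k \<Rightarrow> 'a \<Rightarrow> 'a) \<Rightarrow> ('d \<Rightarrow> 'a::ring_1) \<Rightarrow> ('d, 'k) mat_expr \<Rightarrow> bool" where
  "alg_mx_defined scale a e \<longleftrightarrow> mx_defined (\<lambda>c. scale c 1) 1 (\<lambda>k. mat 1 1 (\<lambda>_. a k)) e"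

definition alg_mx_eval ::
    "('k \<Rightarrow> 'a \<Rightarrow> 'a) \<Rightarrow> ('d \<Rightarrow> 'a::ring_1) \<Rightarrow> ('d, 'k) mat_expr \<Rightarrow> 'a mat" where
  "alg_mx_eval scale a e = mx_eval (\<lambda>c. scale c 1) 1 (\<lambda>k. mat 1 1 (\<lambda>_. a k)) e"

definition alg_rat_dom ::
    "('k::field \<Rightarrow> 'a \<Rightarrow> 'a) \<Rightarrow> ('d, 'k) nc_expr set \<Rightarrow> ('d \<Rightarrow> 'a::ring_1) set" where
  "alg_rat_dom scale r = {a. \<exists>e. mx_represents e r \<and> alg_mx_defined scale a e}"

definition alg_rat_val ::
    "('k::field \<Rightarrow> 'a \<Rightarrow> 'a) \<Rightarrow> ('d, 'k) nc_expr set \<Rightarrow> ('d \<Rightarrow> 'a::ring_1) \<Rightarrow> 'a" where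
  "alg_rat_val scale r a =
     (THE v. \<exists>e. mx_represents e r \<and> alg_mx_defined scale a e \<and> v = alg_mx_eval scale a e $$ (0, 0))"

end

theory Submission
  imports Defs
begin

text \<open>
  A rational expression is linearized: it is the value \<open>c P\<^sup>-\<^sup>1 b\<close> of an affine pencil
  \<open>P = M\<^sub>0 + \<Sum>\<^sub>k M\<^sub>k x\<^sub>k\<close> which is invertible wherever the expression is defined, over the field and over
  every algebra. Centred at \<open>Y\<close>, a pencil is a linear system, and the moments of this system are
  blocks of the values of the expression at nilpotent perturbations of \<open>I \<otimes> Y\<close>. A pencil of least size
  with given moments is reachable and observable; every other pencil with these moments then restricts
  to its reachable states and maps onto the minimal one, so that over a stably finite algebra the
  minimal pencil is invertible wherever the other one is. Two expressions for the same function have a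
  common regular point; comparing their moments there shows that the minimal pencil of the function
  dominates all its representations, by scalar as well as by matrix-valued expressions.

  Conversely, where the minimal pencil is invertible its inverse is a polynomial in it, and block
  elimination turns this polynomial into an expression which is defined at the given point. So the
  domain of the function is exactly the regular set of its minimal pencil. Compressing the associated
  Fornasini--Marchesini realization to its reachable states gives the minimal realization, and
  \<open>det (1 - P Q) = 0\<close> iff \<open>det (1 - Q P) = 0\<close> shows that its regular set is the same one.
\<close>


section \<open>Matrices over a ring\<close>

text \<open>Several obstacles shape the proof. Cutting a system down to its reachable or observable
  states destroys the shape \<open>M_k\<close> \<otimes> \<open>E_ab\<close> that its coefficients
  have when it comes from a pencil centred at Y. So a pencil is shrunk in its left Kronecker factor
  only, and it has to be shown that least size there already forces all states to be observable;
  transposition then gives reachability. Over a finite field a generic scalar on the line joining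
  two points need not exist, so the scalar is replaced by a companion matrix, at the price of larger
  tuples. The size of a tuple need not be a multiple of s; X \<otimes> I_s repairs this without
  changing whether a pencil is invertible. Finally, the input of a pencil is constant, whereas the
  input of a Fornasini-Marchesini realization vanishes at Y: there only the images of the state maps
  are reachable, so even a minimal pencil may give too large a realization, and a second compression
  is required.\<close>

lemma mult_assoc_dim:
  fixes A :: "'a::semiring_0 mat"
  assumes "dim_col A = dim_row B" "dim_col B = dim_row C"
  shows "A * B * C = A * (B * C)"
  using assms by (intro assoc_mult_mat[of _ "dim_row A" "dim_row B" _ "dim_row C" _ "dim_col C"]) auto

lemma mult_add_dim:
  fixes A :: "'a::semiring_0 mat"
  assumes "dim_col A = dim_row B" "dim_row B = dim_row C" "dim_col B = dim_col C"
  shows "A * (B + C) = A * B + A * C"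
  using assms by (intro mult_add_distrib_mat[of _ "dim_row A" "dim_row B" _ "dim_col C"]) auto

lemma add_mult_dim:
  fixes A :: "'a::semiring_0 mat"
  assumes "dim_row A = dim_row B" "dim_col A = dim_col B" "dim_col A = dim_row C"
  shows "(A + B) * C = A * C + B * C"
  using assms by (intro add_mult_distrib_mat[of _ "dim_row A" "dim_row C" _ _ "dim_col C"]) auto

lemma mult_minus_dim:
  fixes A :: "'a::ring mat"
  assumes "dim_col A = dim_row B" "dim_row B = dim_row C" "dim_col B = dim_col C"
  shows "A * (B - C) = A * B - A * C"
  using assms by (intro mult_minus_distrib_mat[of _ "dim_row A" "dim_row B" _ "dim_col C"]) auto

lemma minus_mult_dim:
  fixes A :: "'a::ring mat"
  assumes "dim_row A = dim_row B" "dim_col A = dim_col B" "dim_col A = dim_row C"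
  shows "(A - B) * C = A * C - B * C"
  using assms by (intro minus_mult_distrib_mat[of _ "dim_row A" "dim_row C" _ _ "dim_col C"]) auto

lemma uminus_mult_dim:
  fixes A :: "'a::ring mat"
  assumes "dim_col A = dim_row C"
  shows "(- A) * C = - (A * C)"
  using assms by (intro uminus_mult_left_mat) auto

lemma mult_uminus_dim:
  fixes A :: "'a::ring mat"
  assumes "dim_col A = dim_row C"
  shows "A * (- C) = - (A * C)"
  using assms by (intro uminus_mult_right_mat) auto

lemma one_mult_dim: "dim_row A = n \<Longrightarrow> 1\<^sub>m n * A = (A :: 'a::semiring_1 mat)"
  by (intro left_mult_one_mat') auto

lemma mult_one_dim: "dim_col A = n \<Longrightarrow> A * 1\<^sub>m n = (A :: 'a::semiring_1 mat)"
  by (intro right_mult_one_mat') auto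

lemma zero_mult_dim: "dim_row A = n \<Longrightarrow> 0\<^sub>m m n * A = (0\<^sub>m m (dim_col A) :: 'a::semiring_0 mat)"
  by (intro left_mult_zero_mat) auto

lemma mult_zero_dim: "dim_col A = n \<Longrightarrow> A * 0\<^sub>m n m = (0\<^sub>m (dim_row A) m :: 'a::semiring_0 mat)"
  by (intro right_mult_zero_mat) auto

text \<open>Sizes enter as equations between dimensions, because a carrier premise would mention
  sizes that do not occur in the equation itself. Together the rules expand a product into a sum of
  right-nested products.\<close>

lemmas mat_algebra = mult_assoc_dim mult_add_dim add_mult_dim mult_minus_dim minus_mult_dim
  uminus_mult_dim mult_uminus_dim one_mult_dim mult_one_dim zero_mult_dim mult_zero_dim

section \<open>Two-sided inverses over a noncommutative ring\<close>

lemma invertible_matI: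
  assumes "A \<in> carrier_mat n n" "A * B = 1\<^sub>m n" "B * A = 1\<^sub>m n"
  shows "invertible_mat A"
proof -
  have "dim_row B = n" using assms(3) by (metis index_mult_mat(2) index_one_mat(2))
  then show ?thesis
    using assms unfolding invertible_mat_def inverts_mat_def by auto
qed

lemma invertible_matE:
  assumes "invertible_mat A" "A \<in> carrier_mat n n"
  obtains B where "B \<in> carrier_mat n n" "A * B = 1\<^sub>m n" "B * A = 1\<^sub>m n"
proof -
  from assms obtain B where B: "A * B = 1\<^sub>m n" "B * A = 1\<^sub>m (dim_row B)"
    unfolding invertible_mat_def inverts_mat_def by auto
  then have "dim_col B = n" "dim_row B = n"
    using assms(2) by (metis index_mult_mat(3) index_one_mat(3), metis index_mult_mat(3) index_one_mat(3) carrier_matD(2))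
  with B that[of B] show ?thesis by auto
qed

text \<open>The description in \<open>minv\<close> ranges over matrices of every size, so the size
  of a competitor has to be deduced from the two products before the usual uniqueness argument
  applies.\<close>

lemma minv_eqI:
  fixes A :: "'a::ring_1 mat"
  assumes "A \<in> carrier_mat n n" "B \<in> carrier_mat n n" "A * B = 1\<^sub>m n" "B * A = 1\<^sub>m n"
  shows "minv A = B"
  unfolding minv_def
proof (rule the_equality)
  show "inverts_mat A B \<and> inverts_mat B A"
    using assms unfolding inverts_mat_def by auto
next
  fix C assume C: "inverts_mat A C \<and> inverts_mat C A"
  then have CA: "A * C = 1\<^sub>m n" "C * A = 1\<^sub>m (dim_row C)"
    using assms unfolding inverts_mat_def by auto
  then have d: "dim_col C = n" "dim_row C = n"
    using assms(1) by (metis index_mult_mat(3) index_one_mat(3), metis index_mult_mat(3) index_one_mat(3) carrier_matD(2))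
  have "C = C * (A * B)" using d assms by (simp add: mult_one_dim)
  also have "\<dots> = (C * A) * B" using d assms by (simp add: mult_assoc_dim)
  also have "\<dots> = B" using CA d assms by (simp add: one_mult_dim)
  finally show "C = B" .
qed

lemma minv_inverse:
  fixes A :: "'a::ring_1 mat"
  assumes "invertible_mat A" "A \<in> carrier_mat n n"
  shows "minv A \<in> carrier_mat n n" "A * minv A = 1\<^sub>m n" "minv A * A = 1\<^sub>m n"
proof -
  obtain B where B: "B \<in> carrier_mat n n" "A * B = 1\<^sub>m n" "B * A = 1\<^sub>m n"
    using invertible_matE[OF assms] .
  then have "minv A = B" using assms minv_eqI by blast
  with B show "minv A \<in> carrier_mat n n" "A * minv A = 1\<^sub>m n" "minv A * A = 1\<^sub>m n" by auto
qed

lemma invertible_mult: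
  fixes A :: "'a::ring_1 mat"
  assumes A: "invertible_mat A" "A \<in> carrier_mat n n" and B: "invertible_mat B" "B \<in> carrier_mat n n"
  shows "invertible_mat (A * B)"
proof -
  note a = minv_inverse[OF A] and b = minv_inverse[OF B]
  have "A * B * (minv B * minv A) = A * ((B * minv B) * minv A)"
    using a(1) b(1) A(2) B(2) by (simp add: mult_assoc_dim)
  also have "\<dots> = 1\<^sub>m n" using a b A(2) by (simp add: one_mult_dim)
  finally have 1: "A * B * (minv B * minv A) = 1\<^sub>m n" .
  have "minv B * minv A * (A * B) = minv B * ((minv A * A) * B)"
    using a(1) b(1) A(2) B(2) by (simp add: mult_assoc_dim)
  also have "\<dots> = 1\<^sub>m n" using a b B(2) by (simp add: one_mult_dim)
  finally show ?thesis using 1 A(2) B(2) by (intro invertible_matI) auto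
qed

lemma invertible_one: "invertible_mat (1\<^sub>m n :: 'a::ring_1 mat)"
  by (rule invertible_matI[of _ n "1\<^sub>m n"]) auto

lemma invertible_minv:
  fixes A :: "'a::ring_1 mat"
  assumes "invertible_mat A" "A \<in> carrier_mat n n"
  shows "invertible_mat (minv A)"
  using minv_inverse[OF assms] assms by (intro invertible_matI[of _ n A]) auto

lemma stably_finite_inverse:
  fixes A :: "'a::ring_1 mat"
  assumes "stably_finite TYPE('a)" "A \<in> carrier_mat n n" "B \<in> carrier_mat n n" "A * B = 1\<^sub>m n"
  shows "B * A = 1\<^sub>m n"
  using assms unfolding stably_finite_def by blast

text \<open>The transfer of invertibility between systems over an algebra constructs one-sided
  inverses; this is the step that makes them two-sided.\<close>

lemma stably_finite_invertible:
  fixes A :: "'a::ring_1 mat"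
  assumes "stably_finite TYPE('a)" "A \<in> carrier_mat n n" "B \<in> carrier_mat n n"
    "A * B = 1\<^sub>m n \<or> B * A = 1\<^sub>m n"
  shows "invertible_mat A"
  using assms stably_finite_inverse by (intro invertible_matI[of A n B]) blast+

lemma stably_finite_field: "stably_finite TYPE('k::field)"
  unfolding stably_finite_def using mat_mult_left_right_inverse by blast

lemma invertible_mat_iff_det:
  fixes A :: "'k::field mat"
  assumes A: "A \<in> carrier_mat n n"
  shows "invertible_mat A \<longleftrightarrow> det A \<noteq> 0"
proof
  assume "invertible_mat A"
  then obtain B where "B \<in> carrier_mat n n" "A * B = 1\<^sub>m n" using invertible_matE[OF _ A] by blast
  then have "det A * det B = 1" using det_mult[OF A] det_one by metis
  then show "det A \<noteq> 0" by auto
next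
  assume d: "det A \<noteq> 0"
  have "A * ((1 / det A) \<cdot>\<^sub>m adj_mat A) = (1 / det A) \<cdot>\<^sub>m (A * adj_mat A)"
    using A adj_mat(1)[OF A] by (intro mult_smult_distrib) auto
  also have "\<dots> = 1\<^sub>m n" using adj_mat(2)[OF A] d by (intro eq_matI) auto
  finally show "invertible_mat A"
    using A adj_mat(1)[OF A] by (intro stably_finite_invertible[OF stably_finite_field A, of "(1 / det A) \<cdot>\<^sub>m adj_mat A"]) auto
qed

subsection \<open>Sums of matrices\<close>

text \<open>Matrices of all sizes share one type, which has no common zero for an empty sum; hence
  the size is an explicit parameter and the sum is taken entrywise.\<close>

definition matsum :: "'i set \<Rightarrow> nat \<Rightarrow> nat \<Rightarrow> ('i \<Rightarrow> 'a::comm_monoid_add mat) \<Rightarrow> 'a mat" where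
  "matsum I p q F = mat p q (\<lambda>ij. \<Sum>\<alpha>\<in>I. F \<alpha> $$ ij)"

lemma msum_matsum: "msum p q M = matsum UNIV p q M"
  by (simp add: msum_def matsum_def)

lemma matsum_carrier [simp]: "matsum I p q F \<in> carrier_mat p q"
  by (simp add: matsum_def)

lemma matsum_dim [simp]: "dim_row (matsum I p q F) = p" "dim_col (matsum I p q F) = q"
  by (simp_all add: matsum_def)

lemma matsum_index [simp]:
  "i < p \<Longrightarrow> j < q \<Longrightarrow> matsum I p q F $$ (i, j) = (\<Sum>\<alpha>\<in>I. F \<alpha> $$ (i, j))"
  by (simp add: matsum_def)

lemma matsum_cong:
  "(\<And>\<alpha>. \<alpha> \<in> I \<Longrightarrow> F \<alpha> = G \<alpha>) \<Longrightarrow> matsum I p q F = matsum I p q G"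
  by (simp add: matsum_def)

lemma matsum_mult_left:
  fixes A :: "'a::semiring_0 mat"
  assumes "A \<in> carrier_mat r p" "\<And>\<alpha>. \<alpha> \<in> I \<Longrightarrow> F \<alpha> \<in> carrier_mat p q"
  shows "A * matsum I p q F = matsum I r q (\<lambda>\<alpha>. A * F \<alpha>)" (is "?l = ?r")
proof (rule eq_matI)
  fix i j assume ij: "i < dim_row ?r"
    "j < dim_col ?r"
  have "?l $$ (i, j) = (\<Sum>l<p. A $$ (i, l) * (\<Sum>\<alpha>\<in>I. F \<alpha> $$ (l, j)))"
    using ij assms(1) by (simp add: scalar_prod_def atLeast0LessThan)
  also have "\<dots> = (\<Sum>\<alpha>\<in>I. \<Sum>l<p. A $$ (i, l) * F \<alpha> $$ (l, j))"
    by (simp add: sum_distrib_left sum.swap[of _ "{..<p}"])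
  also have "\<dots> = (\<Sum>\<alpha>\<in>I. (A * F \<alpha>) $$ (i, j))"
    using ij assms by (intro sum.cong) (auto simp: scalar_prod_def atLeast0LessThan dest!: assms(2))
  finally show "?l $$ (i, j) = ?r $$ (i, j)"
    using ij by simp
qed (use assms in auto)

lemma matsum_mult_right:
  fixes A :: "'a::semiring_0 mat"
  assumes "A \<in> carrier_mat q r" "\<And>\<alpha>. \<alpha> \<in> I \<Longrightarrow> F \<alpha> \<in> carrier_mat p q"
  shows "matsum I p q F * A = matsum I p r (\<lambda>\<alpha>. F \<alpha> * A)" (is "?l = ?r")
proof (rule eq_matI)
  fix i j assume ij: "i < dim_row ?r"
    "j < dim_col ?r"
  have "?l $$ (i, j) = (\<Sum>l<q. (\<Sum>\<alpha>\<in>I. F \<alpha> $$ (i, l)) * A $$ (l, j))"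
    using ij assms(1) by (simp add: scalar_prod_def atLeast0LessThan)
  also have "\<dots> = (\<Sum>\<alpha>\<in>I. \<Sum>l<q. F \<alpha> $$ (i, l) * A $$ (l, j))"
    by (simp add: sum_distrib_right sum.swap[of _ "{..<q}"])
  also have "\<dots> = (\<Sum>\<alpha>\<in>I. (F \<alpha> * A) $$ (i, j))"
    using ij assms by (intro sum.cong) (auto simp: scalar_prod_def atLeast0LessThan dest!: assms(2))
  finally show "?l $$ (i, j) = ?r $$ (i, j)"
    using ij by simp
qed (use assms in auto)

lemma matsum_delta:
  fixes F :: "'i \<Rightarrow> 'a::comm_monoid_add mat"
  assumes "finite I" "k \<in> I" "F k \<in> carrier_mat p q"
    and "\<And>\<alpha>. \<alpha> \<in> I \<Longrightarrow> \<alpha> \<noteq> k \<Longrightarrow> F \<alpha> = 0\<^sub>m p q"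
  shows "matsum I p q F = F k"
proof (rule eq_matI)
  fix i j assume "i < dim_row (F k)" "j < dim_col (F k)"
  then have ij: "i < p" "j < q" using assms(3) by auto
  have "(\<Sum>\<alpha>\<in>I. F \<alpha> $$ (i, j)) = (\<Sum>\<alpha>\<in>I. if \<alpha> = k then F k $$ (i, j) else 0)"
    using assms(4) ij by (intro sum.cong) auto
  then show "matsum I p q F $$ (i, j) = F k $$ (i, j)"
    using assms(1,2) ij by simp
qed (use assms in auto)

lemma matsum_zero:
  "(\<And>\<alpha>. \<alpha> \<in> I \<Longrightarrow> F \<alpha> = 0\<^sub>m p q) \<Longrightarrow> matsum I p q F = 0\<^sub>m p q"
  by (intro eq_matI) auto

lemma matsum_lessThan_Suc:
  "matsum {..<Suc n} p q F = matsum {..<n} p q F + F n" if "F n \<in> carrier_mat p q"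
  using that by (intro eq_matI) auto

subsection \<open>Block matrices and Kronecker products\<close>

lemma sum_lessThan_mult:
  fixes f :: "nat \<Rightarrow> 'a::comm_monoid_add"
  shows "(\<Sum>l<q * c. f l) = (\<Sum>j<q. \<Sum>a<c. f (j * c + a))"
proof -
  have "(\<Sum>l<q * c. f l) = (\<Sum>j<q. sum f {j * c..<j * c + c})"
    by (rule sum.nat_group[symmetric])
  also have "\<dots> = (\<Sum>j<q. \<Sum>a<c. f (j * c + a))"
  proof (rule sum.cong[OF refl])
    fix j
    show "sum f {j * c..<j * c + c} = (\<Sum>a<c. f (j * c + a))"
      using sum.shift_bounds_nat_ivl[of f 0 "j * c" c] by (simp add: atLeast0LessThan add.commute)
  qed
  finally show ?thesis .
qed

lemma block_index_less: "i < p \<Longrightarrow> a < r \<Longrightarrow> i * r + a < p * (r::nat)"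
proof -
  assume "i < p" "a < r"
  then have "i * r + a < Suc i * r" by simp
  also have "\<dots> \<le> p * r" using \<open>i < p\<close> by (intro mult_le_mono1) simp
  finally show ?thesis .
qed

lemma block_div_less: "(l::nat) < p * r \<Longrightarrow> l div r < p" "(l::nat) < p * r \<Longrightarrow> l mod r < r"
  by (simp add: less_mult_imp_div_less, metis mod_less_divisor mult_0_right not_gr_zero not_less_zero)

definition bmat :: "nat \<Rightarrow> nat \<Rightarrow> nat \<Rightarrow> nat \<Rightarrow> (nat \<Rightarrow> nat \<Rightarrow> 'a mat) \<Rightarrow> 'a mat" where
  "bmat p q r c F = mat (p * r) (q * c) (\<lambda>(i, j). F (i div r) (j div c) $$ (i mod r, j mod c))"

lemma bmat_carrier [simp]: "bmat p q r c F \<in> carrier_mat (p * r) (q * c)"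
  by (simp add: bmat_def)

lemma bmat_dim [simp]: "dim_row (bmat p q r c F) = p * r" "dim_col (bmat p q r c F) = q * c"
  by (simp_all add: bmat_def)

lemma bmat_index:
  "i < p \<Longrightarrow> a < r \<Longrightarrow> j < q \<Longrightarrow> b < c \<Longrightarrow> bmat p q r c F $$ (i * r + a, j * c + b) = F i j $$ (a, b)"
  by (simp add: bmat_def block_index_less)

lemma bmat_cong:
  assumes "\<And>i j. i < p \<Longrightarrow> j < q \<Longrightarrow> F i j = G i j"
  shows "bmat p q r c F = bmat p q r c G"
  by (rule eq_matI) (auto simp: bmat_def assms block_div_less)

lemma bmat_eqI:
  assumes "A \<in> carrier_mat (p * r) (q * c)"
    and "\<And>i a j b. i < p \<Longrightarrow> a < r \<Longrightarrow> j < q \<Longrightarrow> b < c \<Longrightarrow> A $$ (i * r + a, j * c + b) = B $$ (i * r + a, j * c + b)"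
    and "B \<in> carrier_mat (p * r) (q * c)"
  shows "A = B"
proof (rule eq_matI)
  fix i j assume "i < dim_row B" "j < dim_col B"
  then have ij: "i < p * r" "j < q * c" using assms(3) by auto
  have "A $$ (i div r * r + i mod r, j div c * c + j mod c) =
    B $$ (i div r * r + i mod r, j div c * c + j mod c)"
    by (rule assms(2)) (use ij in \<open>simp_all add: block_div_less\<close>)
  then show "A $$ (i, j) = B $$ (i, j)" by simp
qed (use assms in auto)

lemma bmat_mult:
  fixes F :: "nat \<Rightarrow> nat \<Rightarrow> 'a::semiring_0 mat"
  assumes "\<And>i j. i < p \<Longrightarrow> j < q \<Longrightarrow> F i j \<in> carrier_mat r c"
    and "\<And>j k. j < q \<Longrightarrow> k < t \<Longrightarrow> G j k \<in> carrier_mat c d"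
  shows "bmat p q r c F * bmat q t c d G =
    bmat p t r d (\<lambda>i k. matsum {..<q} r d (\<lambda>j. F i j * G j k))" (is "?l = ?r")
proof (rule bmat_eqI)
  fix i a k b assume *: "i < p" "a < r" "k < t" "b < d"
  have "?l $$ (i * r + a, k * d + b) =
    (\<Sum>l<q * c. bmat p q r c F $$ (i * r + a, l) * bmat q t c d G $$ (l, k * d + b))"
    using * by (simp add: scalar_prod_def atLeast0LessThan block_index_less)
  also have "\<dots> = (\<Sum>j<q. \<Sum>e<c. F i j $$ (a, e) * G j k $$ (e, b))"
    unfolding sum_lessThan_mult by (intro sum.cong refl) (simp add: bmat_index *)
  also have "\<dots> = (\<Sum>j<q. (F i j * G j k) $$ (a, b))"
  proof (rule sum.cong[OF refl])
    fix j assume "j \<in> {..<q}"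
    then have "F i j \<in> carrier_mat r c" "G j k \<in> carrier_mat c d" using assms * by auto
    then show "(\<Sum>e<c. F i j $$ (a, e) * G j k $$ (e, b)) = (F i j * G j k) $$ (a, b)"
      using * by (simp add: scalar_prod_def atLeast0LessThan)
  qed
  finally show "?l $$ (i * r + a, k * d + b) = ?r $$ (i * r + a, k * d + b)"
    using * by (simp add: bmat_index)
qed auto

lemma kron_bmat:
  "kron P Q = bmat (dim_row P) (dim_col P) (dim_row Q) (dim_col Q) (\<lambda>i j. P $$ (i, j) \<cdot>\<^sub>m Q)"
  by (rule eq_matI) (auto simp: kron_def bmat_def block_div_less)

lemma kron_dim [simp]: "dim_row (kron P Q) = dim_row P * dim_row Q" "dim_col (kron P Q) = dim_col P * dim_col Q"
  by (simp_all add: kron_def)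

lemma kron_carrier [intro]:
  "P \<in> carrier_mat p q \<Longrightarrow> Q \<in> carrier_mat r c \<Longrightarrow> kron P Q \<in> carrier_mat (p * r) (q * c)"
  by auto

lemma kron_index:
  assumes "P \<in> carrier_mat p q" "Q \<in> carrier_mat r c" "i < p" "a < r" "j < q" "b < c"
  shows "kron P Q $$ (i * r + a, j * c + b) = P $$ (i, j) * Q $$ (a, b)"
  using assms by (auto simp: kron_bmat bmat_index)

text \<open>Over a noncommutative ring the mixed product rule only needs the entries of the two
  inner factors \<open>B\<close> and \<open>C\<close> to commute with each other, since those are
  the entries that change places.\<close>

lemma kron_mult_commuting:
  fixes A B C D :: "'a::semiring_0 mat"
  assumes "A \<in> carrier_mat p q" "B \<in> carrier_mat r c" "C \<in> carrier_mat q t" "D \<in> carrier_mat c d"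
    and comm: "\<And>a e j k. a < r \<Longrightarrow> e < c \<Longrightarrow> j < q \<Longrightarrow> k < t \<Longrightarrow> B $$ (a, e) * C $$ (j, k) = C $$ (j, k) * B $$ (a, e)"
  shows "kron A B * kron C D = kron (A * C) (B * D)" (is "?l = ?r")
proof (rule bmat_eqI[of _ p r t d])
  fix i a k b assume *: "i < p" "a < r" "k < t" "b < d"
  have "?l $$ (i * r + a, k * d + b) =
    (\<Sum>l<q * c. kron A B $$ (i * r + a, l) * kron C D $$ (l, k * d + b))"
    using * assms by (simp add: scalar_prod_def atLeast0LessThan block_index_less)
  also have "\<dots> = (\<Sum>j<q. \<Sum>e<c. (A $$ (i, j) * B $$ (a, e)) * (C $$ (j, k) * D $$ (e, b)))"
    unfolding sum_lessThan_mult
    by (intro sum.cong refl) (simp add: kron_index[OF assms(1,2)] kron_index[OF assms(3,4)] *)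
  also have "\<dots> = (\<Sum>j<q. \<Sum>e<c. (A $$ (i, j) * C $$ (j, k)) * (B $$ (a, e) * D $$ (e, b)))"
  proof (intro sum.cong refl)
    fix j e assume "j \<in> {..<q}" "e \<in> {..<c}"
    then have "B $$ (a, e) * (C $$ (j, k) * D $$ (e, b)) = C $$ (j, k) * (B $$ (a, e) * D $$ (e, b))"
      using comm[of a e j k] * by (simp add: mult.assoc[symmetric])
    then show "A $$ (i, j) * B $$ (a, e) * (C $$ (j, k) * D $$ (e, b)) =
      A $$ (i, j) * C $$ (j, k) * (B $$ (a, e) * D $$ (e, b))"
      by (simp add: mult.assoc)
  qed
  also have "\<dots> = (A * C) $$ (i, k) * (B * D) $$ (a, b)"
    using * assms by (simp add: scalar_prod_def atLeast0LessThan sum_product)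
  also have "\<dots> = ?r $$ (i * r + a, k * d + b)"
    using * assms by (intro kron_index[symmetric, of _ p t _ r d]) auto
  finally show "?l $$ (i * r + a, k * d + b) = ?r $$ (i * r + a, k * d + b)" .
qed (use assms in auto)

lemma kron_assoc: "kron (kron A B) C = kron A (kron (B :: 'a::semigroup_mult mat) C)"
proof -
  have 1: "i div (b * c) = i div c div b" for i b c :: nat by (simp add: div_mult2_eq[of i c b] mult.commute[of b c])
  have 2: "i mod (b * c) div c = i div c mod b" for i b c :: nat
    by (cases "c = 0") (simp_all add: mod_mult2_eq[of i c b] mult.commute[of b c])
  have 3: "i mod (b * c) mod c = i mod c" for i b c :: nat by (simp add: mod_mod_cancel)
  show ?thesis
    by (rule eq_matI) (auto simp: kron_def 1 2 3 mult.assoc block_div_less less_mult_imp_div_less)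
qed

lemma kron_one [simp]: "kron (1\<^sub>m p) (1\<^sub>m q) = (1\<^sub>m (p * q) :: 'a::semiring_1 mat)"
proof (rule eq_matI)
  fix i j assume ij: "i < dim_row (1\<^sub>m (p * q) :: 'a mat)" "j < dim_col (1\<^sub>m (p * q) :: 'a mat)"
  have "(i div q = j div q \<and> i mod q = j mod q) = (i = j)" by (metis div_mult_mod_eq)
  then show "kron (1\<^sub>m p) (1\<^sub>m q) $$ (i, j) = (1\<^sub>m (p * q) :: 'a mat) $$ (i, j)"
    using ij by (auto simp: kron_def block_div_less)
qed auto

lemma kron_transpose: "transpose_mat (kron A B) = kron (transpose_mat A) (transpose_mat B)"
  by (rule eq_matI) (auto simp: kron_def block_div_less)

lemma kron_zero_left: "kron (0\<^sub>m p q) B = (0\<^sub>m (p * dim_row B) (q * dim_col B) :: 'a::mult_zero mat)"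
  by (rule eq_matI) (auto simp: kron_def block_div_less)

lemma kron_zero_right: "kron B (0\<^sub>m p q) = (0\<^sub>m (dim_row B * p) (dim_col B * q) :: 'a::mult_zero mat)"
  by (rule eq_matI) (auto simp: kron_def block_div_less)


section \<open>Scalars in an algebra\<close>

lemma scalar_mat_dim [simp]:
  "dim_row (scalar_mat scale P) = dim_row P" "dim_col (scalar_mat scale P) = dim_col P"
  by (simp_all add: scalar_mat_def)

lemma scalar_mat_carrier [simp]: "scalar_mat scale P \<in> carrier_mat p q \<longleftrightarrow> P \<in> carrier_mat p q"
  by (simp add: scalar_mat_def)

lemma scalar_mat_index [simp]:
  "i < dim_row P \<Longrightarrow> j < dim_col P \<Longrightarrow> scalar_mat scale P $$ (i, j) = scale (P $$ (i, j)) 1"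
  by (simp add: scalar_mat_def)

lemma scalar_mat_field [simp]: "scalar_mat (*) P = (P :: 'k::field mat)"
  by (rule eq_matI) auto

lemma unital_algebra_field: "unital_algebra ((*) :: 'k::field \<Rightarrow> 'k \<Rightarrow> 'k)"
  by unfold_locales (simp_all add: algebra_simps)

context unital_algebra
begin

lemma scale_one_mult [simp]: "scale c 1 * x = scale c x"
  by (simp add: scale_mult_left[symmetric])

lemma mult_scale_one [simp]: "x * scale c 1 = scale c x"
  by (simp add: scale_mult_right[symmetric])

lemma scalar_mat_mult:
  assumes "dim_col P = dim_row Q"
  shows "scalar_mat scale (P * Q) = scalar_mat scale P * scalar_mat scale Q" (is "?l = ?r")
proof (rule eq_matI)
  fix i j assume "i < dim_row ?r" "j < dim_col ?r"
  then show "?l $$ (i, j) = ?r $$ (i, j)"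
    using assms by (simp add: scalar_prod_def scale_sum_left mult.commute)
qed (use assms in auto)

lemma scalar_mat_one [simp]: "scalar_mat scale (1\<^sub>m n) = 1\<^sub>m n"
  by (rule eq_matI) auto

lemma scalar_mat_zero [simp]: "scalar_mat scale (0\<^sub>m p q) = 0\<^sub>m p q"
  by (rule eq_matI) auto

text \<open>Multiples of the unit are central, so the commutation condition of the mixed product
  rule holds as soon as one inner factor is a scalar matrix.\<close>

lemma kron_scalar_left_mult:
  assumes "dim_col P = dim_row Q" "dim_col X = dim_row Y"
  shows "kron (scalar_mat scale P) X * kron (scalar_mat scale Q) Y = kron (scalar_mat scale (P * Q)) (X * Y)"
  unfolding scalar_mat_mult[OF assms(1)]
  by (rule kron_mult_commuting[of _ "dim_row P" "dim_row Q" _ "dim_row X" "dim_row Y" _ "dim_col Q" _ "dim_col Y"])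
    (use assms in auto)

lemma kron_scalar_right_mult:
  assumes "dim_col P = dim_row Q" "dim_col X = dim_row Y"
  shows "kron X (scalar_mat scale P) * kron Y (scalar_mat scale Q) = kron (X * Y) (scalar_mat scale (P * Q))"
  unfolding scalar_mat_mult[OF assms(1)]
  by (rule kron_mult_commuting[of _ "dim_row X" "dim_row Y" _ "dim_row P" "dim_row Q" _ "dim_col Y" _ "dim_col Q"])
    (use assms in auto)

end

lemma kron_mult:
  fixes P Q X Y :: "'k::field mat"
  assumes "dim_col P = dim_row Q" "dim_col X = dim_row Y"
  shows "kron P X * kron Q Y = kron (P * Q) (X * Y)"
  using unital_algebra.kron_scalar_left_mult[OF unital_algebra_field assms] by simp

subsection \<open>Evaluation of matrix-valued linear forms\<close>

text \<open>States occupy the right Kronecker factor here and in \<open>lin_form\<close>; this is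
  the block order of realizations. Pencils use the opposite order (\<open>ramp\<close>,
  \<open>pform\<close>), and \<open>twist\<close> mediates between the two.\<close>

definition amp :: "('k \<Rightarrow> 'a \<Rightarrow> 'a) \<Rightarrow> nat \<Rightarrow> 'k mat \<Rightarrow> 'a::ring_1 mat" where
  "amp scale m P = kron (1\<^sub>m m) (scalar_mat scale P)"

definition lin_form :: "('k \<Rightarrow> 'a \<Rightarrow> 'a) \<Rightarrow> 'x set \<Rightarrow> nat \<Rightarrow> nat \<Rightarrow> nat \<Rightarrow> ('x \<Rightarrow> 'k mat) \<Rightarrow> ('x \<Rightarrow> 'a mat) \<Rightarrow> 'a::ring_1 mat"
  where "lin_form scale I m p q G x = matsum I (m * p) (m * q) (\<lambda>\<alpha>. kron (x \<alpha>) (scalar_mat scale (G \<alpha>)))"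

lemma amp_carrier [simp]: "P \<in> carrier_mat p q \<Longrightarrow> amp scale m P \<in> carrier_mat (m * p) (m * q)"
  by (auto simp: amp_def)

lemma amp_dim [simp]: "dim_row (amp scale m P) = m * dim_row P" "dim_col (amp scale m P) = m * dim_col P"
  by (auto simp: amp_def)

lemma lin_form_carrier [simp]: "lin_form scale I m p q G x \<in> carrier_mat (m * p) (m * q)"
  by (simp add: lin_form_def)

lemma lin_form_dim [simp]: "dim_row (lin_form scale I m p q G x) = m * p" "dim_col (lin_form scale I m p q G x) = m * q"
  by (simp_all add: lin_form_def)

lemma lin_form_cong:
  "(\<And>\<alpha>. \<alpha> \<in> I \<Longrightarrow> G \<alpha> = H \<alpha>) \<Longrightarrow> lin_form scale I m p q G x = lin_form scale I m p q H x"
  unfolding lin_form_def by (rule matsum_cong) simp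

context unital_algebra
begin

lemma amp_one [simp]: "amp scale m (1\<^sub>m n) = 1\<^sub>m (m * n)"
  by (simp add: amp_def)

lemma amp_mult: "dim_col P = dim_row Q \<Longrightarrow> amp scale m P * amp scale m Q = amp scale m (P * Q)"
  unfolding amp_def by (subst kron_scalar_right_mult) (auto simp: one_mult_dim)

lemma amp_invertible:
  assumes "invertible_mat P" "P \<in> carrier_mat n n"
  shows "invertible_mat (amp scale m P)" "minv (amp scale m P) = amp scale m (minv P)"
proof -
  note p = minv_inverse[OF assms]
  have 1: "amp scale m P * amp scale m (minv P) = 1\<^sub>m (m * n)" "amp scale m (minv P) * amp scale m P = 1\<^sub>m (m * n)"
    using p assms by (auto simp: amp_mult)
  show "invertible_mat (amp scale m P)"
    using 1 assms by (intro invertible_matI[of _ "m * n" "amp scale m (minv P)"]) auto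
  show "minv (amp scale m P) = amp scale m (minv P)"
    using 1 assms p by (intro minv_eqI[of _ "m * n"]) auto
qed

lemma amp_mult_lin_form:
  assumes "P \<in> carrier_mat r p" "\<And>\<alpha>. \<alpha> \<in> I \<Longrightarrow> G \<alpha> \<in> carrier_mat p q"
    "\<And>\<alpha>. \<alpha> \<in> I \<Longrightarrow> x \<alpha> \<in> carrier_mat m m"
  shows "amp scale m P * lin_form scale I m p q G x = lin_form scale I m r q (\<lambda>\<alpha>. P * G \<alpha>) x"
proof -
  have "amp scale m P * lin_form scale I m p q G x =
      matsum I (m * r) (m * q) (\<lambda>\<alpha>. amp scale m P * kron (x \<alpha>) (scalar_mat scale (G \<alpha>)))"
    unfolding lin_form_def using assms by (intro matsum_mult_left) auto
  also have "\<dots> = lin_form scale I m r q (\<lambda>\<alpha>. P * G \<alpha>) x"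
    unfolding lin_form_def
  proof (rule matsum_cong)
    fix \<alpha> assume "\<alpha> \<in> I"
    note a = assms(1) assms(2,3)[OF this]
    show "amp scale m P * kron (x \<alpha>) (scalar_mat scale (G \<alpha>)) = kron (x \<alpha>) (scalar_mat scale (P * G \<alpha>))"
      unfolding amp_def using a by (subst kron_scalar_right_mult) (auto simp: one_mult_dim)
  qed
  finally show ?thesis .
qed

lemma lin_form_mult_amp:
  assumes "P \<in> carrier_mat q r" "\<And>\<alpha>. \<alpha> \<in> I \<Longrightarrow> G \<alpha> \<in> carrier_mat p q"
    "\<And>\<alpha>. \<alpha> \<in> I \<Longrightarrow> x \<alpha> \<in> carrier_mat m m"
  shows "lin_form scale I m p q G x * amp scale m P = lin_form scale I m p r (\<lambda>\<alpha>. G \<alpha> * P) x"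
proof -
  have "lin_form scale I m p q G x * amp scale m P =
      matsum I (m * p) (m * r) (\<lambda>\<alpha>. kron (x \<alpha>) (scalar_mat scale (G \<alpha>)) * amp scale m P)"
    unfolding lin_form_def using assms by (intro matsum_mult_right) auto
  also have "\<dots> = lin_form scale I m p r (\<lambda>\<alpha>. G \<alpha> * P) x"
    unfolding lin_form_def
  proof (rule matsum_cong)
    fix \<alpha> assume "\<alpha> \<in> I"
    note a = assms(1) assms(2,3)[OF this]
    show "kron (x \<alpha>) (scalar_mat scale (G \<alpha>)) * amp scale m P = kron (x \<alpha>) (scalar_mat scale (G \<alpha> * P))"
      unfolding amp_def using a by (subst kron_scalar_right_mult) (auto simp: mult_one_dim)
  qed
  finally show ?thesis .
qed

end

section \<open>Linear systems over a field\<close>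

subsection \<open>Bases\<close>

text \<open>If n < d, padding \<open>J\<close> and \<open>K\<close> with zeros to size d gives a
  square one-sided, hence two-sided, inverse pair, although the product in the other order has the
  entry 0 at position (n, n).\<close>

lemma left_inverse_dim_le:
  fixes J :: "'k::field mat"
  assumes "J \<in> carrier_mat n d" "K \<in> carrier_mat d n" "K * J = 1\<^sub>m d"
  shows "d \<le> n"
proof (rule ccontr)
  assume "\<not> d \<le> n"
  then have nd: "n < d" by simp
  define P where "P = mat d d (\<lambda>(i, j). if j < n then K $$ (i, j) else 0)"
  define R where "R = mat d d (\<lambda>(i, j). if i < n then J $$ (i, j) else 0)"
  have PR: "P * R = 1\<^sub>m d"
  proof (rule eq_matI)
    fix i j assume ij: "i < dim_row (1\<^sub>m d :: 'k mat)" "j < dim_col (1\<^sub>m d :: 'k mat)"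
    have "(P * R) $$ (i, j) = (\<Sum>l\<in>{0..<d}. if l < n then K $$ (i, l) * J $$ (l, j) else 0)"
      using ij by (auto simp: P_def R_def scalar_prod_def intro!: sum.cong)
    also have "\<dots> = (\<Sum>l\<in>{0..<n}. K $$ (i, l) * J $$ (l, j))"
      using nd by (intro sum.mono_neutral_cong_right) auto
    also have "\<dots> = (K * J) $$ (i, j)"
      using ij assms(1,2) by (auto simp: scalar_prod_def)
    finally show "(P * R) $$ (i, j) = 1\<^sub>m d $$ (i, j)" using assms(3) by simp
  qed (auto simp: P_def R_def)
  then have "R * P = 1\<^sub>m d"
    by (intro mat_mult_left_right_inverse[of P]) (auto simp: P_def R_def)
  then have "(R * P) $$ (n, n) = 1" using nd by simp
  moreover have "(R * P) $$ (n, n) = 0"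
    using nd by (auto simp: P_def R_def scalar_prod_def)
  ultimately show False by simp
qed

text \<open>\<open>S k V\<close> says that the k columns of \<open>V\<close> lie in a fixed
  subspace. A family of columns with a left inverse has at most n members; a largest such family
  must span, since a column outside its span could be adjoined together with an enlarged left
  inverse.\<close>

lemma column_space_basis:
  fixes S :: "nat \<Rightarrow> 'k::field mat \<Rightarrow> bool"
  assumes car: "\<And>k V. S k V \<Longrightarrow> V \<in> carrier_mat n k"
    and zero: "\<And>k. S k (0\<^sub>m n k)"
    and add: "\<And>k V W. S k V \<Longrightarrow> S k W \<Longrightarrow> S k (V + W)"
    and mult: "\<And>k k' V R. S k V \<Longrightarrow> R \<in> carrier_mat k k' \<Longrightarrow> S k' (V * R)"
  obtains d J K where "S d J" "K \<in> carrier_mat d n" "K * J = 1\<^sub>m d"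
    "\<And>k V. S k V \<Longrightarrow> J * (K * V) = V"
proof -
  define Q where "Q d \<longleftrightarrow> (\<exists>J K. S d J \<and> K \<in> carrier_mat d n \<and> K * J = 1\<^sub>m d)" for d
  have Q0: "Q 0"
    unfolding Q_def by (rule exI[of _ "0\<^sub>m n 0"], rule exI[of _ "0\<^sub>m 0 n"]) (auto simp: zero)
  have Qn: "d \<le> n" if "Q d" for d
    using that car left_inverse_dim_le unfolding Q_def by blast
  define d where "d = (GREATEST d. Q d)"
  have Qd: "Q d" unfolding d_def by (rule GreatestI_nat[of Q 0 n]) (use Q0 Qn in auto)
  have Qmax: "d' \<le> d" if "Q d'" for d'
    unfolding d_def by (rule Greatest_le_nat[of Q d' n]) (use that Qn in auto)
  from Qd obtain J K where J: "S d J" and K: "K \<in> carrier_mat d n" and KJ: "K * J = 1\<^sub>m d"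
    unfolding Q_def by blast
  have Jc: "J \<in> carrier_mat n d" using car[OF J] .
  have "J * (K * V) = V" if V: "S k V" for k V
  proof (rule ccontr)
    assume ne: "J * (K * V) \<noteq> V"
    have Vc: "V \<in> carrier_mat n k" using car[OF V] .
    then obtain i j where ij: "i < n" "j < k" "(J * (K * V)) $$ (i, j) \<noteq> V $$ (i, j)"
      using ne Jc K by (metis carrier_matD(1) carrier_matD(2) eq_matI index_mult_mat(2) index_mult_mat(3))
    define e where "e = mat k 1 (\<lambda>(a, b). if a = j then 1 else (0::'k))"
    \<comment> \<open>The part of the offending column of \<open>V\<close> that the projection
      \<open>J * K\<close> misses; it lies in the subspace and is killed by
      \<open>K\<close>.\<close>
    define w where "w = V * e + J * - (K * (V * e))"
    have ec: "e \<in> carrier_mat k 1" by (simp add: e_def)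
    have Sw: "S 1 w"
      unfolding w_def using V J ec K Vc by (intro add mult[OF V] mult[OF J]) auto
    have wc: "w \<in> carrier_mat n 1" using car[OF Sw] .
    have "K * w = K * (V * e) + (K * J) * - (K * (V * e))"
      unfolding w_def using K Jc Vc ec by (simp add: mat_algebra)
    also have "\<dots> = 0\<^sub>m d 1"
      unfolding KJ using K Vc ec by (intro eq_matI) (auto simp: mat_algebra simp del: index_mult_mat(1))
    finally have Kw: "K * w = 0\<^sub>m d 1" .
    have Ve: "(M * e) $$ (i, 0) = M $$ (i, j)" if "M \<in> carrier_mat n k" for M
    proof -
      have "(M * e) $$ (i, 0) = (\<Sum>a\<in>{0..<k}. M $$ (i, a) * (if a = j then 1 else 0))"
        using that ij ec by (auto simp: scalar_prod_def e_def)
      also have "\<dots> = (\<Sum>a\<in>{0..<k}. if a = j then M $$ (i, j) else 0)"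
        by (rule sum.cong) auto
      finally show ?thesis using ij by simp
    qed
    have "w = V * e - (J * (K * V)) * e"
      unfolding w_def using K Jc Vc ec by (intro eq_matI) (auto simp: mat_algebra simp del: index_mult_mat(1))
    then have "w $$ (i, 0) = V $$ (i, j) - (J * (K * V)) $$ (i, j)"
      using ij ec Vc Jc K Ve[of V] Ve[of "J * (K * V)"] by (simp del: index_mult_mat(1))
    then have w0: "w $$ (i, 0) \<noteq> 0" using ij by auto
    define r where "r = mat 1 n (\<lambda>(a, b). if b = i then 1 / w $$ (i, 0) else 0)"
    have rc: "r \<in> carrier_mat 1 n" by (simp add: r_def)
    have rw: "r * w = 1\<^sub>m 1"
    proof (rule eq_matI)
      fix a b assume "a < dim_row (1\<^sub>m 1 :: 'k mat)" "b < dim_col (1\<^sub>m 1 :: 'k mat)"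
      then have ab: "a = 0" "b = 0" by auto
      have "(r * w) $$ (0, 0) = (\<Sum>l\<in>{0..<n}. (if l = i then 1 / w $$ (i, 0) else 0) * w $$ (l, 0))"
        using rc wc by (auto simp: scalar_prod_def r_def)
      also have "\<dots> = (\<Sum>l\<in>{0..<n}. if l = i then 1 else 0)"
        by (rule sum.cong) (use w0 in auto)
      finally have "(r * w) $$ (0, 0) = (\<Sum>l\<in>{0..<n}. if l = i then 1 else 0)" .
      then show "(r * w) $$ (a, b) = 1\<^sub>m 1 $$ (a, b)" using ij ab by simp
    qed (use rc wc in auto)
    \<comment> \<open>\<open>r\<close> reads off a nonzero entry of \<open>w\<close>, normalized to
      1. Subtracting its part along \<open>J\<close> gives a row that vanishes on \<open>J\<close>
      and still has the value 1 on \<open>w\<close>, because \<open>K * w\<close> is zero.\<close>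
    define \<rho> where "\<rho> = r + (- (r * J)) * K"
    have \<rho>c: "\<rho> \<in> carrier_mat 1 n" using rc Jc K by (auto simp: \<rho>_def)
    have "\<rho> * J = r * J + (- (r * J)) * (K * J)"
      unfolding \<rho>_def using rc Jc K by (simp add: mat_algebra)
    also have "\<dots> = 0\<^sub>m 1 d"
      unfolding KJ using rc Jc by (intro eq_matI) (auto simp: mat_algebra simp del: index_mult_mat(1))
    finally have \<rho>J: "\<rho> * J = 0\<^sub>m 1 d" .
    have "\<rho> * w = r * w + (- (r * J)) * (K * w)"
      unfolding \<rho>_def using rc Jc K wc by (simp add: mat_algebra)
    then have \<rho>w: "\<rho> * w = 1\<^sub>m 1"
      unfolding Kw rw using rc Jc by (simp add: mat_algebra)
    \<comment> \<open>\<open>E\<close> is the identity of size d followed by a zero column and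
      \<open>f\<close> is the last unit row, so \<open>J * E + w * f\<close> is \<open>J\<close>
      with the column \<open>w\<close> appended, written without block matrices.\<close>
    define E where "E = mat d (Suc d) (\<lambda>(a, b). if a = b then 1 else (0::'k))"
    define f where "f = mat 1 (Suc d) (\<lambda>(a, b). if b = d then 1 else (0::'k))"
    have Ec: "E \<in> carrier_mat d (Suc d)" and fc: "f \<in> carrier_mat 1 (Suc d)"
      by (simp_all add: E_def f_def)
    have Ef: "E\<^sup>T * E + f\<^sup>T * f = 1\<^sub>m (Suc d)" (is "?l = ?r")
    proof (rule eq_matI)
      fix a b assume "a < dim_row ?r" "b < dim_col ?r"
      then have ab: "a < Suc d" "b < Suc d" by auto
      have "(E\<^sup>T * E) $$ (a, b) = (\<Sum>l\<in>{0..<d}. (if l = a then 1 else 0) * (if l = b then 1 else 0))"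
        using ab by (simp add: E_def scalar_prod_def)
      also have "\<dots> = (\<Sum>l\<in>{0..<d}. if l = a then (if a = b then 1 else 0) else 0)"
        by (rule sum.cong) auto
      finally have "(E\<^sup>T * E) $$ (a, b) = (\<Sum>l\<in>{0..<d}. if l = a then (if a = b then 1 else 0) else 0)" .
      moreover have "(f\<^sup>T * f) $$ (a, b) = (if a = d \<and> b = d then 1 else 0)"
        using ab by (auto simp: f_def scalar_prod_def)
      ultimately show "?l $$ (a, b) = ?r $$ (a, b)"
        using ab Ec fc by (auto simp del: index_mult_mat(1))
    qed (use Ec fc in auto)
    have "Q (Suc d)"
      unfolding Q_def
    proof (intro exI conjI)
      show "S (Suc d) (J * E + w * f)" using J Sw Ec fc by (intro add mult[OF J] mult[OF Sw]) auto
      show "E\<^sup>T * K + f\<^sup>T * \<rho> \<in> carrier_mat (Suc d) n" using Ec fc K \<rho>c by auto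
      have "(E\<^sup>T * K + f\<^sup>T * \<rho>) * (J * E + w * f) =
          (E\<^sup>T * ((K * J) * E) + f\<^sup>T * ((\<rho> * J) * E)) + (E\<^sup>T * ((K * w) * f) + f\<^sup>T * ((\<rho> * w) * f))"
        using Ec fc K \<rho>c Jc wc by (simp add: mat_algebra)
      also have "\<dots> = E\<^sup>T * E + f\<^sup>T * f"
        unfolding KJ \<rho>J Kw \<rho>w using Ec fc by (intro eq_matI) (auto simp: mat_algebra simp del: index_mult_mat(1))
      finally show "(E\<^sup>T * K + f\<^sup>T * \<rho>) * (J * E + w * f) = 1\<^sub>m (Suc d)" unfolding Ef .
    qed
    then show False using Qmax by fastforce
  qed
  then show ?thesis using that J K KJ by blast
qed


subsection \<open>Reachability and observability\<close>

definition wprod :: "nat \<Rightarrow> ('x \<Rightarrow> 'k::field mat) \<Rightarrow> 'x list \<Rightarrow> 'k mat" where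
  "wprod n A w = foldr (\<lambda>\<alpha> M. A \<alpha> * M) w (1\<^sub>m n)"

lemma wprod_simps [simp]: "wprod n A [] = 1\<^sub>m n" "wprod n A (\<alpha> # w) = A \<alpha> * wprod n A w"
  by (simp_all add: wprod_def)

text \<open>
  \<open>reach k V\<close>: the columns of the \<open>n \<times> k\<close> matrix \<open>V\<close> are reachable states;
  \<open>coreach k U\<close>: the rows of the \<open>k \<times> n\<close> matrix \<open>U\<close> are observable functionals.
\<close>

inductive reach :: "'x set \<Rightarrow> 'y set \<Rightarrow> nat \<Rightarrow> nat \<Rightarrow> ('x \<Rightarrow> 'k::field mat) \<Rightarrow> ('y \<Rightarrow> 'k mat) \<Rightarrow> nat \<Rightarrow> 'k mat \<Rightarrow> bool"
  for I H n q A B where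
  reach_zero: "reach I H n q A B k (0\<^sub>m n k)"
| reach_base: "y \<in> H \<Longrightarrow> P \<in> carrier_mat q k \<Longrightarrow> reach I H n q A B k (B y * P)"
| reach_step: "\<alpha> \<in> I \<Longrightarrow> reach I H n q A B k V \<Longrightarrow> reach I H n q A B k (A \<alpha> * V)"
| reach_add: "reach I H n q A B k V \<Longrightarrow> reach I H n q A B k W \<Longrightarrow> reach I H n q A B k (V + W)"

inductive coreach :: "'x set \<Rightarrow> nat \<Rightarrow> nat \<Rightarrow> ('x \<Rightarrow> 'k::field mat) \<Rightarrow> 'k mat \<Rightarrow> nat \<Rightarrow> 'k mat \<Rightarrow> bool"
  for I n p A C where
  coreach_zero: "coreach I n p A C k (0\<^sub>m k n)"
| coreach_base: "P \<in> carrier_mat k p \<Longrightarrow> coreach I n p A C k (P * C)"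
| coreach_step: "\<alpha> \<in> I \<Longrightarrow> coreach I n p A C k U \<Longrightarrow> coreach I n p A C k (U * A \<alpha>)"
| coreach_add: "coreach I n p A C k U \<Longrightarrow> coreach I n p A C k W \<Longrightarrow> coreach I n p A C k (U + W)"

locale linear_system =
  fixes I :: "'x set" and H :: "'y set" and n q p :: nat
    and A :: "'x \<Rightarrow> 'k::field mat" and B :: "'y \<Rightarrow> 'k mat" and C :: "'k mat"
  assumes A_car: "\<And>\<alpha>. \<alpha> \<in> I \<Longrightarrow> A \<alpha> \<in> carrier_mat n n"
    and B_car: "\<And>y. y \<in> H \<Longrightarrow> B y \<in> carrier_mat n q"
    and C_car: "C \<in> carrier_mat p n"
begin

abbreviation "rch \<equiv> reach I H n q A B"
abbreviation "crch \<equiv> coreach I n p A C"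

lemma rch_carrier: "rch k V \<Longrightarrow> V \<in> carrier_mat n k"
  by (induction k V rule: reach.induct) (auto intro!: mult_carrier_mat add_carrier_mat A_car B_car)

lemma crch_carrier: "crch k U \<Longrightarrow> U \<in> carrier_mat k n"
  by (induction k U rule: coreach.induct) (auto intro!: mult_carrier_mat add_carrier_mat A_car C_car)

lemma rch_mult: "rch k V \<Longrightarrow> R \<in> carrier_mat k k' \<Longrightarrow> rch k' (V * R)"
proof (induction k V rule: reach.induct)
  case (reach_zero k)
  then show ?case by (simp add: zero_mult_dim reach.reach_zero)
next
  case (reach_base y P k)
  then show ?case using B_car[of y] reach.reach_base[of y H "P * R" q k'] by (simp add: mult_assoc_dim)
next
  case (reach_step \<alpha> k V)
  have "rch k' (A \<alpha> * (V * R))" by (rule reach.reach_step) (use reach_step in auto)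
  then show ?case
    using A_car[OF reach_step(1)] rch_carrier[OF reach_step(2)] reach_step(4) by (simp add: mult_assoc_dim)
next
  case (reach_add k V W)
  have "rch k' (V * R + W * R)" by (rule reach.reach_add) (use reach_add in auto)
  then show ?case
    using rch_carrier[OF reach_add(1)] rch_carrier[OF reach_add(2)] reach_add(5) by (simp add: add_mult_dim)
qed

lemma crch_mult: "crch k U \<Longrightarrow> R \<in> carrier_mat k' k \<Longrightarrow> crch k' (R * U)"
proof (induction k U rule: coreach.induct)
  case (coreach_zero k)
  then show ?case by (simp add: mult_zero_dim coreach.coreach_zero)
next
  case (coreach_base P k)
  then show ?case using C_car coreach.coreach_base[of "R * P" k' p I n A C] by (simp add: mult_assoc_dim)
next
  case (coreach_step \<alpha> k U)
  have "crch k' (R * U * A \<alpha>)" by (rule coreach.coreach_step) (use coreach_step in auto)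
  then show ?case
    using A_car[OF coreach_step(1)] crch_carrier[OF coreach_step(2)] coreach_step(4) by (simp add: mult_assoc_dim)
next
  case (coreach_add k U W)
  have "crch k' (R * U + R * W)" by (rule coreach.coreach_add) (use coreach_add in auto)
  then show ?case
    using crch_carrier[OF coreach_add(1)] crch_carrier[OF coreach_add(2)] coreach_add(5) by (simp add: mult_add_dim)
qed

lemma wprod_car: "w \<in> lists I \<Longrightarrow> wprod n A w \<in> carrier_mat n n"
  by (induction w) (auto intro!: mult_carrier_mat A_car)

lemma wprod_append:
  "w \<in> lists I \<Longrightarrow> v \<in> lists I \<Longrightarrow> wprod n A (w @ v) = wprod n A w * wprod n A v"
proof (induction w)
  case Nil
  then show ?case using wprod_car[of v] by (simp add: one_mult_dim)
next
  case (Cons a w)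
  then show ?case using wprod_car[of v] wprod_car[of w] A_car[of a] by (simp add: mult_assoc_dim)
qed

lemma wprod_snoc:
  "w \<in> lists I \<Longrightarrow> \<alpha> \<in> I \<Longrightarrow> wprod n A (w @ [\<alpha>]) = wprod n A w * A \<alpha>"
  using wprod_append[of w "[\<alpha>]"] A_car[of \<alpha>] by (simp add: mult_one_dim)

lemma reach_basis:
  obtains d J K where "rch d J" "J \<in> carrier_mat n d" "K \<in> carrier_mat d n" "K * J = 1\<^sub>m d"
    "\<And>k V. rch k V \<Longrightarrow> J * (K * V) = V"
proof -
  obtain d J K where "rch d J" "K \<in> carrier_mat d n" "K * J = 1\<^sub>m d" "\<And>k V. rch k V \<Longrightarrow> J * (K * V) = V"
    by (rule column_space_basis[of rch n, OF rch_carrier reach_zero reach_add rch_mult]) blast+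
  then show ?thesis using that rch_carrier by blast
qed

end

text \<open>
  Two systems with the same moments, the first one reachable and observable. The second one
  then restricts to its reachable states and maps onto the first one.
\<close>

locale system_pair =
  S: linear_system I H n q p A B C + S': linear_system I H n' q p A' B' C'
  for I :: "'x set" and H :: "'y set" and n n' q p :: nat
    and A A' :: "'x \<Rightarrow> 'k::field mat" and B B' :: "'y \<Rightarrow> 'k mat" and C C' :: "'k mat" +
  assumes moments: "\<And>w y. w \<in> lists I \<Longrightarrow> y \<in> H \<Longrightarrow> C * (wprod n A w * B y) = C' * (wprod n' A' w * B' y)"
    and reachable: "S.rch n (1\<^sub>m n)" and observable: "S.crch n (1\<^sub>m n)"
begin

text \<open>Follows the construction of an observable row: the base case is the equality of moments,
  and a step by a letter is absorbed by prepending that letter to the word.\<close>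

lemma coreach_match:
  "S.crch k U \<Longrightarrow> \<exists>U'\<in>carrier_mat k n'. \<forall>w\<in>lists I. \<forall>y\<in>H.
     U * (wprod n A w * B y) = U' * (wprod n' A' w * B' y)"
proof (induction k U rule: coreach.induct)
  case (coreach_zero k)
  show ?case
  proof (intro bexI[of _ "0\<^sub>m k n'"] ballI)
    fix w y assume "w \<in> lists I" "y \<in> H"
    note c = S.wprod_car[OF this(1)] S'.wprod_car[OF this(1)] S.B_car[OF this(2)] S'.B_car[OF this(2)]
    show "0\<^sub>m k n * (wprod n A w * B y) = 0\<^sub>m k n' * (wprod n' A' w * B' y)"
      using c by (simp add: zero_mult_dim)
  qed simp
next
  case (coreach_base P k)
  show ?case
  proof (intro bexI[of _ "P * C'"] ballI)
    fix w y assume wy: "w \<in> lists I" "y \<in> H"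
    show "P * C * (wprod n A w * B y) = P * C' * (wprod n' A' w * B' y)"
      using moments[OF wy] S.wprod_car[OF wy(1)] S'.wprod_car[OF wy(1)] S.B_car[OF wy(2)] S'.B_car[OF wy(2)]
        S.C_car S'.C_car coreach_base by (simp add: mult_assoc_dim)
  qed (use coreach_base S'.C_car in auto)
next
  case (coreach_step \<alpha> k U)
  then obtain U' where U': "U' \<in> carrier_mat k n'"
    "\<And>w y. w \<in> lists I \<Longrightarrow> y \<in> H \<Longrightarrow> U * (wprod n A w * B y) = U' * (wprod n' A' w * B' y)" by blast
  note Uc = S.crch_carrier[OF coreach_step(2)]
  show ?case
  proof (intro bexI[of _ "U' * A' \<alpha>"] ballI)
    fix w y assume wy: "w \<in> lists I" "y \<in> H"
    then have "U * (wprod n A (\<alpha> # w) * B y) = U' * (wprod n' A' (\<alpha> # w) * B' y)"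
      using coreach_step(1) by (intro U') auto
    then show "U * A \<alpha> * (wprod n A w * B y) = U' * A' \<alpha> * (wprod n' A' w * B' y)"
      using S.wprod_car[OF wy(1)] S'.wprod_car[OF wy(1)] S.B_car[OF wy(2)] S'.B_car[OF wy(2)]
        S.A_car[OF coreach_step(1)] S'.A_car[OF coreach_step(1)] U'(1) Uc by (simp add: mult_assoc_dim)
  qed (use S'.A_car[OF coreach_step(1)] U'(1) in auto)
next
  case (coreach_add k U W)
  then obtain U' W' where U': "U' \<in> carrier_mat k n'" "W' \<in> carrier_mat k n'"
    "\<And>w y. w \<in> lists I \<Longrightarrow> y \<in> H \<Longrightarrow> U * (wprod n A w * B y) = U' * (wprod n' A' w * B' y)"
    "\<And>w y. w \<in> lists I \<Longrightarrow> y \<in> H \<Longrightarrow> W * (wprod n A w * B y) = W' * (wprod n' A' w * B' y)" by metis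
  show ?case
  proof (intro bexI[of _ "U' + W'"] ballI)
    fix w y assume wy: "w \<in> lists I" "y \<in> H"
    show "(U + W) * (wprod n A w * B y) = (U' + W') * (wprod n' A' w * B' y)"
      using U'(3,4)[OF wy] S.wprod_car[OF wy(1)] S'.wprod_car[OF wy(1)] S.B_car[OF wy(2)] S'.B_car[OF wy(2)]
        U'(1,2) S.crch_carrier[OF coreach_add(1)] S.crch_carrier[OF coreach_add(2)]
      by (simp add: add_mult_dim)
  qed (use U'(1,2) in auto)
qed

text \<open>Observability of the first system makes all coordinate functionals available to
  \<open>coreach_match\<close>; collected as rows they form the state map \<open>T\<close>. Its
  values are determined on the reachable states of the second system only, hence the choice.\<close>

definition T where
  "T = (SOME T. T \<in> carrier_mat n n' \<and> (\<forall>w\<in>lists I. \<forall>y\<in>H.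
     wprod n A w * B y = T * (wprod n' A' w * B' y)))"

lemma T: "T \<in> carrier_mat n n'"
  "\<And>w y. w \<in> lists I \<Longrightarrow> y \<in> H \<Longrightarrow> T * (wprod n' A' w * B' y) = wprod n A w * B y"
proof -
  obtain T0 where "T0 \<in> carrier_mat n n'"
    "\<forall>w\<in>lists I. \<forall>y\<in>H. 1\<^sub>m n * (wprod n A w * B y) = T0 * (wprod n' A' w * B' y)"
    using coreach_match[OF observable] by blast
  moreover have "1\<^sub>m n * (wprod n A w * B y) = wprod n A w * B y" if "w \<in> lists I" "y \<in> H" for w y
    using S.wprod_car[OF that(1)] by (simp add: one_mult_dim)
  ultimately have "\<exists>T. T \<in> carrier_mat n n' \<and> (\<forall>w\<in>lists I. \<forall>y\<in>H. wprod n A w * B y = T * (wprod n' A' w * B' y))"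
    by metis
  from someI_ex[OF this]
  show "T \<in> carrier_mat n n'" "\<And>w y. w \<in> lists I \<Longrightarrow> y \<in> H \<Longrightarrow> T * (wprod n' A' w * B' y) = wprod n A w * B y"
    unfolding T_def by auto
qed

text \<open>The word has to be arbitrary in the induction, because a reachability step by a letter
  is moved to the end of the word.\<close>

lemma T_intertwines:
  "S'.rch k V \<Longrightarrow> w \<in> lists I \<Longrightarrow>
     T * (wprod n' A' w * V) = wprod n A w * (T * V) \<and> C' * (wprod n' A' w * V) = C * (wprod n A w * (T * V))"
proof (induction k V arbitrary: w rule: reach.induct)
  case (reach_zero k)
  then show ?case
    using S.wprod_car[OF reach_zero] S'.wprod_car[OF reach_zero] T(1) S.C_car S'.C_car
    by (simp add: mult_zero_dim)
next
  case (reach_base y P k)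
  note c = S.wprod_car[OF reach_base(3)] S'.wprod_car[OF reach_base(3)] T(1) S.C_car S'.C_car
    S.B_car[OF reach_base(1)] S'.B_car[OF reach_base(1)] reach_base(2)
  have TB: "T * B' y = B y" using T(2)[of "[]" y] reach_base c by (simp add: one_mult_dim)
  have "T * (wprod n' A' w * (B' y * P)) = T * (wprod n' A' w * B' y) * P" using c by (simp add: mult_assoc_dim)
  also have "\<dots> = wprod n A w * ((T * B' y) * P)" using T(2) reach_base c by (simp add: mult_assoc_dim TB)
  finally have 1: "T * (wprod n' A' w * (B' y * P)) = wprod n A w * (T * (B' y * P))" using c by (simp add: mult_assoc_dim)
  have "C' * (wprod n' A' w * (B' y * P)) = C' * (wprod n' A' w * B' y) * P" using c by (simp add: mult_assoc_dim)
  also have "\<dots> = C * (wprod n A w * B y) * P" using moments reach_base by simp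
  also have "\<dots> = C * (wprod n A w * ((T * B' y) * P))" using c by (simp add: TB mult_assoc_dim)
  finally show ?case using 1 c by (simp add: mult_assoc_dim)
next
  case (reach_step \<alpha> k V)
  note c = S.wprod_car[OF reach_step(4)] S'.wprod_car[OF reach_step(4)] T(1) S.C_car S'.C_car
    S.A_car[OF reach_step(1)] S'.A_car[OF reach_step(1)] S'.rch_carrier[OF reach_step(2)]
  have w: "w @ [\<alpha>] \<in> lists I" "[\<alpha>] \<in> lists I" using reach_step by auto
  have "T * (A' \<alpha> * V) = A \<alpha> * (T * V)" using reach_step(3)[OF w(2)] c by (simp add: mult_one_dim)
  then show ?case
    using reach_step(3)[OF w(1)] c S.wprod_snoc[OF reach_step(4,1)] S'.wprod_snoc[OF reach_step(4,1)]
    by (simp add: mult_assoc_dim)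
next
  case (reach_add k V W)
  note c = S.wprod_car[OF reach_add(5)] S'.wprod_car[OF reach_add(5)] T(1) S.C_car S'.C_car
    S'.rch_carrier[OF reach_add(1)] S'.rch_carrier[OF reach_add(2)]
  show ?case using reach_add(3)[OF reach_add(5)] reach_add(4)[OF reach_add(5)] c by (simp add: mult_add_dim)
qed

lemma T_step:
  assumes "S'.rch k V" "\<alpha> \<in> I"
  shows "T * (A' \<alpha> * V) = A \<alpha> * (T * V)"
  using T_intertwines[OF assms(1), of "[\<alpha>]"] assms(2) S.A_car[OF assms(2)] S'.A_car[OF assms(2)]
  by (simp add: mult_one_dim)

lemma T_C:
  assumes "S'.rch k V"
  shows "C' * V = C * (T * V)"
  using T_intertwines[OF assms, of "[]"] S'.rch_carrier[OF assms] T(1) by (simp add: one_mult_dim)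

lemma T_B: "y \<in> H \<Longrightarrow> T * B' y = B y"
  using T(2)[of "[]" y] S.B_car[of y] S'.B_car[of y] by (simp add: one_mult_dim)

text \<open>Whatever builds a reachable state of the first system can be repeated in the second one,
  and \<open>T\<close> respects every step. With reachability this yields a right inverse of
  \<open>T\<close> made of reachable states.\<close>

lemma reach_lift: "S.rch k V \<Longrightarrow> \<exists>V'. S'.rch k V' \<and> T * V' = V"
proof (induction k V rule: reach.induct)
  case (reach_zero k)
  then show ?case using T(1) reach.reach_zero by (metis carrier_matD(1) carrier_matD(2) mult_zero_dim)
next
  case (reach_base y P k)
  then show ?case
    using T_B T(1) S'.B_car[of y] by (intro exI[of _ "B' y * P"]) (simp add: mult_assoc_dim[symmetric] reach.reach_base)
next
  case (reach_step \<alpha> k V)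
  then obtain V' where "S'.rch k V'" "T * V' = V" by blast
  then show ?case using T_step[of k V' \<alpha>] reach_step(1) reach.reach_step by metis
next
  case (reach_add k V W)
  then obtain V' W' where *: "S'.rch k V'" "T * V' = V" "S'.rch k W'" "T * W' = W" by blast
  then show ?case
    using S'.rch_carrier[OF *(1)] S'.rch_carrier[OF *(3)] T(1)
    by (intro exI[of _ "V' + W'"]) (simp add: mult_add_dim reach.reach_add)
qed

lemma T_section: obtains S where "S'.rch n S" "S \<in> carrier_mat n' n" "T * S = 1\<^sub>m n"
  using reach_lift[OF reachable] S'.rch_carrier by blast

lemma dim_le: "n \<le> n'"
proof -
  obtain S where "S \<in> carrier_mat n' n" "T * S = 1\<^sub>m n" using T_section by blast
  then show ?thesis using left_inverse_dim_le T(1) by blast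
qed

text \<open>A square \<open>T\<close> with a right inverse is invertible. As the right inverse
  consists of reachable states, every state of the second system is reachable, so the intertwining
  relations hold without restriction.\<close>

lemma same_dim_similar:
  assumes "n' = n"
  shows "invertible_mat T" "\<And>\<alpha>. \<alpha> \<in> I \<Longrightarrow> T * A' \<alpha> = A \<alpha> * T" "C' = C * T"
proof -
  obtain S where S: "S'.rch n S" "S \<in> carrier_mat n n" "T * S = 1\<^sub>m n"
    using T_section assms by metis
  have Tc: "T \<in> carrier_mat n n" using T(1) assms by simp
  have ST: "S * T = 1\<^sub>m n" using mat_mult_left_right_inverse[OF Tc S(2,3)] .
  show "invertible_mat T" using Tc S ST by (intro invertible_matI)
  have 1: "S'.rch n (1\<^sub>m n)" using S'.rch_mult[OF S(1) Tc] ST by simp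
  show "T * A' \<alpha> = A \<alpha> * T" if "\<alpha> \<in> I" for \<alpha>
    using T_step[OF 1 that] S'.A_car[OF that] Tc assms by (simp add: mult_one_dim)
  show "C' = C * T" using T_C[OF 1] Tc S'.C_car assms by (simp add: mult_one_dim)
qed

end

section \<open>Transfer of invertibility between systems over a stably finite algebra\<close>

locale algebra_system_pair = unital_algebra scale + system_pair I H n n' q p A A' B B' C C'
  for scale :: "'k::field \<Rightarrow> 'a::ring_1 \<Rightarrow> 'a" and I :: "'x set" and H :: "'y set" and n n' q p :: nat
    and A A' :: "'x \<Rightarrow> 'k mat" and B B' :: "'y \<Rightarrow> 'k mat" and C C' :: "'k mat" +
  fixes m :: nat and x :: "'x \<Rightarrow> 'a mat"
  assumes x_car: "\<And>\<alpha>. \<alpha> \<in> I \<Longrightarrow> x \<alpha> \<in> carrier_mat m m"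
    and fin: "finite I" and stably_finite: "stably_finite TYPE('a)"
begin

abbreviation "\<Lambda> \<equiv> 1\<^sub>m (m * n) - lin_form scale I m n n A x"
abbreviation "\<Lambda>' \<equiv> 1\<^sub>m (m * n') - lin_form scale I m n' n' A' x"

lemma pencil_intertwine:
  assumes U: "U \<in> carrier_mat p1 p2"
    and F: "\<And>\<alpha>. \<alpha> \<in> I \<Longrightarrow> F \<alpha> \<in> carrier_mat p1 p1" and G: "\<And>\<alpha>. \<alpha> \<in> I \<Longrightarrow> G \<alpha> \<in> carrier_mat p2 p2"
    and FG: "\<And>\<alpha>. \<alpha> \<in> I \<Longrightarrow> F \<alpha> * U = U * G \<alpha>"
  shows "(1\<^sub>m (m * p1) - lin_form scale I m p1 p1 F x) * amp scale m U =
    amp scale m U * (1\<^sub>m (m * p2) - lin_form scale I m p2 p2 G x)"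
proof -
  have "lin_form scale I m p1 p1 F x * amp scale m U = lin_form scale I m p1 p2 (\<lambda>\<alpha>. F \<alpha> * U) x"
    using U F x_car by (rule lin_form_mult_amp)
  also have "\<dots> = lin_form scale I m p1 p2 (\<lambda>\<alpha>. U * G \<alpha>) x" using FG by (rule lin_form_cong)
  also have "\<dots> = amp scale m U * lin_form scale I m p2 p2 G x"
    using U G x_car by (rule amp_mult_lin_form[symmetric])
  finally show ?thesis using U by (simp add: minus_mult_dim mult_minus_dim one_mult_dim mult_one_dim)
qed

text \<open>Both pencils are compared with the restriction \<open>\<Lambda>J\<close> of the second
  one to its reachable states: \<open>J\<close> embeds these states into the second system and
  \<open>U = T * J\<close> maps them onto the first. A left inverse of \<open>J\<close> and a right
  inverse of \<open>U\<close>, both scalar matrices, carry invertibility from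
  \<open>\<Lambda>'\<close> to \<open>\<Lambda>J\<close> and on to \<open>\<Lambda>\<close>.\<close>

theorem transfer:
  assumes inv': "invertible_mat \<Lambda>'"
  shows "invertible_mat \<Lambda>"
    and "y \<in> H \<Longrightarrow> amp scale m C' * (minv \<Lambda>' * amp scale m (B' y)) = amp scale m C * (minv \<Lambda> * amp scale m (B y))"
proof -
  obtain d J K where J: "S'.rch d J" "J \<in> carrier_mat n' d" "K \<in> carrier_mat d n'" "K * J = 1\<^sub>m d"
    and JK: "\<And>k V. S'.rch k V \<Longrightarrow> J * (K * V) = V" using S'.reach_basis by blast
  obtain S where S: "S'.rch n S" "S \<in> carrier_mat n' n" "T * S = 1\<^sub>m n" using T_section by blast
  define G where "G \<alpha> = K * (A' \<alpha> * J)" for \<alpha>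
  have Gc: "G \<alpha> \<in> carrier_mat d d" if "\<alpha> \<in> I" for \<alpha> using S'.A_car[OF that] J by (auto simp: G_def)
  have A'J: "A' \<alpha> * J = J * G \<alpha>" if "\<alpha> \<in> I" for \<alpha>
    unfolding G_def using JK[OF reach_step[OF that J(1)]] by simp
  define U where "U = T * J"
  have Uc: "U \<in> carrier_mat n d" using T(1) J(2) by (simp add: U_def)
  have AU: "A \<alpha> * U = U * G \<alpha>" if "\<alpha> \<in> I" for \<alpha>
    unfolding U_def using T_step[OF J(1) that] A'J[OF that] T(1) J(2) Gc[OF that]
    by (simp add: mult_assoc_dim)
  define h where "h P = amp scale m P" for P :: "'k mat"
  have hm: "h P * h Q = h (P * Q)" if "dim_col P = dim_row Q" for P Q
    using amp_mult that by (simp add: h_def)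
  define \<Lambda>J where "\<Lambda>J = 1\<^sub>m (m * d) - lin_form scale I m d d G x"
  have \<Lambda>Jc: "\<Lambda>J \<in> carrier_mat (m * d) (m * d)"
    unfolding \<Lambda>J_def by (intro minus_carrier_mat lin_form_carrier)
  have \<Lambda>c: "\<Lambda> \<in> carrier_mat (m * n) (m * n)" "\<Lambda>' \<in> carrier_mat (m * n') (m * n')"
    by (intro minus_carrier_mat lin_form_carrier)+
  have 1: "\<Lambda>' * h J = h J * \<Lambda>J"
    unfolding \<Lambda>J_def h_def using S'.A_car A'J Gc J(2) by (intro pencil_intertwine) auto
  have 2: "\<Lambda> * h U = h U * \<Lambda>J"
    unfolding \<Lambda>J_def h_def using S.A_car AU Gc Uc by (intro pencil_intertwine) auto
  note w' = minv_inverse[OF inv' \<Lambda>c(2)]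
  have hJ: "h J \<in> carrier_mat (m * n') (m * d)" "h K \<in> carrier_mat (m * d) (m * n')" "h U \<in> carrier_mat (m * n) (m * d)"
    using J Uc by (auto simp: h_def)
  \<comment> \<open>Cutting the inverse of \<open>\<Lambda>'\<close> down by \<open>J\<close> and
    its left inverse \<open>K\<close> gives only a left inverse of
    \<open>\<Lambda>J\<close>.\<close>
  have "(h K * (minv \<Lambda>' * h J)) * \<Lambda>J = h K * (minv \<Lambda>' * (\<Lambda>' * h J))"
    unfolding 1 using w'(1) hJ \<Lambda>Jc by (simp add: mult_assoc_dim)
  also have "\<dots> = h K * ((minv \<Lambda>' * \<Lambda>') * h J)"
    using w'(1) hJ \<Lambda>c(2) by (subst mult_assoc_dim) simp_all
  also have "\<dots> = 1\<^sub>m (m * d)" unfolding w'(3) using hJ J hm[of K J] by (simp add: one_mult_dim) (simp add: h_def)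
  finally have invJ: "invertible_mat \<Lambda>J"
    using w'(1) hJ \<Lambda>Jc by (intro stably_finite_invertible[OF stably_finite \<Lambda>Jc, of "h K * (minv \<Lambda>' * h J)"]) auto
  note wJ = minv_inverse[OF invJ \<Lambda>Jc]
  have KS: "K * S \<in> carrier_mat d n" "h (K * S) \<in> carrier_mat (m * d) (m * n)" using J S by (auto simp: h_def)
  \<comment> \<open>Dually, \<open>K * S\<close> is a right inverse of \<open>U\<close>: the columns
    of \<open>S\<close> are reachable, so \<open>J * (K * S) = S\<close>, and
    \<open>T * S = 1\<close>. This produces only a right inverse of
    \<open>\<Lambda>\<close>.\<close>
  have "\<Lambda> * (h U * (minv \<Lambda>J * h (K * S))) = (\<Lambda> * h U) * (minv \<Lambda>J * h (K * S))"
    using hJ wJ(1) KS by (subst mult_assoc_dim) auto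
  also have "\<dots> = h U * ((\<Lambda>J * minv \<Lambda>J) * h (K * S))"
    unfolding 2 using hJ wJ(1) KS \<Lambda>Jc by (simp add: mult_assoc_dim)
  also have "\<dots> = h (U * (K * S))" unfolding wJ(2) using KS hm[of U "K * S"] Uc J(3) by (simp add: one_mult_dim)
  also have "U * (K * S) = 1\<^sub>m n"
    using JK[OF S(1)] S J T(1) by (simp add: U_def mult_assoc_dim)
  finally have "\<Lambda> * (h U * (minv \<Lambda>J * h (K * S))) = 1\<^sub>m (m * n)" by (simp add: h_def)
  then show inv: "invertible_mat \<Lambda>"
    using hJ wJ(1) KS by (intro stably_finite_invertible[OF stably_finite \<Lambda>c(1), of "h U * (minv \<Lambda>J * h (K * S))"]) auto
  note w = minv_inverse[OF inv \<Lambda>c(1)]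
  have intertw: "minv L * h V = h V * minv \<Lambda>J"
    if L: "L * h V = h V * \<Lambda>J" "L \<in> carrier_mat l l" "invertible_mat L" "h V \<in> carrier_mat l (m * d)" for L V l
  proof -
    note wl = minv_inverse[OF L(3,2)]
    have "minv L * h V = minv L * ((h V * \<Lambda>J) * minv \<Lambda>J)"
      using wl(1) L(4) \<Lambda>Jc wJ by (simp add: mult_assoc_dim mult_one_dim)
    also have "\<dots> = (minv L * L) * (h V * minv \<Lambda>J)"
      unfolding L(1)[symmetric] using wl(1) L(2,4) wJ(1) by (simp add: mult_assoc_dim)
    finally show ?thesis unfolding wl(3) using L(4) by (simp add: one_mult_dim)
  qed
  have 3: "minv \<Lambda>' * h J = h J * minv \<Lambda>J" by (rule intertw[OF 1 \<Lambda>c(2) inv' hJ(1)])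
  have 4: "minv \<Lambda> * h U = h U * minv \<Lambda>J" by (rule intertw[OF 2 \<Lambda>c(1) inv hJ(3)])
  assume y: "y \<in> H"
  note Bc = S.B_car[OF y] S'.B_car[OF y]
  have rB: "S'.rch q (B' y)" using reach_base[OF y one_carrier_mat[of q], of I n' A' B'] Bc by (simp add: mult_one_dim)
  define b where "b = K * B' y"
  have bc: "b \<in> carrier_mat d q" "h b \<in> carrier_mat (m * d) (m * q)" using J Bc by (auto simp: b_def h_def)
  have B'b: "h (B' y) = h J * h b" using JK[OF rB] hm[of J b] J bc by (simp add: b_def)
  have Bb: "h (B y) = h U * h b"
    using hm[of U b] Uc bc JK[OF rB] T_B[OF y] T(1) J Bc by (simp add: b_def U_def mult_assoc_dim)
  have CU: "h C' * h J = h C * h U"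
    using T_C[OF J(1)] hm[of C' J] hm[of C U] S.C_car S'.C_car J Uc T(1) by (simp add: U_def)
  have Cc: "h C \<in> carrier_mat (m * p) (m * n)" "h C' \<in> carrier_mat (m * p) (m * n')"
    using S.C_car S'.C_car by (auto simp: h_def)
  have "h C' * (minv \<Lambda>' * h (B' y)) = h C' * ((minv \<Lambda>' * h J) * h b)"
    unfolding B'b using hJ bc w'(1) by (simp add: mult_assoc_dim)
  also have "\<dots> = (h C' * h J) * (minv \<Lambda>J * h b)"
    unfolding 3 using hJ bc wJ(1) Cc by (simp add: mult_assoc_dim)
  also have "\<dots> = h C * ((minv \<Lambda> * h U) * h b)"
    unfolding CU 4 using hJ bc wJ(1) Cc by (simp add: mult_assoc_dim)
  also have "\<dots> = h C * (minv \<Lambda> * h (B y))"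
    unfolding Bb using hJ bc w(1) by (simp add: mult_assoc_dim)
  finally show "amp scale m C' * (minv \<Lambda>' * amp scale m (B' y)) = amp scale m C * (minv \<Lambda> * amp scale m (B y))"
    by (simp add: h_def)
qed

end


section \<open>Linear pencils\<close>

text \<open>
  The affine matrix pencil \<open>M\<^sub>0 + \<Sum>\<^sub>k M\<^sub>k x\<^sub>k\<close> is stored as the family of its coefficients, indexed by
  \<open>'d option\<close>; a pencil with a row \<open>c\<close> and a column \<open>b\<close> represents \<open>c M\<^sup>-\<^sup>1 b\<close>.
\<close>

record ('d, 'k) pencil =
  pen_N :: nat
  pen_M :: "'d option \<Rightarrow> 'k mat"
  pen_c :: "'k mat"
  pen_b :: "'k mat"

definition pen_wf :: "nat \<Rightarrow> nat \<Rightarrow> ('d, 'k) pencil \<Rightarrow> bool" where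
  "pen_wf p q P \<longleftrightarrow> (\<forall>\<kappa>. pen_M P \<kappa> \<in> carrier_mat (pen_N P) (pen_N P)) \<and>
     pen_c P \<in> carrier_mat p (pen_N P) \<and> pen_b P \<in> carrier_mat (pen_N P) q"

definition ext_tuple :: "nat \<Rightarrow> ('d \<Rightarrow> 'a::zero_neq_one mat) \<Rightarrow> 'd option \<Rightarrow> 'a mat" where
  "ext_tuple n X \<kappa> = (case \<kappa> of None \<Rightarrow> 1\<^sub>m n | Some k \<Rightarrow> X k)"

text \<open>Coefficients stand in the left factor, so that the value is an array of n \<times> n
  blocks, as in \<open>mx_eval\<close>.\<close>

definition pform :: "('k \<Rightarrow> 'a \<Rightarrow> 'a) \<Rightarrow> nat \<Rightarrow> nat \<Rightarrow> nat \<Rightarrow> ('d::finite option \<Rightarrow> 'k mat) \<Rightarrow> ('d \<Rightarrow> 'a mat) \<Rightarrow> 'a::ring_1 mat"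
  where "pform scale n p q M X = matsum UNIV (p * n) (q * n) (\<lambda>\<kappa>. kron (scalar_mat scale (M \<kappa>)) (ext_tuple n X \<kappa>))"

definition ramp :: "('k \<Rightarrow> 'a \<Rightarrow> 'a) \<Rightarrow> nat \<Rightarrow> 'k mat \<Rightarrow> 'a::ring_1 mat" where
  "ramp scale n P = kron (scalar_mat scale P) (1\<^sub>m n)"

abbreviation "pen_at scale n P X \<equiv> pform scale n (pen_N P) (pen_N P) (pen_M P) X"

definition pen_val :: "('k \<Rightarrow> 'a \<Rightarrow> 'a) \<Rightarrow> nat \<Rightarrow> ('d::finite, 'k) pencil \<Rightarrow> ('d \<Rightarrow> 'a mat) \<Rightarrow> 'a::ring_1 mat" where
  "pen_val scale n P X = ramp scale n (pen_c P) * (minv (pen_at scale n P X) * ramp scale n (pen_b P))"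

lemma pen_wfD:
  assumes "pen_wf p q P"
  shows "pen_M P \<kappa> \<in> carrier_mat (pen_N P) (pen_N P)" "pen_c P \<in> carrier_mat p (pen_N P)"
    "pen_b P \<in> carrier_mat (pen_N P) q"
  using assms by (auto simp: pen_wf_def)

lemma ext_tuple_simps [simp]: "ext_tuple n X None = 1\<^sub>m n" "ext_tuple n X (Some k) = X k"
  by (simp_all add: ext_tuple_def)

lemma ext_tuple_carrier: "X \<in> tuples n \<Longrightarrow> ext_tuple n X \<kappa> \<in> carrier_mat n n"
  by (cases \<kappa>) (auto simp: tuples_def)

lemma pform_carrier [simp]: "pform scale n p q M X \<in> carrier_mat (p * n) (q * n)"
  by (simp add: pform_def)

lemma pform_dim [simp]: "dim_row (pform scale n p q M X) = p * n" "dim_col (pform scale n p q M X) = q * n"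
  by (simp_all add: pform_def)

lemma ramp_carrier [simp]: "P \<in> carrier_mat p q \<Longrightarrow> ramp scale n P \<in> carrier_mat (p * n) (q * n)"
  by (auto simp: ramp_def)

lemma ramp_dim [simp]: "dim_row (ramp scale n P) = dim_row P * n" "dim_col (ramp scale n P) = dim_col P * n"
  by (auto simp: ramp_def)

lemma sum_UNIV_option:
  fixes f :: "'d::finite option \<Rightarrow> 'a::comm_monoid_add"
  shows "(\<Sum>\<kappa>\<in>UNIV. f \<kappa>) = f None + (\<Sum>k\<in>UNIV. f (Some k))"
  by (simp add: UNIV_option_conv sum.reindex)

context unital_algebra
begin

lemma ramp_one [simp]: "ramp scale m (1\<^sub>m n) = 1\<^sub>m (n * m)"
  by (simp add: ramp_def)

lemma ramp_mult: "dim_col P = dim_row Q \<Longrightarrow> ramp scale m P * ramp scale m Q = ramp scale m (P * Q)"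
  unfolding ramp_def by (subst kron_scalar_left_mult) (auto simp: one_mult_dim)

lemma ramp_mult_pform:
  assumes "P \<in> carrier_mat r p" "\<And>\<kappa>. M \<kappa> \<in> carrier_mat p q" "X \<in> tuples n"
  shows "ramp scale n P * pform scale n p q M X = pform scale n r q (\<lambda>\<kappa>. P * M \<kappa>) X"
proof -
  note e = ext_tuple_carrier[OF assms(3)]
  have "ramp scale n P * pform scale n p q M X =
      matsum UNIV (r * n) (q * n) (\<lambda>\<kappa>. ramp scale n P * kron (scalar_mat scale (M \<kappa>)) (ext_tuple n X \<kappa>))"
    unfolding pform_def using assms e by (intro matsum_mult_left kron_carrier ramp_carrier) auto
  also have "\<dots> = pform scale n r q (\<lambda>\<kappa>. P * M \<kappa>) X"
    unfolding pform_def
  proof (rule matsum_cong)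
    fix \<kappa>
    show "ramp scale n P * kron (scalar_mat scale (M \<kappa>)) (ext_tuple n X \<kappa>) =
      kron (scalar_mat scale (P * M \<kappa>)) (ext_tuple n X \<kappa>)"
      unfolding ramp_def using assms(1) assms(2)[of \<kappa>] e[of \<kappa>]
      by (subst kron_scalar_left_mult) (auto simp: one_mult_dim)
  qed
  finally show ?thesis .
qed

lemma pform_mult_ramp:
  assumes "P \<in> carrier_mat q r" "\<And>\<kappa>. M \<kappa> \<in> carrier_mat p q" "X \<in> tuples n"
  shows "pform scale n p q M X * ramp scale n P = pform scale n p r (\<lambda>\<kappa>. M \<kappa> * P) X"
proof -
  note e = ext_tuple_carrier[OF assms(3)]
  have "pform scale n p q M X * ramp scale n P =
      matsum UNIV (p * n) (r * n) (\<lambda>\<kappa>. kron (scalar_mat scale (M \<kappa>)) (ext_tuple n X \<kappa>) * ramp scale n P)"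
    unfolding pform_def using assms e by (intro matsum_mult_right kron_carrier ramp_carrier) auto
  also have "\<dots> = pform scale n p r (\<lambda>\<kappa>. M \<kappa> * P) X"
    unfolding pform_def
  proof (rule matsum_cong)
    fix \<kappa>
    show "kron (scalar_mat scale (M \<kappa>)) (ext_tuple n X \<kappa>) * ramp scale n P =
      kron (scalar_mat scale (M \<kappa> * P)) (ext_tuple n X \<kappa>)"
      unfolding ramp_def using assms(1) assms(2)[of \<kappa>] e[of \<kappa>]
      by (subst kron_scalar_left_mult) (auto simp: mult_one_dim)
  qed
  finally show ?thesis .
qed

end

subsection \<open>Exchanging Kronecker factors\<close>

lemma block_index_eq:
  assumes "a < (s::nat)" "b < s"
  shows "i * s + a = j * s + b \<longleftrightarrow> i = j \<and> a = b"
proof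
  assume eq: "i * s + a = j * s + b"
  have "0 < s" using assms by simp
  then have "(i * s + a) div s = i" "(j * s + b) div s = j" using assms by simp_all
  then have "i = j" using eq by simp
  then show "i = j \<and> a = b" using eq by simp
qed simp

text \<open>The permutation that sends the position i (p s) + I s + a to I (m s) + i s + a: the two
  outer indices i < m and I < p change places, while the inner index a < s stays.\<close>

definition twist_index :: "nat \<Rightarrow> nat \<Rightarrow> nat \<Rightarrow> nat \<Rightarrow> nat" where
  "twist_index s p m t = (t mod (p * s) div s) * (m * s) + ((t div (p * s)) * s + t mod s)"

definition twist :: "nat \<Rightarrow> nat \<Rightarrow> nat \<Rightarrow> nat \<Rightarrow> nat \<Rightarrow> 'a mat \<Rightarrow> 'a mat" where
  "twist s p m q n W = mat (m * (p * s)) (n * (q * s)) (\<lambda>(t, u). W $$ (twist_index s p m t, twist_index s q n u))"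

lemma twist_index_eval:
  assumes "i < m" "I < p" "a < s"
  shows "twist_index s p m (i * (p * s) + (I * s + a)) = I * (m * s) + (i * s + a)"
proof -
  have "I * s + a < p * s" using assms block_index_less by blast
  moreover from this have "0 < p * s" by (cases "p * s") auto
  ultimately have "(i * (p * s) + (I * s + a)) mod (p * s) = I * s + a" "(i * (p * s) + (I * s + a)) div (p * s) = i"
    by (simp_all only: mod_mult_self3 mod_less div_mult_self3 div_less)
  moreover have "(i * (p * s) + (I * s + a)) mod s = a"
    using assms by (simp add: mult.assoc[symmetric] add.assoc[symmetric] distrib_right[symmetric])
  ultimately show ?thesis using assms by (simp add: twist_index_def)
qed

lemma triple_index:
  assumes "t < m * (p * s)"
  obtains i I a where "i < m" "I < p" "a < (s::nat)" "t = i * (p * s) + (I * s + a)"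
proof
  show "t div (p * s) < m" "t mod (p * s) div s < p" "t mod (p * s) mod s < s"
    using assms block_div_less by blast+
  show "t = t div (p * s) * (p * s) + (t mod (p * s) div s * s + t mod (p * s) mod s)"
    by (simp only: div_mult_mod_eq)
qed

lemma twist_index_less: "t < m * (p * s) \<Longrightarrow> twist_index s p m t < p * (m * s)"
  by (elim triple_index) (simp add: twist_index_eval block_index_less)

lemma twist_index_twist_index: "t < m * (p * s) \<Longrightarrow> twist_index s m p (twist_index s p m t) = t"
  by (elim triple_index) (simp add: twist_index_eval)

lemma twist_dim [simp]: "dim_row (twist s p m q n W) = m * (p * s)" "dim_col (twist s p m q n W) = n * (q * s)"
  by (simp_all add: twist_def)

lemma twist_carrier [simp]: "twist s p m q n W \<in> carrier_mat (m * (p * s)) (n * (q * s))"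
  by (simp add: twist_def)

lemma twist_twist:
  "W \<in> carrier_mat (m * (p * s)) (n * (q * s)) \<Longrightarrow> twist s p m q n (twist s m p n q W) = W"
  by (rule eq_matI) (auto simp: twist_def twist_index_less twist_index_twist_index)

lemma sum_twist_index:
  fixes g :: "nat \<Rightarrow> 'a::comm_monoid_add"
  shows "(\<Sum>t<m * (p * s). g (twist_index s p m t)) = (\<Sum>l<p * (m * s). g l)"
proof -
  have "(\<Sum>t<m * (p * s). g (twist_index s p m t)) = (\<Sum>i<m. \<Sum>I<p. \<Sum>a<s. g (I * (m * s) + (i * s + a)))"
    unfolding sum_lessThan_mult by (intro sum.cong refl) (simp add: twist_index_eval)
  also have "\<dots> = (\<Sum>I<p. \<Sum>i<m. \<Sum>a<s. g (I * (m * s) + (i * s + a)))" by (rule sum.swap)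
  also have "\<dots> = (\<Sum>l<p * (m * s). g l)" unfolding sum_lessThan_mult by simp
  finally show ?thesis .
qed

text \<open>Rows and columns are relabelled by bijections, so \<open>twist\<close> is multiplication
  by permutation matrices on both sides and the inner sum is merely reordered.\<close>

lemma twist_mult:
  fixes V W :: "'a::semiring_0 mat"
  assumes "W \<in> carrier_mat (p * (m * s)) (q * (n * s))" "V \<in> carrier_mat (q * (n * s)) (r * (l * s))"
  shows "twist s p m q n W * twist s q n r l V = twist s p m r l (W * V)" (is "?l = ?r")
proof (rule eq_matI)
  fix t u assume "t < dim_row ?r" "u < dim_col ?r"
  then have tu: "t < m * (p * s)" "u < l * (r * s)" by simp_all
  have "?l $$ (t, u) =
    (\<Sum>v<n * (q * s). W $$ (twist_index s p m t, twist_index s q n v) * V $$ (twist_index s q n v, twist_index s r l u))"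
    using tu by (simp add: scalar_prod_def atLeast0LessThan twist_def)
  also have "\<dots> = (\<Sum>v<q * (n * s). W $$ (twist_index s p m t, v) * V $$ (v, twist_index s r l u))"
    by (rule sum_twist_index)
  also have "\<dots> = ?r $$ (t, u)"
    using tu twist_index_less[OF tu(1)] twist_index_less[OF tu(2)] assms
    by (simp add: scalar_prod_def atLeast0LessThan twist_def)
  finally show "?l $$ (t, u) = ?r $$ (t, u)" .
qed auto

lemma twist_one [simp]: "twist s p m p m (1\<^sub>m (p * (m * s))) = (1\<^sub>m (m * (p * s)) :: 'a::zero_neq_one mat)"
proof (rule eq_matI)
  fix t u assume "t < dim_row (1\<^sub>m (m * (p * s)) :: 'a mat)" "u < dim_col (1\<^sub>m (m * (p * s)) :: 'a mat)"
  then have tu: "t < m * (p * s)" "u < m * (p * s)" by simp_all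
  have "twist_index s p m t = twist_index s p m u \<longleftrightarrow> t = u"
    using twist_index_twist_index[OF tu(1)] twist_index_twist_index[OF tu(2)] by metis
  then show "twist s p m p m (1\<^sub>m (p * (m * s))) $$ (t, u) = (1\<^sub>m (m * (p * s)) :: 'a mat) $$ (t, u)"
    using tu twist_index_less[OF tu(1)] twist_index_less[OF tu(2)] by (simp add: twist_def)
qed auto

lemma twist_invertible:
  fixes W :: "'a::ring_1 mat"
  assumes W: "W \<in> carrier_mat (p * (m * s)) (p * (m * s))" and inv: "invertible_mat W"
  shows "invertible_mat (twist s p m p m W)" "minv (twist s p m p m W) = twist s p m p m (minv W)"
proof -
  note w = minv_inverse[OF inv W]
  have 1: "twist s p m p m W * twist s p m p m (minv W) = 1\<^sub>m (m * (p * s))"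
    "twist s p m p m (minv W) * twist s p m p m W = 1\<^sub>m (m * (p * s))"
    by (subst twist_mult; use w W in simp)+
  show "invertible_mat (twist s p m p m W)" by (rule invertible_matI[OF twist_carrier 1])
  show "minv (twist s p m p m W) = twist s p m p m (minv W)" by (rule minv_eqI[OF twist_carrier twist_carrier 1])
qed

lemma twist_invertible_iff:
  fixes W :: "'a::ring_1 mat"
  assumes W: "W \<in> carrier_mat (p * (m * s)) (p * (m * s))"
  shows "invertible_mat (twist s p m p m W) \<longleftrightarrow> invertible_mat W"
proof
  assume "invertible_mat (twist s p m p m W)"
  then have "invertible_mat (twist s m p m p (twist s p m p m W))"
    by (rule twist_invertible(1)[OF twist_carrier])
  then show "invertible_mat W" by (simp add: twist_twist[OF W])
qed (rule twist_invertible(1)[OF W])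

lemma twist_single: "W \<in> carrier_mat (m * s) (n * s) \<Longrightarrow> twist s 1 m 1 n W = W"
  by (rule eq_matI) (auto simp: twist_def twist_index_def)

lemma (in unital_algebra) twist_ramp:
  assumes "P \<in> carrier_mat p q"
  shows "twist s p m q m (ramp scale (m * s) P) = amp scale m (kron P (1\<^sub>m s))" (is "?l = ?r")
proof (rule bmat_eqI[of _ m "p * s" m "q * s"])
  fix i v j u assume *: "i < m" "v < p * s" "j < m" "u < q * s"
  obtain I a where v: "I < p" "a < s" "v = I * s + a"
    using * block_div_less by (metis div_mult_mod_eq)
  obtain J b where u: "J < q" "b < s" "u = J * s + b"
    using * block_div_less by (metis div_mult_mod_eq)
  have ij: "i * s + a = j * s + b \<longleftrightarrow> i = j \<and> a = b"
    using v u by (simp add: block_index_eq)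
  have l: "i * s + a < m * s" "j * s + b < m * s" using * v u block_index_less by blast+
  have "?l $$ (i * (p * s) + v, j * (q * s) + u) =
      ramp scale (m * s) P $$ (I * (m * s) + (i * s + a), J * (m * s) + (j * s + b))"
    using * v u by (simp add: twist_def twist_index_eval block_index_less)
  also have "\<dots> = scale (P $$ (I, J)) 1 * 1\<^sub>m (m * s) $$ (i * s + a, j * s + b)"
    unfolding ramp_def using v u l assms
    by (subst kron_index[of _ p q _ "m * s" "m * s"]) auto
  also have "\<dots> = 1\<^sub>m m $$ (i, j) * scale (P $$ (I, J) * 1\<^sub>m s $$ (a, b)) 1"
    using l * u v ij by simp
  also have "P $$ (I, J) * 1\<^sub>m s $$ (a, b) = kron P (1\<^sub>m s) $$ (v, u)"
    unfolding v u using v u assms by (subst kron_index[of _ p q _ s s]) auto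
  also have "1\<^sub>m m $$ (i, j) * scale (kron P (1\<^sub>m s) $$ (v, u)) 1 = ?r $$ (i * (p * s) + v, j * (q * s) + u)"
    unfolding amp_def using * assms by (subst kron_index[of _ m m _ "p * s" "q * s"]) auto
  finally show "?l $$ (i * (p * s) + v, j * (q * s) + u) = ?r $$ (i * (p * s) + v, j * (q * s) + u)" .
qed (use assms in auto)

subsection \<open>Pencils as systems centred at a matrix tuple\<close>

text \<open>A linear map on s \<times> s matrices is known from its values at the matrix units;
  every variable therefore contributes one letter (k, a, b) for each unit
  \<open>E_ab\<close>.\<close>

definition letters :: "nat \<Rightarrow> ('d::finite \<times> nat \<times> nat) set" where
  "letters s = UNIV \<times> {..<s} \<times> {..<s}"

text \<open>For the letter (k, a, b) this collects the (a, b) entries of the m \<times> m blocks of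
  \<open>X_k\<close> - I_m \<otimes> \<open>Y_k\<close>.\<close>

definition centred :: "('k \<Rightarrow> 'a \<Rightarrow> 'a) \<Rightarrow> nat \<Rightarrow> nat \<Rightarrow> ('d \<Rightarrow> 'k mat) \<Rightarrow> ('d \<Rightarrow> 'a mat) \<Rightarrow> 'd \<times> nat \<times> nat \<Rightarrow> 'a::ring_1 mat" where
  "centred scale s m Y X = (\<lambda>(k, a, b). mat m m (\<lambda>(i, j).
     X k $$ (i * s + a, j * s + b) - (if i = j then scale (Y k $$ (a, b)) 1 else 0)))"

text \<open>Obtained by expanding the pencil around I \<otimes> Y and extracting its value at Y as a
  left factor: what remains is 1 minus a linear form with these coefficients.\<close>

definition sys_A :: "nat \<Rightarrow> ('d::finite \<Rightarrow> 'k::field mat) \<Rightarrow> ('d, 'k) pencil \<Rightarrow> 'd \<times> nat \<times> nat \<Rightarrow> 'k mat" where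
  "sys_A s Y P = (\<lambda>(k, a, b). - (minv (pen_at (*) s P Y) * kron (pen_M P (Some k)) (unit_mat s a b)))"

definition sys_B :: "nat \<Rightarrow> ('d::finite \<Rightarrow> 'k::field mat) \<Rightarrow> ('d, 'k) pencil \<Rightarrow> 'k mat" where
  "sys_B s Y P = minv (pen_at (*) s P Y) * kron (pen_b P) (1\<^sub>m s)"

definition sys_C :: "nat \<Rightarrow> ('d::finite, 'k::field) pencil \<Rightarrow> 'k mat" where
  "sys_C s P = kron (pen_c P) (1\<^sub>m s)"

definition sys_Lambda where
  "sys_Lambda scale s m Y P X = 1\<^sub>m (m * (pen_N P * s)) -
     lin_form scale (letters s) m (pen_N P * s) (pen_N P * s) (sys_A s Y P) (centred scale s m Y X)"

lemma finite_letters [simp]: "finite (letters s)"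
  by (simp add: letters_def)

lemma unit_mat_carrier [simp]: "unit_mat s a b \<in> carrier_mat s s"
  by (simp add: unit_mat_def)

lemma unit_mat_dim [simp]: "dim_row (unit_mat s a b) = s" "dim_col (unit_mat s a b) = s"
  by (simp_all add: unit_mat_def)

lemma unit_mat_index [simp]:
  "i < s \<Longrightarrow> j < s \<Longrightarrow> unit_mat s a b $$ (i, j) = (if i = a \<and> j = b then 1 else 0)"
  by (simp add: unit_mat_def)

lemma centred_carrier [simp]: "centred scale s m Y X \<alpha> \<in> carrier_mat m m"
  by (cases \<alpha>) (simp add: centred_def)

lemma sum_letters: "(\<Sum>\<alpha>\<in>letters s. f \<alpha>) = (\<Sum>k\<in>UNIV. \<Sum>a<s. \<Sum>b<s. f (k, a, b))"
  by (simp add: letters_def sum.cartesian_product case_prod_unfold)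

lemma sum_letters_delta:
  fixes f :: "'d::finite \<Rightarrow> 'a::comm_monoid_add"
  assumes "a < s" "b < s" "\<And>k a' b'. a' < s \<Longrightarrow> b' < s \<Longrightarrow> g (k, a', b') = (if a' = a \<and> b' = b then f k else 0)"
  shows "(\<Sum>\<alpha>\<in>letters s. g \<alpha>) = (\<Sum>k\<in>UNIV. f k)"
  unfolding sum_letters
proof (rule sum.cong[OF refl])
  fix k
  have "(\<Sum>a'<s. \<Sum>b'<s. g (k, a', b')) = (\<Sum>a'<s. \<Sum>b'<s. if b' = b then (if a' = a then f k else 0) else 0)"
    by (intro sum.cong refl) (auto simp: assms(3))
  then show "(\<Sum>a'<s. \<Sum>b'<s. g (k, a', b')) = f k" using assms(1,2) by simp
qed

lemma pen_sys_carrier: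
  assumes "pen_wf 1 1 P" "invertible_mat (pen_at (*) s P Y)"
  shows "sys_A s Y P \<alpha> \<in> carrier_mat (pen_N P * s) (pen_N P * s)"
    "sys_B s Y P \<in> carrier_mat (pen_N P * s) s" "sys_C s P \<in> carrier_mat s (pen_N P * s)"
  using pen_wfD[OF assms(1)] minv_inverse[OF assms(2) pform_carrier]
  by (cases \<alpha>; auto simp: sys_A_def sys_B_def sys_C_def intro!: mult_carrier_mat kron_carrier)+

lemma pform_index:
  assumes "\<And>\<kappa>. M \<kappa> \<in> carrier_mat p q" "X \<in> tuples n" "I < p" "i < n" "J < q" "j < n"
  shows "pform scale n p q M X $$ (I * n + i, J * n + j) =
    scale (M None $$ (I, J)) 1 * (if i = j then 1 else 0) + (\<Sum>k\<in>UNIV. scale (M (Some k) $$ (I, J)) 1 * X k $$ (i, j))"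
proof -
  have "pform scale n p q M X $$ (I * n + i, J * n + j) =
    (\<Sum>\<kappa>\<in>UNIV. scale (M \<kappa> $$ (I, J)) 1 * ext_tuple n X \<kappa> $$ (i, j))"
    unfolding pform_def using assms block_index_less[of I p i n] block_index_less[of J q j n]
  proof (simp, intro sum.cong refl)
    fix \<kappa>
    show "kron (scalar_mat scale (M \<kappa>)) (ext_tuple n X \<kappa>) $$ (I * n + i, J * n + j) =
      scale (M \<kappa> $$ (I, J)) 1 * ext_tuple n X \<kappa> $$ (i, j)"
      using assms(1)[of \<kappa>] assms(3-) ext_tuple_carrier[OF assms(2), of \<kappa>]
      by (subst kron_index[of _ p q _ n n]) auto
  qed
  then show ?thesis using assms(4,6) by (simp add: sum_UNIV_option)
qed

context unital_algebra
begin

text \<open>A pencil is affine, so its value at X is its value at I \<otimes> Y plus the terms with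
  \<open>X_k\<close> - I \<otimes> \<open>Y_k\<close>. Splitting each s \<times> s block into matrix
  units turns these terms into the linear form of \<open>sys_Lambda\<close>.\<close>

lemma twist_pencil:
  assumes wf: "pen_wf 1 1 P" and inv: "invertible_mat (pen_at (*) s P Y)"
    and Y: "Y \<in> tuples s" and X: "X \<in> tuples (m * s)"
  shows "twist s (pen_N P) m (pen_N P) m (pen_at scale (m * s) P X) =
    amp scale m (pen_at (*) s P Y) * sys_Lambda scale s m Y P X"
proof -
  let ?N = "pen_N P" and ?M = "pen_at (*) s P Y" and ?x = "centred scale s m Y X"
  note Mc = pen_wfD(1)[OF wf] and g = minv_inverse[OF inv pform_carrier]
  have "amp scale m ?M * sys_Lambda scale s m Y P X =
      amp scale m ?M - lin_form scale (letters s) m (?N * s) (?N * s) (\<lambda>\<alpha>. ?M * sys_A s Y P \<alpha>) ?x"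
    unfolding sys_Lambda_def using pen_sys_carrier(1)[OF wf inv]
    by (simp add: mult_minus_dim mult_one_dim amp_mult_lin_form[OF pform_carrier])
  also have "\<dots> = amp scale m ?M - lin_form scale (letters s) m (?N * s) (?N * s)
      (\<lambda>(k, a, b). - kron (pen_M P (Some k)) (unit_mat s a b)) ?x"
  proof (rule arg_cong[where f = "\<lambda>z. amp scale m ?M - z"], rule lin_form_cong, clarify)
    fix k and a b :: nat
    have K: "kron (pen_M P (Some k)) (unit_mat s a b) \<in> carrier_mat (?N * s) (?N * s)"
      using Mc by (intro kron_carrier) auto
    then have "?M * sys_A s Y P (k, a, b) = - (?M * (minv ?M * kron (pen_M P (Some k)) (unit_mat s a b)))"
      unfolding sys_A_def using g(1) Mc[of "Some k"] by (simp add: mult_uminus_dim)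
    also have "\<dots> = - ((?M * minv ?M) * kron (pen_M P (Some k)) (unit_mat s a b))"
      using g(1) K Mc[of "Some k"] by (subst mult_assoc_dim) simp_all
    finally show "?M * sys_A s Y P (k, a, b) = - kron (pen_M P (Some k)) (unit_mat s a b)"
      unfolding g(2) using K Mc[of "Some k"] by (simp add: one_mult_dim)
  qed
  also have "twist s ?N m ?N m (pen_at scale (m * s) P X) = \<dots>" (is "?l = _")
  proof (rule bmat_eqI[of _ m "?N * s" m "?N * s"])
    fix i v j u assume *: "i < m" "v < ?N * s" "j < m" "u < ?N * s"
    obtain I a where v: "I < ?N" "a < s" "v = I * s + a"
      using * block_div_less by (metis div_mult_mod_eq)
    obtain J b where u: "J < ?N" "b < s" "u = J * s + b"
      using * block_div_less by (metis div_mult_mod_eq)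
    have ij: "i * s + a = j * s + b \<longleftrightarrow> i = j \<and> a = b"
      using v u by (simp add: block_index_eq)
    have l: "i * s + a < m * s" "j * s + b < m * s" using * v u block_index_less by blast+
    have iv: "i * (?N * s) + v < m * (?N * s)" "j * (?N * s) + u < m * (?N * s)"
      using * block_index_less by blast+
    let ?m = "\<lambda>\<kappa>. pen_M P \<kappa> $$ (I, J)"
    let ?\<delta> = "\<lambda>c::'a. if i = j then c else 0"
    have 1: "?l $$ (i * (?N * s) + v, j * (?N * s) + u) =
      scale (?m None) (if i = j \<and> a = b then 1 else 0) +
      (\<Sum>k\<in>UNIV. scale (?m (Some k)) (X k $$ (i * s + a, j * s + b)))"
      using * v u l iv pform_index[OF Mc X v(1) l(1) u(1) l(2), of scale] ij
      by (simp add: twist_def twist_index_eval)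
    have "amp scale m ?M $$ (i * (?N * s) + v, j * (?N * s) + u) = ?\<delta> (scale (?M $$ (v, u)) 1)"
      unfolding amp_def using * by (subst kron_index[of _ m m _ "?N * s" "?N * s"]) auto
    also have "?M $$ (v, u) = ?m None * (if a = b then 1 else 0) + (\<Sum>k\<in>UNIV. ?m (Some k) * Y k $$ (a, b))"
      unfolding v u using pform_index[OF Mc Y v(1,2) u(1,2), of "(*)"] by simp
    finally have 2: "amp scale m ?M $$ (i * (?N * s) + v, j * (?N * s) + u) =
      ?\<delta> (scale (?m None) (if a = b then 1 else 0)) + ?\<delta> (\<Sum>k\<in>UNIV. scale (?m (Some k) * Y k $$ (a, b)) 1)"
      by (simp add: scale_left_distrib scale_sum_left)
    have "lin_form scale (letters s) m (?N * s) (?N * s) (\<lambda>(k, a, b). - kron (pen_M P (Some k)) (unit_mat s a b)) ?x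
        $$ (i * (?N * s) + v, j * (?N * s) + u) =
      (\<Sum>k\<in>UNIV. - scale (?m (Some k)) (X k $$ (i * s + a, j * s + b) - ?\<delta> (scale (Y k $$ (a, b)) 1)))"
      unfolding lin_form_def matsum_index[OF iv]
    proof (rule sum_letters_delta[OF v(2) u(2)])
      fix k a' b' assume "a' < s" "b' < s"
      have K: "kron (pen_M P (Some k)) (unit_mat s a' b') \<in> carrier_mat (?N * s) (?N * s)"
        using Mc by (intro kron_carrier) auto
      have "kron (?x (k, a', b')) (scalar_mat scale (case (k, a', b') of (k, a, b) \<Rightarrow> - kron (pen_M P (Some k)) (unit_mat s a b)))
          $$ (i * (?N * s) + v, j * (?N * s) + u) =
        ?x (k, a', b') $$ (i, j) * scale (- kron (pen_M P (Some k)) (unit_mat s a' b') $$ (v, u)) 1"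
        using * K Mc[of "Some k"] by (subst kron_index[of _ m m _ "?N * s" "?N * s"]) auto
      also have "kron (pen_M P (Some k)) (unit_mat s a' b') $$ (v, u) = ?m (Some k) * (if a = a' \<and> b = b' then 1 else 0)"
        unfolding v u using v u Mc[of "Some k"] by (subst kron_index[of _ ?N ?N _ s s]) auto
      finally show "kron (?x (k, a', b')) (scalar_mat scale (case (k, a', b') of (k, a, b) \<Rightarrow> - kron (pen_M P (Some k)) (unit_mat s a b)))
          $$ (i * (?N * s) + v, j * (?N * s) + u) =
        (if a' = a \<and> b' = b then - scale (?m (Some k)) (X k $$ (i * s + a, j * s + b) - ?\<delta> (scale (Y k $$ (a, b)) 1)) else 0)"
        using * by (auto simp: centred_def)
    qed
    then show "?l $$ (i * (?N * s) + v, j * (?N * s) + u) =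
      (amp scale m ?M - lin_form scale (letters s) m (?N * s) (?N * s)
        (\<lambda>(k, a, b). - kron (pen_M P (Some k)) (unit_mat s a b)) ?x) $$ (i * (?N * s) + v, j * (?N * s) + u)"
      using iv 1 2 by (simp add: sum_negf scale_right_diff_distrib sum_subtractf)
  qed (simp_all, intro minus_carrier_mat lin_form_carrier)
  finally show ?thesis .
qed

lemma sys_Lambda_carrier:
  "sys_Lambda scale s m Y P X \<in> carrier_mat (m * (pen_N P * s)) (m * (pen_N P * s))"
  unfolding sys_Lambda_def by (intro minus_carrier_mat lin_form_carrier)

text \<open>In the factorization \<open>twist_pencil\<close> the constant left factor is invertible,
  so only \<open>sys_Lambda\<close> decides; in the value the inverse of that factor is absorbed
  into \<open>sys_B\<close>.\<close>

lemma pencil_sys: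
  assumes wf: "pen_wf 1 1 P" and inv: "invertible_mat (pen_at (*) s P Y)"
    and Y: "Y \<in> tuples s" and X: "X \<in> tuples (m * s)"
  shows "invertible_mat (pen_at scale (m * s) P X) \<longleftrightarrow> invertible_mat (sys_Lambda scale s m Y P X)"
    and "invertible_mat (pen_at scale (m * s) P X) \<Longrightarrow> pen_val scale (m * s) P X =
      amp scale m (sys_C s P) * (minv (sys_Lambda scale s m Y P X) * amp scale m (sys_B s Y P))"
proof -
  let ?N = "pen_N P" and ?M = "pen_at (*) s P Y" and ?\<Lambda> = "sys_Lambda scale s m Y P X"
    and ?W = "pen_at scale (m * s) P X"
  note Mc = pen_wfD[OF wf] and g = minv_inverse[OF inv pform_carrier]
  note tw = twist_pencil[OF assms]
  have aM: "amp scale m ?M \<in> carrier_mat (m * (?N * s)) (m * (?N * s))" by (intro amp_carrier pform_carrier)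
  note ai = amp_invertible[OF inv pform_carrier, of m]
  note a = minv_inverse[OF ai(1) aM]
  have L: "?\<Lambda> = minv (amp scale m ?M) * (amp scale m ?M * ?\<Lambda>)"
  proof -
    have "minv (amp scale m ?M) * (amp scale m ?M * ?\<Lambda>) = (minv (amp scale m ?M) * amp scale m ?M) * ?\<Lambda>"
      using a(1) aM sys_Lambda_carrier[of s m Y P X] by (intro mult_assoc_dim[symmetric]) simp_all
    then show ?thesis unfolding a(3) using sys_Lambda_carrier[of s m Y P X] by (simp add: one_mult_dim)
  qed
  show iff: "invertible_mat ?W \<longleftrightarrow> invertible_mat ?\<Lambda>"
  proof
    assume "invertible_mat ?W"
    then have "invertible_mat (amp scale m ?M * ?\<Lambda>)"
      unfolding tw[symmetric] by (simp add: twist_invertible_iff)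
    then show "invertible_mat ?\<Lambda>"
      by (subst L) (rule invertible_mult[OF invertible_minv[OF ai(1) aM] a(1) _
          mult_carrier_mat[OF aM sys_Lambda_carrier]])
  next
    assume "invertible_mat ?\<Lambda>"
    then have "invertible_mat (amp scale m ?M * ?\<Lambda>)" using ai(1) aM sys_Lambda_carrier by (intro invertible_mult)
    then show "invertible_mat ?W" unfolding tw[symmetric] by (simp add: twist_invertible_iff)
  qed
  assume W: "invertible_mat ?W"
  note w = minv_inverse[OF W pform_carrier]
  have L': "invertible_mat ?\<Lambda>" using iff W by simp
  note l = minv_inverse[OF L' sys_Lambda_carrier]
  have c1: "ramp scale (m * s) (pen_c P) \<in> carrier_mat (1 * (m * s)) (?N * (m * s))"
    "ramp scale (m * s) (pen_b P) \<in> carrier_mat (?N * (m * s)) (1 * (m * s))"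
    using Mc by (intro ramp_carrier; simp)+
  have "pen_val scale (m * s) P X = twist s 1 m 1 m (pen_val scale (m * s) P X)"
    by (rule twist_single[symmetric]) (use c1 w in \<open>auto simp: pen_val_def\<close>)
  also have "\<dots> = twist s 1 m ?N m (ramp scale (m * s) (pen_c P)) *
      twist s ?N m 1 m (minv ?W * ramp scale (m * s) (pen_b P))"
    unfolding pen_val_def using c1 w(1) by (intro twist_mult[symmetric]) auto
  also have "twist s ?N m 1 m (minv ?W * ramp scale (m * s) (pen_b P)) =
      twist s ?N m ?N m (minv ?W) * twist s ?N m 1 m (ramp scale (m * s) (pen_b P))"
    using c1 w(1) by (intro twist_mult[symmetric]) auto
  also have "twist s ?N m ?N m (minv ?W) = minv (amp scale m ?M * ?\<Lambda>)"
    using twist_invertible(2)[OF pform_carrier W] tw by simp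
  also have "\<dots> = minv ?\<Lambda> * minv (amp scale m ?M)"
  proof (rule minv_eqI[of _ "m * (?N * s)"])
    have "amp scale m ?M * ?\<Lambda> * (minv ?\<Lambda> * minv (amp scale m ?M)) =
        amp scale m ?M * ((?\<Lambda> * minv ?\<Lambda>) * minv (amp scale m ?M))"
      using a(1) aM l(1) sys_Lambda_carrier[of s m Y P X] by (simp add: mult_assoc_dim)
    then show "amp scale m ?M * ?\<Lambda> * (minv ?\<Lambda> * minv (amp scale m ?M)) = 1\<^sub>m (m * (?N * s))"
      unfolding l(2) using a by (simp add: one_mult_dim)
    have "minv ?\<Lambda> * minv (amp scale m ?M) * (amp scale m ?M * ?\<Lambda>) = minv ?\<Lambda> * ?\<Lambda>"
      using a(1) aM l(1) sys_Lambda_carrier[of s m Y P X] L by (simp add: mult_assoc_dim)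
    then show "minv ?\<Lambda> * minv (amp scale m ?M) * (amp scale m ?M * ?\<Lambda>) = 1\<^sub>m (m * (?N * s))" using l by simp
  qed (use a(1) aM l(1) sys_Lambda_carrier[of s m Y P X] in auto)
  also have "minv (amp scale m ?M) = amp scale m (minv ?M)" by (rule ai(2))
  also have "twist s 1 m ?N m (ramp scale (m * s) (pen_c P)) = amp scale m (sys_C s P)"
    unfolding sys_C_def by (rule twist_ramp) (rule Mc)
  also have "twist s ?N m 1 m (ramp scale (m * s) (pen_b P)) = amp scale m (kron (pen_b P) (1\<^sub>m s))"
    by (rule twist_ramp) (rule Mc)
  also have "minv ?\<Lambda> * amp scale m (minv ?M) * amp scale m (kron (pen_b P) (1\<^sub>m s)) =
      minv ?\<Lambda> * amp scale m (sys_B s Y P)"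
    unfolding sys_B_def using l(1) g(1) Mc by (simp add: mult_assoc_dim amp_mult)
  finally show "pen_val scale (m * s) P X = amp scale m (sys_C s P) * (minv ?\<Lambda> * amp scale m (sys_B s Y P))" .
qed

end


subsection \<open>Moments\<close>

text \<open>
  At the point \<open>word_point\<close>, a nilpotent perturbation of \<open>I \<otimes> Y\<close>, the top right block of the value of a
  system is its moment along the word.
\<close>

definition word_point :: "nat \<Rightarrow> ('d \<Rightarrow> 'k::field mat) \<Rightarrow> ('d \<times> nat \<times> nat) list \<Rightarrow> 'd \<Rightarrow> 'k mat" where
  "word_point s Y w k = (let m = Suc (length w) in mat (m * s) (m * s) (\<lambda>(u, v).
     (if u div s = v div s then Y k $$ (u mod s, v mod s) else 0) +
     (if v div s = Suc (u div s) \<and> w ! (u div s) = (k, u mod s, v mod s) then 1 else 0)))"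

lemma word_point_tuples: "word_point s Y w \<in> tuples (Suc (length w) * s)"
  by (simp add: tuples_def word_point_def Let_def)

lemma centred_word_point:
  assumes "i < Suc (length w)" "j < Suc (length w)" "\<alpha> \<in> letters s"
  shows "centred (*) s (Suc (length w)) Y (word_point s Y w) \<alpha> $$ (i, j) = (if j = Suc i \<and> w ! i = \<alpha> then 1 else 0)"
proof -
  obtain k a b where \<alpha>: "\<alpha> = (k, a, b)" "a < s" "b < s" using assms(3) by (auto simp: letters_def)
  have "i * s + a < Suc (length w) * s" "j * s + b < Suc (length w) * s"
    using block_index_less assms(1,2) \<alpha>(2,3) by blast+
  then show ?thesis
    using assms(1,2) \<alpha>(2,3) unfolding \<alpha>(1) by (simp add: centred_def word_point_def Let_def)
qed

lemma lin_form_word_point: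
  assumes w: "w \<in> lists (letters s)" and G: "\<And>\<alpha>. \<alpha> \<in> letters s \<Longrightarrow> G \<alpha> \<in> carrier_mat p q"
  defines "m \<equiv> Suc (length w)"
  shows "lin_form (*) (letters s) m p q G (centred (*) s m Y (word_point s Y w)) =
    bmat m m p q (\<lambda>i j. if j = Suc i then G (w ! i) else 0\<^sub>m p q)" (is "?l = ?r")
proof (rule bmat_eqI)
  fix i a j b assume *: "i < m" "a < p" "j < m" "b < q"
  have iv: "i * p + a < m * p" "j * q + b < m * q" using * block_index_less by blast+
  have "?l $$ (i * p + a, j * q + b) =
    (\<Sum>\<alpha>\<in>letters s. if \<alpha> = w ! i then (if j = Suc i then G (w ! i) $$ (a, b) else 0) else 0)"
    unfolding lin_form_def matsum_index[OF iv]
  proof (rule sum.cong[OF refl])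
    fix \<alpha> :: "'a \<times> nat \<times> nat" assume \<alpha>: "\<alpha> \<in> letters s"
    show "kron (centred (*) s m Y (word_point s Y w) \<alpha>) (scalar_mat (*) (G \<alpha>)) $$ (i * p + a, j * q + b) =
      (if \<alpha> = w ! i then (if j = Suc i then G (w ! i) $$ (a, b) else 0) else 0)"
      using G[OF \<alpha>] * centred_word_point[OF _ _ \<alpha>, of i w j Y]
      by (subst kron_index[of _ m m _ p q]) (auto simp: m_def)
  qed
  also have "\<dots> = (if j = Suc i then G (w ! i) $$ (a, b) else 0)"
  proof (cases "j = Suc i")
    case True
    then have "w ! i \<in> letters s" using * w by (auto simp: m_def)
    then show ?thesis by simp
  qed simp
  finally show "?l $$ (i * p + a, j * q + b) = ?r $$ (i * p + a, j * q + b)"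
    using * by (simp add: bmat_index)
qed auto

lemma amp_bmat:
  assumes "P \<in> carrier_mat p q"
  shows "amp (*) m P = bmat m m p q (\<lambda>i j. if i = j then P else 0\<^sub>m p q)" (is "_ = ?r")
proof (rule bmat_eqI)
  fix i a j b assume *: "i < m" "a < p" "j < m" "b < q"
  then show "amp (*) m P $$ (i * p + a, j * q + b) =
    ?r $$ (i * p + a, j * q + b)"
    unfolding amp_def using assms by (subst kron_index[of _ m m _ p q]) (auto simp: bmat_index)
qed (use assms in auto)

text \<open>Block (i, j) of the inverse of 1 minus the matrix with \<open>A (w ! i)\<close> on its
  block superdiagonal: the product of the letters from position i up to, but excluding, position
  j.\<close>

definition word_inverse :: "nat \<Rightarrow> ('x \<Rightarrow> 'k::field mat) \<Rightarrow> 'x list \<Rightarrow> nat \<Rightarrow> nat \<Rightarrow> 'k mat" where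
  "word_inverse n A w i j = (if i \<le> j then wprod n A (take (j - i) (drop i w)) else 0\<^sub>m n n)"

locale word_system =
  fixes s n :: nat and Y :: "'d::finite \<Rightarrow> 'k::field mat" and A :: "'d \<times> nat \<times> nat \<Rightarrow> 'k mat"
    and w :: "('d \<times> nat \<times> nat) list"
  assumes A_car: "\<And>\<alpha>. \<alpha> \<in> letters s \<Longrightarrow> A \<alpha> \<in> carrier_mat n n" and w: "w \<in> lists (letters s)"
begin

abbreviation "m \<equiv> Suc (length w)"
abbreviation "\<Lambda> \<equiv> 1\<^sub>m (m * n) - lin_form (*) (letters s) m n n A (centred (*) s m Y (word_point s Y w))"
abbreviation "W \<equiv> bmat m m n n (word_inverse n A w)"

lemma word_inverse_carrier: "word_inverse n A w i j \<in> carrier_mat n n"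
proof -
  have "wprod n A v \<in> carrier_mat n n" if "v \<in> lists (letters s)" for v
    using that by (induction v) (auto intro!: mult_carrier_mat A_car)
  moreover have "take (j - i) (drop i w) \<in> lists (letters s)" using w by (auto dest!: in_set_takeD in_set_dropD)
  ultimately show ?thesis by (simp add: word_inverse_def)
qed

lemma word_inverse_dim [simp]: "dim_row (word_inverse n A w i j) = n" "dim_col (word_inverse n A w i j) = n"
  using word_inverse_carrier[of i j] by auto

lemma A_nth: "i < length w \<Longrightarrow> A (w ! i) \<in> carrier_mat n n"
  using w by (intro A_car) auto

lemma wprod_w_carrier: "wprod n A w \<in> carrier_mat n n"
  using word_inverse_carrier[of 0 "length w"] by (simp add: word_inverse_def)

text \<open>The Neumann series is finite because the linear form is strictly block triangular. The
  product telescopes: for i < j, \<open>A (w ! i)\<close> times block (i + 1, j) is block (i, j), so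
  only the diagonal survives.\<close>

lemma Lambda_word: "invertible_mat \<Lambda>" "minv \<Lambda> = W"
proof -
  have "bmat m m n n (\<lambda>i j. if j = Suc i then A (w ! i) else 0\<^sub>m n n) * W =
    bmat m m n n (\<lambda>i j. matsum {..<m} n n (\<lambda>l. (if l = Suc i then A (w ! i) else 0\<^sub>m n n) * word_inverse n A w l j))"
    using word_inverse_carrier by (intro bmat_mult) (auto intro!: A_nth)
  also have "\<dots> = bmat m m n n (\<lambda>i j. if i < length w then A (w ! i) * word_inverse n A w (Suc i) j else 0\<^sub>m n n)"
  proof (rule bmat_cong)
    fix i j assume "i < m" "j < m"
    show "matsum {..<m} n n (\<lambda>l. (if l = Suc i then A (w ! i) else 0\<^sub>m n n) * word_inverse n A w l j) =
      (if i < length w then A (w ! i) * word_inverse n A w (Suc i) j else 0\<^sub>m n n)"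
    proof (cases "i < length w")
      case True
      then have "A (w ! i) \<in> carrier_mat n n" by (rule A_nth)
      then have "matsum {..<m} n n (\<lambda>l. (if l = Suc i then A (w ! i) else 0\<^sub>m n n) * word_inverse n A w l j) =
        (if Suc i = Suc i then A (w ! i) else 0\<^sub>m n n) * word_inverse n A w (Suc i) j"
        using True word_inverse_carrier[of _ j] by (intro matsum_delta) (auto simp: zero_mult_dim)
      then show ?thesis using True by simp
    next
      case False
      then show ?thesis
        using word_inverse_carrier[of _ j] \<open>i < m\<close> by (auto intro!: matsum_zero simp: zero_mult_dim)
    qed
  qed
  finally have 1: "lin_form (*) (letters s) m n n A (centred (*) s m Y (word_point s Y w)) * W =
    bmat m m n n (\<lambda>i j. if i < length w then A (w ! i) * word_inverse n A w (Suc i) j else 0\<^sub>m n n)"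
    by (simp add: lin_form_word_point[OF w A_car])
  have "W - bmat m m n n (\<lambda>i j. if i < length w then A (w ! i) * word_inverse n A w (Suc i) j else 0\<^sub>m n n) = 1\<^sub>m (m * n)" (is "?l = ?r")
  proof (rule bmat_eqI[of _ m n m n])
    fix i a j b assume *: "i < m" "a < n" "j < m" "b < n"
    have iv: "i * n + a < m * n" "j * n + b < m * n" using * block_index_less by blast+
    have "word_inverse n A w i j $$ (a, b) -
      (if i < length w then A (w ! i) * word_inverse n A w (Suc i) j else 0\<^sub>m n n) $$ (a, b) =
      (if i = j \<and> a = b then 1 else 0)"
    proof (cases "i < length w")
      case True
      then have Ac: "A (w ! i) \<in> carrier_mat n n" by (rule A_nth)
      show ?thesis
      proof (cases "i < j")
        case True
        then have "take (j - i) (drop i w) = w ! i # take (j - Suc i) (drop (Suc i) w)"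
          using * by (simp add: Cons_nth_drop_Suc[symmetric] take_Cons')
        then show ?thesis using True \<open>i < length w\<close> by (simp add: word_inverse_def)
      next
        case False
        then show ?thesis using * Ac \<open>i < length w\<close> by (auto simp: word_inverse_def mult_zero_dim)
      qed
    next
      case False
      then show ?thesis using * by (auto simp: word_inverse_def)
    qed
    then show "?l $$ (i * n + a, j * n + b) = ?r $$ (i * n + a, j * n + b)"
      using * iv by (simp add: bmat_index block_index_eq del: index_mult_mat(1))
  qed (auto intro!: minus_carrier_mat)
  then have LW: "\<Lambda> * W = 1\<^sub>m (m * n)"
    using 1 by (simp add: minus_mult_dim one_mult_dim)
  have Lc: "\<Lambda> \<in> carrier_mat (m * n) (m * n)" by (intro minus_carrier_mat lin_form_carrier)
  have WL: "W * \<Lambda> = 1\<^sub>m (m * n)" by (rule mat_mult_left_right_inverse[OF Lc bmat_carrier LW])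
  show "invertible_mat \<Lambda>" by (rule invertible_matI[OF Lc LW WL])
  show "minv \<Lambda> = W" by (rule minv_eqI[OF Lc bmat_carrier LW WL])
qed

lemma word_value_bmat:
  assumes C: "C \<in> carrier_mat p n" and V: "\<And>i j. V i j \<in> carrier_mat n q"
  shows "amp (*) m C * (W * bmat m m n q V) =
    bmat m m p q (\<lambda>i j. C * matsum {..<m} n q (\<lambda>l. word_inverse n A w i l * V l j))"
proof -
  have WV: "W * bmat m m n q V = bmat m m n q (\<lambda>i j. matsum {..<m} n q (\<lambda>l. word_inverse n A w i l * V l j))"
    by (rule bmat_mult) (rule word_inverse_carrier, rule V)
  have "amp (*) m C * (W * bmat m m n q V) = bmat m m p q (\<lambda>i j. matsum {..<m} p q
      (\<lambda>h. (if i = h then C else 0\<^sub>m p n) * matsum {..<m} n q (\<lambda>l. word_inverse n A w h l * V l j)))"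
    unfolding amp_bmat[OF C] WV by (rule bmat_mult) (use C in simp_all)
  also have "\<dots> = bmat m m p q (\<lambda>i j. C * matsum {..<m} n q (\<lambda>l. word_inverse n A w i l * V l j))"
  proof (rule bmat_cong)
    fix i j assume "i < m" "j < m"
    define G where "G h = matsum {..<m} n q (\<lambda>l. word_inverse n A w h l * V l j)" for h
    define F where "F h = (if i = h then C else 0\<^sub>m p n) * G h" for h
    have Gc: "G h \<in> carrier_mat n q" for h by (simp add: G_def)
    have "matsum {..<m} p q F = F i"
    proof (rule matsum_delta)
      show "F i \<in> carrier_mat p q" using mult_carrier_mat[OF C Gc] by (simp add: F_def)
      show "F h = 0\<^sub>m p q" if "h \<noteq> i" for h
        using that Gc[of h] by (simp add: F_def zero_mult_dim)
    qed (use \<open>i < m\<close> in simp_all)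
    then show "matsum {..<m} p q (\<lambda>h. (if i = h then C else 0\<^sub>m p n) * matsum {..<m} n q (\<lambda>l. word_inverse n A w h l * V l j)) =
      C * matsum {..<m} n q (\<lambda>l. word_inverse n A w i l * V l j)"
      unfolding F_def G_def by (simp only: if_True simp_thms)
  qed
  finally show ?thesis .
qed

lemma word_value:
  assumes C: "C \<in> carrier_mat p n" and B: "B \<in> carrier_mat n q" and ab: "a < p" "b < q"
  shows "(amp (*) m C * (minv \<Lambda> * amp (*) m B)) $$ (a, length w * q + b) = (C * (wprod n A w * B)) $$ (a, b)"
proof -
  have "amp (*) m C * (W * amp (*) m B) = bmat m m p q
      (\<lambda>i j. C * matsum {..<m} n q (\<lambda>l. word_inverse n A w i l * (if l = j then B else 0\<^sub>m n q)))"
    unfolding amp_bmat[OF B] using C B by (intro word_value_bmat) auto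
  then have "(amp (*) m C * (minv \<Lambda> * amp (*) m B)) $$ (0 * p + a, length w * q + b) =
      (C * matsum {..<m} n q (\<lambda>l. word_inverse n A w 0 l * (if l = length w then B else 0\<^sub>m n q))) $$ (a, b)"
    using ab bmat_index[of 0 m a p "length w" m b q] by (simp only: Lambda_word(2)) simp
  also have "matsum {..<m} n q (\<lambda>l. word_inverse n A w 0 l * (if l = length w then B else 0\<^sub>m n q)) = wprod n A w * B"
    using word_inverse_carrier[of 0] B
    by (subst matsum_delta[where k = "length w"])
      (auto simp: mult_zero_dim word_inverse_def[of n A w 0 "length w"] intro!: mult_carrier_mat wprod_w_carrier)
  finally show ?thesis by simp
qed

text \<open>Realizations have an input that is itself a linear form in X. At the word point its last
  block column contains only \<open>B \<beta>\<close>, in row \<open>length v\<close>, so the last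
  letter is spent on the input and the product runs over the others.\<close>

lemma word_value_input:
  assumes C: "C \<in> carrier_mat p n" and B: "\<And>\<alpha>. \<alpha> \<in> letters s \<Longrightarrow> B \<alpha> \<in> carrier_mat n q"
    and ab: "a < p" "b < q" and wv: "w = v @ [\<beta>]"
  shows "(amp (*) m C * (minv \<Lambda> * lin_form (*) (letters s) m n q B (centred (*) s m Y (word_point s Y w))))
      $$ (a, length w * q + b) = (C * (wprod n A v * B \<beta>)) $$ (a, b)"
proof -
  define B' where "B' \<alpha> = (if \<alpha> \<in> letters s then B \<alpha> else 0\<^sub>m n q)" for \<alpha>
  have B'c: "B' \<alpha> \<in> carrier_mat n q" for \<alpha> using B by (simp add: B'_def)
  have \<beta>: "\<beta> \<in> letters s" using w wv by auto
  have lv: "length v < m" using wv by simp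
  have "lin_form (*) (letters s) m n q B (centred (*) s m Y (word_point s Y w)) =
    lin_form (*) (letters s) m n q B' (centred (*) s m Y (word_point s Y w))"
    by (rule lin_form_cong) (simp add: B'_def)
  also have "\<dots> = bmat m m n q (\<lambda>i j. if j = Suc i then B' (w ! i) else 0\<^sub>m n q)"
    by (rule lin_form_word_point[OF w]) (rule B'c)
  finally have "amp (*) m C * (W * lin_form (*) (letters s) m n q B (centred (*) s m Y (word_point s Y w))) = bmat m m p q
      (\<lambda>i j. C * matsum {..<m} n q (\<lambda>l. word_inverse n A w i l * (if j = Suc l then B' (w ! l) else 0\<^sub>m n q)))"
    using word_value_bmat[OF C, of "\<lambda>i j. if j = Suc i then B' (w ! i) else 0\<^sub>m n q" q] B'c by simp
  then have "(amp (*) m C * (minv \<Lambda> * lin_form (*) (letters s) m n q B (centred (*) s m Y (word_point s Y w))))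
      $$ (0 * p + a, length w * q + b) =
      (C * matsum {..<m} n q (\<lambda>l. word_inverse n A w 0 l * (if length w = Suc l then B' (w ! l) else 0\<^sub>m n q))) $$ (a, b)"
    using ab bmat_index[of 0 m a p "length w" m b q] by (simp only: Lambda_word(2)) simp
  also have "matsum {..<m} n q (\<lambda>l. word_inverse n A w 0 l * (if length w = Suc l then B' (w ! l) else 0\<^sub>m n q)) =
      word_inverse n A w 0 (length v) * (if length w = Suc (length v) then B' (w ! length v) else 0\<^sub>m n q)"
  proof (rule matsum_delta)
    show "word_inverse n A w 0 (length v) * (if length w = Suc (length v) then B' (w ! length v) else 0\<^sub>m n q) \<in> carrier_mat n q"
      using B'c by (intro mult_carrier_mat[OF word_inverse_carrier]) simp
    show "word_inverse n A w 0 l * (if length w = Suc l then B' (w ! l) else 0\<^sub>m n q) = 0\<^sub>m n q"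
      if "l \<noteq> length v" for l
    proof -
      have "length w \<noteq> Suc l" using that wv by simp
      then show ?thesis by (simp add: mult_zero_dim)
    qed
  qed (use lv in simp_all)
  also have "\<dots> = wprod n A v * B \<beta>" using \<beta> wv by (simp add: word_inverse_def B'_def)
  finally show ?thesis by simp
qed

end

definition moment :: "nat \<Rightarrow> ('d::finite \<Rightarrow> 'k::field mat) \<Rightarrow> ('d, 'k) pencil \<Rightarrow> ('d \<times> nat \<times> nat) list \<Rightarrow> 'k mat" where
  "moment s Y P w = sys_C s P * (wprod (pen_N P * s) (sys_A s Y P) w * sys_B s Y P)"

definition same_moments :: "nat \<Rightarrow> ('d::finite \<Rightarrow> 'k::field mat) \<Rightarrow> ('d, 'k) pencil \<Rightarrow> ('d, 'k) pencil \<Rightarrow> bool" where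
  "same_moments s Y P P' \<longleftrightarrow> (\<forall>w\<in>lists (letters s). moment s Y P w = moment s Y P' w)"

definition regular_at :: "nat \<Rightarrow> ('d::finite \<Rightarrow> 'k::field mat) \<Rightarrow> ('d, 'k) pencil \<Rightarrow> bool" where
  "regular_at s Y P \<longleftrightarrow> pen_wf 1 1 P \<and> Y \<in> tuples s \<and> invertible_mat (pen_at (*) s P Y)"

lemma regular_atD:
  assumes "regular_at s Y P"
  shows "pen_wf 1 1 P" "Y \<in> tuples s" "invertible_mat (pen_at (*) s P Y)"
  using assms by (auto simp: regular_at_def)

lemma pen_system:
  assumes "regular_at s Y P"
  shows "linear_system (letters s) (UNIV :: unit set) (pen_N P * s) s s (sys_A s Y P) (\<lambda>_. sys_B s Y P) (sys_C s P)"
  by unfold_locales (use pen_sys_carrier[of P s Y] regular_atD[OF assms] in auto)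

lemma moment_carrier:
  assumes "regular_at s Y P" "w \<in> lists (letters s)"
  shows "moment s Y P w \<in> carrier_mat s s"
  unfolding moment_def
  using linear_system.wprod_car[OF pen_system[OF assms(1)] assms(2)] pen_sys_carrier[of P s Y] regular_atD[OF assms(1)]
  by auto

lemma pencil_word_point:
  assumes reg: "regular_at s Y P" and w: "w \<in> lists (letters s)"
  shows "invertible_mat (pen_at (*) (Suc (length w) * s) P (word_point s Y w))"
    and "a < s \<Longrightarrow> b < s \<Longrightarrow> pen_val (*) (Suc (length w) * s) P (word_point s Y w) $$ (a, length w * s + b) = moment s Y P w $$ (a, b)"
proof -
  interpret unital_algebra "(*) :: 'b \<Rightarrow> 'b \<Rightarrow> 'b" by (rule unital_algebra_field)
  note r = regular_atD[OF reg]
  note c = pen_sys_carrier[OF r(1,3)]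
  interpret word_system s "pen_N P * s" Y "sys_A s Y P" w
    by unfold_locales (use c w in auto)
  have L: "sys_Lambda (*) s m Y P (word_point s Y w) = \<Lambda>" by (simp add: sys_Lambda_def)
  note ps = pencil_sys[OF r(1,3,2) word_point_tuples, of w]
  show inv: "invertible_mat (pen_at (*) (m * s) P (word_point s Y w))"
    using ps(1) Lambda_word(1) by (simp only: L)
  assume "a < s" "b < s"
  then show "pen_val (*) (Suc (length w) * s) P (word_point s Y w) $$ (a, length w * s + b) = moment s Y P w $$ (a, b)"
    unfolding ps(2)[OF inv] moment_def L using c by (intro word_value) auto
qed

lemma same_momentsI:
  assumes reg: "regular_at s Y P" "regular_at s Y P'"
    and eq: "\<And>w. w \<in> lists (letters s) \<Longrightarrow>
      pen_val (*) (Suc (length w) * s) P (word_point s Y w) = pen_val (*) (Suc (length w) * s) P' (word_point s Y w)"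
  shows "same_moments s Y P P'"
  unfolding same_moments_def
proof
  fix w :: "('a \<times> nat \<times> nat) list" assume w: "w \<in> lists (letters s)"
  show "moment s Y P w = moment s Y P' w" (is "?l = ?r")
  proof (rule eq_matI)
    fix a b assume "a < dim_row ?r" "b < dim_col ?r"
    then have "a < s" "b < s" using moment_carrier[OF reg(2) w] by auto
    then show "?l $$ (a, b) = ?r $$ (a, b)"
      using pencil_word_point(2)[OF reg(1) w] pencil_word_point(2)[OF reg(2) w] eq[OF w] by simp
  qed (use moment_carrier[OF reg(1) w] moment_carrier[OF reg(2) w] in auto)
qed


subsection \<open>Minimal pencils\<close>

text \<open>Competitors are pencils, compared by \<open>pen_N\<close>; systems with the same moments
  that do not come from a pencil are left out. That minimality in this sense still implies
  reachability and observability of all \<open>pen_N P * s\<close> states is therefore a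
  theorem.\<close>

definition minimal_at :: "nat \<Rightarrow> ('d::finite \<Rightarrow> 'k::field mat) \<Rightarrow> ('d, 'k) pencil \<Rightarrow> bool" where
  "minimal_at s Y P \<longleftrightarrow> regular_at s Y P \<and>
     (\<forall>P'. regular_at s Y P' \<and> same_moments s Y P P' \<longrightarrow> pen_N P \<le> pen_N P')"

lemma same_moments_sym: "same_moments s Y P P' \<Longrightarrow> same_moments s Y P' P"
  by (simp add: same_moments_def)

lemma same_moments_trans: "same_moments s Y P P' \<Longrightarrow> same_moments s Y P' P'' \<Longrightarrow> same_moments s Y P P''"
  by (simp add: same_moments_def)

lemma minimal_at_exists:
  assumes "regular_at s Y P"
  obtains M where "minimal_at s Y M" "same_moments s Y P M"
proof -
  define Q where "Q M \<longleftrightarrow> regular_at s Y M \<and> same_moments s Y P M" for M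
  have "Q P" using assms by (simp add: Q_def same_moments_def)
  then obtain M where M: "Q M" "\<And>M'. Q M' \<Longrightarrow> pen_N M \<le> pen_N M'"
    using ex_has_least_nat[of Q P pen_N] by blast
  show ?thesis
  proof (rule that[of M])
    show "same_moments s Y P M" using M(1) by (simp add: Q_def)
    show "minimal_at s Y M"
      unfolding minimal_at_def
    proof (intro conjI allI impI)
      show "regular_at s Y M" using M(1) by (simp add: Q_def)
      fix P' assume P': "regular_at s Y P' \<and> same_moments s Y M P'"
      then have "Q P'" using M(1) same_moments_trans unfolding Q_def by blast
      then show "pen_N M \<le> pen_N P'" by (rule M(2))
    qed
  qed
qed

text \<open>The column version applied to transposes.\<close>

lemma row_space_basis:
  fixes S :: "nat \<Rightarrow> 'k::field mat \<Rightarrow> bool"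
  assumes car: "\<And>k U. S k U \<Longrightarrow> U \<in> carrier_mat k n"
    and zero: "\<And>k. S k (0\<^sub>m k n)"
    and add: "\<And>k U W. S k U \<Longrightarrow> S k W \<Longrightarrow> S k (U + W)"
    and mult: "\<And>k k' U R. S k U \<Longrightarrow> R \<in> carrier_mat k' k \<Longrightarrow> S k' (R * U)"
  obtains d Q K where "S d Q" "Q \<in> carrier_mat d n" "K \<in> carrier_mat n d" "Q * K = 1\<^sub>m d"
    "\<And>k U. S k U \<Longrightarrow> U * (K * Q) = U"
proof -
  obtain d J K where J: "S d J\<^sup>T" "K \<in> carrier_mat d n" "K * J = 1\<^sub>m d"
    "\<And>k V. S k V\<^sup>T \<Longrightarrow> J * (K * V) = V"
  proof (rule column_space_basis[of "\<lambda>k V. S k V\<^sup>T" n])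
    fix k and V :: "'k mat" assume "S k V\<^sup>T"
    then show "V \<in> carrier_mat n k" using car[of k "V\<^sup>T"] by simp
  next
    fix k and V W :: "'k mat" assume *: "S k V\<^sup>T" "S k W\<^sup>T"
    then show "S k (V + W)\<^sup>T"
      using add[OF *] car[OF *(1)] car[OF *(2)] transpose_add[of V n k W] by simp
  next
    fix k k' and V R :: "'k mat" assume *: "S k V\<^sup>T" "R \<in> carrier_mat k k'"
    then show "S k' (V * R)\<^sup>T"
      using mult[of k "V\<^sup>T" "R\<^sup>T" k'] car[OF *(1)] transpose_mult[of V n k R k'] by simp
  qed (auto simp: zero)
  have Jc: "J \<in> carrier_mat n d" using car[OF J(1)] by simp
  show ?thesis
  proof (rule that[of d "J\<^sup>T" "K\<^sup>T"])
    show "J\<^sup>T * K\<^sup>T = 1\<^sub>m d" using transpose_mult[OF J(2) Jc] J(3) by simp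
    fix k U assume U: "S k U"
    have "J * (K * U\<^sup>T) = U\<^sup>T" using J(4)[of k "U\<^sup>T"] U by simp
    moreover have "(U * (K\<^sup>T * J\<^sup>T))\<^sup>T = J * (K * U\<^sup>T)"
      using car[OF U] Jc J(2)
      by (simp add: transpose_mult[of U k n _ n] transpose_mult[of _ n d _ n] mult_assoc_dim)
    ultimately show "U * (K\<^sup>T * J\<^sup>T) = U" by (metis transpose_transpose)
  qed (use J Jc in auto)
qed

lemma eq_minus_matI:
  fixes A B :: "'a::ab_group_add mat"
  assumes "A + B = C" "A \<in> carrier_mat p q" "B \<in> carrier_mat p q"
  shows "A = C - B"
  unfolding assms(1)[symmetric] using assms(2,3) by (intro eq_matI) auto

section \<open>Slices of a Kronecker product along its right factor\<close>

definition unit_col :: "nat \<Rightarrow> nat \<Rightarrow> 'k::zero_neq_one mat" where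
  "unit_col s a = mat s 1 (\<lambda>(i, j). if i = a then 1 else 0)"

lemma unit_col_dim [simp]: "dim_row (unit_col s a) = s" "dim_col (unit_col s a) = 1"
  by (simp_all add: unit_col_def)

lemma unit_col_carrier [simp]: "unit_col s a \<in> carrier_mat s 1"
  by (simp add: unit_col_def)

lemma unit_col_mult_transpose:
  "unit_col s a * (unit_col s b)\<^sup>T = (unit_mat s a b :: 'k::field mat)"
  by (rule eq_matI) (auto simp: unit_col_def scalar_prod_def)

lemma one_mat_units: "1\<^sub>m s = matsum {..<s} s s (\<lambda>a. unit_mat s a a :: 'k::field mat)"
proof (rule eq_matI)
  fix i j assume "i < dim_row (matsum {..<s} s s (\<lambda>a. unit_mat s a a :: 'k mat))" "j < dim_col (matsum {..<s} s s (\<lambda>a. unit_mat s a a :: 'k mat))"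
  then have ij: "i < s" "j < s" by simp_all
  have "matsum {..<s} s s (\<lambda>a. unit_mat s a a :: 'k mat) $$ (i, j) = (\<Sum>a<s. unit_mat s a a $$ (i, j))"
    using ij by (rule matsum_index)
  also have "\<dots> = (\<Sum>a<s. if a = i then (if i = j then 1 else 0) else 0)"
    by (rule sum.cong) (use ij in auto)
  finally show "1\<^sub>m s $$ (i, j) = matsum {..<s} s s (\<lambda>a. unit_mat s a a :: 'k mat) $$ (i, j)" using ij by simp
qed auto

lemma kron_matsum_right:
  fixes P :: "'k::semiring_0 mat"
  assumes "\<And>\<alpha>. \<alpha> \<in> I \<Longrightarrow> F \<alpha> \<in> carrier_mat r c" "P \<in> carrier_mat p q"
  shows "kron P (matsum I r c F) = matsum I (p * r) (q * c) (\<lambda>\<alpha>. kron P (F \<alpha>))" (is "?l = ?r")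
proof (rule bmat_eqI[of _ p r q c])
  fix i a j b assume *: "i < p" "a < r" "j < q" "b < c"
  then show "?l $$ (i * r + a, j * c + b) = ?r $$ (i * r + a, j * c + b)"
    using assms by (simp add: kron_index[of _ p q _ r c] block_index_less sum_distrib_left)
qed (use assms in auto)

lemma kron_one_one: "kron P (1\<^sub>m (Suc 0)) = (P :: 'k::semiring_1 mat)"
  by (rule eq_matI) (auto simp: kron_def)

lemma kron_unit_mat:
  fixes M :: "'k::field mat"
  assumes "M \<in> carrier_mat p q"
  shows "kron M (unit_col s a) * kron (1\<^sub>m q) (unit_col s b)\<^sup>T = kron M (unit_mat s a b)"
  using assms by (subst kron_mult) (auto simp: mult_one_dim unit_col_mult_transpose)

text \<open>Splits the identity in the right factor into rank one pieces, so that claims about M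
  \<otimes> I_s can be checked one slice at a time.\<close>

lemma kron_one_units:
  fixes M :: "'k::field mat"
  assumes "M \<in> carrier_mat p q"
  shows "kron M (1\<^sub>m s) = matsum {..<s} (p * s) (q * s) (\<lambda>a. kron M (unit_col s a) * kron (1\<^sub>m q) (unit_col s a)\<^sup>T)"
proof -
  have "kron M (1\<^sub>m s) = matsum {..<s} (p * s) (q * s) (\<lambda>a. kron M (unit_mat s a a))"
    unfolding one_mat_units by (rule kron_matsum_right[OF unit_mat_carrier assms])
  then show ?thesis unfolding kron_unit_mat[OF assms] .
qed

lemma (in linear_system) crch_matsum:
  assumes "finite F" "\<And>i. i \<in> F \<Longrightarrow> crch k (U i)"
  shows "crch k (matsum F k n U)"
  using assms
proof (induction F rule: finite_induct)
  case empty
  have "matsum {} k n U = 0\<^sub>m k n" by (rule matsum_zero) simp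
  then show ?case by (simp add: coreach_zero)
next
  case (insert i F)
  have "crch k (U i + matsum F k n U)" using insert by (intro coreach_add) auto
  also have "U i + matsum F k n U = matsum (insert i F) k n U"
    using insert crch_carrier[of k "U i"] by (intro eq_matI) auto
  finally show ?case .
qed

lemma (in linear_system) crch_uminus: "crch k U \<Longrightarrow> crch k (- U)"
  using crch_mult[of k U "- 1\<^sub>m k" k] crch_carrier[of k U] by (simp add: uminus_mult_dim one_mult_dim)

text \<open>
  The rows \<open>\<eta>\<close> such that all \<open>\<eta> \<otimes> \<xi>\<close> are observable form a space \<open>U\<^sub>0\<close>; together with the space of all
  rows which the coefficients of the pencil map into \<open>U\<^sub>0\<close> it carries a smaller pencil with the same
  moments. Hence \<open>U\<^sub>0\<close> is everything if the pencil is minimal.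
\<close>

locale observable_reduction =
  fixes s :: nat and Y :: "'d::finite \<Rightarrow> 'k::field mat" and P :: "('d, 'k) pencil"
  assumes reg: "regular_at s Y P" and s0: "s > 0"
begin

sublocale linear_system "letters s" "UNIV :: unit set" "pen_N P * s" s s "sys_A s Y P" "\<lambda>_. sys_B s Y P" "sys_C s P"
  by (rule pen_system[OF reg])

sublocale K: unital_algebra "(*) :: 'k \<Rightarrow> 'k \<Rightarrow> 'k" by (rule unital_algebra_field)

abbreviation "N \<equiv> pen_N P"
abbreviation "M \<equiv> pen_M P"
abbreviation "MY \<equiv> pen_at (*) s P Y"
abbreviation "G \<equiv> minv MY"

lemma wf: "M \<kappa> \<in> carrier_mat N N" "pen_c P \<in> carrier_mat 1 N" "pen_b P \<in> carrier_mat N 1"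
  using pen_wfD[OF regular_atD(1)[OF reg]] by auto

lemma M_dim [simp]: "dim_row (M \<kappa>) = N" "dim_col (M \<kappa>) = N"
  using wf(1)[of \<kappa>] by auto

lemma G: "G \<in> carrier_mat (N * s) (N * s)" "MY * G = 1\<^sub>m (N * s)" "G * MY = 1\<^sub>m (N * s)"
  using minv_inverse[OF regular_atD(3)[OF reg] pform_carrier] by auto

lemma G_dim [simp]: "dim_row G = N * s" "dim_col G = N * s"
  using G(1) by auto

lemma Yc: "Y k \<in> carrier_mat s s"
  using regular_atD(2)[OF reg] by (simp add: tuples_def)

definition S0 where "S0 k \<eta> \<longleftrightarrow> \<eta> \<in> carrier_mat k N \<and> crch (k * s) (kron \<eta> (1\<^sub>m s))"

lemma S0_zero: "S0 k (0\<^sub>m k N)"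
  using coreach_zero[of "letters s" "N * s" s "sys_A s Y P" "sys_C s P" "k * s"]
  by (simp add: S0_def kron_zero_left)

lemma S0_add:
  assumes "S0 k U" "S0 k W"
  shows "S0 k (U + W)"
proof -
  have c: "U \<in> carrier_mat k N" "W \<in> carrier_mat k N" using assms by (simp_all add: S0_def)
  have "kron (U + W) (1\<^sub>m s) = kron U (1\<^sub>m s) + kron W (1\<^sub>m s)" (is "?l = ?r")
  proof (rule bmat_eqI[of _ k s N s])
    fix i a j b assume *: "i < k" "a < s" "j < N" "b < s"
    then have "i * s + a < k * s" "j * s + b < N * s" using block_index_less by blast+
    then show "?l $$ (i * s + a, j * s + b) = ?r $$ (i * s + a, j * s + b)"
      using * c by (simp add: kron_index[of _ k N _ s s] distrib_right)
  qed (use c in auto)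
  then show ?thesis using assms by (auto simp: S0_def intro: coreach_add)
qed

lemma S0_mult:
  assumes "S0 k U" "R \<in> carrier_mat k' k"
  shows "S0 k' (R * U)"
proof -
  have c: "U \<in> carrier_mat k N" using assms by (simp add: S0_def)
  have "kron (R * U) (1\<^sub>m s) = kron R (1\<^sub>m s) * kron U (1\<^sub>m s)"
    using c assms by (subst kron_mult) (auto simp: one_mult_dim)
  moreover have "crch (k' * s) (kron R (1\<^sub>m s) * kron U (1\<^sub>m s))"
    using assms by (intro crch_mult[OF _ kron_carrier[OF assms(2) one_carrier_mat]]) (simp add: S0_def)
  ultimately show ?thesis using assms(2) c by (simp add: S0_def)
qed

lemma S0_smult: "S0 k U \<Longrightarrow> S0 k (c \<cdot>\<^sub>m U)"
proof -
  assume U: "S0 k U"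
  then have c: "U \<in> carrier_mat k N" by (simp add: S0_def)
  have "c \<cdot>\<^sub>m U = (c \<cdot>\<^sub>m 1\<^sub>m k) * U" using c by (simp add: mult_smult_assoc_mat[of _ k k _ N])
  then show ?thesis using S0_mult[OF U, of "c \<cdot>\<^sub>m 1\<^sub>m k" k] by simp
qed

lemma S0_matsum: "finite F \<Longrightarrow> (\<And>i. i \<in> F \<Longrightarrow> S0 k (U i)) \<Longrightarrow> S0 k (matsum F k N U)"
proof (induction F rule: finite_induct)
  case empty
  have "matsum {} k N U = 0\<^sub>m k N" by (rule matsum_zero) simp
  then show ?case by (simp add: S0_zero)
next
  case (insert i F)
  then have "U i \<in> carrier_mat k N" by (simp add: S0_def)
  then have "U i + matsum F k N U = matsum (insert i F) k N U"
    using insert(1,2) by (intro eq_matI) auto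
  then show ?case using S0_add[of k "U i" "matsum F k N U"] insert by simp
qed

lemma S0_c: "S0 1 (pen_c P)"
  using coreach_base[OF one_carrier_mat[of s], of "letters s" "N * s" "sys_A s Y P" "sys_C s P"] wf(2)
  by (simp add: S0_def sys_C_def one_mult_dim)

text \<open>Let \<eta> be the row in question. The letter (l, a, b) sends \<open>U\<close>, up to
  sign, to \<eta> (1 \<otimes> e_b)\<dots> transposed in the unit column e_b. All b are available
  for the same \<eta>, and the resulting slices assemble to \<eta> \<otimes> I_s.\<close>

lemma S0_slice:
  assumes U: "crch k U" and a: "a < s"
  shows "S0 k (U * (G * kron (M (Some l)) (unit_col s a)))"
proof -
  define \<eta> where "\<eta> = U * (G * kron (M (Some l)) (unit_col s a))"
  have Uc: "U \<in> carrier_mat k (N * s)" by (rule crch_carrier[OF U])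
  have \<eta>c: "\<eta> \<in> carrier_mat k N" unfolding \<eta>_def by (rule carrier_matI) (use Uc in simp_all)
  have row: "crch k (\<eta> * kron (1\<^sub>m N) (unit_col s b)\<^sup>T)" if b: "b < s" for b
  proof -
    have "(l, a, b) \<in> letters s" using a b by (simp add: letters_def)
    then have cr: "crch k (- (U * sys_A s Y P (l, a, b)))" using U by (intro crch_uminus coreach_step)
    have "- (U * sys_A s Y P (l, a, b)) = U * (G * kron (M (Some l)) (unit_mat s a b))"
      unfolding sys_A_def using Uc by (simp add: mult_uminus_dim)
    also have "\<dots> = \<eta> * kron (1\<^sub>m N) (unit_col s b)\<^sup>T"
      unfolding \<eta>_def kron_unit_mat[OF wf(1), symmetric] using Uc by (simp add: mult_assoc_dim)
    finally show ?thesis using cr by simp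
  qed
  have "crch (k * s) (kron (1\<^sub>m k) (unit_col s b) * (\<eta> * kron (1\<^sub>m N) (unit_col s b)\<^sup>T))" if "b < s" for b
    by (rule crch_mult[OF row[OF that]]) (auto intro!: carrier_matI)
  moreover have "kron (1\<^sub>m k) (unit_col s b) * (\<eta> * kron (1\<^sub>m N) (unit_col s b)\<^sup>T) = kron \<eta> (unit_col s b) * kron (1\<^sub>m N) (unit_col s b)\<^sup>T" for b
  proof -
    have "kron (1\<^sub>m k) (unit_col s b) * kron \<eta> (1\<^sub>m 1) = kron \<eta> (unit_col s b)"
      using \<eta>c by (subst kron_mult) (auto simp: one_mult_dim mult_one_dim)
    then show ?thesis using \<eta>c by (simp add: kron_one_one mult_assoc_dim[symmetric])
  qed
  ultimately have "crch (k * s) (matsum {..<s} (k * s) (N * s) (\<lambda>b. kron \<eta> (unit_col s b) * kron (1\<^sub>m N) (unit_col s b)\<^sup>T))"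
    by (intro crch_matsum) auto
  then show ?thesis using \<eta>c kron_one_units[OF \<eta>c, of s] by (simp add: S0_def \<eta>_def)
qed

text \<open>Extends \<open>S0_slice\<close> by linearity from unit columns to arbitrary ones; the
  columns \<open>Y k * unit_col s b\<close> are needed for the constant coefficient.\<close>

lemma S0_slice_vec:
  assumes U: "crch k U" and y: "y \<in> carrier_mat s 1"
  shows "S0 k (U * (G * kron (M (Some l)) y))"
proof -
  have Uc: "U \<in> carrier_mat k (N * s)" by (rule crch_carrier[OF U])
  have y_eq: "y = matsum {..<s} s 1 (\<lambda>a. y $$ (a, 0) \<cdot>\<^sub>m unit_col s a)" (is "_ = ?r")
  proof (rule eq_matI)
    fix i j assume "i < dim_row ?r" "j < dim_col ?r"
    then have ij: "i < s" "j = 0" by simp_all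
    then have "?r $$ (i, j) = (\<Sum>a<s. (y $$ (a, 0) \<cdot>\<^sub>m unit_col s a) $$ (i, j))"
      by (intro matsum_index) auto
    also have "\<dots> = (\<Sum>a<s. if a = i then y $$ (i, 0) else 0)"
      by (rule sum.cong) (use ij in \<open>auto simp: unit_col_def\<close>)
    finally show "y $$ (i, j) = ?r $$ (i, j)" using ij by simp
  qed (use y in auto)
  have "kron (M (Some l)) y = kron (M (Some l)) (matsum {..<s} s 1 (\<lambda>a. y $$ (a, 0) \<cdot>\<^sub>m unit_col s a))"
    by (rule arg_cong[OF y_eq, of "kron (M (Some l))"])
  also have "\<dots> = matsum {..<s} (N * s) (N * 1) (\<lambda>a. kron (M (Some l)) (y $$ (a, 0) \<cdot>\<^sub>m unit_col s a))"
    using wf(1) by (intro kron_matsum_right) auto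
  also have "\<dots> = matsum {..<s} (N * s) (N * 1) (\<lambda>a. y $$ (a, 0) \<cdot>\<^sub>m kron (M (Some l)) (unit_col s a))"
    by (intro matsum_cong eq_matI) (auto simp: kron_def block_div_less)
  finally have "kron (M (Some l)) y = matsum {..<s} (N * s) N (\<lambda>a. y $$ (a, 0) \<cdot>\<^sub>m kron (M (Some l)) (unit_col s a))"
    by simp
  then have e1: "(U * G) * kron (M (Some l)) y = (U * G) * matsum {..<s} (N * s) N (\<lambda>a. y $$ (a, 0) \<cdot>\<^sub>m kron (M (Some l)) (unit_col s a))"
    by simp
  have e2: "(U * G) * matsum {..<s} (N * s) N (\<lambda>a. y $$ (a, 0) \<cdot>\<^sub>m kron (M (Some l)) (unit_col s a)) =
      matsum {..<s} k N (\<lambda>a. (U * G) * (y $$ (a, 0) \<cdot>\<^sub>m kron (M (Some l)) (unit_col s a)))"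
    by (rule matsum_mult_left[OF mult_carrier_mat[OF Uc G(1)]]) (auto intro!: carrier_matI)
  have e3: "(U * G) * (y $$ (a, 0) \<cdot>\<^sub>m kron (M (Some l)) (unit_col s a)) = y $$ (a, 0) \<cdot>\<^sub>m (U * (G * kron (M (Some l)) (unit_col s a)))" for a
  proof -
    have "kron (M (Some l)) (unit_col s a) \<in> carrier_mat (N * s) N" by (rule carrier_matI) simp_all
    then have "(U * G) * (y $$ (a, 0) \<cdot>\<^sub>m kron (M (Some l)) (unit_col s a)) = y $$ (a, 0) \<cdot>\<^sub>m ((U * G) * kron (M (Some l)) (unit_col s a))"
      by (rule mult_smult_distrib[OF mult_carrier_mat[OF Uc G(1)]])
    then show ?thesis using Uc by (simp add: mult_assoc_dim)
  qed
  have eq: "(U * G) * kron (M (Some l)) y = matsum {..<s} k N (\<lambda>a. y $$ (a, 0) \<cdot>\<^sub>m (U * (G * kron (M (Some l)) (unit_col s a))))"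
    unfolding e1 e2 e3 ..
  moreover have "(U * G) * kron (M (Some l)) y = U * (G * kron (M (Some l)) y)" using Uc y by (simp add: mult_assoc_dim)
  moreover have "S0 k (matsum {..<s} k N (\<lambda>a. y $$ (a, 0) \<cdot>\<^sub>m (U * (G * kron (M (Some l)) (unit_col s a)))))"
    by (intro S0_matsum S0_smult S0_slice U) simp_all
  ultimately show ?thesis by simp
qed

text \<open>Gives access to the constant coefficient of the pencil, for which there is no
  letter.\<close>

lemma MY_unit_col:
  assumes "b < s"
  shows "MY * kron (1\<^sub>m N) (unit_col s b) = kron (M None) (unit_col s b) +
    matsum UNIV (N * s) N (\<lambda>k. kron (M (Some k)) (Y k * unit_col s b))"
proof -
  have e [simp]: "dim_row (ext_tuple s Y \<kappa>) = s" "dim_col (ext_tuple s Y \<kappa>) = s" for \<kappa>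
    using ext_tuple_carrier[OF regular_atD(2)[OF reg], of \<kappa>] by auto
  have "MY * kron (1\<^sub>m N) (unit_col s b) = matsum UNIV (N * s) N (\<lambda>\<kappa>. kron (M \<kappa>) (ext_tuple s Y \<kappa>) * kron (1\<^sub>m N) (unit_col s b))"
    unfolding pform_def scalar_mat_field
    by (intro matsum_mult_right) (auto intro!: carrier_matI)
  also have "\<dots> = matsum UNIV (N * s) N (\<lambda>\<kappa>. kron (M \<kappa>) (ext_tuple s Y \<kappa> * unit_col s b))"
  proof (rule matsum_cong)
    fix \<kappa> show "kron (M \<kappa>) (ext_tuple s Y \<kappa>) * kron (1\<^sub>m N) (unit_col s b) = kron (M \<kappa>) (ext_tuple s Y \<kappa> * unit_col s b)"
      by (subst kron_mult) (auto simp: mult_one_dim)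
  qed
  also have "\<dots> = kron (M None) (unit_col s b) + matsum UNIV (N * s) N (\<lambda>k. kron (M (Some k)) (Y k * unit_col s b))"
    by (rule eq_matI) (auto simp: sum_UNIV_option one_mult_dim)
  finally show ?thesis .
qed

text \<open>With row bases \<open>Q\<close> of \<open>S0\<close> and \<open>Q'\<close> of the second
  space \<open>S1\<close>, the reduced coefficients are determined by M' Q = Q' M. They are a priori
  rectangular; the point is that the reduced pencil at Y is nevertheless invertible, which makes
  both spaces equally large.\<close>

lemma reduction:
  assumes "S0 n1 Q" "K \<in> carrier_mat N n1" "Q * K = 1\<^sub>m n1" and QK: "\<And>k U. S0 k U \<Longrightarrow> U * (K * Q) = U"
  obtains P' where "regular_at s Y P'" "same_moments s Y P P'" "pen_N P' = n1"
proof -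
  have Qc: "Q \<in> carrier_mat n1 N" and crQ: "crch (n1 * s) (kron Q (1\<^sub>m s))" using assms(1) by (simp_all add: S0_def)
  note Kc = assms(2)
  define Z where "Z = K * Q"
  have Zc: "Z \<in> carrier_mat N N" using Kc Qc by (auto simp: Z_def intro!: carrier_matI)
  have QZ: "Q * Z = Q" using QK[OF assms(1)] by (simp add: Z_def)
  \<comment> \<open>Multiplication by \<open>Z\<close> fixes exactly the rows in the span of
    \<open>Q\<close>, so \<open>S1\<close> consists of the rows which every coefficient maps into
    that span.\<close>
  define S1 where "S1 k \<eta> \<longleftrightarrow> \<eta> \<in> carrier_mat k N \<and> (\<forall>\<kappa>. (\<eta> * M \<kappa>) * Z = \<eta> * M \<kappa>)" for k \<eta>
  obtain n2 Q' K' where Q': "S1 n2 Q'" and Q'c: "Q' \<in> carrier_mat n2 N" and K'c: "K' \<in> carrier_mat N n2"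
    and Q'K': "Q' * K' = 1\<^sub>m n2" and S1: "\<And>k U. S1 k U \<Longrightarrow> U * (K' * Q') = U"
  proof (rule row_space_basis[of S1 N])
    fix k and U W :: "'k mat" assume "S1 k U" "S1 k W"
    then show "S1 k (U + W)" using Zc by (auto simp: S1_def add_mult_dim)
  next
    fix k k' and U R :: "'k mat" assume "S1 k U" "R \<in> carrier_mat k' k"
    then show "S1 k' (R * U)" using Zc by (auto simp: S1_def mult_assoc_dim)
  qed (use Zc in \<open>auto simp: S1_def zero_mult_dim\<close>)
  define M' where "M' \<kappa> = Q' * M \<kappa> * K" for \<kappa>
  have M'c: "M' \<kappa> \<in> carrier_mat n2 n1" for \<kappa> using Q'c Kc by (auto simp: M'_def intro!: carrier_matI)
  have M'Q: "M' \<kappa> * Q = Q' * M \<kappa>" for \<kappa>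
    using Q' Q'c Kc Qc by (simp add: M'_def S1_def Z_def mult_assoc_dim)
  define Qh Kh Qh' Kh' where "Qh = kron Q (1\<^sub>m s)" and "Kh = kron K (1\<^sub>m s)" and "Qh' = kron Q' (1\<^sub>m s)" and "Kh' = kron K' (1\<^sub>m s)"
  note hdefs = Qh_def Kh_def Qh'_def Kh'_def
  have hc: "Qh \<in> carrier_mat (n1 * s) (N * s)" "Kh \<in> carrier_mat (N * s) (n1 * s)"
    "Qh' \<in> carrier_mat (n2 * s) (N * s)" "Kh' \<in> carrier_mat (N * s) (n2 * s)"
    using Qc Kc Q'c K'c by (auto simp: hdefs)
  have hh: "Qh * Kh = 1\<^sub>m (n1 * s)" "Qh' * Kh' = 1\<^sub>m (n2 * s)"
    unfolding hdefs using assms(3) Q'K' Qc Kc Q'c K'c by (subst kron_mult; simp add: one_mult_dim)+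
  define \<rho> where "\<rho> = Qh * G"
  have \<rho>c: "\<rho> \<in> carrier_mat (n1 * s) (N * s)" using hc G(1) by (auto simp: \<rho>_def)
  have \<rho>MY: "\<rho> * MY = Qh" unfolding \<rho>_def using hc G by (simp add: mult_assoc_dim mult_one_dim)
  have slice_Some: "(\<rho> * kron (M (Some l)) y) * Z = \<rho> * kron (M (Some l)) y" if "y \<in> carrier_mat s 1" for l y
  proof -
    have "S0 (n1 * s) (\<rho> * kron (M (Some l)) y)"
      using S0_slice_vec[OF crQ that, of l] hc that by (simp add: \<rho>_def Qh_def[symmetric] mult_assoc_dim)
    then show ?thesis using QK by (simp add: Z_def)
  qed
  \<comment> \<open>For the coefficient of a variable this is \<open>S0_slice_vec\<close>. For the
    constant coefficient, \<open>\<rho> * MY = Qh\<close> expresses its slice through a multiple of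
    \<open>Q\<close> and the slices of the variables.\<close>
  have slice: "S1 (n1 * s) (\<rho> * kron (1\<^sub>m N) (unit_col s b))" if b: "b < s" for b
    unfolding S1_def
  proof (intro conjI allI)
    show "\<rho> * kron (1\<^sub>m N) (unit_col s b) \<in> carrier_mat (n1 * s) N" using \<rho>c by (auto intro!: carrier_matI)
    fix \<kappa>
    have comm: "\<rho> * kron (1\<^sub>m N) (unit_col s b) * M \<kappa> = \<rho> * kron (M \<kappa>) (unit_col s b)"
    proof -
      have "kron (1\<^sub>m N) (unit_col s b) * kron (M \<kappa>) (1\<^sub>m 1) = kron (M \<kappa>) (unit_col s b)"
        by (subst kron_mult) (auto simp: one_mult_dim mult_one_dim)
      then show ?thesis using \<rho>c by (simp add: kron_one_one mult_assoc_dim)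
    qed
    show "\<rho> * kron (1\<^sub>m N) (unit_col s b) * M \<kappa> * Z = \<rho> * kron (1\<^sub>m N) (unit_col s b) * M \<kappa>"
    proof (cases \<kappa>)
      case (Some l)
      then show ?thesis unfolding comm using slice_Some[OF unit_col_carrier] by simp
    next
      case None
      let ?T = "\<lambda>k. kron (M (Some k)) (Y k * unit_col s b)"
      have Tc: "?T k \<in> carrier_mat (N * s) N" "Y k * unit_col s b \<in> carrier_mat s 1" for k
        using Yc[of k] by (auto intro!: carrier_matI)
      have e: "Qh * kron (1\<^sub>m N) (unit_col s b) = kron (1\<^sub>m n1) (unit_col s b) * Q"
      proof -
        have "Qh * kron (1\<^sub>m N) (unit_col s b) = kron Q (unit_col s b)"
          unfolding Qh_def using Qc by (subst kron_mult) (auto simp: one_mult_dim mult_one_dim)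
        moreover have "kron (1\<^sub>m n1) (unit_col s b) * kron Q (1\<^sub>m 1) = kron Q (unit_col s b)"
          using Qc by (subst kron_mult) (auto simp: one_mult_dim mult_one_dim)
        ultimately show ?thesis by (simp add: kron_one_one)
      qed
      have "\<rho> * (MY * kron (1\<^sub>m N) (unit_col s b)) = kron (1\<^sub>m n1) (unit_col s b) * Q"
        using \<rho>MY e \<rho>c by (simp add: mult_assoc_dim[symmetric])
      moreover have "\<rho> * (MY * kron (1\<^sub>m N) (unit_col s b)) = \<rho> * kron (M None) (unit_col s b) + \<rho> * matsum UNIV (N * s) N ?T"
        unfolding MY_unit_col[OF b] using \<rho>c by (simp add: mult_add_dim)
      moreover have T_sum: "\<rho> * matsum UNIV (N * s) N ?T = matsum UNIV (n1 * s) N (\<lambda>k. \<rho> * ?T k)"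
        using \<rho>c Tc by (intro matsum_mult_left) auto
      ultimately have "\<rho> * kron (M None) (unit_col s b) + matsum UNIV (n1 * s) N (\<lambda>k. \<rho> * ?T k) = kron (1\<^sub>m n1) (unit_col s b) * Q"
        by simp
      then have 1: "\<rho> * kron (M None) (unit_col s b) = kron (1\<^sub>m n1) (unit_col s b) * Q - matsum UNIV (n1 * s) N (\<lambda>k. \<rho> * ?T k)"
        by (rule eq_minus_matI[of _ _ _ "n1 * s" N]) (use \<rho>c in \<open>auto intro!: carrier_matI\<close>)
      have "matsum UNIV (n1 * s) N (\<lambda>k. \<rho> * ?T k) * Z = matsum UNIV (n1 * s) N (\<lambda>k. \<rho> * ?T k * Z)"
        using \<rho>c Tc(1) Zc by (intro matsum_mult_right) auto
      also have "\<dots> = matsum UNIV (n1 * s) N (\<lambda>k. \<rho> * ?T k)"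
        by (intro matsum_cong slice_Some Tc)
      finally show ?thesis unfolding comm unfolding None 1 using Zc Qc QZ by (simp add: minus_mult_dim mult_assoc_dim)
    qed
  qed
  \<comment> \<open>Each slice of \<open>\<rho>\<close> is fixed by \<open>K' * Q'\<close>;
    reassembling the slices shows the same for \<open>\<rho>\<close> and the amplified
    projection.\<close>
  have \<rho>_Q': "\<rho> * (Kh' * Qh') = \<rho>"
  proof -
    have KQ: "Kh' * Qh' = kron (K' * Q') (1\<^sub>m s)"
      unfolding hdefs using K'c Q'c by (subst kron_mult) (auto simp: one_mult_dim)
    have KQc: "K' * Q' \<in> carrier_mat N N" using K'c Q'c by auto
    have ones: "1\<^sub>m (N * s) = matsum {..<s} (N * s) (N * s) (\<lambda>a. kron (1\<^sub>m N) (unit_col s a) * kron (1\<^sub>m N) (unit_col s a)\<^sup>T :: 'k mat)"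
      using kron_one_units[OF one_carrier_mat[of N], of s] by simp
    have \<rho>_sum: "\<rho> = matsum {..<s} (n1 * s) (N * s) (\<lambda>a. \<rho> * (kron (1\<^sub>m N) (unit_col s a) * kron (1\<^sub>m N) (unit_col s a)\<^sup>T))"
    proof -
      have "\<rho> = \<rho> * 1\<^sub>m (N * s)" using \<rho>c by (simp add: mult_one_dim)
      also have "\<dots> = matsum {..<s} (n1 * s) (N * s) (\<lambda>a. \<rho> * (kron (1\<^sub>m N) (unit_col s a) * kron (1\<^sub>m N) (unit_col s a)\<^sup>T))"
        unfolding ones using \<rho>c by (intro matsum_mult_left) (auto intro!: carrier_matI)
      finally show ?thesis .
    qed
    have "\<rho> * (Kh' * Qh') = matsum {..<s} (n1 * s) (N * s) (\<lambda>a. \<rho> * (kron (1\<^sub>m N) (unit_col s a) * kron (1\<^sub>m N) (unit_col s a)\<^sup>T)) * (Kh' * Qh')"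
      using \<rho>_sum by simp
    also have "\<dots> = matsum {..<s} (n1 * s) (N * s) (\<lambda>a. \<rho> * (kron (1\<^sub>m N) (unit_col s a) * kron (1\<^sub>m N) (unit_col s a)\<^sup>T) * (Kh' * Qh'))"
      using \<rho>c hc by (intro matsum_mult_right) (auto intro!: carrier_matI)
    also have "\<dots> = matsum {..<s} (n1 * s) (N * s) (\<lambda>a. \<rho> * (kron (1\<^sub>m N) (unit_col s a) * kron (1\<^sub>m N) (unit_col s a)\<^sup>T))"
    proof (rule matsum_cong)
      fix a assume "a \<in> {..<s}"
      then have sl: "\<rho> * kron (1\<^sub>m N) (unit_col s a) * (K' * Q') = \<rho> * kron (1\<^sub>m N) (unit_col s a)"
        using S1[OF slice] by auto
      have sw: "kron (1\<^sub>m N) (unit_col s a)\<^sup>T * kron (K' * Q') (1\<^sub>m s) = (K' * Q') * kron (1\<^sub>m N) (unit_col s a)\<^sup>T"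
      proof -
        have "kron (1\<^sub>m N) (unit_col s a)\<^sup>T * kron (K' * Q') (1\<^sub>m s) = kron (K' * Q') (unit_col s a)\<^sup>T"
          using KQc by (subst kron_mult) (auto simp: one_mult_dim mult_one_dim)
        moreover have "kron (K' * Q') (1\<^sub>m 1) * kron (1\<^sub>m N) (unit_col s a)\<^sup>T = kron (K' * Q') (unit_col s a)\<^sup>T"
          using KQc by (subst kron_mult) (auto simp: one_mult_dim mult_one_dim)
        ultimately show ?thesis by (simp add: kron_one_one)
      qed
      have "\<rho> * (kron (1\<^sub>m N) (unit_col s a) * kron (1\<^sub>m N) (unit_col s a)\<^sup>T) * (Kh' * Qh') =
        \<rho> * kron (1\<^sub>m N) (unit_col s a) * (kron (1\<^sub>m N) (unit_col s a)\<^sup>T * kron (K' * Q') (1\<^sub>m s))"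
        unfolding KQ using \<rho>c K'c Q'c by (simp add: mult_assoc_dim)
      also have "\<dots> = (\<rho> * kron (1\<^sub>m N) (unit_col s a) * (K' * Q')) * kron (1\<^sub>m N) (unit_col s a)\<^sup>T"
        unfolding sw using \<rho>c KQc K'c Q'c by (simp add: mult_assoc_dim)
      finally show "\<rho> * (kron (1\<^sub>m N) (unit_col s a) * kron (1\<^sub>m N) (unit_col s a)\<^sup>T) * (Kh' * Qh') =
        \<rho> * (kron (1\<^sub>m N) (unit_col s a) * kron (1\<^sub>m N) (unit_col s a)\<^sup>T)"
        unfolding sl using \<rho>c by (simp add: mult_assoc_dim)
    qed
    finally show ?thesis using \<rho>_sum by simp
  qed
  define W where "W = pform (*) s n2 n1 M' Y"
  have Wc: "W \<in> carrier_mat (n2 * s) (n1 * s)" by (simp add: W_def)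
  have ramp_kron: "ramp (*) s R = kron R (1\<^sub>m s)" for R :: "'k mat" by (simp add: ramp_def)
  have WQ: "W * Qh = Qh' * MY"
    using K.pform_mult_ramp[OF Qc M'c regular_atD(2)[OF reg]] K.ramp_mult_pform[OF Q'c wf(1) regular_atD(2)[OF reg]]
    by (simp add: W_def hdefs ramp_kron M'Q)
  \<comment> \<open>The candidate for the inverse of the reduced pencil \<open>W\<close> at Y,
    namely the old inverse compressed to the two spaces. Since it is a two-sided inverse of a
    rectangular matrix, n1 = n2 follows.\<close>
  define H where "H = \<rho> * Kh'"
  have Hc: "H \<in> carrier_mat (n1 * s) (n2 * s)" using \<rho>c hc by (auto simp: H_def)
  have "H * W = H * (W * Qh) * Kh" using Hc Wc hc hh by (simp add: mult_assoc_dim mult_one_dim)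
  also have "\<dots> = (\<rho> * (Kh' * Qh')) * MY * Kh" unfolding WQ H_def using \<rho>c hc by (simp add: mult_assoc_dim)
  also have "\<dots> = 1\<^sub>m (n1 * s)" unfolding \<rho>_Q' \<rho>MY hh ..
  finally have HW: "H * W = 1\<^sub>m (n1 * s)" .
  have "W * H = (W * Qh) * (G * Kh')" unfolding H_def \<rho>_def using Wc hc by (simp add: mult_assoc_dim)
  also have "\<dots> = Qh' * ((MY * G) * Kh')" unfolding WQ using hc by (simp add: mult_assoc_dim)
  also have "\<dots> = 1\<^sub>m (n2 * s)" unfolding G(2) using hc hh by (simp add: one_mult_dim)
  finally have WH: "W * H = 1\<^sub>m (n2 * s)" .
  have "n1 * s \<le> n2 * s" "n2 * s \<le> n1 * s"
    using left_inverse_dim_le[OF Wc Hc HW] left_inverse_dim_le[OF Hc Wc WH] by auto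
  then have n12: "n2 = n1" using s0 by simp
  define P' where "P' = \<lparr>pen_N = n1, pen_M = M', pen_c = pen_c P * K, pen_b = Q' * pen_b P\<rparr>"
  have P'_sel: "pen_N P' = n1" "pen_M P' = M'" "pen_c P' = pen_c P * K" "pen_b P' = Q' * pen_b P"
    by (simp_all add: P'_def)
  have W_eq: "pen_at (*) s P' Y = W" by (simp add: W_def P'_sel n12)
  have wf': "pen_wf 1 1 P'"
    unfolding pen_wf_def P'_sel using wf M'c Kc Q'c n12 by (auto intro!: carrier_matI)
  have reg': "regular_at s Y P'"
    unfolding regular_at_def W_eq using wf' regular_atD(2)[OF reg] invertible_matI[of W "n1 * s" H] HW WH Wc n12 by auto
  interpret R: linear_system "letters s" "UNIV :: unit set" "n1 * s" s s "sys_A s Y P'" "\<lambda>_. sys_B s Y P'" "sys_C s P'"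
    using pen_system[OF reg'] by (simp add: P'_sel)
  have G': "minv (pform (*) s n1 n1 M' Y) = H"
    unfolding W_eq[unfolded P'_sel] using HW WH Wc Hc n12 by (intro minv_eqI[of _ "n1 * s"]) auto
  have HQ: "H * Qh' = Qh * G" using \<rho>_Q' hc \<rho>c by (simp add: H_def \<rho>_def mult_assoc_dim)
  \<comment> \<open>The reduced system is related to the old one by the intertwiner
    \<open>Qh\<close>, which carries the moments over.\<close>
  have A': "sys_A s Y P' \<alpha> * Qh = Qh * sys_A s Y P \<alpha>" for \<alpha>
  proof -
    obtain k a b where \<alpha>: "\<alpha> = (k, a, b)" by (cases \<alpha>)
    have "kron (M' (Some k)) (unit_mat s a b) * Qh = kron (Q' * M (Some k)) (unit_mat s a b)"
      unfolding Qh_def M'Q[symmetric] using M'c[of "Some k"] Qc by (subst kron_mult) (auto simp: mult_one_dim)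
    also have "\<dots> = Qh' * kron (M (Some k)) (unit_mat s a b)"
      unfolding Qh'_def using Q'c by (subst kron_mult) (auto simp: one_mult_dim)
    finally have 1: "kron (M' (Some k)) (unit_mat s a b) * Qh = Qh' * kron (M (Some k)) (unit_mat s a b)" .
    have "sys_A s Y P' \<alpha> * Qh = - (H * (kron (M' (Some k)) (unit_mat s a b) * Qh))"
      unfolding sys_A_def \<alpha> P'_sel prod.case G' using Hc hc M'c[of "Some k"] n12 by (simp add: uminus_mult_dim mult_assoc_dim)
    also have "\<dots> = - ((H * Qh') * kron (M (Some k)) (unit_mat s a b))"
      unfolding 1 using Hc hc by (simp add: mult_assoc_dim)
    also have "\<dots> = Qh * sys_A s Y P \<alpha>"
      unfolding HQ sys_A_def \<alpha> using hc by (simp add: mult_uminus_dim mult_assoc_dim)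
    finally show ?thesis .
  qed
  have B': "sys_B s Y P' = Qh * sys_B s Y P"
  proof -
    have "kron (Q' * pen_b P) (1\<^sub>m s) = Qh' * kron (pen_b P) (1\<^sub>m s)"
      unfolding Qh'_def using Q'c wf by (subst kron_mult) (auto simp: one_mult_dim)
    then have "sys_B s Y P' = (H * Qh') * kron (pen_b P) (1\<^sub>m s)"
      unfolding sys_B_def P'_sel G' using Hc hc wf by (simp add: mult_assoc_dim)
    then show ?thesis unfolding HQ sys_B_def using hc wf by (simp add: mult_assoc_dim)
  qed
  have C': "sys_C s P' * Qh = sys_C s P"
  proof -
    have "sys_C s P' * Qh = kron (pen_c P * K * Q) (1\<^sub>m s)"
      unfolding sys_C_def P'_sel Qh_def using Qc Kc wf by (subst kron_mult) (auto simp: one_mult_dim)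
    then show ?thesis using QK[OF S0_c] Qc Kc wf by (simp add: sys_C_def mult_assoc_dim)
  qed
  have prod: "wprod (n1 * s) (sys_A s Y P') w * Qh = Qh * wprod (N * s) (sys_A s Y P) w" if "w \<in> lists (letters s)" for w
    using that
  proof (induction w)
    case Nil
    then show ?case using hc by (simp add: one_mult_dim mult_one_dim)
  next
    case (Cons \<alpha> w)
    note c = A_car[of \<alpha>] R.A_car[of \<alpha>] wprod_car[of w] R.wprod_car[of w] hc
    have \<alpha>: "\<alpha> \<in> letters s" "w \<in> lists (letters s)" using Cons by auto
    note c = A_car[OF \<alpha>(1)] R.A_car[OF \<alpha>(1)] wprod_car[OF \<alpha>(2)] R.wprod_car[OF \<alpha>(2)] hc
    have "wprod (n1 * s) (sys_A s Y P') (\<alpha> # w) * Qh = sys_A s Y P' \<alpha> * (wprod (n1 * s) (sys_A s Y P') w * Qh)"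
      using c by (simp add: mult_assoc_dim)
    also have "\<dots> = (sys_A s Y P' \<alpha> * Qh) * wprod (N * s) (sys_A s Y P) w"
      using Cons c by (simp add: mult_assoc_dim)
    also have "\<dots> = Qh * wprod (N * s) (sys_A s Y P) (\<alpha> # w)" unfolding A' using c by (simp add: mult_assoc_dim)
    finally show ?case .
  qed
  have "same_moments s Y P P'"
    unfolding same_moments_def moment_def
  proof
    fix w :: "('d \<times> nat \<times> nat) list" assume w: "w \<in> lists (letters s)"
    note c = wprod_car[OF w] R.wprod_car[OF w] hc B_car R.B_car C_car R.C_car
    have "sys_C s P' * (wprod (n1 * s) (sys_A s Y P') w * sys_B s Y P') =
      sys_C s P' * ((wprod (n1 * s) (sys_A s Y P') w * Qh) * sys_B s Y P)"
      unfolding B' using c by (simp add: mult_assoc_dim)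
    also have "\<dots> = (sys_C s P' * Qh) * (wprod (N * s) (sys_A s Y P) w * sys_B s Y P)"
      unfolding prod[OF w] using c by (simp add: mult_assoc_dim)
    finally show "sys_C s P * (wprod (N * s) (sys_A s Y P) w * sys_B s Y P) =
      sys_C s P' * (wprod (pen_N P' * s) (sys_A s Y P') w * sys_B s Y P')"
      unfolding C' P'_sel by simp
  qed
  then show ?thesis using that[of P'] reg' P'_sel(1) by blast
qed

text \<open>The reduced pencil has the size of a basis of \<open>S0\<close>. Minimality makes this
  basis square, hence invertible, so that \<open>S0\<close> contains the identity.\<close>

lemma minimal_observable:
  assumes "minimal_at s Y P"
  shows "crch (N * s) (1\<^sub>m (N * s))"
proof -
  obtain n1 Q K where Q: "S0 n1 Q" and Qc: "Q \<in> carrier_mat n1 N" and Kc: "K \<in> carrier_mat N n1"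
    and QK: "Q * K = 1\<^sub>m n1" "\<And>k U. S0 k U \<Longrightarrow> U * (K * Q) = U"
    by (rule row_space_basis[of S0 N]) (use S0_zero S0_add S0_mult in \<open>auto simp: S0_def\<close>)
  obtain P' where P': "regular_at s Y P'" "same_moments s Y P P'" "pen_N P' = n1"
    by (rule reduction[OF Q Kc QK])
  have "N \<le> n1" using assms P' unfolding minimal_at_def by blast
  moreover have "n1 \<le> N" using left_inverse_dim_le[OF Kc Qc QK(1)] .
  ultimately have n: "n1 = N" by simp
  have "K * Q = 1\<^sub>m N" using mat_mult_left_right_inverse[OF _ _ QK(1)[unfolded n]] Qc Kc n by simp
  then have "S0 N (1\<^sub>m N)" using S0_mult[OF Q Kc] by simp
  then show ?thesis by (simp add: S0_def)
qed

end


subsection \<open>Transposition\<close>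

text \<open>Transposition interchanges the roles of inputs and outputs, so reachability of a minimal
  pencil can be deduced from observability of its transpose.\<close>

definition pen_transpose :: "('d, 'k) pencil \<Rightarrow> ('d, 'k) pencil" where
  "pen_transpose P = \<lparr>pen_N = pen_N P, pen_M = \<lambda>\<kappa>. (pen_M P \<kappa>)\<^sup>T, pen_c = (pen_b P)\<^sup>T, pen_b = (pen_c P)\<^sup>T\<rparr>"

definition tuple_transpose :: "('d \<Rightarrow> 'k mat) \<Rightarrow> 'd \<Rightarrow> 'k mat" where
  "tuple_transpose Y k = (Y k)\<^sup>T"

definition flip :: "'d \<times> nat \<times> nat \<Rightarrow> 'd \<times> nat \<times> nat" where
  "flip = (\<lambda>(k, a, b). (k, b, a))"

lemma pen_transpose_sel [simp]: "pen_N (pen_transpose P) = pen_N P" "pen_M (pen_transpose P) \<kappa> = (pen_M P \<kappa>)\<^sup>T"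
  "pen_c (pen_transpose P) = (pen_b P)\<^sup>T" "pen_b (pen_transpose P) = (pen_c P)\<^sup>T"
  by (simp_all add: pen_transpose_def)

lemma pen_transpose_transpose [simp]: "pen_transpose (pen_transpose P) = P"
  by (simp add: pen_transpose_def)

lemma tuple_transpose_transpose [simp]: "tuple_transpose (tuple_transpose Y) = Y"
  by (simp add: tuple_transpose_def fun_eq_iff)

lemma flip_flip [simp]: "flip (flip \<alpha>) = \<alpha>" "flip \<circ> flip = id"
  by (auto simp: flip_def split: prod.splits)

lemma flip_letters [simp]: "flip \<alpha> \<in> letters s \<longleftrightarrow> \<alpha> \<in> letters s"
  by (auto simp: flip_def letters_def split: prod.splits)

lemma unit_mat_transpose: "(unit_mat s a b)\<^sup>T = unit_mat s b a"
  by (rule eq_matI) auto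

lemma minv_transpose:
  fixes A :: "'k::field mat"
  assumes "invertible_mat A" "A \<in> carrier_mat n n"
  shows "invertible_mat A\<^sup>T" "minv A\<^sup>T = (minv A)\<^sup>T"
proof -
  note a = minv_inverse[OF assms]
  have 1: "A\<^sup>T * (minv A)\<^sup>T = 1\<^sub>m n" "(minv A)\<^sup>T * A\<^sup>T = 1\<^sub>m n"
    unfolding transpose_mult[OF a(1) assms(2), symmetric] transpose_mult[OF assms(2) a(1), symmetric] a(2,3) by simp_all
  show "invertible_mat A\<^sup>T" using 1 assms(2) by (intro invertible_matI[of _ n]) simp_all
  show "minv A\<^sup>T = (minv A)\<^sup>T" using 1 assms(2) a by (intro minv_eqI[of _ n]) simp_all
qed

lemma pen_at_transpose:
  assumes wf: "pen_wf p q P" and Y: "Y \<in> tuples s"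
  shows "pen_at (*) s (pen_transpose P) (tuple_transpose Y) = (pen_at (*) s P (Y :: 'd::finite \<Rightarrow> 'k::field mat))\<^sup>T"
proof -
  have e: "ext_tuple s (tuple_transpose Y) \<kappa> = (ext_tuple s Y \<kappa>)\<^sup>T" for \<kappa>
    by (cases \<kappa>) (simp_all add: tuple_transpose_def)
  have d [simp]: "dim_row (ext_tuple s Y \<kappa>) = s" "dim_col (ext_tuple s Y \<kappa>) = s" for \<kappa>
    using ext_tuple_carrier[OF Y, of \<kappa>] by auto
  have m [simp]: "dim_row (pen_M P \<kappa>) = pen_N P" "dim_col (pen_M P \<kappa>) = pen_N P" for \<kappa>
    using pen_wfD(1)[OF wf, of \<kappa>] by auto
  show ?thesis
    by (rule eq_matI) (simp_all add: pform_def e kron_transpose[symmetric])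
qed

lemma regular_at_transpose:
  assumes "regular_at s Y P"
  shows "regular_at s (tuple_transpose Y) (pen_transpose P)"
proof -
  note r = regular_atD[OF assms]
  show ?thesis
    unfolding regular_at_def pen_at_transpose[OF r(1,2)]
    using minv_transpose(1)[OF r(3) pform_carrier] r(2) pen_wfD[OF r(1)]
    by (auto simp: pen_wf_def tuples_def tuple_transpose_def)
qed

locale regular_pencil =
  fixes s :: nat and Y :: "'d::finite \<Rightarrow> 'k::field mat" and P :: "('d, 'k) pencil"
  assumes reg: "regular_at s Y P"
begin

abbreviation "N \<equiv> pen_N P"
abbreviation "G \<equiv> minv (pen_at (*) s P Y)"
abbreviation "Pt \<equiv> pen_transpose P"
abbreviation "Yt \<equiv> tuple_transpose Y"

sublocale linear_system "letters s" "UNIV :: unit set" "N * s" s s "sys_A s Y P" "\<lambda>_. sys_B s Y P" "sys_C s P"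
  by (rule pen_system[OF reg])

sublocale t: linear_system "letters s" "UNIV :: unit set" "N * s" s s "sys_A s Yt Pt" "\<lambda>_. sys_B s Yt Pt" "sys_C s Pt"
  using pen_system[OF regular_at_transpose[OF reg]] by simp

lemma G: "G \<in> carrier_mat (N * s) (N * s)" "pen_at (*) s P Y * G = 1\<^sub>m (N * s)"
  using minv_inverse[OF regular_atD(3)[OF reg] pform_carrier] by auto

lemma G_dim [simp]: "dim_row G = N * s" "dim_col G = N * s"
  using G(1) by auto

lemma wf [simp]: "dim_row (pen_M P \<kappa>) = N" "dim_col (pen_M P \<kappa>) = N" "dim_row (pen_c P) = 1" "dim_col (pen_c P) = N"
  "dim_row (pen_b P) = N" "dim_col (pen_b P) = 1"
  using pen_wfD[OF regular_atD(1)[OF reg]] by auto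

lemma Gt: "minv (pen_at (*) s Pt Yt) = G\<^sup>T"
  using pen_at_transpose[OF regular_atD(1,2)[OF reg]] minv_transpose(2)[OF regular_atD(3)[OF reg] pform_carrier] by simp

text \<open>The inverse \<open>G\<close> stands on the left in \<open>sys_A\<close>, and
  transposition moves it to the right. The transposed coefficients are therefore conjugate, by
  \<open>G\<close>, to the original ones; \<open>flip\<close> accounts for transposed matrix
  units.\<close>

lemma A_transpose: "G * (sys_A s Yt Pt \<alpha>)\<^sup>T = sys_A s Y P (flip \<alpha>) * G"
proof -
  obtain k a b where \<alpha>: "\<alpha> = (k, a, b)" by (cases \<alpha>)
  have K: "kron (pen_M P (Some k)) (unit_mat s b a) \<in> carrier_mat (N * s) (N * s)" by (auto intro!: carrier_matI)
  have "sys_A s Yt Pt \<alpha> = - (G\<^sup>T * (kron (pen_M P (Some k)) (unit_mat s b a))\<^sup>T)"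
    unfolding sys_A_def \<alpha> prod.case Gt by (simp add: kron_transpose unit_mat_transpose)
  also have "\<dots> = (- (kron (pen_M P (Some k)) (unit_mat s b a) * G))\<^sup>T"
    using transpose_mult[OF K G(1)] by (simp add: transpose_uminus)
  finally have "(sys_A s Yt Pt \<alpha>)\<^sup>T = - (kron (pen_M P (Some k)) (unit_mat s b a) * G)" by simp
  then show ?thesis
    by (simp add: \<alpha> flip_def sys_A_def mult_uminus_dim uminus_mult_dim mult_assoc_dim)
qed

lemma wprod_transpose:
  "w \<in> lists (letters s) \<Longrightarrow> G * (wprod (N * s) (sys_A s Yt Pt) w)\<^sup>T = wprod (N * s) (sys_A s Y P) (rev (map flip w)) * G"
proof (induction w)
  case Nil
  then show ?case by (simp add: mult_one_dim one_mult_dim)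
next
  case (Cons \<alpha> w)
  then have \<alpha>: "\<alpha> \<in> letters s" "w \<in> lists (letters s)" "rev (map flip w) \<in> lists (letters s)" by auto
  note c = t.A_car[OF \<alpha>(1)] t.wprod_car[OF \<alpha>(2)] wprod_car[OF \<alpha>(3)] A_car[of "flip \<alpha>"]
  have fl: "flip \<alpha> \<in> letters s" using \<alpha> by simp
  note c = t.A_car[OF \<alpha>(1)] t.wprod_car[OF \<alpha>(2)] wprod_car[OF \<alpha>(3)] A_car[OF fl]
  have "G * (wprod (N * s) (sys_A s Yt Pt) (\<alpha> # w))\<^sup>T =
      (G * (wprod (N * s) (sys_A s Yt Pt) w)\<^sup>T) * (sys_A s Yt Pt \<alpha>)\<^sup>T"
    using c transpose_mult[OF c(1,2)] by (simp add: mult_assoc_dim)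
  also have "\<dots> = wprod (N * s) (sys_A s Y P) (rev (map flip w)) * (G * (sys_A s Yt Pt \<alpha>)\<^sup>T)"
    using Cons c by (simp add: mult_assoc_dim)
  also have "\<dots> = wprod (N * s) (sys_A s Y P) (rev (map flip w)) * sys_A s Y P (flip \<alpha>) * G"
    unfolding A_transpose using c by (simp add: mult_assoc_dim)
  finally show ?case using wprod_snoc[OF \<alpha>(3) fl] by simp
qed

lemma moment_transpose:
  assumes "w \<in> lists (letters s)"
  shows "moment s Yt Pt w = (moment s Y P (rev (map flip w)))\<^sup>T"
proof -
  let ?W = "wprod (N * s) (sys_A s Yt Pt) w"
  have W: "?W \<in> carrier_mat (N * s) (N * s)" by (rule t.wprod_car[OF assms])
  have w': "rev (map flip w) \<in> lists (letters s)" using assms by auto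
  have kc: "kron (pen_c P) (1\<^sub>m s) \<in> carrier_mat s (N * s)" "kron (pen_b P) (1\<^sub>m s) \<in> carrier_mat (N * s) s"
    by (auto intro!: carrier_matI)
  have B: "sys_B s Yt Pt = (kron (pen_c P) (1\<^sub>m s) * G)\<^sup>T"
    unfolding sys_B_def Gt transpose_mult[OF kc(1) G(1)] by (simp add: kron_transpose)
  have C: "sys_C s Pt = (kron (pen_b P) (1\<^sub>m s))\<^sup>T" by (simp add: sys_C_def kron_transpose)
  have BC: "sys_B s Yt Pt \<in> carrier_mat (N * s) s" "sys_C s Pt \<in> carrier_mat s (N * s)"
    using t.B_car t.C_car by auto
  have "(moment s Yt Pt w)\<^sup>T = (?W * sys_B s Yt Pt)\<^sup>T * (sys_C s Pt)\<^sup>T"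
    unfolding moment_def using BC W by (simp add: transpose_mult[OF BC(2) mult_carrier_mat[OF W BC(1)]])
  also have "\<dots> = ((sys_B s Yt Pt)\<^sup>T * ?W\<^sup>T) * (sys_C s Pt)\<^sup>T"
    by (simp add: transpose_mult[OF W BC(1)])
  also have "\<dots> = kron (pen_c P) (1\<^sub>m s) * ((G * ?W\<^sup>T) * kron (pen_b P) (1\<^sub>m s))"
    unfolding B C using W by (simp add: mult_assoc_dim)
  also have "\<dots> = moment s Y P (rev (map flip w))"
    unfolding wprod_transpose[OF assms] moment_def sys_C_def sys_B_def using wprod_car[OF w'] by (simp add: mult_assoc_dim)
  finally show ?thesis by (metis transpose_transpose)
qed

lemma reach_of_coreach: "t.crch k U \<Longrightarrow> rch k (G * U\<^sup>T)"
proof (induction k U rule: coreach.induct)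
  case (coreach_zero k)
  then show ?case by (simp add: mult_zero_dim reach_zero)
next
  case (coreach_base R k)
  have "(R * sys_C s Pt)\<^sup>T = kron (pen_b P) (1\<^sub>m s) * R\<^sup>T"
    using transpose_mult[OF coreach_base t.C_car] by (simp add: sys_C_def kron_transpose)
  then have "G * (R * sys_C s Pt)\<^sup>T = sys_B s Y P * R\<^sup>T"
    using coreach_base by (simp add: sys_B_def mult_assoc_dim)
  moreover have "rch k (sys_B s Y P * R\<^sup>T)" using coreach_base by (intro reach_base[of "()"]) auto
  ultimately show ?case by simp
next
  case (coreach_step \<alpha> k U)
  note c = t.crch_carrier[OF coreach_step(2)] t.A_car[OF coreach_step(1)]
  have fl: "flip \<alpha> \<in> letters s" using coreach_step by simp
  have "G * (U * sys_A s Yt Pt \<alpha>)\<^sup>T = (G * (sys_A s Yt Pt \<alpha>)\<^sup>T) * U\<^sup>T"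
    using c transpose_mult[OF c] by (simp add: mult_assoc_dim)
  also have "\<dots> = sys_A s Y P (flip \<alpha>) * (G * U\<^sup>T)"
    unfolding A_transpose using c A_car[OF fl] by (simp add: mult_assoc_dim)
  finally have "G * (U * sys_A s Yt Pt \<alpha>)\<^sup>T = sys_A s Y P (flip \<alpha>) * (G * U\<^sup>T)" .
  moreover have "rch k (sys_A s Y P (flip \<alpha>) * (G * U\<^sup>T))" by (rule reach_step[OF fl coreach_step(3)])
  ultimately show ?case by simp
next
  case (coreach_add k U W)
  note c = t.crch_carrier[OF coreach_add(1)] t.crch_carrier[OF coreach_add(2)]
  have "G * (U + W)\<^sup>T = G * U\<^sup>T + G * W\<^sup>T" using c transpose_add[OF c] by (simp add: mult_add_dim)
  moreover have "rch k (G * U\<^sup>T + G * W\<^sup>T)" by (rule reach_add[OF coreach_add(3,4)])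
  ultimately show ?case by simp
qed

end

lemma same_moments_transpose:
  assumes "regular_at s Y P" "regular_at s Y P'" "same_moments s Y P P'"
  shows "same_moments s (tuple_transpose Y) (pen_transpose P) (pen_transpose P')"
  unfolding same_moments_def
proof
  fix w :: "('a \<times> nat \<times> nat) list" assume w: "w \<in> lists (letters s)"
  interpret P: regular_pencil s Y P by unfold_locales (rule assms)
  interpret P': regular_pencil s Y P' by unfold_locales (rule assms)
  have "rev (map flip w) \<in> lists (letters s)" using w by auto
  then show "moment s (tuple_transpose Y) (pen_transpose P) w = moment s (tuple_transpose Y) (pen_transpose P') w"
    using assms(3) unfolding P.moment_transpose[OF w] P'.moment_transpose[OF w] same_moments_def by simp
qed

lemma minimal_at_transpose:
  assumes "minimal_at s Y P"
  shows "minimal_at s (tuple_transpose Y) (pen_transpose P)"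
  unfolding minimal_at_def
proof (intro conjI allI impI)
  have reg: "regular_at s Y P" using assms by (simp add: minimal_at_def)
  show regt: "regular_at s (tuple_transpose Y) (pen_transpose P)" by (rule regular_at_transpose[OF reg])
  fix P' assume P': "regular_at s (tuple_transpose Y) P' \<and> same_moments s (tuple_transpose Y) (pen_transpose P) P'"
  then have "regular_at s Y (pen_transpose P')" "same_moments s Y P (pen_transpose P')"
    using regular_at_transpose[of s "tuple_transpose Y" P'] same_moments_transpose[OF regt, of P'] by simp_all
  then show "pen_N (pen_transpose P) \<le> pen_N P'" using assms by (force simp: minimal_at_def)
qed

text \<open>Observable rows of the transposed system, transposed and multiplied by the invertible
  \<open>G\<close>, are reachable columns of the original one.\<close>

lemma minimal_reachable_observable:
  assumes min: "minimal_at s Y P" and s: "s > 0"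
  shows "reach (letters s) (UNIV :: unit set) (pen_N P * s) s (sys_A s Y P) (\<lambda>_. sys_B s Y P) (pen_N P * s) (1\<^sub>m (pen_N P * s))"
    and "coreach (letters s) (pen_N P * s) s (sys_A s Y P) (sys_C s P) (pen_N P * s) (1\<^sub>m (pen_N P * s))"
proof -
  have reg: "regular_at s Y P" using min by (simp add: minimal_at_def)
  interpret regular_pencil s Y P by unfold_locales (rule reg)
  interpret O: observable_reduction s Y P by unfold_locales (use reg s in auto)
  show "crch (N * s) (1\<^sub>m (N * s))" by (rule O.minimal_observable[OF min])
  interpret T: observable_reduction s Yt Pt
    by unfold_locales (use regular_at_transpose[OF reg] s in auto)
  have "t.crch (N * s) (1\<^sub>m (N * s))" using T.minimal_observable[OF minimal_at_transpose[OF min]] by simp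
  then have "rch (N * s) (G * (1\<^sub>m (N * s))\<^sup>T)" by (rule reach_of_coreach)
  then have "rch (N * s) (G * (1\<^sub>m (N * s))\<^sup>T * pen_at (*) s P Y)" by (rule rch_mult) simp
  then show "rch (N * s) (1\<^sub>m (N * s))"
    using minv_inverse(3)[OF regular_atD(3)[OF reg] pform_carrier] by (simp add: mult_one_dim)
qed

subsection \<open>Maximality of the domain of a minimal pencil\<close>

lemma kron_matsum_left:
  fixes Q :: "'k::semiring_0 mat"
  assumes "\<And>\<alpha>. \<alpha> \<in> I \<Longrightarrow> F \<alpha> \<in> carrier_mat r c" "Q \<in> carrier_mat p q"
  shows "kron (matsum I r c F) Q = matsum I (r * p) (c * q) (\<lambda>\<alpha>. kron (F \<alpha>) Q)" (is "?l = ?r")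
proof (rule bmat_eqI[of _ r p c q])
  fix i a j b assume *: "i < r" "a < p" "j < c" "b < q"
  then show "?l $$ (i * p + a, j * q + b) = ?r $$ (i * p + a, j * q + b)"
    using assms by (simp add: kron_index[of _ r c _ p q] block_index_less sum_distrib_right)
qed (use assms in auto)

lemma kron_one_mult:
  fixes A B :: "'a::ring_1 mat"
  assumes "dim_col A = dim_row B"
  shows "kron A (1\<^sub>m s) * kron B (1\<^sub>m s) = kron (A * B) (1\<^sub>m s)"
  using assms by (subst kron_mult_commuting[of _ "dim_row A" "dim_row B" _ s s _ "dim_col B" _ s])
    (auto simp: one_mult_dim)

lemma kron_one_cancel:
  fixes A B :: "'a::ring_1 mat"
  assumes "kron A (1\<^sub>m s) = kron B (1\<^sub>m s)" "A \<in> carrier_mat p q" "B \<in> carrier_mat p q" "s > 0"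
  shows "A = B"
proof (rule eq_matI)
  fix i j assume "i < dim_row B" "j < dim_col B"
  then have ij: "i < p" "j < q" using assms by auto
  have "kron A (1\<^sub>m s) $$ (i * s + 0, j * s + 0) = kron B (1\<^sub>m s) $$ (i * s + 0, j * s + 0)" using assms(1) by simp
  then show "A $$ (i, j) = B $$ (i, j)"
    using kron_index[OF assms(2) one_carrier_mat ij(1) assms(4) ij(2) assms(4)]
      kron_index[OF assms(3) one_carrier_mat ij(1) assms(4) ij(2) assms(4)] assms(4) by simp
qed (use assms in auto)

lemma kron_one_invertible:
  fixes A :: "'a::ring_1 mat"
  assumes "invertible_mat A" "A \<in> carrier_mat n n"
  shows "invertible_mat (kron A (1\<^sub>m s))" "minv (kron A (1\<^sub>m s)) = kron (minv A) (1\<^sub>m s)"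
proof -
  note a = minv_inverse[OF assms]
  have 1: "kron A (1\<^sub>m s) * kron (minv A) (1\<^sub>m s) = 1\<^sub>m (n * s)" "kron (minv A) (1\<^sub>m s) * kron A (1\<^sub>m s) = 1\<^sub>m (n * s)"
    using a assms(2) by (simp_all add: kron_one_mult)
  show "invertible_mat (kron A (1\<^sub>m s))" using 1 assms(2) by (intro invertible_matI[of _ "n * s"]) auto
  show "minv (kron A (1\<^sub>m s)) = kron (minv A) (1\<^sub>m s)" using 1 assms(2) a(1) by (intro minv_eqI[of _ "n * s"]) auto
qed

text \<open>Without determinants, the inverse of A is cut out of the inverse of A \<otimes> I_s by
  the first unit column: E = 1 \<otimes> e_0 intertwines A \<otimes> I_s with A, its transpose F
  does so on the other side, and F E = 1.\<close>

lemma kron_one_invertible_iff: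
  fixes A :: "'a::ring_1 mat"
  assumes A: "A \<in> carrier_mat n n" and s: "s > 0"
  shows "invertible_mat (kron A (1\<^sub>m s)) \<longleftrightarrow> invertible_mat A"
proof
  assume inv: "invertible_mat (kron A (1\<^sub>m s))"
  have kA: "kron A (1\<^sub>m s) \<in> carrier_mat (n * s) (n * s)" using A by auto
  note k = minv_inverse[OF inv kA]
  define E where "E = (kron (1\<^sub>m n) (unit_col s 0) :: 'a mat)"
  define F where "F = (kron (1\<^sub>m n) (unit_col s 0)\<^sup>T :: 'a mat)"
  have Ec: "E \<in> carrier_mat (n * s) n" "F \<in> carrier_mat n (n * s)" by (auto simp: E_def F_def intro!: carrier_matI)
  have "(\<Sum>i\<in>{0..<s}. (if i = 0 then 1 else 0) * (if i = 0 then 1 else 0 :: 'a)) = (\<Sum>i\<in>{0..<s}. if i = 0 then 1 else 0)"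
    by (rule sum.cong) auto
  then have "(unit_col s 0)\<^sup>T * unit_col s 0 = (1\<^sub>m 1 :: 'a mat)"
    using s by (intro eq_matI) (auto simp: unit_col_def scalar_prod_def)
  moreover have "F * E = kron (1\<^sub>m n * 1\<^sub>m n) ((unit_col s 0)\<^sup>T * unit_col s 0)"
    unfolding E_def F_def by (rule kron_mult_commuting[of _ n n _ 1 s _ n _ 1]) (auto intro!: carrier_matI)
  ultimately have FE: "F * E = 1\<^sub>m n" by simp
  have "kron A (1\<^sub>m s) * E = kron (A * 1\<^sub>m n) (1\<^sub>m s * unit_col s 0)"
    unfolding E_def using A by (intro kron_mult_commuting[of _ n n _ s s _ n _ 1]) auto
  moreover have "E * kron A (1\<^sub>m 1) = kron (1\<^sub>m n * A) (unit_col s 0 * 1\<^sub>m 1)"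
    unfolding E_def using A by (intro kron_mult_commuting[of _ n n _ s 1 _ n _ 1]) (auto simp: unit_col_def)
  ultimately have kE: "kron A (1\<^sub>m s) * E = E * A"
    using A by (simp add: kron_one_one mult_one_dim one_mult_dim)
  have "F * kron A (1\<^sub>m s) = kron (1\<^sub>m n * A) ((unit_col s 0)\<^sup>T * 1\<^sub>m s)"
    unfolding F_def using A by (intro kron_mult_commuting[of _ n n _ 1 s _ n _ s]) (auto simp: unit_col_def)
  moreover have "kron A (1\<^sub>m 1) * F = kron (A * 1\<^sub>m n) (1\<^sub>m 1 * (unit_col s 0)\<^sup>T)"
    unfolding F_def using A by (intro kron_mult_commuting[of _ n n _ 1 1 _ n _ s]) (auto simp: unit_col_def)
  ultimately have kF: "F * kron A (1\<^sub>m s) = A * F"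
    using A by (simp add: kron_one_one mult_one_dim one_mult_dim)
  let ?V = "F * (minv (kron A (1\<^sub>m s)) * E)"
  have "A * ?V = (F * kron A (1\<^sub>m s)) * (minv (kron A (1\<^sub>m s)) * E)"
    unfolding kF using A Ec k(1) by (simp add: mult_assoc_dim)
  also have "\<dots> = F * ((kron A (1\<^sub>m s) * minv (kron A (1\<^sub>m s))) * E)"
    using A Ec k(1) by (simp add: mult_assoc_dim)
  finally have 1: "A * ?V = 1\<^sub>m n" unfolding k(2) using Ec FE by (simp add: one_mult_dim)
  have "?V * A = F * (minv (kron A (1\<^sub>m s)) * (kron A (1\<^sub>m s) * E))"
    unfolding kE using A Ec k(1) by (simp add: mult_assoc_dim)
  also have "\<dots> = F * ((minv (kron A (1\<^sub>m s)) * kron A (1\<^sub>m s)) * E)"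
    using A Ec k(1) by (simp add: mult_assoc_dim)
  finally have 2: "?V * A = 1\<^sub>m n" unfolding k(3) using Ec FE by (simp add: one_mult_dim)
  show "invertible_mat A" by (rule invertible_matI[OF A 1 2])
qed (rule kron_one_invertible(1)[OF _ A])

text \<open>A system centred at a tuple of size s can only be evaluated at sizes that are multiples
  of s. Passing from X to X \<otimes> I_s reaches such a size from any n, and turns the pencil at X
  into that pencil tensored with I_s.\<close>

definition inflate :: "nat \<Rightarrow> ('d \<Rightarrow> 'a::ring_1 mat) \<Rightarrow> 'd \<Rightarrow> 'a mat" where
  "inflate s X k = kron (X k) (1\<^sub>m s)"

lemma inflate_tuples: "X \<in> tuples n \<Longrightarrow> inflate s X \<in> tuples (n * s)"
  by (auto simp: inflate_def tuples_def)

context unital_algebra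
begin

lemma ramp_ramp: "kron (ramp scale n P) (1\<^sub>m s) = ramp scale (n * s) P"
  by (simp add: ramp_def kron_assoc)

lemma pen_at_inflate:
  assumes "pen_wf p q P" "X \<in> tuples n"
  shows "pen_at scale (n * s) P (inflate s X) = kron (pen_at scale n P X) (1\<^sub>m s)"
proof -
  have e: "ext_tuple (n * s) (inflate s X) \<kappa> = kron (ext_tuple n X \<kappa>) (1\<^sub>m s)" for \<kappa>
    by (cases \<kappa>) (simp_all add: inflate_def)
  have "kron (pen_at scale n P X) (1\<^sub>m s) = matsum UNIV (pen_N P * n * s) (pen_N P * n * s)
      (\<lambda>\<kappa>. kron (kron (scalar_mat scale (pen_M P \<kappa>)) (ext_tuple n X \<kappa>)) (1\<^sub>m s))"
    unfolding pform_def using pen_wfD(1)[OF assms(1)] ext_tuple_carrier[OF assms(2)]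
    by (intro kron_matsum_left kron_carrier) auto
  then show ?thesis by (simp add: pform_def e kron_assoc mult.assoc)
qed

lemma pen_val_carrier:
  assumes "pen_wf p q P" "invertible_mat (pen_at scale n P X)"
  shows "pen_val scale n P X \<in> carrier_mat (p * n) (q * n)"
  unfolding pen_val_def using pen_wfD[OF assms(1)] minv_inverse(1)[OF assms(2) pform_carrier]
  by (intro mult_carrier_mat[of _ _ "pen_N P * n"] ramp_carrier) auto

lemma pen_val_inflate:
  assumes "pen_wf p q P" "X \<in> tuples n" "invertible_mat (pen_at scale n P X)"
  shows "pen_val scale (n * s) P (inflate s X) = kron (pen_val scale n P X) (1\<^sub>m s)"
proof -
  note w = minv_inverse[OF assms(3) pform_carrier] and c = pen_wfD[OF assms(1)]
  have "kron (pen_val scale n P X) (1\<^sub>m s) =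
      kron (ramp scale n (pen_c P)) (1\<^sub>m s) * (kron (minv (pen_at scale n P X)) (1\<^sub>m s) * kron (ramp scale n (pen_b P)) (1\<^sub>m s))"
    unfolding pen_val_def using w(1) c(2,3) by (simp add: kron_one_mult)
  then show ?thesis
    using kron_one_invertible(2)[OF assms(3) pform_carrier] pen_at_inflate[OF assms(1,2), of s]
    by (simp add: pen_val_def ramp_ramp)
qed

end

definition dominated :: "('k \<Rightarrow> 'a \<Rightarrow> 'a::ring_1) \<Rightarrow> ('d::finite, 'k) pencil \<Rightarrow> ('d, 'k) pencil \<Rightarrow> bool" where
  "dominated scale P Q \<longleftrightarrow> (\<forall>n. \<forall>X\<in>tuples n. invertible_mat (pen_at scale n P X) \<longrightarrow>
     invertible_mat (pen_at scale n Q X) \<and> pen_val scale n Q X = pen_val scale n P X)"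

lemma dominated_trans: "dominated scale P Q \<Longrightarrow> dominated scale Q R \<Longrightarrow> dominated scale P R"
  by (simp add: dominated_def)

text \<open>Inflate the point to a multiple of s, apply \<open>transfer\<close> to the systems
  centred at Y, and cancel the factor I_s again.\<close>

theorem minimal_dominates:
  fixes scale :: "'k::field \<Rightarrow> 'a::ring_1 \<Rightarrow> 'a" and Y :: "'d::finite \<Rightarrow> 'k mat"
  assumes "unital_algebra scale" and sf: "stably_finite TYPE('a)" and s: "s > 0"
    and min: "minimal_at s Y M" and reg': "regular_at s Y P" and mom: "same_moments s Y M P"
  shows "dominated scale P M"
  unfolding dominated_def
proof (intro allI ballI impI)
  interpret unital_algebra scale by fact
  fix n and X :: "'d \<Rightarrow> 'a mat" assume X: "X \<in> tuples n" and inv: "invertible_mat (pen_at scale n P X)"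
  have reg: "regular_at s Y M" using min by (simp add: minimal_at_def)
  note r = regular_atD[OF reg] and r' = regular_atD[OF reg']
  let ?X = "inflate s X"
  have X': "?X \<in> tuples (n * s)" by (rule inflate_tuples[OF X])
  interpret S: linear_system "letters s" "UNIV :: unit set" "pen_N M * s" s s "sys_A s Y M" "\<lambda>_. sys_B s Y M" "sys_C s M"
    by (rule pen_system[OF reg])
  interpret S': linear_system "letters s" "UNIV :: unit set" "pen_N P * s" s s "sys_A s Y P" "\<lambda>_. sys_B s Y P" "sys_C s P"
    by (rule pen_system[OF reg'])
  interpret algebra_system_pair scale "letters s" "UNIV :: unit set" "pen_N M * s" "pen_N P * s" s s "sys_A s Y M" "sys_A s Y P"
    "\<lambda>_. sys_B s Y M" "\<lambda>_. sys_B s Y P" "sys_C s M" "sys_C s P" n "centred scale s n Y ?X"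
    using minimal_reachable_observable[OF min s] mom sf
    by unfold_locales (auto simp: same_moments_def moment_def)
  have L: "sys_Lambda scale s n Y M ?X = \<Lambda>" "sys_Lambda scale s n Y P ?X = \<Lambda>'" by (simp_all add: sys_Lambda_def)
  note p = pencil_sys[OF r(1,3,2) X'] and p' = pencil_sys[OF r'(1,3,2) X']
  have i': "invertible_mat (pen_at scale (n * s) P ?X)"
    unfolding pen_at_inflate[OF r'(1) X] by (rule kron_one_invertible(1)[OF inv pform_carrier])
  then have L': "invertible_mat \<Lambda>'" using p'(1) L by simp
  note t = transfer[OF L']
  have i: "invertible_mat (pen_at scale (n * s) M ?X)" using p(1) L t(1) by simp
  then have inv_M: "invertible_mat (pen_at scale n M X)"
    unfolding pen_at_inflate[OF r(1) X] using kron_one_invertible_iff[OF pform_carrier s] by blast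
  have "pen_val scale (n * s) M ?X = pen_val scale (n * s) P ?X"
    unfolding p(2)[OF i] p'(2)[OF i'] L using t(2)[of "()"] by simp
  then have "kron (pen_val scale n M X) (1\<^sub>m s) = kron (pen_val scale n P X) (1\<^sub>m s)"
    unfolding pen_val_inflate[OF r(1) X inv_M] pen_val_inflate[OF r'(1) X inv] .
  then have "pen_val scale n M X = pen_val scale n P X"
    by (rule kron_one_cancel[OF _ pen_val_carrier[OF r(1) inv_M] pen_val_carrier[OF r'(1) inv] s])
  with inv_M show "invertible_mat (pen_at scale n M X) \<and> pen_val scale n M X = pen_val scale n P X" ..
qed

lemma dominated_same_moments:
  assumes reg: "regular_at s Y P" and wf: "pen_wf 1 1 Q" and dom: "dominated (*) P Q"
  shows "regular_at s Y Q" "same_moments s Y P Q"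
proof -
  note r = regular_atD[OF reg]
  show Q: "regular_at s Y Q" using r wf dom by (simp add: regular_at_def dominated_def)
  show "same_moments s Y P Q"
  proof (rule same_momentsI[OF reg Q])
    fix w :: "('a \<times> nat \<times> nat) list" assume "w \<in> lists (letters s)"
    then show "pen_val (*) (Suc (length w) * s) P (word_point s Y w) = pen_val (*) (Suc (length w) * s) Q (word_point s Y w)"
      using pencil_word_point(1)[OF reg] dom word_point_tuples unfolding dominated_def by metis
  qed
qed

text \<open>
  A pencil which agrees with a minimal one near some point \<open>Z\<close>, possibly far away from the centre \<open>Y\<close>,
  is dominated by it: compare both with a pencil that is minimal at \<open>Z\<close>.
\<close>

theorem minimal_dominates_connected:
  fixes scale :: "'k::field \<Rightarrow> 'a::ring_1 \<Rightarrow> 'a" and Y :: "'d::finite \<Rightarrow> 'k mat"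
  assumes alg: "unital_algebra scale" and sf: "stably_finite TYPE('a)" and s: "s > 0" and p: "p > 0"
    and min: "minimal_at s Y M" and M: "regular_at p Z M" and P: "regular_at p Z P" and mom: "same_moments p Z M P"
  shows "dominated scale P M"
proof -
  obtain M1 where M1: "minimal_at p Z M1" "same_moments p Z M M1" using minimal_at_exists[OF M] .
  have wf1: "pen_wf 1 1 M1" using M1(1) by (simp add: minimal_at_def regular_at_def)
  have M1P: "same_moments p Z M1 P" using same_moments_trans[OF same_moments_sym[OF M1(2)] mom] .
  \<comment> \<open>Since \<open>M1\<close> is regular wherever \<open>M\<close> is, it is regular
    at the centre Y and has the moments of \<open>M\<close> there; minimality of \<open>M\<close> at
    Y then gives the converse domination.\<close>
  have "dominated (*) M M1"
    by (rule minimal_dominates[OF unital_algebra_field stably_finite_field p M1(1) M same_moments_sym[OF M1(2)]])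
  moreover have "regular_at s Y M" using min by (simp add: minimal_at_def)
  ultimately have "regular_at s Y M1" "same_moments s Y M M1"
    using dominated_same_moments wf1 by blast+
  then have "dominated scale M1 M" by (rule minimal_dominates[OF alg sf s min])
  moreover have "dominated scale P M1" by (rule minimal_dominates[OF alg sf p M1(1) P M1P])
  ultimately show ?thesis using dominated_trans by blast
qed


section \<open>Linearization of expressions\<close>

subsection \<open>Two by two block matrices\<close>

text \<open>Blocks of height or width 0 let the product rule for four blocks cover rows and columns
  of two blocks; \<open>row2\<close> is also the form in which \<open>MRow\<close> is
  evaluated.\<close>

definition row2 :: "'a::zero mat \<Rightarrow> 'a mat \<Rightarrow> 'a mat" where
  "row2 A B = four_block_mat A B (0\<^sub>m 0 (dim_col A)) (0\<^sub>m 0 (dim_col B))"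

definition col2 :: "'a::zero mat \<Rightarrow> 'a mat \<Rightarrow> 'a mat" where
  "col2 A B = four_block_mat A (0\<^sub>m (dim_row A) 0) B (0\<^sub>m (dim_row B) 0)"

lemma append_rows_col2: "A @\<^sub>r B = col2 A B"
  by (simp add: append_rows_def col2_def)

lemma row2_dim [simp]: "dim_row (row2 A B) = dim_row A" "dim_col (row2 A B) = dim_col A + dim_col B"
  by (simp_all add: row2_def)

lemma col2_dim [simp]: "dim_row (col2 A B) = dim_row A + dim_row B" "dim_col (col2 A B) = dim_col A"
  by (simp_all add: col2_def)

lemma row2_carrier [simp]: "A \<in> carrier_mat p q \<Longrightarrow> B \<in> carrier_mat p r \<Longrightarrow> row2 A B \<in> carrier_mat p (q + r)"
  by (intro carrier_matI) auto

lemma col2_carrier [simp]: "A \<in> carrier_mat p q \<Longrightarrow> B \<in> carrier_mat r q \<Longrightarrow> col2 A B \<in> carrier_mat (p + r) q"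
  by (intro carrier_matI) auto

lemma uminus_zero_mat [simp]: "- 0\<^sub>m p q = (0\<^sub>m p q :: 'a::group_add mat)"
  by (rule eq_matI) auto

lemma row2_mult_col2:
  fixes A :: "'a::semiring_0 mat"
  assumes "A \<in> carrier_mat p n1" "B \<in> carrier_mat p n2" "C \<in> carrier_mat n1 q" "D \<in> carrier_mat n2 q"
  shows "row2 A B * col2 C D = A * C + B * D"
proof -
  have "row2 A B * col2 C D = four_block_mat (A * C + B * D) (A * 0\<^sub>m n1 0 + B * 0\<^sub>m n2 0)
    (0\<^sub>m 0 n1 * C + 0\<^sub>m 0 n2 * D) (0\<^sub>m 0 n1 * 0\<^sub>m n1 0 + 0\<^sub>m 0 n2 * 0\<^sub>m n2 0)"
    unfolding row2_def col2_def using assms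
    by (subst mult_four_block_mat[of _ p n1 _ n2 _ 0 _ _ q _ 0]) auto
  then show ?thesis using assms by (intro eq_matI) auto
qed

lemma four_block_mult_col2:
  fixes A :: "'a::semiring_0 mat"
  assumes "A \<in> carrier_mat p1 n1" "B \<in> carrier_mat p1 n2" "C \<in> carrier_mat p2 n1" "D \<in> carrier_mat p2 n2"
    "E \<in> carrier_mat n1 q" "F \<in> carrier_mat n2 q"
  shows "four_block_mat A B C D * col2 E F = col2 (A * E + B * F) (C * E + D * F)"
proof -
  have "four_block_mat A B C D * col2 E F = four_block_mat (A * E + B * F) (A * 0\<^sub>m n1 0 + B * 0\<^sub>m n2 0)
    (C * E + D * F) (C * 0\<^sub>m n1 0 + D * 0\<^sub>m n2 0)"
    unfolding col2_def using assms
    by (subst mult_four_block_mat[of _ p1 n1 _ n2 _ p2 _ _ q _ 0]) auto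
  then show ?thesis using assms by (intro eq_matI) (auto simp: col2_def)
qed

lemma row2_mult_four_block:
  fixes A :: "'a::semiring_0 mat"
  assumes "A \<in> carrier_mat n1 q1" "B \<in> carrier_mat n1 q2" "C \<in> carrier_mat n2 q1" "D \<in> carrier_mat n2 q2"
    "E \<in> carrier_mat p n1" "F \<in> carrier_mat p n2"
  shows "row2 E F * four_block_mat A B C D = row2 (E * A + F * C) (E * B + F * D)"
proof -
  have "row2 E F * four_block_mat A B C D = four_block_mat (E * A + F * C) (E * B + F * D)
    (0\<^sub>m 0 n1 * A + 0\<^sub>m 0 n2 * C) (0\<^sub>m 0 n1 * B + 0\<^sub>m 0 n2 * D)"
    unfolding row2_def using assms
    by (subst mult_four_block_mat[of _ p n1 _ n2 _ 0 _ _ q1 _ q2]) auto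
  then show ?thesis using assms by (intro eq_matI) (auto simp: row2_def)
qed

lemma block_index_ge:
  assumes "(i::nat) < (p1 + p2) * n"
  shows "i < p1 * n \<longleftrightarrow> i div n < p1" "\<not> i < p1 * n \<Longrightarrow> (i - p1 * n) div n = i div n - p1"
    "\<not> i < p1 * n \<Longrightarrow> (i - p1 * n) mod n = i mod n"
proof -
  have n: "n > 0" using assms by (cases n) auto
  show "i < p1 * n \<longleftrightarrow> i div n < p1" using n by (simp add: div_less_iff_less_mult)
  assume "\<not> i < p1 * n"
  then obtain j where "i = p1 * n + j" by (metis le_iff_add not_less)
  then show "(i - p1 * n) div n = i div n - p1" "(i - p1 * n) mod n = i mod n" using n by simp_all
qed

lemma kron_four_block:
  fixes A :: "'a::semiring_0 mat"
  assumes c: "A \<in> carrier_mat p1 q1" "B \<in> carrier_mat p1 q2" "C \<in> carrier_mat p2 q1" "D \<in> carrier_mat p2 q2"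
  shows "kron (four_block_mat A B C D) Z = four_block_mat (kron A Z) (kron B Z) (kron C Z) (kron D Z)" (is "?l = ?r")
proof (rule eq_matI)
  fix i j assume "i < dim_row ?r" "j < dim_col ?r"
  then have ij: "i < (p1 + p2) * dim_row Z" "j < (q1 + q2) * dim_col Z"
    using c by (auto simp: distrib_right)
  note i = block_index_ge[OF ij(1)] and j = block_index_ge[OF ij(2)]
  have ij': "i < p1 * dim_row Z + p2 * dim_row Z" "j < q1 * dim_col Z + q2 * dim_col Z"
    using ij by (simp_all add: distrib_right)
  have b: "i div dim_row Z < p1 + p2" "j div dim_col Z < q1 + q2" using ij block_div_less by auto
  show "?l $$ (i, j) = ?r $$ (i, j)"
  proof (cases "i < p1 * dim_row Z"; cases "j < q1 * dim_col Z")
  qed (use c ij ij' b i j in \<open>auto simp: kron_def\<close>)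
qed (use c in \<open>auto simp: distrib_right\<close>)

lemma matsum_four_block:
  assumes c: "\<And>\<alpha>. \<alpha> \<in> I \<Longrightarrow> A \<alpha> \<in> carrier_mat p1 q1" "\<And>\<alpha>. \<alpha> \<in> I \<Longrightarrow> B \<alpha> \<in> carrier_mat p1 q2"
    "\<And>\<alpha>. \<alpha> \<in> I \<Longrightarrow> C \<alpha> \<in> carrier_mat p2 q1" "\<And>\<alpha>. \<alpha> \<in> I \<Longrightarrow> D \<alpha> \<in> carrier_mat p2 q2"
  shows "matsum I (p1 + p2) (q1 + q2) (\<lambda>\<alpha>. four_block_mat (A \<alpha>) (B \<alpha>) (C \<alpha>) (D \<alpha>)) =
    four_block_mat (matsum I p1 q1 A) (matsum I p1 q2 B) (matsum I p2 q1 C) (matsum I p2 q2 D)" (is "?l = ?r")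
proof (rule eq_matI)
  fix i j assume "i < dim_row ?r" "j < dim_col ?r"
  then have ij: "i < p1 + p2" "j < q1 + q2" by simp_all
  have "(\<Sum>\<alpha>\<in>I. four_block_mat (A \<alpha>) (B \<alpha>) (C \<alpha>) (D \<alpha>) $$ (i, j)) = (\<Sum>\<alpha>\<in>I. if i < p1 then
      if j < q1 then A \<alpha> $$ (i, j) else B \<alpha> $$ (i, j - q1)
      else if j < q1 then C \<alpha> $$ (i - p1, j) else D \<alpha> $$ (i - p1, j - q1))"
  proof (rule sum.cong[OF refl])
    fix \<alpha> assume "\<alpha> \<in> I"
    then show "four_block_mat (A \<alpha>) (B \<alpha>) (C \<alpha>) (D \<alpha>) $$ (i, j) = (if i < p1 then
      if j < q1 then A \<alpha> $$ (i, j) else B \<alpha> $$ (i, j - q1)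
      else if j < q1 then C \<alpha> $$ (i - p1, j) else D \<alpha> $$ (i - p1, j - q1))"
      using ij c(1)[of \<alpha>] c(4)[of \<alpha>] by simp
  qed
  then show "?l $$ (i, j) = ?r $$ (i, j)"
    using ij by (cases "i < p1"; cases "j < q1") simp_all
qed auto

subsection \<open>Operations on pencils\<close>

definition const_form :: "'k mat \<Rightarrow> 'd option \<Rightarrow> 'k::zero mat" where
  "const_form K \<kappa> = (case \<kappa> of None \<Rightarrow> K | Some _ \<Rightarrow> 0\<^sub>m (dim_row K) (dim_col K))"

definition block_form :: "('d option \<Rightarrow> 'k mat) \<Rightarrow> ('d option \<Rightarrow> 'k mat) \<Rightarrow> ('d option \<Rightarrow> 'k mat) \<Rightarrow>
    ('d option \<Rightarrow> 'k mat) \<Rightarrow> 'd option \<Rightarrow> 'k::zero mat" where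
  "block_form A B C D \<kappa> = four_block_mat (A \<kappa>) (B \<kappa>) (C \<kappa>) (D \<kappa>)"

lemma const_form_carrier [simp]: "K \<in> carrier_mat p q \<Longrightarrow> const_form K \<kappa> \<in> carrier_mat p q"
  by (cases \<kappa>) (auto simp: const_form_def)

context unital_algebra
begin

lemma scalar_mat_four_block:
  assumes "A \<in> carrier_mat p1 q1" "B \<in> carrier_mat p1 q2" "C \<in> carrier_mat p2 q1" "D \<in> carrier_mat p2 q2"
  shows "scalar_mat scale (four_block_mat A B C D) =
    four_block_mat (scalar_mat scale A) (scalar_mat scale B) (scalar_mat scale C) (scalar_mat scale D)"
  unfolding scalar_mat_def using assms by (intro map_four_block_mat) auto

lemma ramp_four_block:
  assumes "A \<in> carrier_mat p1 q1" "B \<in> carrier_mat p1 q2" "C \<in> carrier_mat p2 q1" "D \<in> carrier_mat p2 q2"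
  shows "ramp scale n (four_block_mat A B C D) =
    four_block_mat (ramp scale n A) (ramp scale n B) (ramp scale n C) (ramp scale n D)"
  unfolding ramp_def scalar_mat_four_block[OF assms] using assms by (intro kron_four_block) auto

lemma ramp_zero [simp]: "ramp scale n (0\<^sub>m p q) = 0\<^sub>m (p * n) (q * n)"
  by (simp add: ramp_def kron_zero_left)

lemma ramp_uminus: "ramp scale n (- P) = - ramp scale n P"
  by (rule eq_matI) (auto simp: ramp_def kron_def block_div_less)

lemma ramp_row2:
  assumes "A \<in> carrier_mat p q" "B \<in> carrier_mat p r"
  shows "ramp scale n (row2 A B) = row2 (ramp scale n A) (ramp scale n B)"
  unfolding row2_def using assms by (subst ramp_four_block[of _ p q _ r _ 0]) auto

lemma ramp_col2:
  assumes "A \<in> carrier_mat p q" "B \<in> carrier_mat r q"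
  shows "ramp scale n (col2 A B) = col2 (ramp scale n A) (ramp scale n B)"
  unfolding col2_def using assms by (subst ramp_four_block[of _ p q _ 0 _ r]) auto

lemma pform_block_form:
  assumes X: "X \<in> tuples n" and "\<And>\<kappa>. A \<kappa> \<in> carrier_mat p1 q1" "\<And>\<kappa>. B \<kappa> \<in> carrier_mat p1 q2"
    "\<And>\<kappa>. C \<kappa> \<in> carrier_mat p2 q1" "\<And>\<kappa>. D \<kappa> \<in> carrier_mat p2 q2"
  shows "pform scale n (p1 + p2) (q1 + q2) (block_form A B C D) X =
    four_block_mat (pform scale n p1 q1 A X) (pform scale n p1 q2 B X) (pform scale n p2 q1 C X) (pform scale n p2 q2 D X)"
proof -
  note e = ext_tuple_carrier[OF X]
  have k: "kron (scalar_mat scale (block_form A B C D \<kappa>)) (ext_tuple n X \<kappa>) =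
    four_block_mat (kron (scalar_mat scale (A \<kappa>)) (ext_tuple n X \<kappa>)) (kron (scalar_mat scale (B \<kappa>)) (ext_tuple n X \<kappa>))
      (kron (scalar_mat scale (C \<kappa>)) (ext_tuple n X \<kappa>)) (kron (scalar_mat scale (D \<kappa>)) (ext_tuple n X \<kappa>))" for \<kappa>
    unfolding block_form_def scalar_mat_four_block[OF assms(2-5)]
    by (rule kron_four_block[of _ p1 q1 _ q2 _ p2]) (simp_all add: assms(2-5))
  show ?thesis
    unfolding pform_def k distrib_right
    by (rule matsum_four_block) (auto intro!: kron_carrier simp: assms(2-5) e)
qed

lemma pform_const_form:
  assumes "K \<in> carrier_mat p q" "X \<in> tuples n"
  shows "pform scale n p q (const_form K) X = ramp scale n K"
proof -
  define F where "F \<kappa> = kron (scalar_mat scale (const_form K \<kappa>)) (ext_tuple n X \<kappa>)" for \<kappa>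
  have F0: "F \<kappa> = 0\<^sub>m (p * n) (q * n)" if neq: "\<kappa> \<noteq> None" for \<kappa>
  proof -
    obtain k where "\<kappa> = Some k" using neq by auto
    then show ?thesis
      using assms(1) ext_tuple_carrier[OF assms(2), of "Some k"] by (simp add: F_def const_form_def kron_zero_left)
  qed
  have "F None \<in> carrier_mat (p * n) (q * n)" using assms(1) by (auto simp: F_def intro!: kron_carrier)
  then have "matsum UNIV (p * n) (q * n) F = F None" by (intro matsum_delta F0) simp_all
  then have "pform scale n p q (const_form K) X = F None" unfolding pform_def F_def .
  then show ?thesis by (simp add: F_def const_form_def ramp_def)
qed

lemma pen_valI:
  assumes "W \<in> carrier_mat (pen_N P * n) (pen_N P * n)"
    "pen_at scale n P X * W = 1\<^sub>m (pen_N P * n)" "W * pen_at scale n P X = 1\<^sub>m (pen_N P * n)"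
  shows "invertible_mat (pen_at scale n P X)" "minv (pen_at scale n P X) = W"
    "pen_val scale n P X = ramp scale n (pen_c P) * (W * ramp scale n (pen_b P))"
proof -
  show "invertible_mat (pen_at scale n P X)" by (rule invertible_matI[OF pform_carrier assms(2,3)])
  show "minv (pen_at scale n P X) = W" by (rule minv_eqI[OF pform_carrier assms])
  then show "pen_val scale n P X = ramp scale n (pen_c P) * (W * ramp scale n (pen_b P))" by (simp add: pen_val_def)
qed

end

definition pen_const :: "'k::field \<Rightarrow> ('d, 'k) pencil" where
  "pen_const c = \<lparr>pen_N = 1, pen_M = const_form (1\<^sub>m 1), pen_c = 1\<^sub>m 1, pen_b = c \<cdot>\<^sub>m 1\<^sub>m 1\<rparr>"

text \<open>The pencil 1 - \<open>E_01\<close> \<otimes> x is unipotent with inverse 1 +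
  \<open>E_01\<close> \<otimes> x; the row and the column select its entry x.\<close>

definition pen_var :: "'d \<Rightarrow> ('d, 'k::field) pencil" where
  "pen_var x = \<lparr>pen_N = 2, pen_M = \<lambda>\<kappa>. case \<kappa> of None \<Rightarrow> 1\<^sub>m 2 | Some k \<Rightarrow> if k = x then - unit_mat 2 0 1 else 0\<^sub>m 2 2,
     pen_c = mat 1 2 (\<lambda>(i, j). if j = 0 then 1 else 0), pen_b = mat 2 1 (\<lambda>(i, j). if i = 1 then 1 else 0)\<rparr>"

abbreviation diag_form where
  "diag_form P Q \<equiv> block_form (pen_M P) (const_form (0\<^sub>m (pen_N P) (pen_N Q))) (const_form (0\<^sub>m (pen_N Q) (pen_N P))) (pen_M Q)"

definition pen_add :: "('d, 'k::field) pencil \<Rightarrow> ('d, 'k) pencil \<Rightarrow> ('d, 'k) pencil" where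
  "pen_add P Q = \<lparr>pen_N = pen_N P + pen_N Q, pen_M = diag_form P Q,
     pen_c = row2 (pen_c P) (pen_c Q), pen_b = col2 (pen_b P) (pen_b Q)\<rparr>"

text \<open>Block triangular, with coupling -b c chosen so that the upper right block of the inverse
  is P^-1 b c Q^-1.\<close>

definition pen_mul :: "('d, 'k::field) pencil \<Rightarrow> ('d, 'k) pencil \<Rightarrow> ('d, 'k) pencil" where
  "pen_mul P Q = \<lparr>pen_N = pen_N P + pen_N Q,
     pen_M = block_form (pen_M P) (const_form (- (pen_b P * pen_c Q))) (const_form (0\<^sub>m (pen_N Q) (pen_N P))) (pen_M Q),
     pen_c = row2 (pen_c P) (0\<^sub>m (dim_row (pen_c P)) (pen_N Q)),
     pen_b = col2 (0\<^sub>m (pen_N P) (dim_col (pen_b Q))) (pen_b Q)\<rparr>"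

text \<open>Bordering by b and c creates the Schur complement -c P^-1 b, whose inverse is the lower
  right block of the inverse; the entry -1 in the column corrects the sign.\<close>

definition pen_inv :: "nat \<Rightarrow> ('d, 'k::field) pencil \<Rightarrow> ('d, 'k) pencil" where
  "pen_inv p P = \<lparr>pen_N = pen_N P + p,
     pen_M = block_form (pen_M P) (const_form (pen_b P)) (const_form (pen_c P)) (const_form (0\<^sub>m p p)),
     pen_c = row2 (0\<^sub>m p (pen_N P)) (1\<^sub>m p), pen_b = col2 (0\<^sub>m (pen_N P) p) (- 1\<^sub>m p)\<rparr>"

definition pen_row :: "('d, 'k::field) pencil \<Rightarrow> ('d, 'k) pencil \<Rightarrow> ('d, 'k) pencil" where
  "pen_row P Q = \<lparr>pen_N = pen_N P + pen_N Q, pen_M = diag_form P Q, pen_c = row2 (pen_c P) (pen_c Q),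
     pen_b = four_block_mat (pen_b P) (0\<^sub>m (pen_N P) (dim_col (pen_b Q))) (0\<^sub>m (pen_N Q) (dim_col (pen_b P))) (pen_b Q)\<rparr>"

definition pen_col :: "('d, 'k::field) pencil \<Rightarrow> ('d, 'k) pencil \<Rightarrow> ('d, 'k) pencil" where
  "pen_col P Q = \<lparr>pen_N = pen_N P + pen_N Q, pen_M = diag_form P Q,
     pen_c = four_block_mat (pen_c P) (0\<^sub>m (dim_row (pen_c P)) (pen_N Q)) (0\<^sub>m (dim_row (pen_c Q)) (pen_N P)) (pen_c Q),
     pen_b = col2 (pen_b P) (pen_b Q)\<rparr>"

lemma block_form_carrier [simp]:
  "A \<kappa> \<in> carrier_mat p1 q1 \<Longrightarrow> D \<kappa> \<in> carrier_mat p2 q2 \<Longrightarrow> block_form A B C D \<kappa> \<in> carrier_mat (p1 + p2) (q1 + q2)"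
  by (simp add: block_form_def)

lemma pen_wf_ops:
  "pen_wf 1 1 (pen_const c)" "pen_wf 1 1 (pen_var x)"
  "pen_wf p q P \<Longrightarrow> pen_wf p q Q \<Longrightarrow> pen_wf p q (pen_add P Q)"
  "pen_wf p q P \<Longrightarrow> pen_wf q r Q \<Longrightarrow> pen_wf p r (pen_mul P Q)"
  "pen_wf p p P \<Longrightarrow> pen_wf p p (pen_inv p P)"
  "pen_wf p q P \<Longrightarrow> pen_wf p r Q \<Longrightarrow> pen_wf p (q + r) (pen_row P Q)"
  "pen_wf p q P \<Longrightarrow> pen_wf r q Q \<Longrightarrow> pen_wf (p + r) q (pen_col P Q)"
  by (auto simp: pen_wf_def pen_const_def pen_var_def pen_add_def pen_mul_def pen_inv_def pen_row_def pen_col_def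
      split: option.split)

context unital_algebra
begin

abbreviation "emb \<equiv> \<lambda>c. scale c 1"

definition linearizes :: "('d::finite, 'k) pencil \<Rightarrow> ('d, 'k) mat_expr \<Rightarrow> bool" where
  "linearizes P e \<longleftrightarrow> (\<forall>n. \<forall>X\<in>tuples n. mx_defined emb n X e \<longrightarrow>
     invertible_mat (pen_at scale n P X) \<and> pen_val scale n P X = mx_eval emb n X e)"

abbreviation "solves n P X v \<equiv> \<exists>W\<in>carrier_mat (pen_N P * n) (pen_N P * n). pen_at scale n P X * W = 1\<^sub>m (pen_N P * n) \<and>
  W * pen_at scale n P X = 1\<^sub>m (pen_N P * n) \<and> ramp scale n (pen_c P) * (W * ramp scale n (pen_b P)) = v"

lemma linearizesI:
  assumes "\<And>n X. X \<in> tuples n \<Longrightarrow> mx_defined emb n X e \<Longrightarrow>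
    solves n P X (mx_eval emb n X e)"
  shows "linearizes P e"
  unfolding linearizes_def
proof (intro allI ballI impI)
  fix n X assume "X \<in> tuples n" "mx_defined emb n X e"
  from assms[OF this] obtain W where "W \<in> carrier_mat (pen_N P * n) (pen_N P * n)"
    "pen_at scale n P X * W = 1\<^sub>m (pen_N P * n)" "W * pen_at scale n P X = 1\<^sub>m (pen_N P * n)"
    "ramp scale n (pen_c P) * (W * ramp scale n (pen_b P)) = mx_eval emb n X e" by blast
  then show "invertible_mat (pen_at scale n P X) \<and> pen_val scale n P X = mx_eval emb n X e"
    using pen_valI[of W P n X] by simp
qed

definition "resolved n X P p q v N c b A W \<longleftrightarrow> N = pen_N P * n \<and> c = ramp scale n (pen_c P) \<and> b = ramp scale n (pen_b P) \<and>
  A = pen_at scale n P X \<and> W \<in> carrier_mat N N \<and> A * W = 1\<^sub>m N \<and> W * A = 1\<^sub>m N \<and> v = c * (W * b) \<and>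
  c \<in> carrier_mat (p * n) N \<and> b \<in> carrier_mat N (q * n) \<and> A \<in> carrier_mat N N"

lemma resolvedD:
  assumes "resolved n X P p q v N c b A W"
  shows "N = pen_N P * n" "c = ramp scale n (pen_c P)" "b = ramp scale n (pen_b P)" "A = pen_at scale n P X"
    "W \<in> carrier_mat N N" "A * W = 1\<^sub>m N" "W * A = 1\<^sub>m N" "v = c * (W * b)"
    "c \<in> carrier_mat (p * n) N" "b \<in> carrier_mat N (q * n)" "A \<in> carrier_mat N N"
  using assms by (auto simp: resolved_def)

lemma linearizes_resolved:
  assumes "linearizes P e" "pen_wf p q P" "X \<in> tuples n" "mx_defined emb n X e"
  shows "\<exists>N c b A W. resolved n X P p q (mx_eval emb n X e) N c b A W"
proof -
  have inv: "invertible_mat (pen_at scale n P X)" and v: "pen_val scale n P X = mx_eval emb n X e"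
    using assms unfolding linearizes_def by auto
  have "resolved n X P p q (mx_eval emb n X e) (pen_N P * n) (ramp scale n (pen_c P)) (ramp scale n (pen_b P))
      (pen_at scale n P X) (minv (pen_at scale n P X))"
    using minv_inverse[OF inv pform_carrier] v pen_wfD[OF assms(2)] by (simp add: resolved_def pen_val_def)
  then show ?thesis by blast
qed

lemma linearizes_const: "linearizes (pen_const c :: ('d::finite, 'k) pencil) (MConst c)"
proof (rule linearizesI)
  fix n and X :: "'d \<Rightarrow> 'a mat" assume X: "X \<in> tuples n"
  have "pen_at scale n (pen_const c :: ('d, 'k) pencil) X = 1\<^sub>m (1 * n)"
    using pform_const_form[OF one_carrier_mat[of 1] X] by (simp add: pen_const_def)
  moreover have "ramp scale n (c \<cdot>\<^sub>m 1\<^sub>m 1) = scale c 1 \<cdot>\<^sub>m 1\<^sub>m n"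
    by (rule eq_matI) (auto simp: ramp_def kron_def)
  ultimately show "\<exists>W\<in>carrier_mat (pen_N (pen_const c :: ('d, 'k) pencil) * n) (pen_N (pen_const c :: ('d, 'k) pencil) * n).
      pen_at scale n (pen_const c :: ('d, 'k) pencil) X * W = 1\<^sub>m (pen_N (pen_const c :: ('d, 'k) pencil) * n) \<and>
      W * pen_at scale n (pen_const c :: ('d, 'k) pencil) X = 1\<^sub>m (pen_N (pen_const c :: ('d, 'k) pencil) * n) \<and>
      ramp scale n (pen_c (pen_const c :: ('d, 'k) pencil)) * (W * ramp scale n (pen_b (pen_const c :: ('d, 'k) pencil))) = mx_eval emb n X (MConst c)"
    by (intro bexI[of _ "1\<^sub>m n"]) (auto simp: pen_const_def one_mult_dim)
qed

lemma linearizes_var: "linearizes (pen_var (x :: 'd::finite)) (MVar x)"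
proof (rule linearizesI)
  fix n and X :: "'d \<Rightarrow> 'a mat" assume X: "X \<in> tuples n"
  then have Xc: "X x \<in> carrier_mat n n" by (simp add: tuples_def)
  define E :: "'k mat" where "E = unit_mat 2 0 1"
  define Z where "Z = kron (scalar_mat scale E) (X x)"
  have Ec: "E \<in> carrier_mat 2 2" by (simp add: E_def)
  have Zc: "Z \<in> carrier_mat (2 * n) (2 * n)" using Ec Xc by (auto simp: Z_def)
  have EE: "E * E = 0\<^sub>m 2 2" by (rule eq_matI) (auto simp: E_def scalar_prod_def numeral_2_eq_2)
  have ZZ: "Z * Z = 0\<^sub>m (2 * n) (2 * n)"
    unfolding Z_def using Ec Xc by (subst kron_scalar_left_mult) (auto simp: EE kron_zero_left)
  let ?P = "pen_var x :: ('d, 'k) pencil"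
  have "pen_at scale n ?P X = 1\<^sub>m (2 * n) - Z" (is "?l = ?r")
  proof (rule eq_matI)
    fix i j assume "i < dim_row ?r" "j < dim_col ?r"
    then have ij: "i < 2 * n" "j < 2 * n" using Zc by auto
    have "(\<Sum>k\<in>UNIV. kron (scalar_mat scale (pen_M ?P (Some k))) (X k) $$ (i, j)) = (\<Sum>k\<in>UNIV. if k = x then - Z $$ (i, j) else 0)"
    proof (rule sum.cong[OF refl])
      fix k
      have "X k \<in> carrier_mat n n" using X by (simp add: tuples_def)
      then show "kron (scalar_mat scale (pen_M ?P (Some k))) (X k) $$ (i, j) = (if k = x then - Z $$ (i, j) else 0)"
        using ij by (auto simp: pen_var_def Z_def E_def kron_def block_div_less)
    qed
    then show "?l $$ (i, j) = ?r $$ (i, j)"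
      using ij Zc by (simp add: pform_def sum_UNIV_option pen_var_def)
  qed (use Zc in \<open>auto simp: pen_var_def\<close>)
  note at = this
  let ?c = "ramp scale n (pen_c ?P)" and ?b = "ramp scale n (pen_b ?P)"
  have c: "pen_c ?P \<in> carrier_mat 1 2" "pen_b ?P \<in> carrier_mat 2 1" by (simp_all add: pen_var_def)
  have cb: "pen_c ?P * pen_b ?P = 0\<^sub>m 1 1" "pen_c ?P * (E * pen_b ?P) = 1\<^sub>m 1"
    by (intro eq_matI; auto simp: pen_var_def E_def scalar_prod_def numeral_2_eq_2)+
  have "?c * (Z * ?b) = kron (scalar_mat scale (pen_c ?P * (E * pen_b ?P))) (1\<^sub>m n * (X x * 1\<^sub>m n))"
    unfolding ramp_def Z_def using c Ec Xc by (simp add: kron_scalar_left_mult)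
  also have "\<dots> = X x"
    unfolding cb using Xc by (intro eq_matI) (auto simp: kron_def mult_one_dim one_mult_dim)
  finally have cZb: "?c * (Z * ?b) = X x" .
  have "?c * ((1\<^sub>m (2 * n) + Z) * ?b) = ?c * ?b + ?c * (Z * ?b)"
    using c Zc by (simp add: add_mult_dim mult_add_dim one_mult_dim)
  also have "?c * ?b = 0\<^sub>m n n" using c by (simp add: ramp_mult cb)
  finally have val: "?c * ((1\<^sub>m (2 * n) + Z) * ?b) = X x" unfolding cZb using Xc by simp
  have 1: "(1\<^sub>m (2 * n) - Z) * (1\<^sub>m (2 * n) + Z) = 1\<^sub>m (2 * n)"
  proof -
    have "(1\<^sub>m (2 * n) - Z) * (1\<^sub>m (2 * n) + Z) = 1\<^sub>m (2 * n) - Z + (Z - Z * Z)"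
      using Zc by (simp add: minus_mult_dim mult_add_dim one_mult_dim mult_one_dim)
    then show ?thesis unfolding ZZ using Zc by (intro eq_matI) auto
  qed
  have 2: "(1\<^sub>m (2 * n) + Z) * (1\<^sub>m (2 * n) - Z) = 1\<^sub>m (2 * n)"
  proof -
    have "(1\<^sub>m (2 * n) + Z) * (1\<^sub>m (2 * n) - Z) = 1\<^sub>m (2 * n) + Z - (Z + Z * Z)"
      using Zc by (simp add: add_mult_dim mult_minus_dim one_mult_dim mult_one_dim)
    then show ?thesis unfolding ZZ using Zc by (intro eq_matI) auto
  qed
  have N: "pen_N ?P = 2" by (simp add: pen_var_def)
  show "\<exists>W\<in>carrier_mat (pen_N ?P * n) (pen_N ?P * n). pen_at scale n ?P X * W = 1\<^sub>m (pen_N ?P * n) \<and>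
      W * pen_at scale n ?P X = 1\<^sub>m (pen_N ?P * n) \<and> ?c * (W * ?b) = mx_eval emb n X (MVar x)"
    unfolding at unfolding N using 1 2 val Zc by (intro bexI[of _ "1\<^sub>m (2 * n) + Z"]) auto
qed

lemma diag_inverse:
  fixes P1 P2 :: "'a mat"
  assumes "P1 \<in> carrier_mat n1 n1" "W1 \<in> carrier_mat n1 n1" "P1 * W1 = 1\<^sub>m n1"
    "P2 \<in> carrier_mat n2 n2" "W2 \<in> carrier_mat n2 n2" "P2 * W2 = 1\<^sub>m n2"
  shows "four_block_mat P1 (0\<^sub>m n1 n2) (0\<^sub>m n2 n1) P2 * four_block_mat W1 (0\<^sub>m n1 n2) (0\<^sub>m n2 n1) W2 = 1\<^sub>m (n1 + n2)"
  using assms by (subst mult_four_block_mat[of _ n1 n1 _ n2 _ n2]) (auto simp: mult_zero_dim zero_mult_dim)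

lemma pen_at_diag:
  assumes "pen_wf p q P" "pen_wf p' q' Q" "X \<in> tuples n"
  shows "pform scale n (pen_N P + pen_N Q) (pen_N P + pen_N Q) (diag_form P Q) X =
    four_block_mat (pen_at scale n P X) (0\<^sub>m (pen_N P * n) (pen_N Q * n)) (0\<^sub>m (pen_N Q * n) (pen_N P * n)) (pen_at scale n Q X)"
  using pen_wfD[OF assms(1)] pen_wfD[OF assms(2)] assms(3)
  by (simp add: pform_block_form pform_const_form)

lemma linearizes_add:
  assumes P: "linearizes P e" "pen_wf p q P" and Q: "linearizes Q f" "pen_wf p q Q"
  shows "linearizes (pen_add P Q) (MAdd e f)"
proof (rule linearizesI)
  fix n X assume X: "X \<in> tuples n" and d: "mx_defined emb n X (MAdd e f)"
  obtain N1 c1 b1 P1 W1 where R1: "resolved n X P p q (mx_eval emb n X e) N1 c1 b1 P1 W1" using linearizes_resolved[OF P X] d by auto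
  obtain N2 c2 b2 P2 W2 where R2: "resolved n X Q p q (mx_eval emb n X f) N2 c2 b2 P2 W2" using linearizes_resolved[OF Q X] d by auto
  note defs = resolvedD(1-4)[OF R1] resolvedD(1-4)[OF R2] and w1 = resolvedD(5-11)[OF R1] and w2 = resolvedD(5-11)[OF R2]
  note wP = pen_wfD[OF P(2)] and wQ = pen_wfD[OF Q(2)]
  let ?W = "four_block_mat W1 (0\<^sub>m N1 N2) (0\<^sub>m N2 N1) W2"
  have at: "pen_at scale n (pen_add P Q) X = four_block_mat P1 (0\<^sub>m N1 N2) (0\<^sub>m N2 N1) P2"
    using pen_at_diag[OF P(2) Q(2) X] by (simp add: pen_add_def defs)
  have cc: "ramp scale n (pen_c (pen_add P Q)) = row2 c1 c2" "ramp scale n (pen_b (pen_add P Q)) = col2 b1 b2"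
    using wP wQ by (simp_all add: pen_add_def defs ramp_row2[of _ p "pen_N P" _ "pen_N Q"] ramp_col2[of _ "pen_N P" q _ "pen_N Q"])
  have "?W * col2 b1 b2 = col2 (W1 * b1) (W2 * b2)"
    using w1 w2 by (subst four_block_mult_col2[of _ N1 N1 _ N2 _ N2 _ _ "q * n"]) (auto simp: zero_mult_dim)
  then have "row2 c1 c2 * (?W * col2 b1 b2) = c1 * (W1 * b1) + c2 * (W2 * b2)"
    using w1 w2 by (simp add: row2_mult_col2[of _ "p * n" N1 _ N2 _ "q * n"])
  then have val: "ramp scale n (pen_c (pen_add P Q)) * (?W * ramp scale n (pen_b (pen_add P Q))) = mx_eval emb n X (MAdd e f)"
    unfolding cc using w1(4) w2(4) by simp
  have N: "pen_N (pen_add P Q) * n = N1 + N2" by (simp add: pen_add_def defs distrib_right)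
  show "solves n (pen_add P Q) X (mx_eval emb n X (MAdd e f))"
    using val w1 w2 diag_inverse unfolding N at by (intro bexI[of _ ?W]) auto
qed

lemma linearizes_mul:
  assumes P: "linearizes P e" "pen_wf p q P" and Q: "linearizes Q f" "pen_wf q r Q"
  shows "linearizes (pen_mul P Q) (MMul e f)"
proof (rule linearizesI)
  fix n X assume X: "X \<in> tuples n" and d: "mx_defined emb n X (MMul e f)"
  obtain N1 c1 b1 P1 W1 where R1: "resolved n X P p q (mx_eval emb n X e) N1 c1 b1 P1 W1" using linearizes_resolved[OF P X] d by auto
  obtain N2 c2 b2 P2 W2 where R2: "resolved n X Q q r (mx_eval emb n X f) N2 c2 b2 P2 W2" using linearizes_resolved[OF Q X] d by auto
  note defs = resolvedD(1-4)[OF R1] resolvedD(1-4)[OF R2] and w1 = resolvedD(5-11)[OF R1] and w2 = resolvedD(5-11)[OF R2]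
  note wP = pen_wfD[OF P(2)] and wQ = pen_wfD[OF Q(2)]
  define \<beta> where "\<beta> = b1 * c2"
  have \<beta>c: "\<beta> \<in> carrier_mat N1 N2" using w1 w2 by (auto simp: \<beta>_def)
  define V where "V = W1 * (\<beta> * W2)"
  have Vc: "V \<in> carrier_mat N1 N2" using w1 w2 \<beta>c by (auto simp: V_def)
  let ?W = "four_block_mat W1 V (0\<^sub>m N2 N1) W2"
  have b: "ramp scale n (- (pen_b P * pen_c Q)) = - \<beta>"
    unfolding ramp_uminus \<beta>_def resolvedD(3)[OF R1] resolvedD(2)[OF R2] using wP wQ by (simp add: ramp_mult)
  have at: "pen_at scale n (pen_mul P Q) X = four_block_mat P1 (- \<beta>) (0\<^sub>m N2 N1) P2"
    using wP wQ X b by (simp add: pen_mul_def pform_block_form pform_const_form defs)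
  have "P1 * V = (P1 * W1) * (\<beta> * W2)"
    unfolding V_def using w1(1,7) w2(1) \<beta>c by (intro mult_assoc_dim[symmetric]) auto
  then have PV: "P1 * V = \<beta> * W2" unfolding w1(2) using w2 \<beta>c by (simp add: one_mult_dim)
  have "V * P2 = W1 * (\<beta> * (W2 * P2))" unfolding V_def using w1 w2 \<beta>c by (simp add: mult_assoc_dim)
  then have VP: "V * P2 = W1 * \<beta>" unfolding w2(3) using \<beta>c by (simp add: mult_one_dim)
  have 1: "pen_at scale n (pen_mul P Q) X * ?W = 1\<^sub>m (N1 + N2)"
  proof -
    have "P1 * V + - \<beta> * W2 = 0\<^sub>m N1 N2" unfolding PV using \<beta>c w2 by (intro eq_matI) (auto simp: uminus_mult_dim)
    moreover have "P1 * W1 + - \<beta> * 0\<^sub>m N2 N1 = 1\<^sub>m N1" using w1 \<beta>c by (simp add: mult_zero_dim)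
    moreover have "0\<^sub>m N2 N1 * W1 + P2 * 0\<^sub>m N2 N1 = 0\<^sub>m N2 N1" "0\<^sub>m N2 N1 * V + P2 * W2 = 1\<^sub>m N2"
      using w1 w2 Vc by (simp_all add: mult_zero_dim zero_mult_dim)
    ultimately show ?thesis
      unfolding at using w1 w2 \<beta>c Vc by (subst mult_four_block_mat[of _ N1 N1 _ N2 _ N2]) auto
  qed
  have 2: "?W * pen_at scale n (pen_mul P Q) X = 1\<^sub>m (N1 + N2)"
  proof -
    have "W1 * - \<beta> + V * P2 = 0\<^sub>m N1 N2" unfolding VP using \<beta>c w1 by (intro eq_matI) (auto simp: mult_uminus_dim)
    moreover have "W1 * P1 + V * 0\<^sub>m N2 N1 = 1\<^sub>m N1" using w1 Vc by (simp add: mult_zero_dim)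
    moreover have "0\<^sub>m N2 N1 * P1 + W2 * 0\<^sub>m N2 N1 = 0\<^sub>m N2 N1" "0\<^sub>m N2 N1 * - \<beta> + W2 * P2 = 1\<^sub>m N2"
      using w1 w2 \<beta>c by (simp_all add: mult_zero_dim zero_mult_dim)
    ultimately show ?thesis
      unfolding at using w1 w2 \<beta>c Vc by (subst mult_four_block_mat[of _ N1 N1 _ N2 _ N2]) auto
  qed
  have cc: "ramp scale n (pen_c (pen_mul P Q)) = row2 c1 (0\<^sub>m (p * n) N2)" "ramp scale n (pen_b (pen_mul P Q)) = col2 (0\<^sub>m N1 (r * n)) b2"
    using wP wQ by (simp_all add: pen_mul_def defs ramp_row2[of _ p "pen_N P" _ "pen_N Q"] ramp_col2[of _ "pen_N P" r _ "pen_N Q"])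
  have "?W * col2 (0\<^sub>m N1 (r * n)) b2 = col2 (V * b2) (W2 * b2)"
    using w1 w2 Vc by (subst four_block_mult_col2[of _ N1 N1 _ N2 _ N2 _ _ "r * n"]) (auto simp: mult_zero_dim zero_mult_dim)
  then have "row2 c1 (0\<^sub>m (p * n) N2) * (?W * col2 (0\<^sub>m N1 (r * n)) b2) = c1 * (V * b2)"
    using w1 w2 Vc by (simp add: row2_mult_col2[of _ "p * n" N1 _ N2 _ "r * n"] zero_mult_dim)
  also have "\<dots> = (c1 * (W1 * b1)) * (c2 * (W2 * b2))"
    unfolding V_def \<beta>_def using w1 w2 by (simp add: mult_assoc_dim)
  finally have val: "ramp scale n (pen_c (pen_mul P Q)) * (?W * ramp scale n (pen_b (pen_mul P Q))) = mx_eval emb n X (MMul e f)"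
    unfolding cc using w1 w2 by simp
  have N: "pen_N (pen_mul P Q) * n = N1 + N2" by (simp add: pen_mul_def defs distrib_right)
  show "solves n (pen_mul P Q) X (mx_eval emb n X (MMul e f))"
    unfolding N using 1 2 val w1(1) w2(1) by (intro bexI[of _ ?W]) auto
qed

lemma pen_at_inv:
  assumes "pen_wf p p P" "X \<in> tuples n"
  shows "pen_at scale n (pen_inv p P) X =
    four_block_mat (pen_at scale n P X) (ramp scale n (pen_b P)) (ramp scale n (pen_c P)) (0\<^sub>m (p * n) (p * n))"
  using pen_wfD[OF assms(1)] assms(2) by (simp add: pen_inv_def pform_block_form pform_const_form)

text \<open>Block inversion with pivot \<open>P1\<close>, whose Schur complement is the negative of
  \<open>c * (W * b)\<close>.\<close>

lemma pen_inv_inverse: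
  fixes P1 W :: "'a mat"
  assumes w: "P1 \<in> carrier_mat N N" "W \<in> carrier_mat N N" "P1 * W = 1\<^sub>m N" "W * P1 = 1\<^sub>m N"
    and cb: "c \<in> carrier_mat l N" "b \<in> carrier_mat N l"
    and U: "U \<in> carrier_mat l l" "(c * (W * b)) * U = 1\<^sub>m l" "U * (c * (W * b)) = 1\<^sub>m l"
  shows "four_block_mat P1 b c (0\<^sub>m l l) * four_block_mat (W - W * (b * (U * (c * W)))) (W * (b * U)) (U * (c * W)) (- U) = 1\<^sub>m (N + l)"
    "four_block_mat (W - W * (b * (U * (c * W)))) (W * (b * U)) (U * (c * W)) (- U) * four_block_mat P1 b c (0\<^sub>m l l) = 1\<^sub>m (N + l)"
proof -
  have PW: "P1 * (W * Z) = Z" "W * (P1 * Z) = Z" if "dim_row Z = N" for Z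
    using that w by (simp_all add: mult_assoc_dim[symmetric] one_mult_dim)
  have cWbU: "c * (W * (b * (U * Z))) = Z" if "dim_row Z = l" for Z
  proof -
    have "c * (W * (b * (U * Z))) = ((c * (W * b)) * U) * Z" using that w cb U(1) by (simp add: mult_assoc_dim)
    then show ?thesis unfolding U(2) using that by (simp add: one_mult_dim)
  qed
  have UcWb: "U * (c * (W * b)) = 1\<^sub>m l" by (rule U(3))
  have cWbU1: "c * (W * (b * U)) = 1\<^sub>m l" using U(2) w cb U(1) by (simp add: mult_assoc_dim)
  have a: "P1 * (W - W * (b * (U * (c * W)))) + b * (U * (c * W)) = 1\<^sub>m N"
    using w cb U(1) by (intro eq_matI) (auto simp: mult_minus_dim PW simp del: index_mult_mat(1))
  have b': "P1 * (W * (b * U)) + b * - U = 0\<^sub>m N l"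
    using w cb U(1) by (intro eq_matI) (auto simp: mult_uminus_dim PW simp del: index_mult_mat(1))
  have c': "c * (W - W * (b * (U * (c * W)))) + 0\<^sub>m l l * (U * (c * W)) = 0\<^sub>m l N"
    using w cb U(1) by (intro eq_matI) (auto simp: mult_minus_dim cWbU zero_mult_dim simp del: index_mult_mat(1))
  have d': "c * (W * (b * U)) + 0\<^sub>m l l * - U = 1\<^sub>m l" unfolding cWbU1 using U(1) by (simp add: zero_mult_dim)
  show "four_block_mat P1 b c (0\<^sub>m l l) * four_block_mat (W - W * (b * (U * (c * W)))) (W * (b * U)) (U * (c * W)) (- U) = 1\<^sub>m (N + l)"
    using w cb U(1) a b' c' d'
    by (subst mult_four_block_mat[of _ N N _ l _ l _ _ N _ l]) (auto intro!: minus_carrier_mat mult_carrier_mat)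
  have a2: "(W - W * (b * (U * (c * W)))) * P1 + W * (b * U) * c = 1\<^sub>m N"
    using w cb U(1) by (intro eq_matI) (auto simp: minus_mult_dim mult_assoc_dim w(4) mult_one_dim simp del: index_mult_mat(1))
  have b2: "(W - W * (b * (U * (c * W)))) * b + W * (b * U) * 0\<^sub>m l l = 0\<^sub>m N l"
    using w cb U(1) by (intro eq_matI) (auto simp: minus_mult_dim mult_assoc_dim UcWb mult_one_dim mult_zero_dim simp del: index_mult_mat(1))
  have c2: "U * (c * W) * P1 + - U * c = 0\<^sub>m l N"
    using w cb U(1) by (intro eq_matI) (auto simp: mult_assoc_dim uminus_mult_dim w(4) mult_one_dim simp del: index_mult_mat(1))
  have d2: "U * (c * W) * b + - U * 0\<^sub>m l l = 1\<^sub>m l"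
    using w cb U(1) by (simp add: mult_assoc_dim UcWb mult_zero_dim)
  show "four_block_mat (W - W * (b * (U * (c * W)))) (W * (b * U)) (U * (c * W)) (- U) * four_block_mat P1 b c (0\<^sub>m l l) = 1\<^sub>m (N + l)"
    using w cb U(1) a2 b2 c2 d2
    by (subst mult_four_block_mat[of _ N N _ l _ l _ _ N _ l]) (auto intro!: minus_carrier_mat mult_carrier_mat)
qed

lemma linearizes_inv:
  assumes P: "linearizes P e" "pen_wf p p P"
  shows "linearizes (pen_inv p P) (MInv e)"
proof (rule linearizesI)
  fix n X assume X: "X \<in> tuples n" and d: "mx_defined emb n X (MInv e)"
  obtain N c b P1 W where R: "resolved n X P p p (mx_eval emb n X e) N c b P1 W" using linearizes_resolved[OF P X] d by auto
  note defs = resolvedD(1-4)[OF R] and w = resolvedD(5-11)[OF R]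
  have V: "c * (W * b) \<in> carrier_mat (p * n) (p * n)" using w by auto
  have inv: "invertible_mat (c * (W * b))" using d w(4) by simp
  define U where "U = minv (c * (W * b))"
  note u = minv_inverse[OF inv V, folded U_def]
  let ?W = "four_block_mat (W - W * (b * (U * (c * W)))) (W * (b * U)) (U * (c * W)) (- U)"
  note pi = pen_inv_inverse[OF w(7,1,2,3,5,6) u]
  have at: "pen_at scale n (pen_inv p P) X = four_block_mat P1 b c (0\<^sub>m (p * n) (p * n))"
    unfolding defs by (rule pen_at_inv[OF P(2) X])
  have N: "pen_N (pen_inv p P) * n = N + p * n" by (simp add: pen_inv_def defs distrib_right)
  have cc: "ramp scale n (pen_c (pen_inv p P)) = row2 (0\<^sub>m (p * n) N) (1\<^sub>m (p * n))"
    "ramp scale n (pen_b (pen_inv p P)) = col2 (0\<^sub>m N (p * n)) (- 1\<^sub>m (p * n))"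
    by (simp_all add: pen_inv_def defs ramp_row2[of _ p "pen_N P" _ p] ramp_col2[of _ "pen_N P" p _ p] ramp_uminus)
  have Wc: "W - W * (b * (U * (c * W))) \<in> carrier_mat N N" "W * (b * U) \<in> carrier_mat N (p * n)"
    "U * (c * W) \<in> carrier_mat (p * n) N" "- U \<in> carrier_mat (p * n) (p * n)"
    using w u(1) by (auto intro!: minus_carrier_mat mult_carrier_mat)
  have "?W * col2 (0\<^sub>m N (p * n)) (- 1\<^sub>m (p * n)) = col2 (- (W * (b * U))) U"
    using Wc u(1) w by (subst four_block_mult_col2[OF Wc zero_carrier_mat uminus_carrier_mat[OF one_carrier_mat]])
      (auto simp: mult_zero_dim zero_mult_dim mult_uminus_dim uminus_mult_dim mult_one_dim intro!: cong[of "col2 _"] arg_cong2[of _ _ _ _ col2])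
  then have "row2 (0\<^sub>m (p * n) N) (1\<^sub>m (p * n)) * (?W * col2 (0\<^sub>m N (p * n)) (- 1\<^sub>m (p * n))) = U"
    using Wc u(1) w by (simp add: row2_mult_col2[of _ "p * n" N _ "p * n" _ "p * n"] zero_mult_dim one_mult_dim)
  then have val: "ramp scale n (pen_c (pen_inv p P)) * (?W * ramp scale n (pen_b (pen_inv p P))) = mx_eval emb n X (MInv e)"
    unfolding cc by (simp add: w(4) U_def)
  show "solves n (pen_inv p P) X (mx_eval emb n X (MInv e))"
    using val pi Wc unfolding N at by (intro bexI[of _ ?W]) auto
qed

lemma linearizes_row:
  assumes P: "linearizes P e" "pen_wf p q P" and Q: "linearizes Q f" "pen_wf p r Q"
  shows "linearizes (pen_row P Q) (MRow e f)"
proof (rule linearizesI)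
  fix n X assume X: "X \<in> tuples n" and d: "mx_defined emb n X (MRow e f)"
  obtain N1 c1 b1 P1 W1 where R1: "resolved n X P p q (mx_eval emb n X e) N1 c1 b1 P1 W1" using linearizes_resolved[OF P X] d by auto
  obtain N2 c2 b2 P2 W2 where R2: "resolved n X Q p r (mx_eval emb n X f) N2 c2 b2 P2 W2" using linearizes_resolved[OF Q X] d by auto
  note defs = resolvedD(1-4)[OF R1] resolvedD(1-4)[OF R2] and w1 = resolvedD(5-11)[OF R1] and w2 = resolvedD(5-11)[OF R2]
  note wP = pen_wfD[OF P(2)] and wQ = pen_wfD[OF Q(2)]
  let ?W = "four_block_mat W1 (0\<^sub>m N1 N2) (0\<^sub>m N2 N1) W2"
  have at: "pen_at scale n (pen_row P Q) X = four_block_mat P1 (0\<^sub>m N1 N2) (0\<^sub>m N2 N1) P2"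
    using pen_at_diag[OF P(2) Q(2) X] by (simp add: pen_row_def defs)
  have cc: "ramp scale n (pen_c (pen_row P Q)) = row2 c1 c2"
    "ramp scale n (pen_b (pen_row P Q)) = four_block_mat b1 (0\<^sub>m N1 (r * n)) (0\<^sub>m N2 (q * n)) b2"
    using wP wQ by (simp_all add: pen_row_def defs ramp_row2[of _ p "pen_N P" _ "pen_N Q"]
        ramp_four_block[of _ "pen_N P" q _ r _ "pen_N Q"])
  have "?W * four_block_mat b1 (0\<^sub>m N1 (r * n)) (0\<^sub>m N2 (q * n)) b2 = four_block_mat (W1 * b1) (0\<^sub>m N1 (r * n)) (0\<^sub>m N2 (q * n)) (W2 * b2)"
    using w1 w2 by (subst mult_four_block_mat[of _ N1 N1 _ N2 _ N2 _ _ "q * n" _ "r * n"]) (auto simp: mult_zero_dim zero_mult_dim)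
  then have "row2 c1 c2 * (?W * four_block_mat b1 (0\<^sub>m N1 (r * n)) (0\<^sub>m N2 (q * n)) b2) = row2 (c1 * (W1 * b1)) (c2 * (W2 * b2))"
    using w1 w2 by (simp add: row2_mult_four_block[of _ N1 "q * n" _ "r * n" _ N2 _ _ "p * n"] mult_zero_dim)
  then have val: "ramp scale n (pen_c (pen_row P Q)) * (?W * ramp scale n (pen_b (pen_row P Q))) = mx_eval emb n X (MRow e f)"
    unfolding cc using w1(4) w2(4) by (simp add: row2_def)
  have N: "pen_N (pen_row P Q) * n = N1 + N2" by (simp add: pen_row_def defs distrib_right)
  show "solves n (pen_row P Q) X (mx_eval emb n X (MRow e f))"
    using val w1 w2 diag_inverse unfolding N at by (intro bexI[of _ ?W]) auto
qed

lemma linearizes_col: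
  assumes P: "linearizes P e" "pen_wf p q P" and Q: "linearizes Q f" "pen_wf r q Q"
  shows "linearizes (pen_col P Q) (MCol e f)"
proof (rule linearizesI)
  fix n X assume X: "X \<in> tuples n" and d: "mx_defined emb n X (MCol e f)"
  obtain N1 c1 b1 P1 W1 where R1: "resolved n X P p q (mx_eval emb n X e) N1 c1 b1 P1 W1" using linearizes_resolved[OF P X] d by auto
  obtain N2 c2 b2 P2 W2 where R2: "resolved n X Q r q (mx_eval emb n X f) N2 c2 b2 P2 W2" using linearizes_resolved[OF Q X] d by auto
  note defs = resolvedD(1-4)[OF R1] resolvedD(1-4)[OF R2] and w1 = resolvedD(5-11)[OF R1] and w2 = resolvedD(5-11)[OF R2]
  note wP = pen_wfD[OF P(2)] and wQ = pen_wfD[OF Q(2)]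
  let ?W = "four_block_mat W1 (0\<^sub>m N1 N2) (0\<^sub>m N2 N1) W2"
  have at: "pen_at scale n (pen_col P Q) X = four_block_mat P1 (0\<^sub>m N1 N2) (0\<^sub>m N2 N1) P2"
    using pen_at_diag[OF P(2) Q(2) X] by (simp add: pen_col_def defs)
  have cc: "ramp scale n (pen_c (pen_col P Q)) = four_block_mat c1 (0\<^sub>m (p * n) N2) (0\<^sub>m (r * n) N1) c2"
    "ramp scale n (pen_b (pen_col P Q)) = col2 b1 b2"
    using wP wQ by (simp_all add: pen_col_def defs ramp_col2[of _ "pen_N P" q _ "pen_N Q"]
        ramp_four_block[of _ p "pen_N P" _ "pen_N Q" _ r])
  have "?W * col2 b1 b2 = col2 (W1 * b1) (W2 * b2)"
    using w1 w2 by (subst four_block_mult_col2[of _ N1 N1 _ N2 _ N2 _ _ "q * n"]) (auto simp: zero_mult_dim)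
  then have "four_block_mat c1 (0\<^sub>m (p * n) N2) (0\<^sub>m (r * n) N1) c2 * (?W * col2 b1 b2) = col2 (c1 * (W1 * b1)) (c2 * (W2 * b2))"
    using w1 w2 by (simp add: four_block_mult_col2[of _ "p * n" N1 _ N2 _ "r * n" _ _ "q * n"] zero_mult_dim)
  then have val: "ramp scale n (pen_c (pen_col P Q)) * (?W * ramp scale n (pen_b (pen_col P Q))) = mx_eval emb n X (MCol e f)"
    unfolding cc using w1(4) w2(4) by (simp add: append_rows_col2)
  have N: "pen_N (pen_col P Q) * n = N1 + N2" by (simp add: pen_col_def defs distrib_right)
  show "solves n (pen_col P Q) X (mx_eval emb n X (MCol e f))"
    using val w1 w2 diag_inverse unfolding N at by (intro bexI[of _ ?W]) auto
qed

end


text \<open>The pencil depends on the expression alone. One and the same pencil has to serve both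
  settings: over the field it is compared with other representations of the function, over the
  algebra it is evaluated.\<close>

theorem has_linearization:
  fixes scale :: "'k::field \<Rightarrow> 'a::ring_1 \<Rightarrow> 'a" and e :: "('d::finite, 'k) mat_expr"
  assumes "unital_algebra scale" "has_size e p q"
  shows "\<exists>P. pen_wf p q P \<and> unital_algebra.linearizes (*) P e \<and> unital_algebra.linearizes scale P e"
proof -
  interpret K: unital_algebra "(*) :: 'k \<Rightarrow> 'k \<Rightarrow> 'k" by (rule unital_algebra_field)
  interpret A: unital_algebra scale by fact
  let ?L = "\<lambda>P e. K.linearizes P e \<and> A.linearizes P (e :: ('d, 'k) mat_expr)"
  show ?thesis using assms(2)
  proof induction
    case (1 c)
    show ?case by (intro exI[of _ "pen_const c"] conjI pen_wf_ops(1) K.linearizes_const A.linearizes_const)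
  next
    case (2 k)
    show ?case by (intro exI[of _ "pen_var k"] conjI pen_wf_ops(2) K.linearizes_var A.linearizes_var)
  next
    case (3 e p q f)
    obtain P where P: "pen_wf p q P" "?L P e" using 3(3) by (elim exE) blast
    obtain Q where Q: "pen_wf p q Q" "?L Q f" using 3(4) by (elim exE) blast
    show ?case using P(2) Q(2)
      by (intro exI[of _ "pen_add P Q"] conjI pen_wf_ops(3)[OF P(1) Q(1)] K.linearizes_add[OF _ P(1) _ Q(1)] A.linearizes_add[OF _ P(1) _ Q(1)]) simp_all
  next
    case (4 e p q f r)
    obtain P where P: "pen_wf p q P" "?L P e" using 4(3) by (elim exE) blast
    obtain Q where Q: "pen_wf q r Q" "?L Q f" using 4(4) by (elim exE) blast
    show ?case using P(2) Q(2)
      by (intro exI[of _ "pen_mul P Q"] conjI pen_wf_ops(4)[OF P(1) Q(1)] K.linearizes_mul[OF _ P(1) _ Q(1)] A.linearizes_mul[OF _ P(1) _ Q(1)]) simp_all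
  next
    case (5 e p)
    obtain P where P: "pen_wf p p P" "?L P e" using 5(2) by (elim exE) blast
    show ?case using P(2)
      by (intro exI[of _ "pen_inv p P"] conjI pen_wf_ops(5)[OF P(1)] K.linearizes_inv[OF _ P(1)] A.linearizes_inv[OF _ P(1)]) simp_all
  next
    case (6 e p q f r)
    obtain P where P: "pen_wf p q P" "?L P e" using 6(3) by (elim exE) blast
    obtain Q where Q: "pen_wf p r Q" "?L Q f" using 6(4) by (elim exE) blast
    show ?case using P(2) Q(2)
      by (intro exI[of _ "pen_row P Q"] conjI pen_wf_ops(6)[OF P(1) Q(1)] K.linearizes_row[OF _ P(1) _ Q(1)] A.linearizes_row[OF _ P(1) _ Q(1)]) simp_all
  next
    case (7 e p q f r)
    obtain P where P: "pen_wf p q P" "?L P e" using 7(3) by (elim exE) blast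
    obtain Q where Q: "pen_wf r q Q" "?L Q f" using 7(4) by (elim exE) blast
    show ?case using P(2) Q(2)
      by (intro exI[of _ "pen_col P Q"] conjI pen_wf_ops(7)[OF P(1) Q(1)] K.linearizes_col[OF _ P(1) _ Q(1)] A.linearizes_col[OF _ P(1) _ Q(1)]) simp_all
  qed
qed

subsection \<open>The domain of an expression\<close>

definition pen_diag :: "('d, 'k::field) pencil \<Rightarrow> ('d, 'k) pencil \<Rightarrow> ('d, 'k) pencil" where
  "pen_diag P Q = \<lparr>pen_N = pen_N P + pen_N Q, pen_M = diag_form P Q,
     pen_c = 0\<^sub>m 1 (pen_N P + pen_N Q), pen_b = 0\<^sub>m (pen_N P + pen_N Q) 1\<rparr>"

lemma invertible_diag_iff:
  fixes A D :: "'k::field mat"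
  assumes "A \<in> carrier_mat p p" "D \<in> carrier_mat q q"
  shows "invertible_mat (four_block_mat A (0\<^sub>m p q) (0\<^sub>m q p) D) \<longleftrightarrow> invertible_mat A \<and> invertible_mat D"
  using assms det_four_block_mat_lower_left_zero[OF assms(1) zero_carrier_mat refl assms(2)]
  by (simp add: invertible_mat_iff_det[of _ p] invertible_mat_iff_det[of _ q] invertible_mat_iff_det[of _ "p + q"])

lemma pen_diag_invertible_iff:
  assumes "pen_wf p q P" "pen_wf p' q' Q" "X \<in> tuples n"
  shows "invertible_mat (pen_at (*) n (pen_diag P Q) X) \<longleftrightarrow>
    invertible_mat (pen_at (*) n P (X :: 'd::finite \<Rightarrow> 'k::field mat)) \<and> invertible_mat (pen_at (*) n Q X)"
  using unital_algebra.pen_at_diag[OF unital_algebra_field assms] invertible_diag_iff[OF pform_carrier pform_carrier]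
  by (simp add: pen_diag_def)

text \<open>For the converse, let Z2 and Z4 be the blocks in the last block column of the inverse.
  They satisfy P1 Z2 + b Z4 = 0 and c Z2 = 1; eliminating Z2 exhibits -Z4 as a right inverse of c
  P1^-1 b.\<close>

lemma pen_inv_invertible_iff:
  fixes X :: "'d::finite \<Rightarrow> 'k::field mat"
  assumes wf: "pen_wf p p P" and X: "X \<in> tuples n" and inv: "invertible_mat (pen_at (*) n P X)"
  shows "invertible_mat (pen_at (*) n (pen_inv p P) X) \<longleftrightarrow> invertible_mat (pen_val (*) n P X)"
proof -
  interpret unital_algebra "(*) :: 'k \<Rightarrow> 'k \<Rightarrow> 'k" by (rule unital_algebra_field)
  define N c b P1 W where "N = pen_N P * n" and "c = ramp (*) n (pen_c P)" and "b = ramp (*) n (pen_b P)"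
    and "P1 = pen_at (*) n P X" and "W = minv (pen_at (*) n P X)"
  note defs = N_def c_def b_def P1_def W_def
  note w = minv_inverse[OF inv pform_carrier, folded defs]
  have P1c: "P1 \<in> carrier_mat N N" by (simp add: defs)
  have cb: "c \<in> carrier_mat (p * n) N" "b \<in> carrier_mat N (p * n)"
    using pen_wfD[OF wf] by (simp_all add: defs)
  have val: "pen_val (*) n P X = c * (W * b)" by (simp add: pen_val_def defs)
  have V: "c * (W * b) \<in> carrier_mat (p * n) (p * n)" using w cb by auto
  have at: "pen_at (*) n (pen_inv p P) X = four_block_mat P1 b c (0\<^sub>m (p * n) (p * n))"
    unfolding defs by (rule pen_at_inv[OF wf X])
  have atc: "four_block_mat P1 b c (0\<^sub>m (p * n) (p * n)) \<in> carrier_mat (N + p * n) (N + p * n)"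
    using P1c by simp
  show ?thesis
    unfolding at val
  proof
    assume "invertible_mat (c * (W * b))"
    note u = minv_inverse[OF this V]
    show "invertible_mat (four_block_mat P1 b c (0\<^sub>m (p * n) (p * n)))"
      by (rule invertible_matI[OF atc pen_inv_inverse[OF P1c w cb u]])
  next
    assume "invertible_mat (four_block_mat P1 b c (0\<^sub>m (p * n) (p * n)))"
    note z = minv_inverse[OF this atc]
    let ?Z = "minv (four_block_mat P1 b c (0\<^sub>m (p * n) (p * n)))"
    obtain Z1 Z2 Z3 Z4 where sb: "split_block ?Z N N = (Z1, Z2, Z3, Z4)" by (metis prod_cases4)
    note zc = split_block[OF sb, of "p * n" "p * n"]
    have zc: "Z1 \<in> carrier_mat N N" "Z2 \<in> carrier_mat N (p * n)" "Z3 \<in> carrier_mat (p * n) N" "Z4 \<in> carrier_mat (p * n) (p * n)"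
      "?Z = four_block_mat Z1 Z2 Z3 Z4"
      using zc z(1) by auto
    have "four_block_mat (P1 * Z1 + b * Z3) (P1 * Z2 + b * Z4) (c * Z1 + 0\<^sub>m (p * n) (p * n) * Z3) (c * Z2 + 0\<^sub>m (p * n) (p * n) * Z4) =
      four_block_mat (1\<^sub>m N) (0\<^sub>m N (p * n)) (0\<^sub>m (p * n) N) (1\<^sub>m (p * n))"
      using z(2) unfolding zc(5) mult_four_block_mat[OF P1c cb(2,1) zero_carrier_mat zc(1-4)] by simp
    note fb = this
    have e1: "P1 * Z2 + b * Z4 = 0\<^sub>m N (p * n)" (is "?l = ?r")
    proof (rule eq_matI)
      fix i j assume ij: "i < dim_row ?r" "j < dim_col ?r"
      have "four_block_mat (P1 * Z1 + b * Z3) (P1 * Z2 + b * Z4) (c * Z1 + 0\<^sub>m (p * n) (p * n) * Z3) (c * Z2 + 0\<^sub>m (p * n) (p * n) * Z4) $$ (i, N + j) = (0 :: 'k)"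
        unfolding fb using ij by simp
      then show "?l $$ (i, j) = ?r $$ (i, j)"
        using ij P1c cb zc by (simp del: index_mult_mat(1) index_add_mat(1))
    qed (use P1c cb zc in auto)
    have e2: "c * Z2 = 1\<^sub>m (p * n)" (is "_ = ?r")
    proof (rule eq_matI)
      fix i j assume ij: "i < dim_row ?r" "j < dim_col ?r"
      have "four_block_mat (P1 * Z1 + b * Z3) (P1 * Z2 + b * Z4) (c * Z1 + 0\<^sub>m (p * n) (p * n) * Z3) (c * Z2 + 0\<^sub>m (p * n) (p * n) * Z4) $$ (N + i, N + j)
        = ?r $$ (i, j)"
        unfolding fb using ij by simp
      then show "(c * Z2) $$ (i, j) = ?r $$ (i, j)"
        using ij P1c cb zc by (simp add: zero_mult_dim del: index_mult_mat(1))
    qed (use cb zc in auto)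
    have "Z2 = W * (P1 * Z2)" using w P1c zc by (simp add: mult_assoc_dim[symmetric] one_mult_dim)
    also have "P1 * Z2 = 0\<^sub>m N (p * n) - b * Z4"
      by (rule eq_minus_matI[OF e1]) (use P1c cb zc in auto)
    also have "W * (0\<^sub>m N (p * n) - b * Z4) = (W * b) * - Z4"
      using w cb zc by (intro eq_matI) (auto simp: mult_minus_dim mult_assoc_dim mult_uminus_dim mult_zero_dim simp del: index_mult_mat(1))
    finally have Z2: "Z2 = (W * b) * - Z4" .
    have "(c * (W * b)) * - Z4 = c * Z2" unfolding Z2 using w cb zc by (simp add: mult_assoc_dim)
    then have "(c * (W * b)) * - Z4 = 1\<^sub>m (p * n)" unfolding e2 .
    then show "invertible_mat (c * (W * b))"
      using zc by (intro stably_finite_invertible[OF stably_finite_field V, of "- Z4"]) auto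
  qed
qed

text \<open>A linearization is known to be invertible on the domain of its expression, but this is
  one implication only. Word points around a point of the domain must be shown to stay inside it,
  which calls for a pencil with exactly this regular set.\<close>

definition domain_pencil :: "('d::finite, 'k::field) pencil \<Rightarrow> ('d, 'k) mat_expr \<Rightarrow> bool" where
  "domain_pencil D e \<longleftrightarrow> pen_wf 1 1 D \<and>
     (\<forall>n. \<forall>X\<in>tuples n. mx_defined (\<lambda>c. c) n X e \<longleftrightarrow> invertible_mat (pen_at (*) n D X))"

lemma domain_pencil_diag:
  assumes "domain_pencil D e" "pen_wf 1 1 F"
    "\<And>n X. X \<in> tuples n \<Longrightarrow> mx_defined (\<lambda>c. c) n X e \<Longrightarrow> mx_defined (\<lambda>c. c) n X f \<longleftrightarrow> invertible_mat (pen_at (*) n F X)"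
    "\<And>n X. mx_defined (\<lambda>c. c) n X f \<Longrightarrow> mx_defined (\<lambda>c. c) n X e"
  shows "domain_pencil (pen_diag D F) f"
proof -
  have D: "pen_wf 1 1 D" using assms(1) by (simp add: domain_pencil_def)
  have "pen_wf 1 1 (pen_diag D F)"
    using D assms(2) by (auto simp: pen_diag_def pen_wf_def)
  moreover have "mx_defined (\<lambda>c. c) n X f \<longleftrightarrow> invertible_mat (pen_at (*) n (pen_diag D F) X)" if X: "X \<in> tuples n" for n X
    using assms(1) X assms(3)[OF X] assms(4)[of n X] pen_diag_invertible_iff[OF D assms(2) X]
    unfolding domain_pencil_def by blast
  ultimately show ?thesis unfolding domain_pencil_def by blast
qed

lemma domain_pencil_binary:
  assumes "domain_pencil D e" "domain_pencil F f"
    "\<And>n X. mx_defined (\<lambda>c. c) n X g \<longleftrightarrow> mx_defined (\<lambda>c. c) n X e \<and> mx_defined (\<lambda>c. c) n X f"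
  shows "domain_pencil (pen_diag D F) g"
  by (rule domain_pencil_diag[OF assms(1)]) (use assms(2,3) in \<open>auto simp: domain_pencil_def\<close>)

lemma domain_pencil_empty:
  assumes "\<And>n X. mx_defined (\<lambda>c. c) n X (e :: ('d::finite, 'k::field) mat_expr)"
  shows "\<exists>D. domain_pencil D e"
proof -
  \<comment> \<open>The pencil of size 0 is invertible everywhere and so describes an unrestricted
    domain.\<close>
  define D :: "('d, 'k) pencil" where "D = \<lparr>pen_N = 0, pen_M = \<lambda>_. 0\<^sub>m 0 0, pen_c = 0\<^sub>m 1 0, pen_b = 0\<^sub>m 0 1\<rparr>"
  have "invertible_mat (pen_at (*) n D X)" for n and X :: "'d \<Rightarrow> 'k mat"
  proof -
    have c: "pen_at (*) n D X \<in> carrier_mat 0 0" using pform_carrier[of "(*)" n "pen_N D" "pen_N D" "pen_M D" X] by (simp add: D_def)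
    show ?thesis by (rule invertible_matI[OF c, of "0\<^sub>m 0 0"]) (use c in \<open>auto intro!: eq_matI\<close>)
  qed
  moreover have "pen_wf 1 1 D" by (simp add: D_def pen_wf_def)
  ultimately show ?thesis using assms unfolding domain_pencil_def by blast
qed

text \<open>Only inversions restrict a domain. Where e is defined, the bordered pencil of its
  linearization is singular exactly where the value of e is; its row and column are reset to zero
  because only invertibility counts.\<close>

lemma domain_pencil_exists:
  fixes e :: "('d::finite, 'k::field) mat_expr"
  shows "has_size e p q \<Longrightarrow> \<exists>D. domain_pencil D e"
proof (induction rule: has_size.induct)
  case (5 e p)
  then obtain D where D: "domain_pencil D e" by blast
  obtain P where P: "pen_wf p p P" "unital_algebra.linearizes (*) P e"
    using has_linearization[OF unital_algebra_field 5(1)] by blast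
  define F where "F = pen_inv p P\<lparr>pen_c := 0\<^sub>m 1 (pen_N P + p), pen_b := 0\<^sub>m (pen_N P + p) 1\<rparr>"
  have F: "pen_N F = pen_N (pen_inv p P)" "pen_M F = pen_M (pen_inv p P)" by (simp_all add: F_def pen_inv_def)
  have "domain_pencil (pen_diag D F) (MInv e)"
  proof (rule domain_pencil_diag[OF D])
    show "pen_wf 1 1 F" using pen_wf_ops(5)[OF P(1)] by (auto simp: F_def pen_wf_def pen_inv_def)
    fix n and X :: "'d \<Rightarrow> 'k mat" assume X: "X \<in> tuples n" and d: "mx_defined (\<lambda>c. c) n X e"
    have "invertible_mat (pen_at (*) n P X)" "pen_val (*) n P X = mx_eval (\<lambda>c. c) n X e"
      using P(2) X d unfolding unital_algebra.linearizes_def[OF unital_algebra_field] by auto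
    then show "mx_defined (\<lambda>c. c) n X (MInv e) \<longleftrightarrow> invertible_mat (pen_at (*) n F X)"
      using pen_inv_invertible_iff[OF P(1) X] d by (simp add: F)
  qed simp
  then show ?case by blast
next
  case (1 c)
  show ?case by (rule domain_pencil_empty) simp
next
  case (2 k)
  show ?case by (rule domain_pencil_empty) simp
next
  case (3 e p q f)
  then show ?case using domain_pencil_binary[where g = "MAdd e f"] by fastforce
next
  case (4 e p q f r)
  then show ?case using domain_pencil_binary[where g = "MMul e f"] by fastforce
next
  case (6 e p q f r)
  then show ?case using domain_pencil_binary[where g = "MRow e f"] by fastforce
next
  case (7 e p q f r)
  then show ?case using domain_pencil_binary[where g = "MCol e f"] by fastforce
qed

subsection \<open>Polynomials in a matrix\<close>

definition mpoly :: "nat \<Rightarrow> 'k::field mat \<Rightarrow> 'k poly \<Rightarrow> 'k mat" where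
  "mpoly n T p = fold_coeffs (\<lambda>a M. a \<cdot>\<^sub>m 1\<^sub>m n + T * M) p (0\<^sub>m n n)"

lemma mpoly_0 [simp]: "mpoly n T 0 = 0\<^sub>m n n"
  by (simp add: mpoly_def)

lemma mpoly_pCons: "T \<in> carrier_mat n n \<Longrightarrow> mpoly n T (pCons a p) = a \<cdot>\<^sub>m 1\<^sub>m n + T * mpoly n T p"
  by (cases "a = 0 \<and> p = 0") (auto simp: mpoly_def mult_zero_dim)

lemma mpoly_carrier: "T \<in> carrier_mat n n \<Longrightarrow> mpoly n T p \<in> carrier_mat n n"
  by (induction p) (auto simp: mpoly_pCons)

lemma mpoly_add:
  assumes T: "T \<in> carrier_mat n n"
  shows "mpoly n T (p + q) = mpoly n T p + mpoly n T q"
proof (induction p arbitrary: q)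
  case 0
  then show ?case using mpoly_carrier[OF T, of q] by simp
next
  case (pCons a p)
  obtain b q' where q: "q = pCons b q'" by (cases q)
  show ?case
    unfolding q add_pCons mpoly_pCons[OF T] pCons(2)[of q']
    using T mpoly_carrier[OF T, of p] mpoly_carrier[OF T, of q']
    by (intro eq_matI) (auto simp: mult_add_dim distrib_right simp del: index_mult_mat(1))
qed

lemma mpoly_smult:
  assumes T: "T \<in> carrier_mat n n"
  shows "mpoly n T (smult c p) = c \<cdot>\<^sub>m mpoly n T p"
proof (induction p)
  case (pCons a p)
  show ?case
    unfolding smult_pCons mpoly_pCons[OF T] pCons(2) mult_smult_distrib[OF T mpoly_carrier[OF T]]
    using T mpoly_carrier[OF T, of p] by (intro eq_matI) (auto simp: distrib_left simp del: index_mult_mat(1))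
qed simp

lemma mpoly_mult:
  assumes T: "T \<in> carrier_mat n n"
  shows "mpoly n T (p * q) = mpoly n T p * mpoly n T q"
proof (induction p)
  case 0
  then show ?case using mpoly_carrier[OF T, of q] by (simp add: zero_mult_dim)
next
  case (pCons a p)
  note c = mpoly_carrier[OF T, of p] mpoly_carrier[OF T, of q] T
  have z: "0 \<cdot>\<^sub>m 1\<^sub>m n + T * (mpoly n T p * mpoly n T q) = T * (mpoly n T p * mpoly n T q)"
    using c by (intro eq_matI) (auto simp del: index_mult_mat(1))
  have "mpoly n T (pCons a p * q) = a \<cdot>\<^sub>m mpoly n T q + T * (mpoly n T p * mpoly n T q)"
    unfolding mult_pCons_left mpoly_add[OF T] mpoly_smult[OF T] mpoly_pCons[OF T] pCons(2) z ..
  also have "a \<cdot>\<^sub>m mpoly n T q = (a \<cdot>\<^sub>m 1\<^sub>m n) * mpoly n T q"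
    using c by (simp add: mult_smult_assoc_mat[of _ n n _ n] one_mult_dim)
  finally show ?case unfolding mpoly_pCons[OF T] using c by (simp add: add_mult_dim mult_assoc_dim)
qed

lemma mpoly_sum:
  assumes T: "T \<in> carrier_mat n n"
  shows "mpoly n T (\<Sum>i\<in>F. p i) = matsum F n n (\<lambda>i. mpoly n T (p i))"
proof (induction F rule: infinite_finite_induct)
  case (insert i F)
  then show ?case
    using mpoly_carrier[OF T, of "p i"] by (simp add: mpoly_add[OF T]) (intro eq_matI, auto)
qed (auto simp: matsum_def intro!: eq_matI)

text \<open>
  Substituting \<open>T\<close> for the indeterminate in a matrix of polynomials is multiplicative; applied to the
  adjugate of \<open>P\<^sub>0 + t P\<^sub>1\<close> it inverts \<open>P\<^sub>0 \<otimes> 1 + P\<^sub>1 \<otimes> T\<close> whenever \<open>T\<close> is not a root of the determinant.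
\<close>

definition subst_mat :: "nat \<Rightarrow> 'k::field mat \<Rightarrow> 'k poly mat \<Rightarrow> 'k mat" where
  "subst_mat n T A = bmat (dim_row A) (dim_col A) n n (\<lambda>i j. mpoly n T (A $$ (i, j)))"

definition pencil_poly :: "'k::field mat \<Rightarrow> 'k mat \<Rightarrow> 'k poly mat" where
  "pencil_poly P0 P1 = mat (dim_row P0) (dim_col P0) (\<lambda>ij. [:P0 $$ ij, P1 $$ ij:])"

lemma subst_mat_mult:
  assumes T: "T \<in> carrier_mat n n" and AB: "A \<in> carrier_mat p q" "B \<in> carrier_mat q r"
  shows "subst_mat n T (A * B) = subst_mat n T A * subst_mat n T B"
proof -
  have "subst_mat n T A * subst_mat n T B =
      bmat p r n n (\<lambda>i k. matsum {..<q} n n (\<lambda>j. mpoly n T (A $$ (i, j)) * mpoly n T (B $$ (j, k))))"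
    unfolding subst_mat_def carrier_matD[OF AB(1)] carrier_matD[OF AB(2)]
    by (rule bmat_mult) (rule mpoly_carrier[OF T])+
  also have "\<dots> = bmat p r n n (\<lambda>i k. mpoly n T ((A * B) $$ (i, k)))"
    by (rule bmat_cong) (use AB in \<open>simp add: scalar_prod_def atLeast0LessThan mpoly_sum[OF T] mpoly_mult[OF T]\<close>)
  finally show ?thesis using AB by (simp add: subst_mat_def)
qed

lemma subst_mat_pencil_poly:
  assumes T: "T \<in> carrier_mat n n" and P: "P0 \<in> carrier_mat d d" "P1 \<in> carrier_mat d d"
  shows "subst_mat n T (pencil_poly P0 P1) = kron P0 (1\<^sub>m n) + kron P1 T" (is "?l = ?r")
proof (rule bmat_eqI[of _ d n d n])
  fix i a j b assume *: "i < d" "a < n" "j < d" "b < n"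
  then have l: "i * n + a < d * n" "j * n + b < d * n" using block_index_less by blast+
  have "mpoly n T [:P0 $$ (i, j), P1 $$ (i, j):] = P0 $$ (i, j) \<cdot>\<^sub>m 1\<^sub>m n + P1 $$ (i, j) \<cdot>\<^sub>m T"
    using T by (simp add: mpoly_pCons mult_smult_distrib[of _ n n _ n] mult_zero_dim mult_one_dim)
  then show "?l $$ (i * n + a, j * n + b) = ?r $$ (i * n + a, j * n + b)"
    using * l P T unfolding subst_mat_def
    by (simp add: pencil_poly_def bmat_index kron_index[of _ d d _ n n])
qed (use P T in \<open>auto simp: subst_mat_def pencil_poly_def\<close>)

lemma subst_mat_smult_one:
  assumes T: "T \<in> carrier_mat n n"
  shows "subst_mat n T (p \<cdot>\<^sub>m 1\<^sub>m d) = kron (1\<^sub>m d) (mpoly n T p)" (is "?l = ?r")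
proof (rule bmat_eqI[of _ d n d n])
  fix i a j b assume *: "i < d" "a < n" "j < d" "b < n"
  then show "?l $$ (i * n + a, j * n + b) = ?r $$ (i * n + a, j * n + b)"
    using mpoly_carrier[OF T] by (auto simp: subst_mat_def bmat_index kron_index[of _ d d _ n n])
qed (use mpoly_carrier[OF T] in \<open>auto simp: subst_mat_def\<close>)

lemma pencil_poly_adjugate:
  assumes T: "T \<in> carrier_mat n n" and P: "P0 \<in> carrier_mat d d" "P1 \<in> carrier_mat d d"
  obtains R where "R \<in> carrier_mat (d * n) (d * n)"
    "(kron P0 (1\<^sub>m n) + kron P1 T) * R = kron (1\<^sub>m d) (mpoly n T (det (pencil_poly P0 P1)))"
proof -
  have A: "pencil_poly P0 P1 \<in> carrier_mat d d" using P by (simp add: pencil_poly_def)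
  note adj = adj_mat[OF A]
  show ?thesis
  proof (rule that)
    show "subst_mat n T (adj_mat (pencil_poly P0 P1)) \<in> carrier_mat (d * n) (d * n)"
      using adj(1) by (simp add: subst_mat_def)
    show "(kron P0 (1\<^sub>m n) + kron P1 T) * subst_mat n T (adj_mat (pencil_poly P0 P1)) = kron (1\<^sub>m d) (mpoly n T (det (pencil_poly P0 P1)))"
      unfolding subst_mat_pencil_poly[OF T P, symmetric] subst_mat_mult[OF T A adj(1), symmetric] adj(2) subst_mat_smult_one[OF T] ..
  qed
qed

lemma poly_det_pencil_poly:
  assumes P: "P0 \<in> carrier_mat d d" "P1 \<in> carrier_mat d d"
  shows "poly (det (pencil_poly P0 P1)) t = det (P0 + t \<cdot>\<^sub>m P1)"
proof -
  interpret comm_ring_hom "\<lambda>p. poly p t" by unfold_locales auto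
  have "map_mat (\<lambda>p. poly p t) (pencil_poly P0 P1) = P0 + t \<cdot>\<^sub>m P1"
    using P by (intro eq_matI) (auto simp: pencil_poly_def)
  then show ?thesis using hom_det[of "pencil_poly P0 P1"] by simp
qed

text \<open>Over a finite field a nonzero q may vanish at every scalar, but some matrix T has q(T)
  invertible: take T annihilated by p = 1 + t q, so that T q(T) = -1.\<close>

lemma annihilated_matrix_exists:
  fixes q :: "'k::field poly"
  assumes "q \<noteq> 0"
  obtains n T where "n > 0" "T \<in> carrier_mat n n" "T * mpoly n T q = - 1\<^sub>m n"
proof -
  define n where "n = Suc (degree q)"
  define p where "p = pCons 1 q"
  \<comment> \<open>The companion matrix of p, whose degree is \<open>degree q + 1 = n\<close> and
    whose leading coefficient is that of q.\<close>
  define T where "T = mat n n (\<lambda>(i, j). if j = degree q then - coeff p i / lead_coeff q else if i = Suc j then 1 else 0)"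
  have T: "T \<in> carrier_mat n n" by (simp add: T_def)
  define e where "e = (unit_col n 0 :: 'k mat)"
  have ec: "e \<in> carrier_mat n 1" unfolding e_def by (rule unit_col_carrier)
  \<comment> \<open>Below degree n, applying a polynomial in T to the first unit column returns its
    coefficient vector.\<close>
  have low: "(mpoly n T r * e) $$ (i, 0) = coeff r i" if "r = 0 \<or> degree r < n" "i < n" for r i
    using that
  proof (induction r arbitrary: i)
    case 0
    then show ?case using ec by (simp add: zero_mult_dim)
  next
    case (pCons a r)
    note c = mpoly_carrier[OF T, of r]
    have deg: "r = 0 \<or> degree r < degree q" using pCons by (cases "r = 0") (auto simp: n_def)
    then have IH: "(mpoly n T r * e) $$ (j, 0) = coeff r j" if "j < n" for j
      using pCons(2)[of j] that by (auto simp: n_def)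
    have "mpoly n T (pCons a r) * e = a \<cdot>\<^sub>m e + T * (mpoly n T r * e)"
      unfolding mpoly_pCons[OF T] using c T ec
      by (simp add: add_mult_dim mult_assoc_dim mult_smult_assoc_mat[of _ n n _ 1] one_mult_dim)
    moreover have "(T * (mpoly n T r * e)) $$ (i, 0) = (\<Sum>j<n. T $$ (i, j) * coeff r j)"
      using T c ec \<open>i < n\<close> IH by (simp add: scalar_prod_def atLeast0LessThan del: index_mult_mat(1)) (simp add: scalar_prod_def atLeast0LessThan)
    moreover have "(\<Sum>j<n. T $$ (i, j) * coeff r j) = (\<Sum>j<n. if i = Suc j then coeff r j else 0)"
    proof (rule sum.cong[OF refl])
      fix j assume "j \<in> {..<n}"
      moreover have "coeff r (degree q) = 0" using deg by (auto simp: coeff_eq_0)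
      ultimately show "T $$ (i, j) * coeff r j = (if i = Suc j then coeff r j else 0)"
        using \<open>i < n\<close> by (auto simp: T_def n_def)
    qed
    moreover have "\<dots> = (case i of 0 \<Rightarrow> 0 | Suc j \<Rightarrow> coeff r j)"
      using \<open>i < n\<close> by (cases i) auto
    ultimately show ?case
      using T c ec \<open>i < n\<close> by (auto simp: e_def unit_col_def coeff_pCons split: nat.split simp del: index_mult_mat(1))
  qed
  have pe: "mpoly n T p * e = 0\<^sub>m n 1" (is "?l = ?r")
  proof (rule eq_matI)
    fix i j assume "i < dim_row ?r" "j < dim_col ?r"
    then have ij: "i < n" "j = 0" by auto
    note c = mpoly_carrier[OF T, of q]
    have "mpoly n T p * e = 1 \<cdot>\<^sub>m e + T * (mpoly n T q * e)"
      unfolding p_def mpoly_pCons[OF T] using c T ec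
      by (simp add: add_mult_dim mult_assoc_dim mult_smult_assoc_mat[of _ n n _ 1] one_mult_dim)
    moreover have "(T * (mpoly n T q * e)) $$ (i, 0) = (\<Sum>j<n. T $$ (i, j) * coeff q j)"
      using T c ec ij low[of q] by (simp add: scalar_prod_def atLeast0LessThan n_def del: index_mult_mat(1)) (simp add: scalar_prod_def atLeast0LessThan)
    moreover have "(\<Sum>j<n. T $$ (i, j) * coeff q j) = (\<Sum>j<degree q. if i = Suc j then coeff q j else 0) - coeff p i"
    proof -
      have "(\<Sum>j<n. T $$ (i, j) * coeff q j) = (\<Sum>j<degree q. T $$ (i, j) * coeff q j) + T $$ (i, degree q) * lead_coeff q"
        by (simp add: n_def)
      moreover have "T $$ (i, degree q) * lead_coeff q = - coeff p i"
        using ij assms by (simp add: T_def n_def)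
      moreover have "(\<Sum>j<degree q. T $$ (i, j) * coeff q j) = (\<Sum>j<degree q. if i = Suc j then coeff q j else 0)"
        using ij by (intro sum.cong) (auto simp: T_def n_def)
      ultimately show ?thesis by simp
    qed
    moreover have "(\<Sum>j<degree q. if i = Suc j then coeff q j else 0) = (case i of 0 \<Rightarrow> 0 | Suc j \<Rightarrow> coeff q j)"
      using ij by (cases i) (auto simp: n_def)
    ultimately show "?l $$ (i, j) = ?r $$ (i, j)"
      using ij T c ec by (auto simp: e_def unit_col_def p_def coeff_pCons split: nat.split simp del: index_mult_mat(1))
  qed (use mpoly_carrier[OF T, of p] ec in auto)
  \<comment> \<open>The first unit column is cyclic: the j-th one is its image under T^j, which
    commutes with p(T), so p(T) kills every column.\<close>
  have "mpoly n T p = 0\<^sub>m n n" (is "_ = ?r")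
  proof (rule eq_matI)
    fix i j assume "i < dim_row ?r" "j < dim_col ?r"
    then have ij: "i < n" "j < n" by auto
    note c = mpoly_carrier[OF T, of p] mpoly_carrier[OF T, of "monom 1 j"]
    have mj: "mpoly n T (monom 1 j) * e = unit_col n j"
    proof (rule eq_matI)
      fix l h assume "l < dim_row (unit_col n j :: 'k mat)" "h < dim_col (unit_col n j :: 'k mat)"
      then show "(mpoly n T (monom 1 j) * e) $$ (l, h) = unit_col n j $$ (l, h)"
        using low[of "monom 1 j" l] ij by (auto simp: degree_monom_eq unit_col_def simp del: index_mult_mat(1))
    qed (use c ec in auto)
    have "mpoly n T p * unit_col n j = mpoly n T (p * monom 1 j) * e"
      unfolding mj[symmetric] mpoly_mult[OF T] using c ec by (simp add: mult_assoc_dim)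
    also have "\<dots> = mpoly n T (monom 1 j) * (mpoly n T p * e)"
      unfolding mult.commute[of p] mpoly_mult[OF T] using c ec by (simp add: mult_assoc_dim)
    finally have "(mpoly n T p * unit_col n j) $$ (i, 0) = 0" unfolding pe using c ij by (simp add: mult_zero_dim)
    moreover have "(mpoly n T p * unit_col n j) $$ (i, 0) = (\<Sum>l\<in>{0..<n}. mpoly n T p $$ (i, l) * (if l = j then 1 else 0))"
      using c ij by (simp add: scalar_prod_def unit_col_def)
    moreover have "\<dots> = (\<Sum>l\<in>{0..<n}. if l = j then mpoly n T p $$ (i, j) else 0)" by (rule sum.cong) auto
    ultimately show "mpoly n T p $$ (i, j) = ?r $$ (i, j)" using ij by simp
  qed (use mpoly_carrier[OF T] in auto)
  then have "1 \<cdot>\<^sub>m 1\<^sub>m n + T * mpoly n T q = 0\<^sub>m n n" by (simp add: p_def mpoly_pCons[OF T])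
  then have z: "T * mpoly n T q + 1 \<cdot>\<^sub>m 1\<^sub>m n = 0\<^sub>m n n"
    using T mpoly_carrier[OF T, of q] by (subst comm_add_mat[of _ n n]) auto
  have "T * mpoly n T q = 0\<^sub>m n n - 1 \<cdot>\<^sub>m 1\<^sub>m n"
    by (rule eq_minus_matI[OF z]) (use T mpoly_carrier[OF T, of q] in auto)
  also have "\<dots> = - 1\<^sub>m n" by (rule eq_matI) auto
  finally show ?thesis using that[of n T] T by (simp add: n_def)
qed

subsection \<open>Common points of two domains\<close>

text \<open>The tuple is the line X + t (Z - X) with the scalar t replaced by the matrix T. A pencil
  is affine, so evaluating it commutes with this substitution.\<close>

lemma pen_at_path:
  fixes X Z :: "'d::finite \<Rightarrow> 'k::field mat"
  assumes wf: "pen_wf p q P" and X: "X \<in> tuples n" and Z: "Z \<in> tuples n" and T: "T \<in> carrier_mat l l"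
  shows "pen_at (*) (n * l) P (\<lambda>k. kron (X k) (1\<^sub>m l) + kron (Z k - X k) T) =
    kron (pen_at (*) n P X) (1\<^sub>m l) + kron (pen_at (*) n P Z - pen_at (*) n P X) T"
proof -
  let ?N = "pen_N P"
  note M = pen_wfD(1)[OF wf]
  note eX = ext_tuple_carrier[OF X] and eZ = ext_tuple_carrier[OF Z]
  have "(\<lambda>k. kron (X k) (1\<^sub>m l) + kron (Z k - X k) T) \<in> tuples (n * l)"
    using X Z by (auto simp: tuples_def intro!: add_carrier_mat kron_carrier[OF minus_carrier_mat T])
  note e = ext_tuple_carrier[OF this]
  have ext: "ext_tuple (n * l) (\<lambda>k. kron (X k) (1\<^sub>m l) + kron (Z k - X k) T) \<kappa> =
      kron (ext_tuple n X \<kappa>) (1\<^sub>m l) + kron (ext_tuple n Z \<kappa> - ext_tuple n X \<kappa>) T" for \<kappa>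
  proof (cases \<kappa>)
    case None
    have "1\<^sub>m n - 1\<^sub>m n = (0\<^sub>m n n :: 'k mat)" by (rule eq_matI) auto
    then have "kron (1\<^sub>m n - 1\<^sub>m n) T = 0\<^sub>m (n * l) (n * l)" using T by (simp only: kron_zero_left carrier_matD)
    then show ?thesis unfolding None using T by simp
  qed simp
  show ?thesis
  proof (rule bmat_eqI[of _ "?N * n" l "?N * n" l])
    fix u a v b assume *: "u < ?N * n" "a < l" "v < ?N * n" "b < l"
    define I i where "I = u div n" and "i = u mod n"
    define J j where "J = v div n" and "j = v mod n"
    have u: "u = I * n + i" "I < ?N" "i < n" using * block_div_less by (simp_all add: I_def i_def)
    have v: "v = J * n + j" "J < ?N" "j < n" using * block_div_less by (simp_all add: J_def j_def)
    have l: "i * l + a < n * l" "j * l + b < n * l" "u * l + a < ?N * n * l" "v * l + b < ?N * n * l"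
      using * u v block_index_less by blast+
    have l': "I * (n * l) + (i * l + a) < ?N * (n * l)" "J * (n * l) + (j * l + b) < ?N * (n * l)"
      using l u v block_index_less by blast+
    have uv: "u * l + a = I * (n * l) + (i * l + a)" "v * l + b = J * (n * l) + (j * l + b)"
      unfolding u v by (simp_all add: algebra_simps)
    let ?\<delta> = "1\<^sub>m l $$ (a, b) :: 'k"
    have "pen_at (*) (n * l) P (\<lambda>k. kron (X k) (1\<^sub>m l) + kron (Z k - X k) T) $$ (u * l + a, v * l + b) =
      (\<Sum>\<kappa>\<in>UNIV. pen_M P \<kappa> $$ (I, J) * (ext_tuple n X \<kappa> $$ (i, j) * ?\<delta> +
        (ext_tuple n Z \<kappa> $$ (i, j) - ext_tuple n X \<kappa> $$ (i, j)) * T $$ (a, b)))"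
      unfolding uv pform_def scalar_mat_field matsum_index[OF l']
    proof (rule sum.cong[OF refl])
      fix \<kappa> :: "'d option"
      have "kron (ext_tuple n X \<kappa>) (1\<^sub>m l) $$ (i * l + a, j * l + b) = ext_tuple n X \<kappa> $$ (i, j) * ?\<delta>"
        using * u v eX by (intro kron_index) auto
      moreover have "kron (ext_tuple n Z \<kappa> - ext_tuple n X \<kappa>) T $$ (i * l + a, j * l + b) =
        (ext_tuple n Z \<kappa> $$ (i, j) - ext_tuple n X \<kappa> $$ (i, j)) * T $$ (a, b)"
        using * u v eX[of \<kappa>] eZ[of \<kappa>] T by (subst kron_index[of _ n n _ l l]) auto
      ultimately show "kron (pen_M P \<kappa>) (ext_tuple (n * l) (\<lambda>k. kron (X k) (1\<^sub>m l) + kron (Z k - X k) T) \<kappa>)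
          $$ (I * (n * l) + (i * l + a), J * (n * l) + (j * l + b)) =
        pen_M P \<kappa> $$ (I, J) * (ext_tuple n X \<kappa> $$ (i, j) * ?\<delta> +
          (ext_tuple n Z \<kappa> $$ (i, j) - ext_tuple n X \<kappa> $$ (i, j)) * T $$ (a, b))"
        using u v l M e eX[of \<kappa>] eZ[of \<kappa>] T
        by (subst kron_index[of _ ?N ?N _ "n * l" "n * l"]) (auto simp: ext)
    qed
    also have "\<dots> = pen_at (*) n P X $$ (u, v) * ?\<delta> + (pen_at (*) n P Z $$ (u, v) - pen_at (*) n P X $$ (u, v)) * T $$ (a, b)"
    proof -
      have "kron (pen_M P \<kappa>) (ext_tuple n F \<kappa>) $$ (u, v) = pen_M P \<kappa> $$ (I, J) * ext_tuple n F \<kappa> $$ (i, j)"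
        if "F \<in> tuples n" for F :: "'d \<Rightarrow> 'k mat" and \<kappa>
        unfolding u v using u v M ext_tuple_carrier[OF that] by (intro kron_index) auto
      then show ?thesis
        using * X Z by (simp add: pform_def sum_distrib_right sum_distrib_left sum_subtractf sum.distrib algebra_simps)
    qed
    also have "\<dots> = (kron (pen_at (*) n P X) (1\<^sub>m l) + kron (pen_at (*) n P Z - pen_at (*) n P X) T) $$ (u * l + a, v * l + b)"
      using * l T kron_index[of "pen_at (*) n P Z - pen_at (*) n P X", OF _ T *]
      by (simp add: minus_carrier_mat[OF pform_carrier] kron_index[of _ "?N * n" "?N * n" _ l l])
    finally show "pen_at (*) (n * l) P (\<lambda>k. kron (X k) (1\<^sub>m l) + kron (Z k - X k) T) $$ (u * l + a, v * l + b) =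
      (kron (pen_at (*) n P X) (1\<^sub>m l) + kron (pen_at (*) n P Z - pen_at (*) n P X) T) $$ (u * l + a, v * l + b)" .
  qed (use T in \<open>auto simp: mult.assoc\<close>)
qed

lemma path_invertible:
  fixes P0 P1 :: "'k::field mat"
  assumes P: "P0 \<in> carrier_mat d d" "P1 \<in> carrier_mat d d" and T: "T \<in> carrier_mat l l"
    and V: "V \<in> carrier_mat l l" "mpoly l T (det (pencil_poly P0 P1)) * V = 1\<^sub>m l"
  shows "invertible_mat (kron P0 (1\<^sub>m l) + kron P1 T)"
proof -
  obtain R where R: "R \<in> carrier_mat (d * l) (d * l)"
    "(kron P0 (1\<^sub>m l) + kron P1 T) * R = kron (1\<^sub>m d) (mpoly l T (det (pencil_poly P0 P1)))"
    by (rule pencil_poly_adjugate[OF T P])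
  have A: "kron P0 (1\<^sub>m l) + kron P1 T \<in> carrier_mat (d * l) (d * l)" using P T by auto
  have k: "kron (1\<^sub>m d) V \<in> carrier_mat (d * l) (d * l)" using V by auto
  have "(kron P0 (1\<^sub>m l) + kron P1 T) * (R * kron (1\<^sub>m d) V) = kron (1\<^sub>m d) (mpoly l T (det (pencil_poly P0 P1))) * kron (1\<^sub>m d) V"
    unfolding R(2)[symmetric] using A R(1) k by (intro mult_assoc_dim[symmetric]) auto
  also have "\<dots> = 1\<^sub>m (d * l)"
    using V mpoly_carrier[OF T] by (subst kron_mult) (auto simp: one_mult_dim)
  finally show ?thesis
    using R(1) k by (intro stably_finite_invertible[OF stably_finite_field A, of "R * kron (1\<^sub>m d) V"]) auto
qed

text \<open>Along the line from X to Z the determinants of P and Q are polynomials in t, nonzero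
  since they do not vanish at t = 0 and t = 1 respectively. A matrix T at which their product is
  invertible gives a common point.\<close>

theorem common_regular_point:
  fixes X Z :: "'d::finite \<Rightarrow> 'k::field mat"
  assumes P: "pen_wf p q P" "X \<in> tuples n" "n > 0" "invertible_mat (pen_at (*) n P X)"
    and Q: "pen_wf p' q' Q" "Z \<in> tuples l" "l > 0" "invertible_mat (pen_at (*) l Q Z)"
  obtains m U where "m > 0" "U \<in> tuples m" "invertible_mat (pen_at (*) m P U)" "invertible_mat (pen_at (*) m Q U)"
proof -
  interpret unital_algebra "(*) :: 'k \<Rightarrow> 'k \<Rightarrow> 'k" by (rule unital_algebra_field)
  \<comment> \<open>Repetition brings both points to the same size, as needed for a line between
    them.\<close>
  define X' Z' where "X' = inflate l X" and "Z' = inflate n Z"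
  have t: "X' \<in> tuples (n * l)" "Z' \<in> tuples (n * l)"
    using inflate_tuples[OF P(2), of l] inflate_tuples[OF Q(2), of n] by (simp_all add: X'_def Z'_def mult.commute)
  let ?n = "n * l"
  have iP: "invertible_mat (pen_at (*) ?n P X')"
    unfolding X'_def pen_at_inflate[OF P(1,2)] by (rule kron_one_invertible(1)[OF P(4) pform_carrier])
  have "invertible_mat (pen_at (*) (l * n) Q Z')"
    unfolding Z'_def pen_at_inflate[OF Q(1,2)] by (rule kron_one_invertible(1)[OF Q(4) pform_carrier])
  then have iQ: "invertible_mat (pen_at (*) ?n Q Z')" by (simp add: mult.commute)
  define \<delta> where "\<delta> R = det (pencil_poly (pen_at (*) ?n R X') (pen_at (*) ?n R Z' - pen_at (*) ?n R X'))" for R :: "('d, 'k) pencil"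
  have pc: "pen_at (*) ?n R Z' - pen_at (*) ?n R X' \<in> carrier_mat (pen_N R * ?n) (pen_N R * ?n)" for R :: "('d, 'k) pencil"
    by (intro minus_carrier_mat pform_carrier)
  have "poly (\<delta> P) 0 = det (pen_at (*) ?n P X')"
  proof -
    have "pen_at (*) ?n P X' + 0 \<cdot>\<^sub>m (pen_at (*) ?n P Z' - pen_at (*) ?n P X') = pen_at (*) ?n P X'"
      by (rule eq_matI) auto
    then show ?thesis unfolding \<delta>_def poly_det_pencil_poly[OF pform_carrier pc] by simp
  qed
  then have "\<delta> P \<noteq> 0" using iP invertible_mat_iff_det[OF pform_carrier] by fastforce
  moreover have "poly (\<delta> Q) 1 = det (pen_at (*) ?n Q Z')"
  proof -
    have "pen_at (*) ?n Q X' + 1 \<cdot>\<^sub>m (pen_at (*) ?n Q Z' - pen_at (*) ?n Q X') = pen_at (*) ?n Q Z'"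
      by (rule eq_matI) auto
    then show ?thesis unfolding \<delta>_def poly_det_pencil_poly[OF pform_carrier pc] by simp
  qed
  then have "\<delta> Q \<noteq> 0" using iQ invertible_mat_iff_det[OF pform_carrier] by fastforce
  ultimately have "\<delta> P * \<delta> Q \<noteq> 0" by simp
  then obtain m T where T: "m > 0" "T \<in> carrier_mat m m" "T * mpoly m T (\<delta> P * \<delta> Q) = - 1\<^sub>m m"
    by (rule annihilated_matrix_exists)
  note mc = mpoly_carrier[OF T(2)]
  have one: "mpoly m T (\<delta> P * \<delta> Q) * - T = 1\<^sub>m m"
  proof -
    have "(- T) * mpoly m T (\<delta> P * \<delta> Q) = 1\<^sub>m m"
      using T mc[of "\<delta> P * \<delta> Q"] by (simp add: uminus_mult_dim)
    then show ?thesis using T(2) mc by (intro mat_mult_left_right_inverse[of "- T"]) auto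
  qed
  have vP: "mpoly m T (\<delta> P) * (mpoly m T (\<delta> Q) * - T) = 1\<^sub>m m"
    using one T(2) mc[of "\<delta> P"] mc[of "\<delta> Q"] by (simp add: mpoly_mult[OF T(2)] mult_assoc_dim)
  have vQ: "mpoly m T (\<delta> Q) * (mpoly m T (\<delta> P) * - T) = 1\<^sub>m m"
    using one T(2) mc[of "\<delta> P"] mc[of "\<delta> Q"] unfolding mult.commute[of "\<delta> P"]
    by (simp add: mpoly_mult[OF T(2)] mult_assoc_dim)
  have vc: "mpoly m T d * - T \<in> carrier_mat m m" for d
    by (rule mult_carrier_mat[OF mc]) (use T(2) in simp)
  define U where "U k = kron (X' k) (1\<^sub>m m) + kron (Z' k - X' k) T" for k
  have "U \<in> tuples (?n * m)"
    using t by (auto simp: U_def tuples_def intro!: add_carrier_mat kron_carrier[OF minus_carrier_mat T(2)])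
  moreover have "invertible_mat (pen_at (*) (?n * m) P U)"
    unfolding U_def pen_at_path[OF P(1) t T(2)]
    by (rule path_invertible[OF pform_carrier pc T(2) _ vP[unfolded \<delta>_def]]) (rule vc)
  moreover have "invertible_mat (pen_at (*) (?n * m) Q U)"
    unfolding U_def pen_at_path[OF Q(1) t T(2)]
    by (rule path_invertible[OF pform_carrier pc T(2) _ vQ[unfolded \<delta>_def]]) (rule vc)
  ultimately show ?thesis using that[of "?n * m" U] P(3) Q(3) T(1) by simp
qed


subsection \<open>Rational expressions for the values of a pencil\<close>

text \<open>Cayley-Hamilton: \<delta> = det (A\<dots> transposed - t) annihilates A, and its
  constant coefficient det A is nonzero, so the relation \<delta>(A) = 0 can be solved for the
  inverse.\<close>

lemma polynomial_inverse:
  fixes A :: "'k::field mat"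
  assumes A: "A \<in> carrier_mat D D" and inv: "invertible_mat A"
  obtains p where "A * mpoly D A p = 1\<^sub>m D"
proof -
  define \<delta> where "\<delta> = det (pencil_poly A\<^sup>T (- 1\<^sub>m D))"
  have P: "A\<^sup>T \<in> carrier_mat D D" "- 1\<^sub>m D \<in> carrier_mat D D" using A by auto
  define K where "K = kron A\<^sup>T (1\<^sub>m D) + kron (- 1\<^sub>m D) A"
  have K: "K \<in> carrier_mat (D * D) (D * D)" using A P by (auto simp: K_def)
  obtain R where R: "R \<in> carrier_mat (D * D) (D * D)" "K * R = kron (1\<^sub>m D) (mpoly D A \<delta>)"
    using pencil_poly_adjugate[OF A P] unfolding K_def \<delta>_def by blast
  \<comment> \<open>The sum of the rows e_i \<otimes> e_i. It does not distinguish the transpose of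
    A in the left factor from A in the right one, hence kills \<open>K\<close>; and its product with
    1 \<otimes> B lists the entries of B.\<close>
  define v where "v = mat 1 (D * D) (\<lambda>(_, l). if l div D = l mod D then 1 else (0 :: 'k))"
  have v: "v \<in> carrier_mat 1 (D * D)" by (simp add: v_def)
  have trace: "(v * Z) $$ (0, w) = (\<Sum>i<D. Z $$ (i * D + i, w))" if "Z \<in> carrier_mat (D * D) (D * D)" "w < D * D" for Z w
  proof -
    have "(v * Z) $$ (0, w) = (\<Sum>l<D * D. (if l div D = l mod D then 1 else 0) * Z $$ (l, w))"
      using that by (simp add: v_def scalar_prod_def atLeast0LessThan)
    also have "\<dots> = (\<Sum>i<D. \<Sum>a<D. if a = i then Z $$ (i * D + i, w) else 0)"
      unfolding sum_lessThan_mult by (intro sum.cong refl) auto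
    finally show ?thesis by simp
  qed
  have vK: "v * K = 0\<^sub>m 1 (D * D)"
  proof (rule bmat_eqI[of _ 1 1 D D])
    fix h l j b assume *: "h < (1 :: nat)" "l < (1 :: nat)" "j < D" "b < D"
    then have w: "j * D + b < D * D" using block_index_less by blast
    have "K $$ (i * D + i, j * D + b) = (if i = b then A $$ (j, b) else 0) - (if i = j then A $$ (j, b) else 0)" if "i < D" for i
    proof -
      have "kron A\<^sup>T (1\<^sub>m D) $$ (i * D + i, j * D + b) = (if i = b then A $$ (j, b) else 0)"
        using kron_index[OF P(1) one_carrier_mat[of D] that that *(3,4)] A that * by auto
      moreover have "kron (- 1\<^sub>m D) A $$ (i * D + i, j * D + b) = - (if i = j then A $$ (j, b) else 0)"
        using kron_index[OF P(2) A that that *(3,4)] that * by auto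
      ultimately show ?thesis using w block_index_less[OF that that] A by (simp add: K_def)
    qed
    then have "(\<Sum>i<D. K $$ (i * D + i, j * D + b)) = 0" using * by (simp add: sum_subtractf)
    then show "(v * K) $$ (h * 1 + l, j * D + b) = 0\<^sub>m 1 (D * D) $$ (h * 1 + l, j * D + b)"
      using trace[OF K w] w * by simp
  qed (use v K in auto)
  have M: "mpoly D A \<delta> \<in> carrier_mat D D" by (rule mpoly_carrier[OF A])
  have "v * kron (1\<^sub>m D) (mpoly D A \<delta>) = (v * K) * R"
    unfolding R(2)[symmetric] using v K R(1) by (simp add: mult_assoc_dim)
  then have vM: "v * kron (1\<^sub>m D) (mpoly D A \<delta>) = 0\<^sub>m 1 (D * D)" unfolding vK using R(1) by (simp add: zero_mult_dim)
  have zero: "mpoly D A \<delta> = 0\<^sub>m D D" (is "?l = ?r")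
  proof (rule eq_matI)
    fix j b assume "j < dim_row ?r" "b < dim_col ?r"
    then have *: "j < D" "b < D" by auto
    then have w: "j * D + b < D * D" using block_index_less by blast
    have kc: "kron (1\<^sub>m D) (mpoly D A \<delta>) \<in> carrier_mat (D * D) (D * D)" using M by auto
    have "kron (1\<^sub>m D) ?l $$ (i * D + i, j * D + b) = (if i = j then mpoly D A \<delta> $$ (j, b) else 0)" if "i < D" for i
      using kron_index[OF one_carrier_mat[of D] M that that *] that * by auto
    then show "?l $$ (j, b) = ?r $$ (j, b)"
      using trace[OF kc w] * w unfolding vM by simp
  qed (use M in auto)
  \<comment> \<open>\<delta> = d + t p, so A p(A) = -d with d = det A.\<close>
  obtain d p where dp: "\<delta> = pCons d p" by (cases \<delta>)
  have "d = poly \<delta> 0" by (simp add: dp)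
  also have "\<dots> = det (A\<^sup>T + 0 \<cdot>\<^sub>m (- 1\<^sub>m D))" unfolding \<delta>_def by (rule poly_det_pencil_poly[OF P])
  also have "A\<^sup>T + 0 \<cdot>\<^sub>m (- 1\<^sub>m D) = A\<^sup>T" using A by (intro eq_matI) auto
  finally have d: "d \<noteq> 0" using inv A by (simp add: det_transpose invertible_mat_iff_det[OF A])
  note c = mpoly_carrier[OF A, of p]
  have "A * mpoly D A (smult (- (1 / d)) p) = (- (1 / d)) \<cdot>\<^sub>m (A * mpoly D A p)"
    unfolding mpoly_smult[OF A] by (rule mult_smult_distrib[OF A c])
  also have "\<dots> = 1\<^sub>m D"
  proof (rule eq_matI)
    fix i j assume "i < dim_row (1\<^sub>m D :: 'k mat)" "j < dim_col (1\<^sub>m D :: 'k mat)"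
    then have ij: "i < D" "j < D" by auto
    have "(d \<cdot>\<^sub>m 1\<^sub>m D + A * mpoly D A p) $$ (i, j) = 0" using zero ij unfolding dp mpoly_pCons[OF A] by simp
    then have "(A * mpoly D A p) $$ (i, j) = - (d * 1\<^sub>m D $$ (i, j))"
      using ij A c by (simp add: eq_neg_iff_add_eq_0 add.commute del: index_mult_mat(1))
    then show "((- (1 / d)) \<cdot>\<^sub>m (A * mpoly D A p)) $$ (i, j) = 1\<^sub>m D $$ (i, j)"
      using ij A c d by (simp del: index_mult_mat(1))
  qed (use A c in auto)
  finally show ?thesis by (rule that)
qed

section \<open>Matrices of rational expressions\<close>

lemma nc_eval_carrier: "X \<in> tuples n \<Longrightarrow> nc_defined n X e \<Longrightarrow> nc_eval n X e \<in> carrier_mat n n"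
  by (induction e) (auto simp: tuples_def minv_inverse(1))

primrec expr_sum :: "nat \<Rightarrow> (nat \<Rightarrow> ('d, 'k::field) nc_expr) \<Rightarrow> ('d, 'k) nc_expr" where
  "expr_sum 0 f = Const 0"
| "expr_sum (Suc N) f = Add (expr_sum N f) (f N)"

lemma nc_defined_expr_sum: "nc_defined n X (expr_sum N f) \<longleftrightarrow> (\<forall>i<N. nc_defined n X (f i))"
  by (induction N) (auto simp: less_Suc_eq)

lemma nc_eval_expr_sum:
  assumes "X \<in> tuples n" "\<And>i. i < N \<Longrightarrow> nc_defined n X (f i)"
  shows "nc_eval n X (expr_sum N f) = matsum {..<N} n n (\<lambda>i. nc_eval n X (f i))"
  using assms(2)
proof (induction N)
  case (Suc N)
  then have "nc_eval n X (f N) \<in> carrier_mat n n" using nc_eval_carrier[OF assms(1)] by blast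
  from matsum_lessThan_Suc[of "\<lambda>i. nc_eval n X (f i)" N n n, OF this] Suc show ?case by simp
qed (intro eq_matI, auto)

definition eval_mat :: "nat \<Rightarrow> ('d \<Rightarrow> 'k::field mat) \<Rightarrow> nat \<Rightarrow> nat \<Rightarrow> (nat \<Rightarrow> nat \<Rightarrow> ('d, 'k) nc_expr) \<Rightarrow> 'k mat" where
  "eval_mat n X p q E = bmat p q n n (\<lambda>i j. nc_eval n X (E i j))"

definition expr_mult :: "nat \<Rightarrow> (nat \<Rightarrow> nat \<Rightarrow> ('d, 'k::field) nc_expr) \<Rightarrow> (nat \<Rightarrow> nat \<Rightarrow> ('d, 'k) nc_expr) \<Rightarrow> nat \<Rightarrow> nat \<Rightarrow> ('d, 'k) nc_expr" where
  "expr_mult q E F i k = expr_sum q (\<lambda>j. Mul (E i j) (F j k))"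

definition everywhere_defined :: "(nat \<Rightarrow> nat \<Rightarrow> ('d, 'k::field) nc_expr) \<Rightarrow> bool" where
  "everywhere_defined E \<longleftrightarrow> (\<forall>n X i j. nc_defined n X (E i j))"

lemma everywhere_definedD: "everywhere_defined E \<Longrightarrow> nc_defined n X (E i j)"
  by (simp add: everywhere_defined_def)

lemma everywhere_defined_expr_mult:
  "everywhere_defined E \<Longrightarrow> everywhere_defined F \<Longrightarrow> everywhere_defined (expr_mult q E F)"
  by (simp add: everywhere_defined_def expr_mult_def nc_defined_expr_sum)

lemma eval_mat_carrier [simp]: "eval_mat n X p q E \<in> carrier_mat (p * n) (q * n)"
  by (simp add: eval_mat_def)

lemma eval_mat_expr_mult:
  assumes X: "X \<in> tuples n" and E: "everywhere_defined E" and F: "everywhere_defined F"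
  shows "eval_mat n X p r (expr_mult q E F) = eval_mat n X p q E * eval_mat n X q r F"
proof -
  note c = nc_eval_carrier[OF X everywhere_definedD[OF E]] nc_eval_carrier[OF X everywhere_definedD[OF F]]
  have "eval_mat n X p q E * eval_mat n X q r F =
      bmat p r n n (\<lambda>i k. matsum {..<q} n n (\<lambda>j. nc_eval n X (E i j) * nc_eval n X (F j k)))"
    unfolding eval_mat_def by (rule bmat_mult) (rule c)+
  also have "\<dots> = eval_mat n X p r (expr_mult q E F)"
    unfolding eval_mat_def expr_mult_def using E F
    by (intro bmat_cong) (simp add: nc_eval_expr_sum[OF X] everywhere_defined_def)
  finally show ?thesis ..
qed

lemma eval_mat_scalars:
  assumes "P \<in> carrier_mat p q"
  shows "eval_mat n X p q (\<lambda>i j. Const (P $$ (i, j))) = kron P (1\<^sub>m n)"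
  unfolding eval_mat_def kron_bmat using assms by simp

lemma pencil_expr_exists:
  fixes P :: "('d::finite, 'k::field) pencil"
  assumes wf: "pen_wf p q P"
  obtains E where "everywhere_defined E"
    "\<And>n X. X \<in> tuples n \<Longrightarrow> eval_mat n X (pen_N P) (pen_N P) E = pen_at (*) n P X"
proof -
  obtain f :: "nat \<Rightarrow> 'd option" where f: "bij_betw f {..<card (UNIV :: 'd option set)} UNIV"
    using ex_bij_betw_nat_finite[OF finite_UNIV] unfolding atLeast0LessThan by blast
  define x :: "'d option \<Rightarrow> ('d, 'k) nc_expr" where "x \<kappa> = (case \<kappa> of None \<Rightarrow> Const 1 | Some k \<Rightarrow> Var k)" for \<kappa>
  define E where "E i j = expr_sum (card (UNIV :: 'd option set)) (\<lambda>l. Mul (Const (pen_M P (f l) $$ (i, j))) (x (f l)))" for i j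
  have x: "nc_defined n X (x \<kappa>)" "nc_eval n X (x \<kappa>) = ext_tuple n X \<kappa>" for n X \<kappa>
    by (cases \<kappa>; auto simp: x_def intro!: eq_matI)+
  show ?thesis
  proof (rule that)
    show "everywhere_defined E" by (simp add: everywhere_defined_def E_def nc_defined_expr_sum x)
    fix n and X :: "'d \<Rightarrow> 'k mat" assume X: "X \<in> tuples n"
    note e = ext_tuple_carrier[OF X] and M = pen_wfD(1)[OF wf]
    show "eval_mat n X (pen_N P) (pen_N P) E = pen_at (*) n P X" (is "?l = ?r")
    proof (rule bmat_eqI[of _ "pen_N P" n "pen_N P" n])
      fix i a j b assume *: "i < pen_N P" "a < n" "j < pen_N P" "b < n"
      have "nc_eval n X (E i j) $$ (a, b) = (\<Sum>l<card (UNIV :: 'd option set). pen_M P (f l) $$ (i, j) * ext_tuple n X (f l) $$ (a, b))"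
        unfolding E_def using * e
        by (subst nc_eval_expr_sum[OF X]) (auto simp: x carrier_matD[OF e] mult_smult_assoc_mat[OF one_carrier_mat e] one_mult_dim simp del: index_mult_mat(1))
      also have "\<dots> = (\<Sum>\<kappa>\<in>UNIV. pen_M P \<kappa> $$ (i, j) * ext_tuple n X \<kappa> $$ (a, b))"
        by (rule sum.reindex_bij_betw[OF f, of "\<lambda>\<kappa>. pen_M P \<kappa> $$ (i, j) * ext_tuple n X \<kappa> $$ (a, b)"])
      also have "\<dots> = ?r $$ (i * n + a, j * n + b)"
        using * block_index_less[OF *(1,2)] block_index_less[OF *(3,4)]
        by (simp add: pform_def kron_index[OF M e])
      finally show "?l $$ (i * n + a, j * n + b) = ?r $$ (i * n + a, j * n + b)"
        unfolding eval_mat_def bmat_index[OF *] .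
    qed auto
  qed
qed

lemma mpoly_expr_exists:
  assumes E: "everywhere_defined (E :: nat \<Rightarrow> nat \<Rightarrow> ('d, 'k::field) nc_expr)"
  shows "\<exists>F. everywhere_defined F \<and> (\<forall>n. \<forall>X\<in>tuples n. eval_mat n X N N F = mpoly (N * n) (eval_mat n X N N E) p)"
proof (induction p)
  case 0
  have "eval_mat n X N N (\<lambda>i j. Const (0\<^sub>m N N $$ (i, j)) :: ('d, 'k) nc_expr) = 0\<^sub>m (N * n) (N * n)" for n X
    unfolding eval_mat_scalars[OF zero_carrier_mat] by (simp add: kron_zero_left)
  then show ?case
    by (intro exI[of _ "\<lambda>i j. Const (0\<^sub>m N N $$ (i, j))"]) (simp add: everywhere_defined_def)
next
  case (pCons a p)
  then obtain F where F: "everywhere_defined F" "\<And>n X. X \<in> tuples n \<Longrightarrow> eval_mat n X N N F = mpoly (N * n) (eval_mat n X N N E) p"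
    by blast
  define G where "G i j = Add (Const ((a \<cdot>\<^sub>m 1\<^sub>m N) $$ (i, j))) (expr_mult N E F i j)" for i j
  have EF: "everywhere_defined (expr_mult N E F)" by (rule everywhere_defined_expr_mult[OF E F(1)])
  have "eval_mat n X N N G = mpoly (N * n) (eval_mat n X N N E) (pCons a p)" if X: "X \<in> tuples n" for n X
  proof -
    have "eval_mat n X N N G = eval_mat n X N N (\<lambda>i j. Const ((a \<cdot>\<^sub>m 1\<^sub>m N) $$ (i, j))) + eval_mat n X N N (expr_mult N E F)" (is "?l = ?r")
    proof (rule bmat_eqI[of _ N n N n])
      fix i u j v assume *: "i < N" "u < n" "j < N" "v < n"
      note c = nc_eval_carrier[OF X everywhere_definedD[OF EF, of n X i j]]
      show "?l $$ (i * n + u, j * n + v) = ?r $$ (i * n + u, j * n + v)"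
        using * c block_index_less[OF *(1,2)] block_index_less[OF *(3,4)]
        by (simp add: eval_mat_def bmat_index[OF *] G_def)
    qed auto
    also have "eval_mat n X N N (\<lambda>i j. Const ((a \<cdot>\<^sub>m 1\<^sub>m N) $$ (i, j)) :: ('d, 'k) nc_expr) = a \<cdot>\<^sub>m 1\<^sub>m (N * n)"
    proof -
      have "kron (a \<cdot>\<^sub>m 1\<^sub>m N) (1\<^sub>m n) = a \<cdot>\<^sub>m kron (1\<^sub>m N) (1\<^sub>m n)"
        by (rule eq_matI) (auto simp: kron_def block_div_less)
      then show ?thesis by (subst eval_mat_scalars) (auto simp: kron_one)
    qed
    finally show ?thesis
      unfolding eval_mat_expr_mult[OF X E F(1)] F(2)[OF X] mpoly_pCons[OF eval_mat_carrier] .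
  qed
  moreover have "everywhere_defined G" using EF by (simp add: everywhere_defined_def G_def)
  ultimately show ?case by blast
qed

text \<open>
  The value \<open>d + c U\<^sup>-\<^sup>1 b\<close> of a bordered system, characterized through the solutions of \<open>U y = b t\<close>:
  \<open>t = 1\<close> gives the value and \<open>t = 0\<close> the injectivity of \<open>U\<close>.
\<close>

definition eliminates where
  "eliminates g (N :: nat) U c b d \<longleftrightarrow> (\<forall>n X. X \<in> tuples n \<longrightarrow> nc_defined n X (g :: ('d, 'k::field) nc_expr) \<longrightarrow>
     (\<forall>i<N. \<forall>j<N. nc_defined n X (U i j)) \<and> (\<forall>i<N. nc_defined n X (c i) \<and> nc_defined n X (b i)) \<and> nc_defined n X d \<and>
     (\<forall>q t y. t \<in> carrier_mat n q \<longrightarrow> (\<forall>j<N. y j \<in> carrier_mat n q) \<longrightarrow>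
       (\<forall>i<N. matsum {..<N} n q (\<lambda>j. nc_eval n X (U i j) * y j) = nc_eval n X (b i) * t) \<longrightarrow>
       nc_eval n X g * t = nc_eval n X d * t + matsum {..<N} n q (\<lambda>j. nc_eval n X (c j) * y j) \<and>
       (t = 0\<^sub>m n q \<longrightarrow> (\<forall>j<N. y j = 0\<^sub>m n q))))"

text \<open>The Schur complement x - y u^-1 z; expressions have no subtraction, hence the factor
  -1.\<close>

definition expr_schur :: "('d, 'k::field) nc_expr \<Rightarrow> ('d, 'k) nc_expr \<Rightarrow> ('d, 'k) nc_expr \<Rightarrow> ('d, 'k) nc_expr \<Rightarrow> ('d, 'k) nc_expr" where
  "expr_schur u x y z = Add x (Mul (Const (- 1)) (Mul (Mul y (Inv u)) z))"

lemma nc_defined_expr_schur [simp]: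
  "nc_defined n X (expr_schur u x y z) \<longleftrightarrow>
     nc_defined n X x \<and> nc_defined n X y \<and> nc_defined n X z \<and> nc_defined n X u \<and> invertible_mat (nc_eval n X u)"
  by (auto simp: expr_schur_def)

lemma nc_eval_expr_schur:
  assumes "X \<in> tuples n" "nc_defined n X (expr_schur u x y z)"
  shows "nc_eval n X (expr_schur u x y z) = nc_eval n X x - nc_eval n X y * minv (nc_eval n X u) * nc_eval n X z"
proof -
  have d: "nc_defined n X x" "nc_defined n X y" "nc_defined n X z" "nc_defined n X u" "invertible_mat (nc_eval n X u)"
    using assms(2) by auto
  note c = d(1-4)[THEN nc_eval_carrier[OF assms(1)]]
  have k: "nc_eval n X y * minv (nc_eval n X u) * nc_eval n X z \<in> carrier_mat n n"
    by (intro mult_carrier_mat[of _ n n _ n] c minv_inverse(1)[OF d(5)])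
  show ?thesis
    unfolding expr_schur_def nc_eval.simps mult_smult_assoc_mat[OF one_carrier_mat k]
    using c(1) k by (intro eq_matI) (auto simp: one_mult_dim simp del: index_mult_mat(1))
qed

lemma matsum_diff:
  fixes F G :: "'i \<Rightarrow> 'a::ab_group_add mat"
  assumes "\<And>i. i \<in> I \<Longrightarrow> F i \<in> carrier_mat p q" "\<And>i. i \<in> I \<Longrightarrow> G i \<in> carrier_mat p q"
  shows "matsum I p q (\<lambda>i. F i - G i) = matsum I p q F - matsum I p q G" (is "?l = ?r")
proof (rule eq_matI)
  fix a b assume "a < dim_row ?r" "b < dim_col ?r"
  then have ab: "a < p" "b < q" by auto
  have "(F i - G i) $$ (a, b) = F i $$ (a, b) - G i $$ (a, b)" if "i \<in> I" for i
    using assms(2)[OF that] ab by auto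
  then show "?l $$ (a, b) = ?r $$ (a, b)"
    using ab by (simp add: sum_subtractf)
qed auto

text \<open>The last equation is solved for the last unknown \<open>y\<close>, which is then
  substituted into another equation (second claim) and into the output (third claim).\<close>

lemma elimination_step:
  fixes u V S y b t :: "'k::field mat"
  assumes "V * u = 1\<^sub>m n" "u \<in> carrier_mat n n" "V \<in> carrier_mat n n" "S \<in> carrier_mat n q" "y \<in> carrier_mat n q"
    and "b \<in> carrier_mat n n" "t \<in> carrier_mat n q" and e: "S + u * y = b * t"
    and a: "a \<in> carrier_mat n n" and Sa: "Sa \<in> carrier_mat n q"
  shows "y = V * (b * t - S)"
    and "ba \<in> carrier_mat n n \<Longrightarrow> Sa + a * y = ba * t \<Longrightarrow> Sa - (a * V) * S = (ba - (a * V) * b) * t"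
    and "d \<in> carrier_mat n n \<Longrightarrow> (d + (a * V) * b) * t + (Sa - (a * V) * S) = d * t + (Sa + a * y)"
proof -
  have "u * y = b * t - S"
    unfolding e[symmetric] using assms(2-7) by (intro eq_matI) (auto simp del: index_mult_mat(1))
  then have "V * (u * y) = V * (b * t - S)" by (rule arg_cong)
  then show y: "y = V * (b * t - S)" using assms(1-7) by (simp add: mult_assoc_dim[symmetric] one_mult_dim)
  have ay: "a * y = (a * V) * (b * t) - (a * V) * S"
    unfolding y using assms(2-9) by (simp add: mult_assoc_dim mult_minus_dim)
  note c = assms(2-7) a Sa
  { assume ba: "ba \<in> carrier_mat n n" and eq: "Sa + a * y = ba * t"
    have "(ba - (a * V) * b) * t = ba * t - (a * V) * (b * t)" using c ba by (simp add: minus_mult_dim mult_assoc_dim)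
    also have "\<dots> = Sa - (a * V) * S" unfolding eq[symmetric] ay using c by (intro eq_matI) (auto simp del: index_mult_mat(1))
    finally show "Sa - (a * V) * S = (ba - (a * V) * b) * t" ..
  }
  { assume d: "d \<in> carrier_mat n n"
    have "(d + (a * V) * b) * t = d * t + (a * V) * (b * t)" using c d by (simp add: add_mult_dim mult_assoc_dim)
    then show "(d + (a * V) * b) * t + (Sa - (a * V) * S) = d * t + (Sa + a * y)"
      unfolding ay using c d by (intro eq_matI) (auto simp del: index_mult_mat(1))
  }
qed

text \<open>Gaussian elimination with the last diagonal entry as pivot: all other data are replaced
  by Schur complements, and \<open>d\<close> takes up the contribution of the pivot. The pivot is
  inverted within \<open>d\<close>, so wherever \<open>g\<close> is defined the pivot is
  invertible.\<close>

lemma eliminates_Suc: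
  assumes g: "eliminates g N (\<lambda>i j. expr_schur (U N N) (U i j) (U i N) (U N j))
      (\<lambda>j. expr_schur (U N N) (c j) (c N) (U N j)) (\<lambda>i. expr_schur (U N N) (b i) (U i N) (b N))
      (Add d (Mul (Mul (c N) (Inv (U N N))) (b N)))"
  shows "eliminates g (Suc N) U c b (d :: ('d, 'k::field) nc_expr)"
  unfolding eliminates_def
proof (intro allI impI)
  fix n and X :: "'d \<Rightarrow> 'k mat" assume X: "X \<in> tuples n" and dg: "nc_defined n X g"
  note * = g[unfolded eliminates_def, rule_format, OF X dg]
  let ?e = "nc_eval n X"
  have dd: "nc_defined n X d" "nc_defined n X (c N)" "nc_defined n X (b N)" "nc_defined n X (U N N)" "invertible_mat (?e (U N N))"
    using * by auto
  have def: "nc_defined n X (U i j)" "nc_defined n X (c i)" "nc_defined n X (b i)" if "i < Suc N" "j < Suc N" for i j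
    using that * dd unfolding less_Suc_eq by auto
  have U: "?e (U i j) \<in> carrier_mat n n" if "i < Suc N" "j < Suc N" for i j by (rule nc_eval_carrier[OF X def(1)[OF that]])
  have c: "?e (c i) \<in> carrier_mat n n" if "i < Suc N" for i by (rule nc_eval_carrier[OF X def(2)[OF that that]])
  have b: "?e (b i) \<in> carrier_mat n n" if "i < Suc N" for i by (rule nc_eval_carrier[OF X def(3)[OF that that]])
  have d: "?e d \<in> carrier_mat n n" by (rule nc_eval_carrier[OF X dd(1)])
  define V where "V = minv (?e (U N N))"
  note V = minv_inverse[OF dd(5) U[OF lessI lessI], folded V_def]
  have main: "?e g * t = ?e d * t + matsum {..<Suc N} n q (\<lambda>j. ?e (c j) * y j) \<and> (t = 0\<^sub>m n q \<longrightarrow> (\<forall>j<Suc N. y j = 0\<^sub>m n q))"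
    if t: "t \<in> carrier_mat n q" and y: "\<And>j. j < Suc N \<Longrightarrow> y j \<in> carrier_mat n q"
      and eq: "\<And>i. i < Suc N \<Longrightarrow> matsum {..<Suc N} n q (\<lambda>j. ?e (U i j) * y j) = ?e (b i) * t" for q t y
  proof -
    define S where "S i = matsum {..<N} n q (\<lambda>j. ?e (U i j) * y j)" for i
    define Sc where "Sc = matsum {..<N} n q (\<lambda>j. ?e (c j) * y j)"
    have Sc1: "S i \<in> carrier_mat n q" "Sc \<in> carrier_mat n q" for i by (simp_all add: S_def Sc_def)
    have split: "matsum {..<Suc N} n q (\<lambda>j. ?e (U i j) * y j) = S i + ?e (U i N) * y N" if "i < Suc N" for i
      unfolding S_def using U[OF that lessI] y[OF lessI] by (intro matsum_lessThan_Suc) auto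
    have splitc: "matsum {..<Suc N} n q (\<lambda>j. ?e (c j) * y j) = Sc + ?e (c N) * y N"
      unfolding Sc_def using c[OF lessI] y[OF lessI] by (intro matsum_lessThan_Suc) auto
    note step = elimination_step[OF V(3) U[OF lessI lessI] V(1) Sc1(1) y[OF lessI] b[OF lessI] t eq[OF lessI, unfolded split[OF lessI]]]
    have schur: "matsum {..<N} n q (\<lambda>j. (?e (x j) - (a * V) * ?e (U N j)) * y j) =
        matsum {..<N} n q (\<lambda>j. ?e (x j) * y j) - (a * V) * S N"
      if a: "a \<in> carrier_mat n n" and x: "\<And>j. j < N \<Longrightarrow> ?e (x j) \<in> carrier_mat n n" for a x
    proof -
      have "(?e (x j) - (a * V) * ?e (U N j)) * y j = ?e (x j) * y j - (a * V) * (?e (U N j) * y j)" if j: "j < N" for j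
        using a V(1) x[OF j] U[OF lessI less_SucI[OF j]] y[OF less_SucI[OF j]]
        by (simp add: minus_mult_dim mult_assoc_dim)
      then have "matsum {..<N} n q (\<lambda>j. (?e (x j) - (a * V) * ?e (U N j)) * y j) =
          matsum {..<N} n q (\<lambda>j. ?e (x j) * y j - (a * V) * (?e (U N j) * y j))"
        by (intro matsum_cong) auto
      also have "\<dots> = matsum {..<N} n q (\<lambda>j. ?e (x j) * y j) - matsum {..<N} n q (\<lambda>j. (a * V) * (?e (U N j) * y j))"
        using a x U y V(1) by (intro matsum_diff mult_carrier_mat[of _ n n]) auto
      also have "matsum {..<N} n q (\<lambda>j. (a * V) * (?e (U N j) * y j)) = (a * V) * S N"
        unfolding S_def using a U y V(1) by (intro matsum_mult_left[symmetric] mult_carrier_mat[of _ n n]) auto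
      finally show ?thesis .
    qed
    have "?e g * t = ?e (Add d (Mul (Mul (c N) (Inv (U N N))) (b N))) * t +
        matsum {..<N} n q (\<lambda>j. ?e (expr_schur (U N N) (c j) (c N) (U N j)) * y j) \<and> (t = 0\<^sub>m n q \<longrightarrow> (\<forall>j<N. y j = 0\<^sub>m n q))"
    proof (rule *[THEN conjunct2, THEN conjunct2, THEN conjunct2, rule_format])
      show "t \<in> carrier_mat n q" by fact
      show "y j \<in> carrier_mat n q" if "j < N" for j using y that by simp
      fix i assume i: "i < N"
      have "matsum {..<N} n q (\<lambda>j. ?e (expr_schur (U N N) (U i j) (U i N) (U N j)) * y j) =
          matsum {..<N} n q (\<lambda>j. (?e (U i j) - (?e (U i N) * V) * ?e (U N j)) * y j)"
        using * i by (intro matsum_cong) (auto simp: nc_eval_expr_schur[OF X] V_def)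
      also have "\<dots> = S i - (?e (U i N) * V) * S N"
        unfolding S_def[of i] by (rule schur[OF U[OF less_SucI[OF i] lessI] U[OF less_SucI[OF i] less_SucI]])
      also have "\<dots> = (?e (b i) - (?e (U i N) * V) * ?e (b N)) * t"
        by (rule step(2)[OF U[OF less_SucI[OF i] lessI] Sc1(1) b[OF less_SucI[OF i]]
              eq[OF less_SucI[OF i], unfolded split[OF less_SucI[OF i]]]])
      also have "\<dots> = ?e (expr_schur (U N N) (b i) (U i N) (b N)) * t"
        using * i by (subst nc_eval_expr_schur[OF X]) (auto simp: V_def)
      finally show "matsum {..<N} n q (\<lambda>j. ?e (expr_schur (U N N) (U i j) (U i N) (U N j)) * y j) =
        ?e (expr_schur (U N N) (b i) (U i N) (b N)) * t" .
    qed
    moreover have "matsum {..<N} n q (\<lambda>j. ?e (expr_schur (U N N) (c j) (c N) (U N j)) * y j) = Sc - (?e (c N) * V) * S N"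
    proof -
      have "matsum {..<N} n q (\<lambda>j. ?e (expr_schur (U N N) (c j) (c N) (U N j)) * y j) =
          matsum {..<N} n q (\<lambda>j. (?e (c j) - (?e (c N) * V) * ?e (U N j)) * y j)"
        using * by (intro matsum_cong) (auto simp: nc_eval_expr_schur[OF X] V_def)
      also have "\<dots> = Sc - (?e (c N) * V) * S N"
        unfolding Sc_def by (rule schur[OF c[OF lessI] c[OF less_SucI]])
      finally show ?thesis .
    qed
    moreover have "?e (Add d (Mul (Mul (c N) (Inv (U N N))) (b N))) = ?e d + (?e (c N) * V) * ?e (b N)"
      by (simp add: V_def)
    moreover note step(3)[OF c[OF lessI] Sc1(2) d]
    moreover have "y N = 0\<^sub>m n q" if t0: "t = 0\<^sub>m n q" and y0: "\<forall>j<N. y j = 0\<^sub>m n q"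
    proof -
      have "?e (U N j) * y j = 0\<^sub>m n q" if "j < N" for j
        using y0 that U[OF lessI less_SucI[OF that]] by (simp add: mult_zero_dim)
      then have "S N = 0\<^sub>m n q" unfolding S_def by (intro matsum_zero) auto
      then have "?e (b N) * t - S N = 0\<^sub>m n q" using t0 b[OF lessI] by (auto simp: mult_zero_dim intro!: eq_matI)
      then show ?thesis using step(1)[OF c[OF lessI] Sc1(2)] V(1) by (simp add: mult_zero_dim)
    qed
    ultimately show ?thesis unfolding splitc by (auto simp: less_Suc_eq)
  qed
  show "(\<forall>i<Suc N. \<forall>j<Suc N. nc_defined n X (U i j)) \<and> (\<forall>i<Suc N. nc_defined n X (c i) \<and> nc_defined n X (b i)) \<and> nc_defined n X d \<and>
    (\<forall>q t y. t \<in> carrier_mat n q \<longrightarrow> (\<forall>j<Suc N. y j \<in> carrier_mat n q) \<longrightarrow>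
       (\<forall>i<Suc N. matsum {..<Suc N} n q (\<lambda>j. ?e (U i j) * y j) = ?e (b i) * t) \<longrightarrow>
       ?e g * t = ?e d * t + matsum {..<Suc N} n q (\<lambda>j. ?e (c j) * y j) \<and>
       (t = 0\<^sub>m n q \<longrightarrow> (\<forall>j<Suc N. y j = 0\<^sub>m n q)))"
    using def dd(1) main by (intro conjI allI impI) (blast | simp)+
qed

text \<open>At the given point the matrix is the identity, so the pivot is 1 and the Schur
  complements again form an identity. Hence every inverse introduced on the way exists at this
  point.\<close>

lemma eliminates_exists:
  fixes X :: "'d \<Rightarrow> 'k::field mat"
  assumes X: "X \<in> tuples n"
    and "\<And>i j. i < N \<Longrightarrow> j < N \<Longrightarrow> nc_defined n X (U i j) \<and> nc_eval n X (U i j) = (if i = j then 1\<^sub>m n else 0\<^sub>m n n)"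
    and "\<And>i. i < N \<Longrightarrow> nc_defined n X (c i) \<and> nc_defined n X (b i)" "nc_defined n X d"
  shows "\<exists>g. nc_defined n X g \<and> eliminates g N U c b d"
  using assms(2-4)
proof (induction N arbitrary: U c b d)
  case 0
  have "eliminates d 0 U c b d"
    unfolding eliminates_def
  proof (intro allI impI conjI)
    fix n q and X :: "'d \<Rightarrow> 'k mat" and t :: "'k mat" assume "X \<in> tuples n" "nc_defined n X d" "t \<in> carrier_mat n q"
    then show "nc_eval n X d * t = nc_eval n X d * t + matsum {..<0} n q (\<lambda>j. nc_eval n X (c j) * y j)" for y
      using nc_eval_carrier[of X n d] by (intro eq_matI) (auto simp del: index_mult_mat(1))
  qed auto
  then show ?case using 0 by blast
next
  case (Suc N)
  note pre = Suc.prems(1)[of N N, OF lessI lessI] Suc.prems(1)[OF less_SucI less_SucI] Suc.prems(1)[OF less_SucI lessI]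
    Suc.prems(1)[OF lessI less_SucI] Suc.prems(2)[OF lessI] Suc.prems(2)[OF less_SucI] Suc.prems(3)
  have inv: "invertible_mat (nc_eval n X (U N N))" using pre(1) by (simp add: invertible_one)
  have m: "minv (nc_eval n X (U N N)) \<in> carrier_mat n n" by (rule minv_inverse(1)[OF inv]) (use pre(1) in simp)
  have "\<exists>g. nc_defined n X g \<and> eliminates g N (\<lambda>i j. expr_schur (U N N) (U i j) (U i N) (U N j))
      (\<lambda>j. expr_schur (U N N) (c j) (c N) (U N j)) (\<lambda>i. expr_schur (U N N) (b i) (U i N) (b N))
      (Add d (Mul (Mul (c N) (Inv (U N N))) (b N)))"
  proof (rule Suc.IH)
    fix i j assume ij: "i < N" "j < N"
    have dxyz: "nc_defined n X (expr_schur (U N N) (U i j) (U i N) (U N j))" using pre ij inv by auto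
    have "nc_eval n X (expr_schur (U N N) (U i j) (U i N) (U N j)) = (if i = j then 1\<^sub>m n else 0\<^sub>m n n)"
      unfolding nc_eval_expr_schur[OF X dxyz] using pre(2)[OF ij] pre(3)[OF ij(1)] pre(4)[OF ij(2)] ij m
      by (auto simp: zero_mult_dim intro!: eq_matI)
    then show "nc_defined n X (expr_schur (U N N) (U i j) (U i N) (U N j)) \<and>
      nc_eval n X (expr_schur (U N N) (U i j) (U i N) (U N j)) = (if i = j then 1\<^sub>m n else 0\<^sub>m n n)" using dxyz by blast
  next
    fix i assume i: "i < N"
    show "nc_defined n X (expr_schur (U N N) (c i) (c N) (U N i)) \<and> nc_defined n X (expr_schur (U N N) (b i) (U i N) (b N))"
      using pre inv i by auto
  next
    show "nc_defined n X (Add d (Mul (Mul (c N) (Inv (U N N))) (b N)))" using pre inv by auto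
  qed
  then show ?case using eliminates_Suc by blast
qed

lemma bmat_inj:
  assumes "bmat p q r c F = bmat p q r c G" "i < p" "j < q" "F i j \<in> carrier_mat r c" "G i j \<in> carrier_mat r c"
  shows "F i j = G i j"
proof (rule eq_matI)
  fix a b assume "a < dim_row (G i j)" "b < dim_col (G i j)"
  then have ab: "a < r" "b < c" using assms(5) by auto
  show "F i j $$ (a, b) = G i j $$ (a, b)"
    using bmat_index[OF assms(2) ab(1) assms(3) ab(2), of F] bmat_index[OF assms(2) ab(1) assms(3) ab(2), of G] assms(1) by simp
qed (use assms in auto)

lemma bmat_col_index:
  assumes "i < p" "a < r" "b < c"
  shows "bmat p (Suc 0) r c F $$ (i * r + a, b) = F i 0 $$ (a, b)"
  using bmat_index[OF assms(1,2) zero_less_Suc[of 0] assms(3), of F] by simp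

lemma bmat_single:
  assumes "A \<in> carrier_mat r c"
  shows "bmat 1 1 r c (\<lambda>_ _. A) = A"
  using assms by (intro eq_matI) (auto simp: bmat_def)

lemma eliminates_blocks:
  fixes X :: "'d \<Rightarrow> 'k::field mat"
  assumes g: "eliminates g N U c b d" and X: "X \<in> tuples n" "nc_defined n X g"
    and t: "t \<in> carrier_mat n q" and z: "z \<in> carrier_mat (N * n) q"
    and eq: "eval_mat n X N N U * z = eval_mat n X N 1 (\<lambda>i j. b i) * t"
  shows "nc_eval n X g * t = nc_eval n X d * t + eval_mat n X 1 N (\<lambda>i j. c j) * z"
    and "t = 0\<^sub>m n q \<Longrightarrow> z = 0\<^sub>m (N * n) q"
proof -
  note * = g[unfolded eliminates_def, rule_format, OF X]
  let ?e = "nc_eval n X"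
  define y where "y j = mat n q (\<lambda>(a, h). z $$ (j * n + a, h))" for j
  have y: "y j \<in> carrier_mat n q" for j by (simp add: y_def)
  have zy: "z = bmat N 1 n q (\<lambda>j _. y j)"
    by (rule bmat_eqI[of _ N n 1 q]) (use z in \<open>auto simp: bmat_col_index y_def\<close>)
  have t1: "t = bmat 1 1 n q (\<lambda>_ _. t)"
    by (rule bmat_single[OF t, symmetric])
  have U: "?e (U i j) \<in> carrier_mat n n" if "i < N" "j < N" for i j using * that nc_eval_carrier[OF X(1)] by blast
  have c: "?e (c i) \<in> carrier_mat n n" if "i < N" for i using * that nc_eval_carrier[OF X(1)] by blast
  have b: "?e (b i) \<in> carrier_mat n n" if "i < N" for i using * that nc_eval_carrier[OF X(1)] by blast
  have d: "?e d \<in> carrier_mat n n" using * nc_eval_carrier[OF X(1)] by blast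
  have m1: "bmat N N n n (\<lambda>i j. ?e (U i j)) * bmat N 1 n q (\<lambda>j _. y j) = bmat N 1 n q (\<lambda>i _. matsum {..<N} n q (\<lambda>j. ?e (U i j) * y j))"
    by (rule bmat_mult) (use U y in auto)
  have m2: "bmat N 1 n n (\<lambda>i j. ?e (b i)) * bmat 1 1 n q (\<lambda>_ _. t) = bmat N 1 n q (\<lambda>i _. matsum {..<1::nat} n q (\<lambda>j. ?e (b i) * t))"
    by (rule bmat_mult) (use b t in auto)
  have "matsum {..<N} n q (\<lambda>j. ?e (U i j) * y j) = ?e (b i) * t" if i: "i < N" for i
  proof -
    have "bmat N 1 n q (\<lambda>i _. matsum {..<N} n q (\<lambda>j. ?e (U i j) * y j)) = bmat N 1 n q (\<lambda>i _. matsum {..<1::nat} n q (\<lambda>j. ?e (b i) * t))"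
      unfolding m1[symmetric] m2[symmetric] zy[symmetric] t1[symmetric] using eq unfolding eval_mat_def .
    then have "matsum {..<N} n q (\<lambda>j. ?e (U i j) * y j) = matsum {..<1::nat} n q (\<lambda>j. ?e (b i) * t)"
      by (rule bmat_inj[of N 1 n q "\<lambda>i _. matsum {..<N} n q (\<lambda>j. ?e (U i j) * y j)" "\<lambda>i _. matsum {..<1::nat} n q (\<lambda>j. ?e (b i) * t)" i 0])
        (use i in auto)
    also have "\<dots> = ?e (b i) * t" using b[OF i] t by (intro eq_matI) auto
    finally show ?thesis .
  qed
  note concl = *[THEN conjunct2, THEN conjunct2, THEN conjunct2, rule_format, OF t y this]
  have "bmat 1 N n n (\<lambda>i j. ?e (c j)) * bmat N 1 n q (\<lambda>j _. y j) = bmat 1 1 n q (\<lambda>_ _. matsum {..<N} n q (\<lambda>j. ?e (c j) * y j))"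
    by (rule bmat_mult) (use c y in auto)
  also have "\<dots> = matsum {..<N} n q (\<lambda>j. ?e (c j) * y j)"
    by (rule bmat_single) simp
  finally have cz: "eval_mat n X 1 N (\<lambda>i j. c j) * z = matsum {..<N} n q (\<lambda>j. ?e (c j) * y j)"
    unfolding zy[symmetric] eval_mat_def .
  show "?e g * t = ?e d * t + eval_mat n X 1 N (\<lambda>i j. c j) * z" unfolding cz using concl by blast
  assume "t = 0\<^sub>m n q"
  then have "y j = 0\<^sub>m n q" if "j < N" for j using concl that by blast
  then have "z = bmat N 1 n q (\<lambda>j _. 0\<^sub>m n q)" unfolding zy by (intro bmat_cong) auto
  also have "\<dots> = 0\<^sub>m (N * n) q" by (rule eq_matI) (auto simp: bmat_def block_div_less)
  finally show "z = 0\<^sub>m (N * n) q" .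
qed

lemma injective_invertible:
  fixes A :: "'k::field mat"
  assumes A: "A \<in> carrier_mat n n" and inj: "\<And>z. z \<in> carrier_mat n 1 \<Longrightarrow> A * z = 0\<^sub>m n 1 \<Longrightarrow> z = 0\<^sub>m n 1"
  shows "invertible_mat A"
proof (rule ccontr)
  assume "\<not> invertible_mat A"
  then obtain v where v: "v \<in> carrier_vec n" "v \<noteq> 0\<^sub>v n" "A *\<^sub>v v = 0\<^sub>v n"
    using invertible_mat_iff_det[OF A] det_0_iff_vec_prod_zero_field[OF A] by blast
  define z where "z = mat n 1 (\<lambda>(i, _). v $ i)"
  have z: "z \<in> carrier_mat n 1" by (simp add: z_def)
  have "A * z = 0\<^sub>m n 1" (is "_ = ?r")
  proof (rule eq_matI)
    fix i j assume "i < dim_row ?r" "j < dim_col ?r"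
    then have ij: "i < n" "j = 0" by auto
    have "(A *\<^sub>v v) $ i = 0" using v(3) ij by simp
    then show "(A * z) $$ (i, j) = ?r $$ (i, j)"
      using ij A v(1) by (simp add: z_def scalar_prod_def)
  qed (use A z in auto)
  from inj[OF z this] have zz: "z = 0\<^sub>m n 1" .
  have "v $ i = 0" if "i < n" for i
  proof -
    have "z $$ (i, 0) = 0" unfolding zz using that by simp
    then show ?thesis using that by (simp add: z_def)
  qed
  then have "v = 0\<^sub>v n" using v(1) by (intro eq_vecI) auto
  then show False using v(2) by blast
qed

text \<open>Elimination applied to the pencil itself could meet a singular pivot at X. The pencil is
  therefore first multiplied on the left by the polynomial in it that is its inverse at X: the
  product \<open>U\<close> is the identity at X, and at other points still gives c U^-1 (F b) = c
  P^-1 b.\<close>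

theorem expression_at_regular_point:
  fixes X :: "'d::finite \<Rightarrow> 'k::field mat"
  assumes wf: "pen_wf 1 1 P" and X: "X \<in> tuples n" and inv: "invertible_mat (pen_at (*) n P X)"
  shows "\<exists>g. X \<in> nc_dom n g \<and>
    (\<forall>m. \<forall>W\<in>nc_dom m g. invertible_mat (pen_at (*) m P W) \<and> nc_eval m W g = pen_val (*) m P W)"
proof -
  let ?N = "pen_N P"
  note cb = pen_wfD(2,3)[OF wf]
  obtain E where E: "everywhere_defined E" "\<And>n X. X \<in> tuples n \<Longrightarrow> eval_mat n X ?N ?N E = pen_at (*) n P X"
    using pencil_expr_exists[OF wf] by blast
  obtain p where p: "pen_at (*) n P X * mpoly (?N * n) (pen_at (*) n P X) p = 1\<^sub>m (?N * n)"
    by (rule polynomial_inverse[OF pform_carrier inv])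
  obtain F where F: "everywhere_defined F"
    "\<And>n X. X \<in> tuples n \<Longrightarrow> eval_mat n X ?N ?N F = mpoly (?N * n) (eval_mat n X ?N ?N E) p"
    using mpoly_expr_exists[OF E(1)] by blast
  define U where "U = expr_mult ?N F E"
  define K :: "nat \<Rightarrow> nat \<Rightarrow> ('d, 'k) nc_expr" where "K i j = Const (pen_b P $$ (i, j))" for i j
  define b where "b i = expr_mult ?N F K i 0" for i
  define c :: "nat \<Rightarrow> ('d, 'k) nc_expr" where "c j = Const (pen_c P $$ (0, j))" for j
  have K: "everywhere_defined K" by (simp add: everywhere_defined_def K_def)
  have U: "everywhere_defined U" unfolding U_def by (rule everywhere_defined_expr_mult[OF F(1) E(1)])
  have evU: "eval_mat n X ?N ?N U = eval_mat n X ?N ?N F * pen_at (*) n P X" if "X \<in> tuples n" for n X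
    unfolding U_def eval_mat_expr_mult[OF that F(1) E(1)] E(2)[OF that] ..
  have evb: "eval_mat n X ?N 1 (\<lambda>i j. b i) = eval_mat n X ?N ?N F * ramp (*) n (pen_b P)" if X: "X \<in> tuples n" for n X
  proof -
    have "eval_mat n X ?N 1 (\<lambda>i j. b i) = eval_mat n X ?N 1 (expr_mult ?N F K)"
      unfolding eval_mat_def by (rule bmat_cong) (simp add: b_def)
    also have "\<dots> = eval_mat n X ?N ?N F * eval_mat n X ?N 1 K" by (rule eval_mat_expr_mult[OF X F(1) K])
    finally show ?thesis unfolding K_def eval_mat_scalars[OF cb(2)] by (simp add: ramp_def)
  qed
  have evc: "eval_mat n X 1 ?N (\<lambda>i j. c j) = ramp (*) n (pen_c P)" for n and X :: "'d \<Rightarrow> 'k mat"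
  proof -
    have "eval_mat n X 1 ?N (\<lambda>i j. c j) = eval_mat n X 1 ?N (\<lambda>i j. Const (pen_c P $$ (i, j)))"
      unfolding eval_mat_def by (rule bmat_cong) (simp add: c_def)
    then show ?thesis unfolding eval_mat_scalars[OF cb(1)] by (simp add: ramp_def)
  qed
  have one: "eval_mat n X ?N ?N U = 1\<^sub>m (?N * n)"
    unfolding evU[OF X] F(2)[OF X] E(2)[OF X]
    by (rule mat_mult_left_right_inverse[OF pform_carrier mpoly_carrier[OF pform_carrier] p])
  have "\<exists>g. nc_defined n X g \<and> eliminates g ?N U c b (Const 0)"
  proof (rule eliminates_exists[OF X])
    fix i j assume ij: "i < ?N" "j < ?N"
    have uc: "nc_eval n X (U i j) \<in> carrier_mat n n" by (rule nc_eval_carrier[OF X everywhere_definedD[OF U]])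
    have "nc_eval n X (U i j) = (if i = j then 1\<^sub>m n else 0\<^sub>m n n)" (is "?l = ?r")
    proof (rule eq_matI)
      fix a h assume "a < dim_row (if i = j then 1\<^sub>m n else 0\<^sub>m n n :: 'k mat)" "h < dim_col (if i = j then 1\<^sub>m n else 0\<^sub>m n n :: 'k mat)"
      then have ah: "a < n" "h < n" by (auto split: if_splits)
      have "?l $$ (a, h) = kron (1\<^sub>m ?N) (1\<^sub>m n) $$ (i * n + a, j * n + h)"
        using one bmat_index[OF ij(1) ah(1) ij(2) ah(2), of "\<lambda>i j. nc_eval n X (U i j)"]
        unfolding eval_mat_def kron_one by simp
      also have "\<dots> = ?r $$ (a, h)"
        by (subst kron_index[OF one_carrier_mat[of ?N] one_carrier_mat[of n] ij(1) ah(1) ij(2) ah(2)]) (use ij ah in simp)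
      finally show "?l $$ (a, h) = ?r $$ (a, h)" .
    qed (use uc in auto)
    then show "nc_defined n X (U i j) \<and> nc_eval n X (U i j) = (if i = j then 1\<^sub>m n else 0\<^sub>m n n)"
      using everywhere_definedD[OF U] by blast
  next
    fix i show "nc_defined n X (c i) \<and> nc_defined n X (b i)"
      using everywhere_definedD[OF everywhere_defined_expr_mult[OF F(1) K]] by (simp add: b_def c_def)
  qed simp
  then obtain g where g: "nc_defined n X g" "eliminates g ?N U c b (Const 0)" by blast
  have "invertible_mat (pen_at (*) m P W) \<and> nc_eval m W g = pen_val (*) m P W" if W: "W \<in> nc_dom m g" for m W
  proof -
    have w: "W \<in> tuples m" "nc_defined m W g" using W by (auto simp: nc_dom_def)
    define A where "A = pen_at (*) m P W"
    define H where "H = eval_mat m W ?N ?N F"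
    define rb where "rb = ramp (*) m (pen_b P)"
    have A: "A \<in> carrier_mat (?N * m) (?N * m)" and H: "H \<in> carrier_mat (?N * m) (?N * m)" and rb: "rb \<in> carrier_mat (?N * m) m"
      using ramp_carrier[OF cb(2), of "(*)" m] by (simp_all add: A_def H_def rb_def)
    have rc: "ramp (*) m (pen_c P) \<in> carrier_mat m (?N * m)" using ramp_carrier[OF cb(1), of "(*)" m] by simp
    note blocks = eliminates_blocks[OF g(2) w, unfolded evU[OF w(1)] evb[OF w(1)] evc, folded A_def H_def rb_def]
    \<comment> \<open>Where \<open>g\<close> is defined, elimination with right-hand side 0 shows
      that \<open>H * A\<close> is injective, hence so is the pencil \<open>A\<close>.\<close>
    have inv: "invertible_mat A"
    proof (rule injective_invertible[OF A])
      fix z assume z: "z \<in> carrier_mat (?N * m) 1" "A * z = 0\<^sub>m (?N * m) 1"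
      have "H * A * z = H * rb * 0\<^sub>m m 1" using A H rb z by (simp add: mult_assoc_dim mult_zero_dim)
      then show "z = 0\<^sub>m (?N * m) 1" by (rule blocks(2)[OF zero_carrier_mat z(1)]) simp
    qed
    note V = minv_inverse[OF inv A]
    have Vb: "minv A * rb \<in> carrier_mat (?N * m) m" using V(1) rb by auto
    have "H * A * (minv A * rb) = H * rb * 1\<^sub>m m"
    proof -
      have "H * A * (minv A * rb) = H * ((A * minv A) * rb)" using A H V(1) rb by (simp add: mult_assoc_dim)
      also have "\<dots> = H * rb * 1\<^sub>m m" using H rb by (simp add: V(2) one_mult_dim mult_one_dim)
      finally show ?thesis .
    qed
    from blocks(1)[OF one_carrier_mat Vb this]
    have "nc_eval m W g = ramp (*) m (pen_c P) * (minv A * rb)"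
      using nc_eval_carrier[OF w] rc Vb cb(1) rb
      by (simp add: mult_one_dim) (intro eq_matI, auto simp del: index_mult_mat(1))
    then show ?thesis using inv by (simp add: pen_val_def A_def rb_def)
  qed
  then show ?thesis using X g(1) by (intro exI[of _ g]) (auto simp: nc_dom_def)
qed


subsection \<open>The pencil of a rational function\<close>

primrec mat_of_nc :: "('d, 'k) nc_expr \<Rightarrow> ('d, 'k) mat_expr" where
  "mat_of_nc (Const c) = MConst c"
| "mat_of_nc (Var k) = MVar k"
| "mat_of_nc (Add e f) = MAdd (mat_of_nc e) (mat_of_nc f)"
| "mat_of_nc (Mul e f) = MMul (mat_of_nc e) (mat_of_nc f)"
| "mat_of_nc (Inv e) = MInv (mat_of_nc e)"

lemma mat_of_nc_size: "has_size (mat_of_nc e) 1 1"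
  by (induction e) (auto intro: has_size.intros simp del: One_nat_def)

lemma mat_of_nc_eval: "mx_eval (\<lambda>c. c) n X (mat_of_nc e) = nc_eval n X e"
  by (induction e) auto

lemma mat_of_nc_defined: "mx_defined (\<lambda>c. c) n X (mat_of_nc e) \<longleftrightarrow> nc_defined n X e"
  by (induction e) (auto simp: mat_of_nc_eval)

lemma mat_of_nc_dom: "mx_dom n (mat_of_nc e) = nc_dom n e"
  by (simp add: mx_dom_def nc_dom_def mat_of_nc_defined)

lemma linearizes_field:
  assumes "unital_algebra.linearizes (*) P e" "X \<in> mx_dom n (e :: ('d::finite, 'k::field) mat_expr)"
  shows "invertible_mat (pen_at (*) n P X)" "pen_val (*) n P X = mx_eval (\<lambda>c. c) n X e"
  using assms unfolding unital_algebra.linearizes_def[OF unital_algebra_field] by (auto simp: mx_dom_def)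

text \<open>Around a common regular point of the two domain pencils all word points lie in both
  domains. The two expressions have equal values there, so \<open>M\<close>, which dominates the
  pencil of \<open>f\<close>, has the same moments at that point as \<open>P\<close>.\<close>

theorem agreeing_dominated:
  fixes scale :: "'k::field \<Rightarrow> 'a::ring_1 \<Rightarrow> 'a" and Y :: "'d::finite \<Rightarrow> 'k mat"
  assumes alg: "unital_algebra scale" and sf: "stably_finite TYPE('a)" and s: "s > 0" and min: "minimal_at s Y M"
    and f: "has_size f 1 1" "n > 0" "mx_dom n f \<noteq> {}" "pen_wf 1 1 Q" "unital_algebra.linearizes (*) Q f" "dominated (*) Q M"
    and e: "has_size e 1 1" "l > 0" "mx_dom l e \<noteq> {}" "pen_wf 1 1 P" "unital_algebra.linearizes (*) P e"
    and eq: "\<And>n X. n > 0 \<Longrightarrow> X \<in> mx_dom n e \<Longrightarrow> X \<in> mx_dom n f \<Longrightarrow> mx_eval (\<lambda>c. c) n X e = mx_eval (\<lambda>c. c) n X f"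
  shows "dominated scale P M"
proof -
  obtain F where F: "domain_pencil F f" using domain_pencil_exists[OF f(1)] by blast
  obtain E where E: "domain_pencil E e" using domain_pencil_exists[OF e(1)] by blast
  have dom: "X \<in> mx_dom n f \<longleftrightarrow> X \<in> tuples n \<and> invertible_mat (pen_at (*) n F X)"
    "X \<in> mx_dom n e \<longleftrightarrow> X \<in> tuples n \<and> invertible_mat (pen_at (*) n E X)" for n X
    using E F by (auto simp: domain_pencil_def mx_dom_def)
  have wf: "pen_wf 1 1 F" "pen_wf 1 1 E" using E F by (simp_all add: domain_pencil_def)
  have Mwf: "pen_wf 1 1 M" using min by (simp add: minimal_at_def regular_at_def)
  obtain X Z where X: "X \<in> mx_dom n f" and Z: "Z \<in> mx_dom l e" using f(3) e(3) by blast
  obtain m U where U: "m > 0" "U \<in> tuples m" "invertible_mat (pen_at (*) m F U)" "invertible_mat (pen_at (*) m E U)"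
    using common_regular_point[OF wf(1) _ f(2) _ wf(2) _ e(2), of X Z] X Z unfolding dom by blast
  have reg: "regular_at m U F" "regular_at m U E" using wf U by (simp_all add: regular_at_def)
  have fM: "invertible_mat (pen_at (*) n M X) \<and> pen_val (*) n M X = mx_eval (\<lambda>c. c) n X f" if "X \<in> mx_dom n f" for n X
    using f(6) linearizes_field[OF f(5) that] that unfolding dominated_def dom(1) by simp
  have regM: "regular_at m U M" using fM[of U m] U Mwf by (simp add: regular_at_def dom(1))
  have regP: "regular_at m U P" using linearizes_field(1)[OF e(5), of U m] U e(4) by (simp add: regular_at_def dom(2))
  have "same_moments m U M P"
  proof (rule same_momentsI[OF regM regP])
    fix w :: "('d \<times> nat \<times> nat) list" assume w: "w \<in> lists (letters m)"
    let ?n = "Suc (length w) * m" and ?X = "word_point m U w"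
    have "?X \<in> mx_dom ?n f" "?X \<in> mx_dom ?n e"
      unfolding dom using pencil_word_point(1)[OF reg(1) w] pencil_word_point(1)[OF reg(2) w] word_point_tuples by blast+
    moreover have "?n > 0" using U(1) by simp
    ultimately show "pen_val (*) ?n M ?X = pen_val (*) ?n P ?X"
      using fM[of ?X ?n] eq[of ?n ?X] linearizes_field(2)[OF e(5), of ?X ?n] by simp
  qed
  then show ?thesis by (rule minimal_dominates_connected[OF alg sf s U(1) min regM regP])
qed

text \<open>The class is described through one representative, because membership in
  \<open>r\<close> compares an expression with \<open>e\<^sub>0\<close> alone; two other members are
  only compared by way of \<open>M\<close>.\<close>

locale function_pencil =
  fixes r :: "('d::finite, 'k::field) nc_expr set" and s :: nat and Y :: "'d \<Rightarrow> 'k mat" and M :: "('d, 'k) pencil"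
    and e\<^sub>0 :: "('d, 'k) nc_expr"
  assumes s0: "s > 0" and min: "minimal_at s Y M" and Y_dom: "Y \<in> rat_dom s r"
    and r_eq: "r = nc_equiv `` {e\<^sub>0}" and e0_nondegenerate: "nc_nondegenerate e\<^sub>0"
    and e0_dominated: "\<exists>P. pen_wf 1 1 P \<and> unital_algebra.linearizes (*) P (mat_of_nc e\<^sub>0) \<and> dominated (*) P M"

text \<open>The centre Y lies in the domain of some member e, possibly not of the representative.
  \<open>M\<close> is chosen minimal for e at Y; as the representative agrees with e, its pencil is
  dominated by \<open>M\<close> as well.\<close>

lemma function_pencil_exists:
  fixes r :: "('d::finite, 'k::field) nc_expr set"
  assumes r: "r \<in> nc_rat_functions" and s: "s > 0" and Y: "Y \<in> rat_dom s r"
  shows "\<exists>M e\<^sub>0. function_pencil r s Y M e\<^sub>0"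
proof -
  obtain e0 where e0: "nc_nondegenerate e0" "r = nc_equiv `` {e0}"
    using r unfolding nc_rat_functions_def by (auto elim: quotientE)
  obtain e where e: "e \<in> r" "Y \<in> nc_dom s e" using Y by (auto simp: rat_dom_def)
  then have eq: "nc_eval n X e0 = nc_eval n X e" if "n > 0" "X \<in> nc_dom n e0" "X \<in> nc_dom n e" for n X
    using e0 that by (auto simp: nc_equiv_def)
  obtain Q where Q: "pen_wf 1 1 Q" "unital_algebra.linearizes (*) Q (mat_of_nc e)"
    using has_linearization[OF unital_algebra_field mat_of_nc_size] by blast
  obtain P where P: "pen_wf 1 1 P" "unital_algebra.linearizes (*) P (mat_of_nc e0)"
    using has_linearization[OF unital_algebra_field mat_of_nc_size] by blast
  have "Y \<in> mx_dom s (mat_of_nc e)" using e(2) by (simp add: mat_of_nc_dom)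
  from linearizes_field(1)[OF Q(2) this] have reg: "regular_at s Y Q"
    using Q(1) e(2) by (simp add: regular_at_def nc_dom_def)
  obtain M where M: "minimal_at s Y M" "same_moments s Y Q M" by (rule minimal_at_exists[OF reg])
  have QM: "dominated (*) Q M"
    by (rule minimal_dominates[OF unital_algebra_field stably_finite_field s M(1) reg same_moments_sym[OF M(2)]])
  obtain l where l: "l > 0" "nc_dom l e0 \<noteq> {}" using e0(1) by (auto simp: nc_nondegenerate_def)
  have "dominated (*) P M"
  proof (rule agreeing_dominated[OF unital_algebra_field stably_finite_field s M(1) mat_of_nc_size s _ Q QM mat_of_nc_size l(1) _ P])
    show "mx_dom s (mat_of_nc e) \<noteq> {}" "mx_dom l (mat_of_nc e0) \<noteq> {}" using e(2) l(2) by (auto simp: mat_of_nc_dom)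
  qed (use eq in \<open>simp add: mat_of_nc_dom mat_of_nc_eval\<close>)
  then show ?thesis using s M(1) Y e0 P by (intro exI[of _ M] exI[of _ e0]) (unfold_locales, auto)
qed

context function_pencil
begin

lemma expr_dominated:
  fixes scale :: "'k \<Rightarrow> 'a::ring_1 \<Rightarrow> 'a"
  assumes alg: "unital_algebra scale" and sf: "stably_finite TYPE('a)"
    and e: "has_size e 1 1" "l > 0" "mx_dom l e \<noteq> {}" "pen_wf 1 1 P" "unital_algebra.linearizes (*) P e"
    and eq: "\<And>n X. n > 0 \<Longrightarrow> X \<in> mx_dom n e \<Longrightarrow> X \<in> nc_dom n e\<^sub>0 \<Longrightarrow> mx_eval (\<lambda>c. c) n X e = nc_eval n X e\<^sub>0"
  shows "dominated scale P M"
proof -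
  obtain Q where Q: "pen_wf 1 1 Q" "unital_algebra.linearizes (*) Q (mat_of_nc e\<^sub>0)" "dominated (*) Q M"
    using e0_dominated by blast
  obtain n where n: "n > 0" "nc_dom n e\<^sub>0 \<noteq> {}" using e0_nondegenerate by (auto simp: nc_nondegenerate_def)
  show ?thesis
  proof (rule agreeing_dominated[OF alg sf s0 min mat_of_nc_size n(1) _ Q e])
    show "mx_dom n (mat_of_nc e\<^sub>0) \<noteq> {}" using n(2) by (simp add: mat_of_nc_dom)
  qed (use eq in \<open>simp_all add: mat_of_nc_dom mat_of_nc_eval\<close>)
qed

lemma rat_expr:
  assumes f: "f \<in> r" "X \<in> nc_dom n f" "n > 0"
  shows "invertible_mat (pen_at (*) n M X)" "pen_val (*) n M X = nc_eval n X f"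
proof -
  obtain P where P: "pen_wf 1 1 P" "unital_algebra.linearizes (*) P (mat_of_nc f)"
    using has_linearization[OF unital_algebra_field mat_of_nc_size] by blast
  have ef: "nc_nondegenerate f" "\<And>n X. n > 0 \<Longrightarrow> X \<in> nc_dom n f \<Longrightarrow> X \<in> nc_dom n e\<^sub>0 \<Longrightarrow> nc_eval n X f = nc_eval n X e\<^sub>0"
    using f(1) unfolding r_eq by (auto simp: nc_equiv_def)
  have "dominated (*) P M"
  proof (rule expr_dominated[OF unital_algebra_field stably_finite_field mat_of_nc_size f(3) _ P])
    show "mx_dom n (mat_of_nc f) \<noteq> {}" using f(2) by (auto simp: mat_of_nc_dom)
  qed (use ef(2) in \<open>simp add: mat_of_nc_dom mat_of_nc_eval\<close>)
  moreover have "X \<in> mx_dom n (mat_of_nc f)" "X \<in> tuples n" using f(2) by (simp_all add: mat_of_nc_dom nc_dom_def)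
  ultimately show "invertible_mat (pen_at (*) n M X)" "pen_val (*) n M X = nc_eval n X f"
    using linearizes_field[OF P(2)] by (auto simp: dominated_def mat_of_nc_eval)
qed

text \<open>Makes the description in \<open>rat_val\<close> well defined: any two members that are
  defined at X both take the value of \<open>M\<close> there.\<close>

lemma rat_val_eq:
  assumes "f \<in> r" "X \<in> nc_dom n f" "n > 0"
  shows "rat_val n r X = nc_eval n X f"
  unfolding rat_val_def
proof (rule the_equality)
  show "\<exists>e\<in>r. X \<in> nc_dom n e \<and> nc_eval n X f = nc_eval n X e" using assms by blast
  fix v assume "\<exists>e\<in>r. X \<in> nc_dom n e \<and> v = nc_eval n X e"
  then obtain g where "g \<in> r" "X \<in> nc_dom n g" "v = nc_eval n X g" by blast
  then show "v = nc_eval n X f" using rat_expr(2)[of f X n] rat_expr(2)[of g X n] assms by simp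
qed

theorem rat_val_pencil:
  assumes "X \<in> rat_dom n r" "n > 0"
  shows "rat_val n r X = pen_val (*) n M X"
  using assms rat_val_eq rat_expr(2) unfolding rat_dom_def by fastforce

lemma M_wf: "pen_wf 1 1 M"
  using min by (simp add: minimal_at_def regular_at_def)

text \<open>At a regular point of \<open>M\<close> elimination provides an expression defined there.
  It belongs to \<open>r\<close>, since it and the representative both take the values of
  \<open>M\<close> wherever they are defined.\<close>

theorem rat_dom_pencil:
  assumes n: "n > 0"
  shows "rat_dom n r = {X \<in> tuples n. invertible_mat (pen_at (*) n M X)}"
proof (intro equalityI subsetI)
  fix X assume "X \<in> rat_dom n r"
  then show "X \<in> {X \<in> tuples n. invertible_mat (pen_at (*) n M X)}"
    using rat_expr(1)[OF _ _ n] by (auto simp: rat_dom_def nc_dom_def)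
next
  fix X assume "X \<in> {X \<in> tuples n. invertible_mat (pen_at (*) n M X)}"
  then have X: "X \<in> tuples n" "invertible_mat (pen_at (*) n M X)" by auto
  obtain g where g: "X \<in> nc_dom n g" "\<And>m W. W \<in> nc_dom m g \<Longrightarrow> nc_eval m W g = pen_val (*) m M W"
    using expression_at_regular_point[OF M_wf X] by blast
  have e0: "e\<^sub>0 \<in> r" using e0_nondegenerate unfolding r_eq by (auto simp: nc_equiv_def)
  have "nc_nondegenerate g" using g(1) n by (auto simp: nc_nondegenerate_def)
  moreover have "nc_eval m W e\<^sub>0 = nc_eval m W g" if "m > 0" "W \<in> nc_dom m e\<^sub>0 \<inter> nc_dom m g" for m W
    using rat_expr(2)[OF e0 _ that(1), of W] g(2)[of W m] that by simp
  ultimately have "g \<in> r" using e0_nondegenerate unfolding r_eq by (auto simp: nc_equiv_def)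
  then show "X \<in> rat_dom n r" using g(1) by (auto simp: rat_dom_def)
qed

theorem represents_dominated:
  fixes scale :: "'k \<Rightarrow> 'a::ring_1 \<Rightarrow> 'a"
  assumes alg: "unital_algebra scale" and sf: "stably_finite TYPE('a)" and E: "mx_represents E r"
    and d: "mx_defined (\<lambda>c. scale c 1) n X E" and X: "X \<in> tuples n"
  shows "invertible_mat (pen_at scale n M X)" "pen_val scale n M X = mx_eval (\<lambda>c. scale c 1) n X E"
proof -
  obtain l where E1: "has_size E 1 1" "l > 0" "mx_dom l E \<noteq> {}" using E by (auto simp: mx_represents_def)
  obtain P where P: "pen_wf 1 1 P" "unital_algebra.linearizes (*) P E" "unital_algebra.linearizes scale P E"
    using has_linearization[OF alg E1(1)] by blast
  have "dominated scale P M"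
  proof (rule expr_dominated[OF alg sf E1 P(1,2)])
    fix n X assume *: "n > 0" "X \<in> mx_dom n E" "X \<in> nc_dom n e\<^sub>0"
    have e0: "e\<^sub>0 \<in> r" using e0_nondegenerate unfolding r_eq by (auto simp: nc_equiv_def)
    then have "X \<in> rat_dom n r" using *(3) by (auto simp: rat_dom_def)
    then show "mx_eval (\<lambda>c. c) n X E = nc_eval n X e\<^sub>0"
      using E * rat_val_eq[OF e0 *(3,1)] by (simp add: mx_represents_def)
  qed
  then show "invertible_mat (pen_at scale n M X)" "pen_val scale n M X = mx_eval (\<lambda>c. scale c 1) n X E"
    using P(3) d X unfolding unital_algebra.linearizes_def[OF alg] dominated_def by auto
qed

end

subsection \<open>The expression of a pencil\<close>

text \<open>The number counts the entries after the first, so \<open>mx_row f q\<close> has q + 1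
  columns: there are no empty matrix expressions to start from.\<close>

primrec mx_row :: "(nat \<Rightarrow> ('d, 'k) mat_expr) \<Rightarrow> nat \<Rightarrow> ('d, 'k) mat_expr" where
  "mx_row f 0 = f 0"
| "mx_row f (Suc q) = MRow (mx_row f q) (f (Suc q))"

primrec mx_col :: "(nat \<Rightarrow> ('d, 'k) mat_expr) \<Rightarrow> nat \<Rightarrow> ('d, 'k) mat_expr" where
  "mx_col f 0 = f 0"
| "mx_col f (Suc p) = MCol (mx_col f p) (f (Suc p))"

lemma mx_row_size: "(\<And>j. j \<le> q \<Longrightarrow> has_size (f j) 1 1) \<Longrightarrow> has_size (mx_row f q) 1 (Suc q)"
  using has_size.intros(6)[of "mx_row f q'" 1 "Suc q'" "f (Suc q')" 1 for q']
  by (induction q) auto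

lemma mx_col_size: "(\<And>i. i \<le> p \<Longrightarrow> has_size (f i) 1 q) \<Longrightarrow> has_size (mx_col f p) (Suc p) q"
  using has_size.intros(7)[of "mx_col f p'" "Suc p'" q "f (Suc p')" 1 for p']
  by (induction p) auto

lemma mx_row_defined: "mx_defined \<iota> n X (mx_row f q) \<longleftrightarrow> (\<forall>j\<le>q. mx_defined \<iota> n X (f j))"
  by (induction q) (auto simp: le_Suc_eq)

lemma mx_col_defined: "mx_defined \<iota> n X (mx_col f q) \<longleftrightarrow> (\<forall>j\<le>q. mx_defined \<iota> n X (f j))"
  by (induction q) (auto simp: le_Suc_eq)

lemma bmat_row_index:
  assumes "a < r" "j < q" "b < c"
  shows "bmat (Suc 0) q r c F $$ (a, j * c + b) = F 0 j $$ (a, b)"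
  using bmat_index[OF zero_less_Suc[of 0] assms, of F] by simp

lemma mult_empty:
  fixes A :: "'a::semiring_0 mat"
  assumes "A \<in> carrier_mat p 0" "B \<in> carrier_mat 0 q"
  shows "A * B = 0\<^sub>m p q"
  using assms by (intro eq_matI) (auto simp: scalar_prod_def)

lemma mx_row_eval:
  assumes "\<And>j. j \<le> q \<Longrightarrow> mx_eval \<iota> n X (f j) \<in> carrier_mat n n"
  shows "mx_eval \<iota> n X (mx_row f q) = bmat 1 (Suc q) n n (\<lambda>_ j. mx_eval \<iota> n X (f j))"
  using assms
proof (induction q)
  case 0
  then show ?case by (intro eq_matI) (auto simp: bmat_def)
next
  case (Suc q)
  note IH = Suc.IH[OF Suc.prems[OF le_SucI]]
  have c: "mx_eval \<iota> n X (f (Suc q)) \<in> carrier_mat n n" using Suc.prems by simp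
  show ?case
  proof (rule bmat_eqI[of _ 1 n "Suc (Suc q)" n])
    fix i a j b assume *: "i < (1::nat)" "a < n" "j < Suc (Suc q)" "b < n"
    have lj: "j * n + b < Suc (Suc q) * n" by (rule block_index_less[OF *(3,4)])
    show "mx_eval \<iota> n X (mx_row f (Suc q)) $$ (i * n + a, j * n + b) =
      bmat 1 (Suc (Suc q)) n n (\<lambda>_ j. mx_eval \<iota> n X (f j)) $$ (i * n + a, j * n + b)"
    proof (cases "j < Suc q")
      case True
      then have "j * n + b < Suc q * n" using *(4) by (rule block_index_less)
      then show ?thesis using * True c lj by (simp add: IH bmat_row_index)
    next
      case False
      then have "j = Suc q" using * by simp
      then show ?thesis using * c lj by (simp add: IH bmat_row_index del: mult_Suc)
    qed
  qed (use c in \<open>auto simp: IH\<close>)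
qed

lemma mx_col_eval:
  assumes "\<And>i. i \<le> p \<Longrightarrow> mx_eval \<iota> n X (f i) = bmat 1 q n n (F i)"
  shows "mx_eval \<iota> n X (mx_col f p) = bmat (Suc p) q n n (\<lambda>i. F i 0)"
  using assms
proof (induction p)
  case 0
  then show ?case by (intro eq_matI) (auto simp: bmat_def)
next
  case (Suc p)
  note IH = Suc.IH[OF Suc.prems[OF le_SucI]]
  have e: "mx_eval \<iota> n X (f (Suc p)) = bmat 1 q n n (F (Suc p))" using Suc.prems by simp
  show ?case
  proof (rule bmat_eqI[of _ "Suc (Suc p)" n q n])
    fix i a j b assume *: "i < Suc (Suc p)" "a < n" "j < q" "b < n"
    have l: "i * n + a < Suc (Suc p) * n" "j * n + b < q * n" using * block_index_less by blast+
    show "mx_eval \<iota> n X (mx_col f (Suc p)) $$ (i * n + a, j * n + b) =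
      bmat (Suc (Suc p)) q n n (\<lambda>i. F i 0) $$ (i * n + a, j * n + b)"
    proof (cases "i < Suc p")
      case True
      then have "i * n + a < Suc p * n" using *(2) by (rule block_index_less)
      then show ?thesis using * True l bmat_index[OF True *(2-4), of "\<lambda>i. F i 0"]
        by (simp add: IH e append_rows_def bmat_index[OF *])
    next
      case False
      then have "i = Suc p" using * by simp
      then show ?thesis unfolding bmat_index[OF *] using * l by (simp add: IH e append_rows_def bmat_row_index)
    qed
  qed (auto simp: IH e append_rows_def)
qed

definition mx_table :: "(nat \<Rightarrow> nat \<Rightarrow> ('d, 'k) mat_expr) \<Rightarrow> nat \<Rightarrow> nat \<Rightarrow> ('d, 'k) mat_expr" where
  "mx_table F p q = mx_col (\<lambda>i. mx_row (F i) q) p"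

lemma mx_table_size: "(\<And>i j. has_size (F i j) 1 1) \<Longrightarrow> has_size (mx_table F p q) (Suc p) (Suc q)"
  unfolding mx_table_def by (intro mx_col_size mx_row_size)

lemma mx_table_defined: "(\<And>i j. mx_defined \<iota> n X (F i j)) \<Longrightarrow> mx_defined \<iota> n X (mx_table F p q)"
  by (simp add: mx_table_def mx_col_defined mx_row_defined)

lemma mx_table_eval:
  assumes "\<And>i j. mx_eval \<iota> n X (F i j) \<in> carrier_mat n n"
  shows "mx_eval \<iota> n X (mx_table F p q) = bmat (Suc p) (Suc q) n n (\<lambda>i j. mx_eval \<iota> n X (F i j))"
  unfolding mx_table_def
  by (rule mx_col_eval[where F = "\<lambda>i _ j. mx_eval \<iota> n X (F i j)"]) (rule mx_row_eval[OF assms])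

primrec mx_sum :: "nat \<Rightarrow> (nat \<Rightarrow> ('d, 'k::field) mat_expr) \<Rightarrow> ('d, 'k) mat_expr" where
  "mx_sum 0 f = MConst 0"
| "mx_sum (Suc N) f = MAdd (mx_sum N f) (f N)"

lemma mx_sum_size: "(\<And>i. has_size (f i) 1 1) \<Longrightarrow> has_size (mx_sum N f) 1 1"
  by (induction N) (auto intro: has_size.intros simp del: One_nat_def)

lemma mx_sum_defined: "(\<And>i. mx_defined \<iota> n X (f i)) \<Longrightarrow> mx_defined \<iota> n X (mx_sum N f)"
  by (induction N) auto

lemma mx_sum_eval:
  assumes "\<And>i. mx_eval \<iota> n X (f i) \<in> carrier_mat n n" "\<iota> 0 = 0"
  shows "mx_eval \<iota> n X (mx_sum N f) = matsum {..<N} n n (\<lambda>i. mx_eval \<iota> n X (f i))"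
proof (induction N)
  case (Suc N)
  from matsum_lessThan_Suc[of "\<lambda>i. mx_eval \<iota> n X (f i)" N n n, OF assms(1)] Suc show ?case by simp
qed (use assms in \<open>intro eq_matI, auto\<close>)

lemma smult_one_mult:
  fixes A :: "'a::ring_1 mat"
  assumes "A \<in> carrier_mat n q"
  shows "(k \<cdot>\<^sub>m 1\<^sub>m n) * A = k \<cdot>\<^sub>m A" (is "?l = ?r")
proof (rule eq_matI)
  fix i j assume "i < dim_row ?r" "j < dim_col ?r"
  then have ij: "i < n" "j < q" using assms by auto
  have "?l $$ (i, j) = (\<Sum>l\<in>{0..<n}. (k * (if l = i then 1 else 0)) * A $$ (l, j))"
    using ij assms by (simp add: scalar_prod_def)
  also have "\<dots> = (\<Sum>l\<in>{0..<n}. if l = i then k * A $$ (i, j) else 0)" by (rule sum.cong) auto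
  finally show "?l $$ (i, j) = ?r $$ (i, j)" using ij assms by simp
qed (use assms in auto)

text \<open>A matrix-valued expression can invert the whole pencil at once, so c P^-1 b is itself an
  expression. The field is listed separately because \<open>'a\<close> is fixed in the statement,
  while one expression must work over both.\<close>

theorem pencil_mat_expr:
  fixes P :: "('d::finite, 'k::field) pencil"
  assumes wf: "pen_wf 1 1 P"
  obtains e where "has_size e 1 1"
    "\<And>(scale :: 'k \<Rightarrow> 'a::ring_1 \<Rightarrow> 'a) n X. unital_algebra scale \<Longrightarrow> X \<in> tuples n \<Longrightarrow> invertible_mat (pen_at scale n P X) \<Longrightarrow>
       mx_defined (\<lambda>c. scale c 1) n X e \<and> mx_eval (\<lambda>c. scale c 1) n X e = pen_val scale n P X"
    "\<And>n X. X \<in> tuples n \<Longrightarrow> invertible_mat (pen_at (*) n P X) \<Longrightarrow>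
       mx_defined (\<lambda>c. c) n X e \<and> mx_eval (\<lambda>c. c) n X e = pen_val (*) n P X"
proof -
  let ?N = "pen_N P"
  note M = pen_wfD(1)[OF wf] and cb = pen_wfD(2,3)[OF wf]
  define x :: "'d option \<Rightarrow> ('d, 'k) mat_expr" where "x \<kappa> = (case \<kappa> of None \<Rightarrow> MConst 1 | Some k \<Rightarrow> MVar k)" for \<kappa>
  obtain f :: "nat \<Rightarrow> 'd option" where f: "bij_betw f {..<card (UNIV :: 'd option set)} UNIV"
    using ex_bij_betw_nat_finite[OF finite_UNIV] unfolding atLeast0LessThan by blast
  define E where "E i j = mx_sum (card (UNIV :: 'd option set)) (\<lambda>l. MMul (MConst (pen_M P (f l) $$ (i, j))) (x (f l)))" for i j
  define c b :: "nat \<Rightarrow> nat \<Rightarrow> ('d, 'k) mat_expr"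
    where "c i j = MConst (pen_c P $$ (i, j))" and "b i j = MConst (pen_b P $$ (i, j))" for i j
  \<comment> \<open>A pencil of size 0 cannot be written as a table of expressions; its value is the
    empty sum 0.\<close>
  define e where "e = (if ?N = 0 then MConst 0 else
    MMul (mx_table c 0 (?N - 1)) (MMul (MInv (mx_table E (?N - 1) (?N - 1))) (mx_table b (?N - 1) 0)))"
  have x: "has_size (x \<kappa>) 1 1" for \<kappa> by (cases \<kappa>) (auto simp: x_def intro: has_size.intros simp del: One_nat_def)
  have E: "has_size (E i j) 1 1" for i j
    unfolding E_def using x by (intro mx_sum_size has_size.intros(4)[of _ 1 1]) (auto intro: has_size.intros simp del: One_nat_def)
  have size: "has_size e 1 1"
  proof (cases "?N = 0")
    case True
    then show ?thesis by (simp add: e_def has_size.intros del: One_nat_def)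
  next
    case False
    then have N: "Suc (?N - 1) = ?N" by simp
    have "has_size (mx_table c 0 (?N - 1)) (Suc 0) ?N" "has_size (mx_table E (?N - 1) (?N - 1)) ?N ?N" "has_size (mx_table b (?N - 1) 0) ?N (Suc 0)"
      using mx_table_size[of c 0 "?N - 1"] mx_table_size[of E "?N - 1" "?N - 1"] mx_table_size[of b "?N - 1" 0] E
      unfolding N by (auto simp: c_def b_def intro: has_size.intros(1)[unfolded One_nat_def])
    then show ?thesis unfolding e_def using False by (auto intro!: has_size.intros(4,5))
  qed
  have main: "mx_defined \<iota> n X e \<and> mx_eval \<iota> n X e = pen_val scale n P X"
    if alg: "unital_algebra scale" and \<iota>: "\<iota> = (\<lambda>c. scale c 1)" and X: "X \<in> tuples n" and inv: "invertible_mat (pen_at scale n P X)"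
    for scale :: "'k \<Rightarrow> 'b::ring_1 \<Rightarrow> 'b" and \<iota> n X
  proof (cases "?N = 0")
    case True
    interpret unital_algebra scale by fact
    note V = minv_inverse(1)[OF inv pform_carrier]
    have cv: "ramp scale n (pen_c P) \<in> carrier_mat (1 * n) 0" "minv (pen_at scale n P X) * ramp scale n (pen_b P) \<in> carrier_mat 0 (1 * n)"
      using ramp_carrier[OF cb(1), of scale n] ramp_carrier[OF cb(2), of scale n] V True by auto
    have "pen_val scale n P X = 0\<^sub>m n n" using mult_empty[OF cv] by (simp add: pen_val_def)
    moreover have "mx_eval \<iota> n X e = 0\<^sub>m n n" using True by (intro eq_matI) (auto simp: e_def \<iota>)
    ultimately show ?thesis using True by (simp add: e_def)
  next
    case False
    interpret unital_algebra scale by fact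
    have N: "Suc (?N - Suc 0) = ?N" using False by simp
    note ext = ext_tuple_carrier[OF X]
    have \<iota>0: "\<iota> 0 = 0" by (simp add: \<iota>)
    have xe: "mx_eval \<iota> n X (x \<kappa>) = ext_tuple n X \<kappa>" for \<kappa> by (cases \<kappa>) (auto simp: x_def \<iota> intro!: eq_matI)
    have tm: "mx_eval \<iota> n X (MMul (MConst t) (x \<kappa>)) = mat n n (\<lambda>ij. scale t (ext_tuple n X \<kappa> $$ ij))" for t \<kappa>
    proof -
      have "mx_eval \<iota> n X (MMul (MConst t) (x \<kappa>)) = scale t 1 \<cdot>\<^sub>m ext_tuple n X \<kappa>"
        using ext[of \<kappa>] by (simp only: mx_eval.simps xe) (simp add: \<iota> smult_one_mult)
      then show ?thesis using ext[of \<kappa>] by (intro eq_matI) auto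
    qed
    have Ee: "mx_eval \<iota> n X (E i j) = matsum {..<card (UNIV :: 'd option set)} n n
        (\<lambda>l. mat n n (\<lambda>ab. scale (pen_M P (f l) $$ (i, j)) (ext_tuple n X (f l) $$ ab)))" for i j
      unfolding E_def by (subst mx_sum_eval) (simp_all add: tm \<iota>0 del: mx_eval.simps)
    have at: "mx_eval \<iota> n X (mx_table E (?N - 1) (?N - 1)) = pen_at scale n P X" (is "?l = ?r")
    proof (rule bmat_eqI[of _ ?N n ?N n])
      fix i a j h assume *: "i < ?N" "a < n" "j < ?N" "h < n"
      have "?l $$ (i * n + a, j * n + h) = mx_eval \<iota> n X (E i j) $$ (a, h)"
        by (subst mx_table_eval) (auto simp: Ee N bmat_index[OF *])
      also have "\<dots> = (\<Sum>l<card (UNIV :: 'd option set). scale (pen_M P (f l) $$ (i, j)) (ext_tuple n X (f l) $$ (a, h)))"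
        using * by (simp add: Ee)
      also have "\<dots> = (\<Sum>\<kappa>\<in>UNIV. scale (pen_M P \<kappa> $$ (i, j)) (ext_tuple n X \<kappa> $$ (a, h)))"
        by (rule sum.reindex_bij_betw[OF f, of "\<lambda>\<kappa>. scale (pen_M P \<kappa> $$ (i, j)) (ext_tuple n X \<kappa> $$ (a, h))"])
      also have "\<dots> = ?r $$ (i * n + a, j * n + h)"
        using * unfolding pform_index[OF M X *] sum_UNIV_option by (simp add: if_distrib cong: if_cong)
      finally show "?l $$ (i * n + a, j * n + h) = ?r $$ (i * n + a, j * n + h)" .
    qed (subst mx_table_eval, auto simp: Ee N)
    have scal: "bmat p q n n (\<lambda>i j. mx_eval \<iota> n X (MConst (G $$ (i, j)))) = ramp scale n G" if "G \<in> carrier_mat p q" for G p q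
      unfolding ramp_def kron_bmat using that by (auto simp: \<iota> intro!: bmat_cong)
    have ce: "mx_eval \<iota> n X (mx_table c 0 (?N - 1)) = ramp scale n (pen_c P)"
      by (subst mx_table_eval) (auto simp: c_def N scal[OF cb(1), unfolded One_nat_def mx_eval.simps])
    have be: "mx_eval \<iota> n X (mx_table b (?N - 1) 0) = ramp scale n (pen_b P)"
      by (subst mx_table_eval) (auto simp: b_def N scal[OF cb(2), unfolded One_nat_def mx_eval.simps])
    have "mx_defined \<iota> n X (x \<kappa>)" for \<kappa> by (cases \<kappa>) (auto simp: x_def)
    then have "mx_defined \<iota> n X (mx_table E (?N - 1) (?N - 1))"
      unfolding E_def by (intro mx_table_defined mx_sum_defined) simp
    moreover have "mx_defined \<iota> n X (mx_table c 0 (?N - 1))" "mx_defined \<iota> n X (mx_table b (?N - 1) 0)"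
      by (auto simp: c_def b_def intro: mx_table_defined)
    ultimately show ?thesis using False inv by (simp add: e_def pen_val_def at[unfolded One_nat_def] ce[unfolded One_nat_def] be[unfolded One_nat_def])
  qed
  show ?thesis
  proof (rule that[OF size])
    show "mx_defined (\<lambda>c. scale c 1) n X e \<and> mx_eval (\<lambda>c. scale c 1) n X e = pen_val scale n P X"
      if "unital_algebra scale" "X \<in> tuples n" "invertible_mat (pen_at scale n P X)"
      for scale :: "'k \<Rightarrow> 'a::ring_1 \<Rightarrow> 'a" and n X
      using main[OF that(1) refl that(2,3)] .
    show "mx_defined (\<lambda>c. c) n X e \<and> mx_eval (\<lambda>c. c) n X e = pen_val (*) n P X"
      if "X \<in> tuples n" "invertible_mat (pen_at (*) n P X)" for n X
      using main[OF unital_algebra_field _ that, of "\<lambda>c. c"] by simp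
  qed
qed


subsection \<open>Compression of systems\<close>

text \<open>The inverse of 1 - Q P is 1 + Q (1 - P Q)^-1 P, over any ring.\<close>

lemma one_minus_swap:
  fixes P Q :: "'a::ring_1 mat"
  assumes P: "P \<in> carrier_mat n d" and Q: "Q \<in> carrier_mat d n" and inv: "invertible_mat (1\<^sub>m n - P * Q)"
  shows "invertible_mat (1\<^sub>m d - Q * P)" "minv (1\<^sub>m n - P * Q) * P = P * minv (1\<^sub>m d - Q * P)"
proof -
  define W where "W = minv (1\<^sub>m n - P * Q)"
  have c: "1\<^sub>m n - P * Q \<in> carrier_mat n n" "1\<^sub>m d - Q * P \<in> carrier_mat d d" using P Q by (auto intro!: minus_carrier_mat)
  note w = minv_inverse[OF inv c(1), folded W_def]
  have W: "W \<in> carrier_mat n n" by (rule w(1))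
  have PQW: "P * (Q * W) = W - 1\<^sub>m n" "W * (P * Q) = W - 1\<^sub>m n"
  proof -
    have d: "W - P * (Q * W) = 1\<^sub>m n" "W - W * (P * Q) = 1\<^sub>m n"
      using w P Q by (simp_all add: minus_mult_dim mult_minus_dim mult_assoc_dim one_mult_dim mult_one_dim)
    have "P * (Q * W) = W - (W - P * (Q * W))" "W * (P * Q) = W - (W - W * (P * Q))"
      using P Q W by (intro eq_matI; auto simp del: index_mult_mat(1))+
    then show "P * (Q * W) = W - 1\<^sub>m n" "W * (P * Q) = W - 1\<^sub>m n" unfolding d .
  qed
  define V where "V = 1\<^sub>m d + Q * (W * P)"
  have V: "V \<in> carrier_mat d d" using P Q W by (auto simp: V_def)
  have e1: "Q * (P * (Q * (W * P))) = Q * (W * P) - Q * P"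
  proof -
    have "Q * (P * (Q * (W * P))) = Q * ((P * (Q * W)) * P)" using P Q W by (simp add: mult_assoc_dim)
    then show ?thesis unfolding PQW using P Q W by (simp add: minus_mult_dim mult_minus_dim one_mult_dim)
  qed
  have e2: "Q * (W * (P * (Q * P))) = Q * (W * P) - Q * P"
  proof -
    have "Q * (W * (P * (Q * P))) = Q * ((W * (P * Q)) * P)" using P Q W by (simp add: mult_assoc_dim)
    then show ?thesis unfolding PQW using P Q W by (simp add: minus_mult_dim mult_minus_dim one_mult_dim)
  qed
  have "(1\<^sub>m d - Q * P) * V = 1\<^sub>m d"
    unfolding V_def using P Q W
    by (intro eq_matI) (auto simp: minus_mult_dim mult_add_dim mult_assoc_dim one_mult_dim mult_one_dim e1 simp del: index_mult_mat(1))
  moreover have "V * (1\<^sub>m d - Q * P) = 1\<^sub>m d"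
    unfolding V_def using P Q W
    by (intro eq_matI) (auto simp: mult_minus_dim add_mult_dim mult_assoc_dim one_mult_dim mult_one_dim e2 simp del: index_mult_mat(1))
  ultimately show inv': "invertible_mat (1\<^sub>m d - Q * P)" by (rule invertible_matI[OF c(2)])
  note v = minv_inverse[OF inv' c(2)]
  have "W * P = W * (P * ((1\<^sub>m d - Q * P) * minv (1\<^sub>m d - Q * P)))" unfolding v(2) using P by (simp add: mult_one_dim)
  also have "\<dots> = W * ((1\<^sub>m n - P * Q) * (P * minv (1\<^sub>m d - Q * P)))"
    using P Q v(1) by (simp add: minus_mult_dim mult_minus_dim mult_assoc_dim one_mult_dim)
  also have "\<dots> = (W * (1\<^sub>m n - P * Q)) * (P * minv (1\<^sub>m d - Q * P))"
    using P Q W v(1) c by (intro mult_assoc_dim[symmetric]) auto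
  also have "\<dots> = P * minv (1\<^sub>m d - Q * P)" unfolding w(3) using P v(1) by (simp add: one_mult_dim)
  finally show "minv (1\<^sub>m n - P * Q) * P = P * minv (1\<^sub>m d - Q * P)" unfolding W_def .
qed

text \<open>The images of all coefficients and inputs lie in the column space of \<open>J\<close>.
  This is what factors each coefficient as \<open>J\<close> times \<open>K * A \<alpha>\<close> and
  so makes the compression reversible as far as invertibility is concerned.\<close>

locale compression = linear_system I I n q p A B C
  for I :: "'x set" and n q p :: nat and A B :: "'x \<Rightarrow> 'k::field mat" and C :: "'k mat" +
  fixes d :: nat and J K :: "'k mat"
  assumes J: "J \<in> carrier_mat n d" and K: "K \<in> carrier_mat d n" and KJ: "K * J = 1\<^sub>m d"
    and JKA: "\<And>\<alpha>. \<alpha> \<in> I \<Longrightarrow> J * (K * A \<alpha>) = A \<alpha>" and JKB: "\<And>\<alpha>. \<alpha> \<in> I \<Longrightarrow> J * (K * B \<alpha>) = B \<alpha>"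
begin

lemma JK_reachable: "rch k V \<Longrightarrow> J * (K * V) = V"
proof (induction k V rule: reach.induct)
  case (reach_zero k)
  then show ?case using J K by (simp add: mult_zero_dim)
next
  case (reach_base y P k)
  have "J * (K * (B y * P)) = (J * (K * B y)) * P"
    using J K B_car[OF reach_base(1)] reach_base(2) by (simp add: mult_assoc_dim)
  then show ?case unfolding JKB[OF reach_base(1)] .
next
  case (reach_step \<alpha> k V)
  have "J * (K * (A \<alpha> * V)) = (J * (K * A \<alpha>)) * V"
    using J K A_car[OF reach_step(1)] rch_carrier[OF reach_step(2)] by (simp add: mult_assoc_dim)
  then show ?case unfolding JKA[OF reach_step(1)] .
next
  case (reach_add k V W)
  then show ?case using J K rch_carrier[OF reach_add(1)] rch_carrier[OF reach_add(2)]
    by (simp add: mult_add_dim)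
qed

lemma reach_compressed: "rch k V \<Longrightarrow> reach I I d q (\<lambda>\<alpha>. K * (A \<alpha> * J)) (\<lambda>\<alpha>. K * B \<alpha>) k (K * V)"
proof (induction k V rule: reach.induct)
  case (reach_zero k)
  then show ?case using K by (simp add: mult_zero_dim reach.reach_zero)
next
  case (reach_base y P k)
  have "K * (B y * P) = (K * B y) * P" using K B_car[OF reach_base(1)] reach_base(2) by (simp add: mult_assoc_dim)
  then show ?case using reach.reach_base[OF reach_base, of I d "\<lambda>\<alpha>. K * (A \<alpha> * J)" "\<lambda>\<alpha>. K * B \<alpha>"] by simp
next
  case (reach_step \<alpha> k V)
  have "(K * (A \<alpha> * J)) * (K * V) = K * (A \<alpha> * (J * (K * V)))"
    using J K A_car[OF reach_step(1)] rch_carrier[OF reach_step(2)] by (simp add: mult_assoc_dim)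
  then show ?case using reach.reach_step[OF reach_step(1,3)] unfolding JK_reachable[OF reach_step(2)] by simp
next
  case (reach_add k V W)
  then show ?case using K rch_carrier[OF reach_add(1)] rch_carrier[OF reach_add(2)]
    by (simp add: mult_add_dim reach.reach_add)
qed

lemma coreach_compressed: "crch k U \<Longrightarrow> coreach I d p (\<lambda>\<alpha>. K * (A \<alpha> * J)) (C * J) k (U * J)"
proof (induction k U rule: coreach.induct)
  case (coreach_zero k)
  then show ?case using J by (simp add: zero_mult_dim coreach.coreach_zero)
next
  case (coreach_base P k)
  have "(P * C) * J = P * (C * J)" using J C_car coreach_base by (simp add: mult_assoc_dim)
  then show ?case using coreach.coreach_base[OF coreach_base] by simp
next
  case (coreach_step \<alpha> k U)
  note c = J K A_car[OF coreach_step(1)] crch_carrier[OF coreach_step(2)]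
  have "(U * J) * (K * (A \<alpha> * J)) = U * ((J * (K * A \<alpha>)) * J)" using c by (simp add: mult_assoc_dim)
  also have "\<dots> = (U * A \<alpha>) * J" unfolding JKA[OF coreach_step(1)] using c by (simp add: mult_assoc_dim)
  finally show ?case using coreach.coreach_step[OF coreach_step(1,3)] by simp
next
  case (coreach_add k U W)
  then show ?case using J crch_carrier[OF coreach_add(1)] crch_carrier[OF coreach_add(2)]
    by (simp add: add_mult_dim coreach.coreach_add)
qed

lemma observable_compressed:
  assumes "crch n (1\<^sub>m n)"
  shows "coreach I d p (\<lambda>\<alpha>. K * (A \<alpha> * J)) (C * J) d (1\<^sub>m d)"
proof -
  have "crch d (K * 1\<^sub>m n)" by (rule crch_mult[OF assms K])
  then have "crch d K" using K by (simp add: mult_one_dim)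
  from coreach_compressed[OF this] show ?thesis unfolding KJ .
qed

lemma reachable_compressed:
  assumes "rch d J"
  shows "reach I I d q (\<lambda>\<alpha>. K * (A \<alpha> * J)) (\<lambda>\<alpha>. K * B \<alpha>) d (1\<^sub>m d)"
  using reach_compressed[OF assms] unfolding KJ .

text \<open>The linear form of the large system is P Q with P = I \<otimes> J and Q the form with
  coefficients \<open>K * A \<alpha>\<close>, and that of the small system is Q P;
  \<open>one_minus_swap\<close> applies in both directions.\<close>

theorem transfer_compressed:
  assumes alg: "unital_algebra scale" and x: "\<And>\<alpha>. \<alpha> \<in> I \<Longrightarrow> x \<alpha> \<in> carrier_mat m m"
  shows "invertible_mat (1\<^sub>m (m * n) - lin_form scale I m n n A x) \<longleftrightarrow>
      invertible_mat (1\<^sub>m (m * d) - lin_form scale I m d d (\<lambda>\<alpha>. K * (A \<alpha> * J)) x)"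
    and "invertible_mat (1\<^sub>m (m * n) - lin_form scale I m n n A x) \<Longrightarrow>
      amp scale m (C * J) * (minv (1\<^sub>m (m * d) - lin_form scale I m d d (\<lambda>\<alpha>. K * (A \<alpha> * J)) x) * lin_form scale I m d q (\<lambda>\<alpha>. K * B \<alpha>) x) =
      amp scale m C * (minv (1\<^sub>m (m * n) - lin_form scale I m n n A x) * lin_form scale I m n q B x)"
proof -
  interpret U: unital_algebra scale by (rule alg)
  define P where "P = amp scale m J"
  define Q where "Q = lin_form scale I m d n (\<lambda>\<alpha>. K * A \<alpha>) x"
  define Qb where "Qb = lin_form scale I m d q (\<lambda>\<alpha>. K * B \<alpha>) x"
  have P: "P \<in> carrier_mat (m * n) (m * d)" and Q: "Q \<in> carrier_mat (m * d) (m * n)" and Qb: "Qb \<in> carrier_mat (m * d) (m * q)"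
    using J by (simp_all add: P_def Q_def Qb_def)
  have KA: "K * A \<alpha> \<in> carrier_mat d n" "K * B \<alpha> \<in> carrier_mat d q" if "\<alpha> \<in> I" for \<alpha>
    using K A_car[OF that] B_car[OF that] by auto
  have PQ: "P * Q = lin_form scale I m n n A x"
  proof -
    have "P * Q = lin_form scale I m n n (\<lambda>\<alpha>. J * (K * A \<alpha>)) x"
      unfolding P_def Q_def by (rule U.amp_mult_lin_form[OF J KA(1) x])
    also have "\<dots> = lin_form scale I m n n A x" by (rule lin_form_cong) (rule JKA)
    finally show ?thesis .
  qed
  have PQb: "P * Qb = lin_form scale I m n q B x"
  proof -
    have "P * Qb = lin_form scale I m n q (\<lambda>\<alpha>. J * (K * B \<alpha>)) x"
      unfolding P_def Qb_def by (rule U.amp_mult_lin_form[OF J KA(2) x])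
    also have "\<dots> = lin_form scale I m n q B x" by (rule lin_form_cong) (rule JKB)
    finally show ?thesis .
  qed
  have QP: "Q * P = lin_form scale I m d d (\<lambda>\<alpha>. K * (A \<alpha> * J)) x"
  proof -
    have "Q * P = lin_form scale I m d d (\<lambda>\<alpha>. (K * A \<alpha>) * J) x"
      unfolding P_def Q_def by (rule U.lin_form_mult_amp[OF J KA(1) x])
    also have "\<dots> = lin_form scale I m d d (\<lambda>\<alpha>. K * (A \<alpha> * J)) x"
    proof (rule lin_form_cong)
      show "(K * A \<alpha>) * J = K * (A \<alpha> * J)" if "\<alpha> \<in> I" for \<alpha>
        using K J A_car[OF that] by (simp add: mult_assoc_dim)
    qed
    finally show ?thesis .
  qed
  have iff: "invertible_mat (1\<^sub>m (m * n) - P * Q) \<longleftrightarrow> invertible_mat (1\<^sub>m (m * d) - Q * P)"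
    using one_minus_swap(1)[OF P Q] one_minus_swap(1)[OF Q P] by blast
  then show "invertible_mat (1\<^sub>m (m * n) - lin_form scale I m n n A x) \<longleftrightarrow>
      invertible_mat (1\<^sub>m (m * d) - lin_form scale I m d d (\<lambda>\<alpha>. K * (A \<alpha> * J)) x)"
    unfolding PQ QP .
  assume "invertible_mat (1\<^sub>m (m * n) - lin_form scale I m n n A x)"
  then have inv: "invertible_mat (1\<^sub>m (m * n) - P * Q)" unfolding PQ .
  have c: "1\<^sub>m (m * n) - P * Q \<in> carrier_mat (m * n) (m * n)" "1\<^sub>m (m * d) - Q * P \<in> carrier_mat (m * d) (m * d)"
    using P Q by (auto intro!: minus_carrier_mat)
  note W = minv_inverse(1)[OF inv c(1)] and V = minv_inverse(1)[OF iff[THEN iffD1, OF inv] c(2)]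
  have aC: "amp scale m C \<in> carrier_mat (m * p) (m * n)" using C_car by simp
  have "amp scale m (C * J) = amp scale m C * P" unfolding P_def using C_car J by (intro U.amp_mult[symmetric]) auto
  then have "amp scale m (C * J) * (minv (1\<^sub>m (m * d) - Q * P) * Qb) = amp scale m C * ((P * minv (1\<^sub>m (m * d) - Q * P)) * Qb)"
    using aC C_car P V Qb by (simp add: mult_assoc_dim)
  also have "\<dots> = amp scale m C * (minv (1\<^sub>m (m * n) - P * Q) * (P * Qb))"
    unfolding one_minus_swap(2)[OF P Q inv, symmetric] using W P Qb by (simp add: mult_assoc_dim)
  finally show "amp scale m (C * J) * (minv (1\<^sub>m (m * d) - lin_form scale I m d d (\<lambda>\<alpha>. K * (A \<alpha> * J)) x) * lin_form scale I m d q (\<lambda>\<alpha>. K * B \<alpha>) x) =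
      amp scale m C * (minv (1\<^sub>m (m * n) - lin_form scale I m n n A x) * lin_form scale I m n q B x)"
    unfolding PQ QP PQb Qb_def[symmetric] .
qed

end

subsection \<open>Fornasini--Marchesini realizations as systems\<close>

definition units_map :: "nat \<Rightarrow> nat \<Rightarrow> nat \<Rightarrow> (nat \<times> nat \<Rightarrow> 'k::field mat) \<Rightarrow> 'k mat \<Rightarrow> 'k mat" where
  "units_map s p q G Z = matsum ({..<s} \<times> {..<s}) p q (\<lambda>\<alpha>. Z $$ \<alpha> \<cdot>\<^sub>m G \<alpha>)"

lemma units_map_index:
  assumes "\<And>\<alpha>. G \<alpha> \<in> carrier_mat p q" "u < p" "v < q"
  shows "units_map s p q G Z $$ (u, v) = (\<Sum>a<s. \<Sum>b<s. Z $$ (a, b) * G (a, b) $$ (u, v))"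
proof -
  have "(Z $$ \<alpha> \<cdot>\<^sub>m G \<alpha>) $$ (u, v) = (case \<alpha> of (a, b) \<Rightarrow> Z $$ (a, b) * G (a, b) $$ (u, v))" for \<alpha>
    using assms(1)[of \<alpha>] assms(2,3) by (cases \<alpha>) auto
  then show ?thesis unfolding sum.cartesian_product using assms(2,3) by (simp add: units_map_def)
qed

lemma linear_units_map:
  assumes G: "\<And>\<alpha>. G \<alpha> \<in> carrier_mat p q"
  shows "linear_mat_map s p q (units_map s p q G)"
  unfolding linear_mat_map_def
proof (intro conjI ballI allI)
  show "units_map s p q G X \<in> carrier_mat p q" for X by (simp add: units_map_def)
  note c = this
  show "units_map s p q G (X + Z) = units_map s p q G X + units_map s p q G Z" (is "?l = ?r") if "X \<in> carrier_mat s s" "Z \<in> carrier_mat s s" for X Z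
  proof (rule eq_matI)
    fix u v assume "u < dim_row ?r" "v < dim_col ?r"
    then have uv: "u < p" "v < q" using c[of Z] by auto
    show "?l $$ (u, v) = ?r $$ (u, v)"
      using that uv c[of Z] by (simp add: units_map_index[OF G uv] distrib_right sum.distrib)
  qed (auto simp: carrier_matD[OF c])
  show "units_map s p q G (h \<cdot>\<^sub>m X) = h \<cdot>\<^sub>m units_map s p q G X" (is "?l = ?r") if "X \<in> carrier_mat s s" for h X
  proof (rule eq_matI)
    fix u v assume "u < dim_row ?r" "v < dim_col ?r"
    then have uv: "u < p" "v < q" using c[of X] by auto
    show "?l $$ (u, v) = ?r $$ (u, v)"
      using that uv c[of X] by (simp add: units_map_index[OF G uv] sum_distrib_left mult.assoc)
  qed (auto simp: carrier_matD[OF c])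
qed

lemma units_map_unit:
  assumes G: "\<And>\<alpha>. G \<alpha> \<in> carrier_mat p q" and ab: "a < s" "b < s"
  shows "units_map s p q G (unit_mat s a b) = G (a, b)"
  unfolding units_map_def
proof (rule eq_matI)
  fix u v assume "u < dim_row (G (a, b))" "v < dim_col (G (a, b))"
  then have uv: "u < p" "v < q" using G[of "(a, b)"] by auto
  have "(\<Sum>\<alpha>\<in>{..<s} \<times> {..<s}. (unit_mat s a b $$ \<alpha> \<cdot>\<^sub>m G \<alpha>) $$ (u, v)) = (\<Sum>\<alpha>\<in>{..<s} \<times> {..<s}. if \<alpha> = (a, b) then G (a, b) $$ (u, v) else 0)"
  proof (rule sum.cong[OF refl])
    fix \<alpha> assume "\<alpha> \<in> {..<s} \<times> {..<s}"
    then show "(unit_mat s a b $$ \<alpha> \<cdot>\<^sub>m G \<alpha>) $$ (u, v) = (if \<alpha> = (a, b) then G (a, b) $$ (u, v) else 0)"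
      using G[of \<alpha>] uv by (cases \<alpha>) auto
  qed
  then show "matsum ({..<s} \<times> {..<s}) p q (\<lambda>\<alpha>. unit_mat s a b $$ \<alpha> \<cdot>\<^sub>m G \<alpha>) $$ (u, v) = G (a, b) $$ (u, v)"
    using uv ab by simp
qed (use G[of "(a, b)"] in auto)

lemma linear_mat_map_units:
  assumes T: "linear_mat_map s p q T" and Z: "Z \<in> carrier_mat s s"
  shows "T Z = units_map s p q (\<lambda>(a, b). T (unit_mat s a b)) Z"
proof -
  have Tc: "T X \<in> carrier_mat p q" if "X \<in> carrier_mat s s" for X using T that by (simp add: linear_mat_map_def)
  have "T (matsum F s s (\<lambda>(a, b). Z $$ (a, b) \<cdot>\<^sub>m unit_mat s a b)) = matsum F p q (\<lambda>\<alpha>. Z $$ \<alpha> \<cdot>\<^sub>m (case \<alpha> of (a, b) \<Rightarrow> T (unit_mat s a b)))"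
    if "finite F" for F
    using that
  proof (induction F)
    case empty
    have "T (0 \<cdot>\<^sub>m 0\<^sub>m s s) = 0 \<cdot>\<^sub>m T (0\<^sub>m s s)" using T zero_carrier_mat unfolding linear_mat_map_def by blast
    moreover have "0 \<cdot>\<^sub>m 0\<^sub>m s s = (0\<^sub>m s s :: 'a mat)" by (rule eq_matI) auto
    moreover have "0 \<cdot>\<^sub>m T (0\<^sub>m s s) = 0\<^sub>m p q" using Tc[OF zero_carrier_mat] by (intro eq_matI) auto
    moreover have "matsum {} s s f = (0\<^sub>m s s :: 'a mat)" "matsum {} p q g = (0\<^sub>m p q :: 'a mat)" for f g :: "nat \<times> nat \<Rightarrow> 'a mat"
      by (auto intro!: eq_matI)
    ultimately show ?case by simp
  next
    case (insert \<alpha> F)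
    obtain a b where \<alpha>: "\<alpha> = (a, b)" by (cases \<alpha>)
    note u = Tc[OF unit_mat_carrier, of a b]
    have "matsum (insert \<alpha> F) s s (\<lambda>(a, b). Z $$ (a, b) \<cdot>\<^sub>m unit_mat s a b) =
        Z $$ (a, b) \<cdot>\<^sub>m unit_mat s a b + matsum F s s (\<lambda>(a, b). Z $$ (a, b) \<cdot>\<^sub>m unit_mat s a b)"
      using insert(1,2) by (intro eq_matI) (auto simp: \<alpha>)
    also have "T \<dots> = T (Z $$ (a, b) \<cdot>\<^sub>m unit_mat s a b) + T (matsum F s s (\<lambda>(a, b). Z $$ (a, b) \<cdot>\<^sub>m unit_mat s a b))"
      using T unfolding linear_mat_map_def by (blast intro: smult_carrier_mat unit_mat_carrier matsum_carrier)
    also have "T (Z $$ (a, b) \<cdot>\<^sub>m unit_mat s a b) = Z $$ (a, b) \<cdot>\<^sub>m T (unit_mat s a b)"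
      using T unit_mat_carrier unfolding linear_mat_map_def by blast
    finally show ?case unfolding insert(3) using insert(1,2) u by (intro eq_matI) (auto simp: \<alpha>)
  qed
  from this[of "{..<s} \<times> {..<s}"]
  have "T (matsum ({..<s} \<times> {..<s}) s s (\<lambda>(a, b). Z $$ (a, b) \<cdot>\<^sub>m unit_mat s a b)) = units_map s p q (\<lambda>(a, b). T (unit_mat s a b)) Z"
    by (simp add: units_map_def)
  moreover have "matsum ({..<s} \<times> {..<s}) s s (\<lambda>(a, b). Z $$ (a, b) \<cdot>\<^sub>m unit_mat s a b) = Z" (is "?l = _")
  proof (rule eq_matI)
    fix i j assume "i < dim_row Z" "j < dim_col Z"
    then have ij: "i < s" "j < s" using Z by auto
    have "(\<Sum>\<alpha>\<in>{..<s} \<times> {..<s}. (case \<alpha> of (a, b) \<Rightarrow> Z $$ (a, b) \<cdot>\<^sub>m unit_mat s a b) $$ (i, j)) =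
      (\<Sum>\<alpha>\<in>{..<s} \<times> {..<s}. if \<alpha> = (i, j) then Z $$ (i, j) else 0)"
      using ij by (intro sum.cong) (auto split: if_splits)
    then show "?l $$ (i, j) = Z $$ (i, j)"
      using ij by simp
  qed (use Z in auto)
  ultimately show ?thesis by simp
qed

definition real_A :: "nat \<Rightarrow> ('d, 'k::field) fm_realization \<Rightarrow> 'd \<times> nat \<times> nat \<Rightarrow> 'k mat" where
  "real_A s R = (\<lambda>(k, a, b). fm_A R k (unit_mat s a b))"

definition real_B :: "nat \<Rightarrow> ('d, 'k::field) fm_realization \<Rightarrow> 'd \<times> nat \<times> nat \<Rightarrow> 'k mat" where
  "real_B s R = (\<lambda>(k, a, b). fm_B R k (unit_mat s a b))"

definition real_Lambda where
  "real_Lambda scale s m Y R X = 1\<^sub>m (m * fm_L R) - lin_form scale (letters s) m (fm_L R) (fm_L R) (real_A s R) (centred scale s m Y X)"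

definition real_val where
  "real_val scale s m Y R X = amp scale m (fm_D R) + amp scale m (fm_C R) *
     (minv (real_Lambda scale s m Y R X) * lin_form scale (letters s) m (fm_L R) s (real_B s R) (centred scale s m Y X))"

lemma real_carrier:
  assumes "fm_wf s R"
  shows "real_A s R \<alpha> \<in> carrier_mat (fm_L R) (fm_L R)" "real_B s R \<alpha> \<in> carrier_mat (fm_L R) s"
    "fm_C R \<in> carrier_mat s (fm_L R)" "fm_D R \<in> carrier_mat s s"
  using assms by (auto simp: fm_wf_def linear_mat_map_def real_A_def real_B_def split: prod.split)

lemma real_system:
  assumes "fm_wf s R"
  shows "linear_system (letters s) (letters s) (fm_L R) s s (real_A s R) (real_B s R) (fm_C R)"
  by unfold_locales (use real_carrier[OF assms] in auto)

lemma real_Lambda_carrier: "real_Lambda scale s m Y R X \<in> carrier_mat (m * fm_L R) (m * fm_L R)"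
  unfolding real_Lambda_def by (intro minus_carrier_mat lin_form_carrier)

text \<open>A linear map applied blockwise is the sum over the matrix units of the array of (a, b)
  entries of the blocks, tensored with the value of the map at \<open>E_ab\<close>.\<close>

lemma block_ext_lin_form:
  fixes Y :: "'d::finite \<Rightarrow> 'k::field mat"
  assumes G: "\<And>k. linear_mat_map s p q (G k)" and Y: "Y \<in> tuples s"
  shows "msum (p * m) (q * m) (\<lambda>k. block_ext s p q m (G k) (X k - kron (1\<^sub>m m) (Y k))) =
    lin_form (*) (letters s) m p q (\<lambda>(k, a, b). G k (unit_mat s a b)) (centred (*) s m Y X)" (is "?l = ?r")
proof (rule bmat_eqI[of _ m p m q])
  fix i u j v assume *: "i < m" "u < p" "j < m" "v < q"
  have l: "i * p + u < p * m" "j * q + v < q * m" "i * p + u < m * p" "j * q + v < m * q"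
    using block_index_less[OF *(1,2)] block_index_less[OF *(3,4)] by (simp_all add: mult.commute)
  have Gc: "G k (unit_mat s a b) \<in> carrier_mat p q" for k a b using G[of k] by (simp add: linear_mat_map_def)
  have Yc: "Y k \<in> carrier_mat s s" for k using Y by (simp add: tuples_def)
  have "block_ext s p q m (G k) (X k - kron (1\<^sub>m m) (Y k)) $$ (i * p + u, j * q + v) =
    (\<Sum>a<s. \<Sum>b<s. centred (*) s m Y X (k, a, b) $$ (i, j) * G k (unit_mat s a b) $$ (u, v))" for k
  proof -
    have "block_ext s p q m (G k) (X k - kron (1\<^sub>m m) (Y k)) $$ (i * p + u, j * q + v) =
        G k (mblock s (X k - kron (1\<^sub>m m) (Y k)) i j) $$ (u, v)"
      using * l by (simp add: block_ext_def)
    also have "\<dots> = units_map s p q (\<lambda>(a, b). G k (unit_mat s a b)) (mblock s (X k - kron (1\<^sub>m m) (Y k)) i j) $$ (u, v)"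
      by (subst linear_mat_map_units[OF G[of k]]) (auto simp: mblock_def)
    also have "\<dots> = (\<Sum>a<s. \<Sum>b<s. centred (*) s m Y X (k, a, b) $$ (i, j) * G k (unit_mat s a b) $$ (u, v))"
    proof (subst units_map_index[OF _ *(2,4)])
      show "(case \<alpha> of (a, b) \<Rightarrow> G k (unit_mat s a b)) \<in> carrier_mat p q" for \<alpha> using Gc by (cases \<alpha>) auto
      have "mblock s (X k - kron (1\<^sub>m m) (Y k)) i j $$ (a, b) = centred (*) s m Y X (k, a, b) $$ (i, j)" if "a < s" "b < s" for a b
        using that * block_index_less[OF *(1) that(1)] block_index_less[OF *(3) that(2)] Yc[of k]
          kron_index[OF one_carrier_mat[of m] Yc[of k] *(1) that(1) *(3) that(2)]
        by (simp add: mblock_def centred_def)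
      then show "(\<Sum>a<s. \<Sum>b<s. mblock s (X k - kron (1\<^sub>m m) (Y k)) i j $$ (a, b) * (case (a, b) of (a, b) \<Rightarrow> G k (unit_mat s a b)) $$ (u, v)) =
        (\<Sum>a<s. \<Sum>b<s. centred (*) s m Y X (k, a, b) $$ (i, j) * G k (unit_mat s a b) $$ (u, v))"
        by simp
    qed
    finally show ?thesis .
  qed
  moreover have "?r $$ (i * p + u, j * q + v) =
      (\<Sum>k\<in>UNIV. \<Sum>a<s. \<Sum>b<s. centred (*) s m Y X (k, a, b) $$ (i, j) * G k (unit_mat s a b) $$ (u, v))"
    using l by (simp add: lin_form_def sum_letters kron_index[OF centred_carrier Gc *])
  ultimately show "?l $$ (i * p + u, j * q + v) = ?r $$ (i * p + u, j * q + v)"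
    using l by (simp add: msum_def)
qed (auto simp: msum_matsum mult.commute[of m])

text \<open>An s \<times> s matrix over the algebra is a single block, so evaluation over algebras
  is the case m = 1 of the same linear form.\<close>

lemma (in unital_algebra) alg_ext_lin_form:
  fixes Y :: "'d::finite \<Rightarrow> 'k mat"
  assumes G: "\<And>k. linear_mat_map s p q (G k)" and Y: "Y \<in> tuples s"
  shows "msum p q (\<lambda>k. alg_ext scale s p q (G k) (X k - scalar_mat scale (Y k))) =
    lin_form scale (letters s) 1 p q (\<lambda>(k, a, b). G k (unit_mat s a b)) (centred scale s 1 Y X)"
proof (rule eq_matI)
  let ?r = "lin_form scale (letters s) 1 p q (\<lambda>(k, a, b). G k (unit_mat s a b)) (centred scale s 1 Y X)"
  fix u v assume "u < dim_row ?r" "v < dim_col ?r"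
  then have uv: "u < p" "v < q" by auto
  have Gc: "scalar_mat scale (G k (unit_mat s a b)) \<in> carrier_mat p q" for k a b
    using G[of k] unfolding linear_mat_map_def scalar_mat_def by simp
  have Yc: "Y k \<in> carrier_mat s s" for k using Y by (simp add: tuples_def)
  have "kron (centred scale s 1 Y X (k, a, b)) (scalar_mat scale (G k (unit_mat s a b))) $$ (u, v) =
      scale (G k (unit_mat s a b) $$ (u, v)) ((X k - scalar_mat scale (Y k)) $$ (a, b))" if "a < s" "b < s" for k a b
    using kron_index[OF centred_carrier Gc zero_less_Suc[of 0] uv(1) zero_less_Suc[of 0] uv(2), of scale s Y X "(k, a, b)" k a b]
      that uv Yc[of k] Gc[of k a b] by (simp add: centred_def scalar_mat_def)
  then show "msum p q (\<lambda>k. alg_ext scale s p q (G k) (X k - scalar_mat scale (Y k))) $$ (u, v) = ?r $$ (u, v)"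
    using uv by (simp add: msum_def alg_ext_def lin_form_def sum_letters)
qed (auto simp: msum_def)

lemma kron_one_left: "kron (1\<^sub>m (Suc 0)) A = (A :: 'a::semiring_1 mat)"
  by (rule eq_matI) (auto simp: kron_def)

context
  fixes s :: nat and Y :: "'d::finite \<Rightarrow> 'k::field mat" and R :: "('d, 'k) fm_realization"
  assumes wf: "fm_wf s R" and Y: "Y \<in> tuples s"
begin

lemma fm_Lambda_eq: "fm_Lambda s m Y R X = real_Lambda (*) s m Y R X"
  unfolding fm_Lambda_def real_Lambda_def real_A_def
  using wf by (subst block_ext_lin_form[OF _ Y]) (auto simp: fm_wf_def mult.commute)

lemma fm_Omega_eq: "fm_Omega s m Y R = {X \<in> tuples (m * s). invertible_mat (real_Lambda (*) s m Y R X)}"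
  unfolding fm_Omega_def fm_Lambda_eq invertible_mat_iff_det[OF real_Lambda_carrier] by (simp add: mult.commute)

lemma fm_eval_eq:
  assumes "invertible_mat (real_Lambda (*) s m Y R X)"
  shows "fm_eval s m Y R X = real_val (*) s m Y R X"
proof -
  have "msum (fm_L R * m) (s * m) (\<lambda>k. block_ext s (fm_L R) s m (fm_B R k) (X k - kron (1\<^sub>m m) (Y k))) =
      lin_form (*) (letters s) m (fm_L R) s (real_B s R) (centred (*) s m Y X)"
    unfolding real_B_def using wf by (intro block_ext_lin_form[OF _ Y]) (auto simp: fm_wf_def)
  then show ?thesis
    unfolding fm_eval_def fm_Lambda_eq real_val_def
    using minv_inverse(1)[OF assms real_Lambda_carrier] real_carrier(3)[OF wf]
    by (simp add: amp_def mult_assoc_dim)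
qed

lemma alg_Lambda_eq:
  assumes "unital_algebra scale"
  shows "alg_Lambda scale s Y R X = real_Lambda scale s 1 Y R X"
  unfolding alg_Lambda_def real_Lambda_def real_A_def
  using wf by (subst unital_algebra.alg_ext_lin_form[OF assms _ Y]) (auto simp: fm_wf_def)

lemma alg_eval_eq:
  assumes "unital_algebra scale" "invertible_mat (real_Lambda scale s 1 Y R X)"
  shows "alg_eval scale s Y R X = real_val scale s 1 Y R X"
proof -
  have "msum (fm_L R) s (\<lambda>k. alg_ext scale s (fm_L R) s (fm_B R k) (X k - scalar_mat scale (Y k))) =
      lin_form scale (letters s) 1 (fm_L R) s (real_B s R) (centred scale s 1 Y X)"
    unfolding real_B_def using wf by (intro unital_algebra.alg_ext_lin_form[OF assms(1) _ Y]) (auto simp: fm_wf_def)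
  then show ?thesis
    unfolding alg_eval_def alg_Lambda_eq[OF assms(1)] real_val_def
    using minv_inverse(1)[OF assms(2) real_Lambda_carrier] real_carrier(3)[OF wf]
    by (simp add: amp_def mult_assoc_dim kron_one_left scalar_mat_def)
qed

end

text \<open>Stronger than realizing the function: the two regular sets coincide, and over the
  algebra given by \<open>scale\<close>. This is the property that survives compression.\<close>

definition models :: "('k \<Rightarrow> 'a \<Rightarrow> 'a::ring_1) \<Rightarrow> nat \<Rightarrow> ('d::finite \<Rightarrow> 'k::field mat) \<Rightarrow> ('d, 'k) pencil \<Rightarrow> ('d, 'k) fm_realization \<Rightarrow> bool" where
  "models scale s Y M R \<longleftrightarrow> (\<forall>m. \<forall>X\<in>tuples (m * s).
     (invertible_mat (real_Lambda scale s m Y R X) \<longleftrightarrow> invertible_mat (pen_at scale (m * s) M X)) \<and>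
     (invertible_mat (pen_at scale (m * s) M X) \<longrightarrow> real_val scale s m Y R X = pen_val scale (m * s) M X))"

lemma models_compressed:
  fixes scale :: "'k::field \<Rightarrow> 'a::ring_1 \<Rightarrow> 'a" and Y :: "'d::finite \<Rightarrow> 'k mat"
  assumes alg: "unital_algebra scale" and mod: "models scale s Y M R'"
    and comp: "compression (letters s) (fm_L R') s s (real_A s R') (real_B s R') (fm_C R') (fm_L R) J K"
    and R: "fm_D R = fm_D R'" "fm_C R = fm_C R' * J"
      "\<And>\<alpha>. \<alpha> \<in> letters s \<Longrightarrow> real_A s R \<alpha> = K * (real_A s R' \<alpha> * J)"
      "\<And>\<alpha>. \<alpha> \<in> letters s \<Longrightarrow> real_B s R \<alpha> = K * real_B s R' \<alpha>"
  shows "models scale s Y M R"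
  unfolding models_def
proof (intro allI ballI)
  interpret compression "letters s" "fm_L R'" s s "real_A s R'" "real_B s R'" "fm_C R'" "fm_L R" J K by (rule comp)
  fix m and X :: "'d \<Rightarrow> 'a mat" assume X: "X \<in> tuples (m * s)"
  have e: "lin_form scale (letters s) m (fm_L R) (fm_L R) (real_A s R) x = lin_form scale (letters s) m (fm_L R) (fm_L R) (\<lambda>\<alpha>. K * (real_A s R' \<alpha> * J)) x"
    "lin_form scale (letters s) m (fm_L R) s (real_B s R) x = lin_form scale (letters s) m (fm_L R) s (\<lambda>\<alpha>. K * real_B s R' \<alpha>) x" for x
    by (rule lin_form_cong, rule R(3), assumption) (rule lin_form_cong, rule R(4))
  note t = transfer_compressed[OF alg, of "centred scale s m Y X" m, OF centred_carrier]
  from mod X t show "(invertible_mat (real_Lambda scale s m Y R X) \<longleftrightarrow> invertible_mat (pen_at scale (m * s) M X)) \<and>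
     (invertible_mat (pen_at scale (m * s) M X) \<longrightarrow> real_val scale s m Y R X = pen_val scale (m * s) M X)"
    unfolding models_def real_Lambda_def real_val_def e R(1,2) by auto
qed

text \<open>With l the linear form of the system, \<Lambda>^-1 = 1 + \<Lambda>^-1 l, so C
  \<Lambda>^-1 B = C B + C \<Lambda>^-1 (l B). This splits off the constant term C B and makes the
  input linear, with coefficients \<open>A \<alpha>\<close> B.\<close>

definition pencil_fm :: "nat \<Rightarrow> ('d::finite \<Rightarrow> 'k::field mat) \<Rightarrow> ('d, 'k) pencil \<Rightarrow> ('d, 'k) fm_realization" where
  "pencil_fm s Y M = \<lparr>fm_L = pen_N M * s, fm_D = sys_C s M * sys_B s Y M, fm_C = sys_C s M,
     fm_A = \<lambda>k. units_map s (pen_N M * s) (pen_N M * s) (\<lambda>(a, b). sys_A s Y M (k, a, b)),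
     fm_B = \<lambda>k. units_map s (pen_N M * s) s (\<lambda>(a, b). sys_A s Y M (k, a, b) * sys_B s Y M)\<rparr>"

lemma pencil_fm_realizes:
  fixes scale :: "'k::field \<Rightarrow> 'a::ring_1 \<Rightarrow> 'a" and Y :: "'d::finite \<Rightarrow> 'k mat"
  assumes reg: "regular_at s Y M"
  shows "fm_wf s (pencil_fm s Y M)"
    and "\<alpha> \<in> letters s \<Longrightarrow> real_A s (pencil_fm s Y M) \<alpha> = sys_A s Y M \<alpha>"
    and "\<alpha> \<in> letters s \<Longrightarrow> real_B s (pencil_fm s Y M) \<alpha> = sys_A s Y M \<alpha> * sys_B s Y M"
    and "unital_algebra scale \<Longrightarrow> models scale s Y M (pencil_fm s Y M)"
proof -
  note r = regular_atD[OF reg]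
  note c = pen_sys_carrier[OF r(1,3)]
  let ?R = "pencil_fm s Y M" and ?n = "pen_N M * s"
  have cAB: "sys_A s Y M \<alpha> * sys_B s Y M \<in> carrier_mat ?n s" for \<alpha> by (rule mult_carrier_mat[OF c(1,2)])
  show "fm_wf s ?R"
    unfolding fm_wf_def pencil_fm_def using c cAB
    by (auto intro!: linear_units_map mult_carrier_mat split: prod.split)
  show A: "real_A s ?R \<alpha> = sys_A s Y M \<alpha>" if "\<alpha> \<in> letters s" for \<alpha>
  proof -
    obtain k a b where \<alpha>: "\<alpha> = (k, a, b)" "a < s" "b < s" using \<open>\<alpha> \<in> letters s\<close> by (auto simp: letters_def)
    have "(case \<gamma> of (a, b) \<Rightarrow> sys_A s Y M (k, a, b)) \<in> carrier_mat ?n ?n" for \<gamma> using c(1) by (cases \<gamma>) simp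
    from units_map_unit[of "\<lambda>(a, b). sys_A s Y M (k, a, b)", OF this \<alpha>(2,3)] show ?thesis by (simp add: \<alpha> real_A_def pencil_fm_def)
  qed
  show B: "real_B s ?R \<alpha> = sys_A s Y M \<alpha> * sys_B s Y M" if "\<alpha> \<in> letters s" for \<alpha>
  proof -
    obtain k a b where \<alpha>: "\<alpha> = (k, a, b)" "a < s" "b < s" using \<open>\<alpha> \<in> letters s\<close> by (auto simp: letters_def)
    have "(case \<gamma> of (a, b) \<Rightarrow> sys_A s Y M (k, a, b) * sys_B s Y M) \<in> carrier_mat ?n s" for \<gamma> using cAB by (cases \<gamma>) simp
    from units_map_unit[of "\<lambda>(a, b). sys_A s Y M (k, a, b) * sys_B s Y M", OF this \<alpha>(2,3)] show ?thesis by (simp add: \<alpha> real_B_def pencil_fm_def)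
  qed
  show "models scale s Y M ?R" if alg: "unital_algebra scale"
    unfolding models_def
  proof (intro allI ballI)
    interpret unital_algebra scale by (rule alg)
    fix m and X :: "'d \<Rightarrow> 'a mat" assume X: "X \<in> tuples (m * s)"
    let ?l = "lin_form scale (letters s) m ?n ?n (sys_A s Y M) (centred scale s m Y X)"
    let ?b = "amp scale m (sys_B s Y M)"
    have sel: "fm_L ?R = ?n" by (simp add: pencil_fm_def)
    have "lin_form scale (letters s) m ?n ?n (real_A s ?R) (centred scale s m Y X) = ?l"
      by (rule lin_form_cong) (rule A)
    then have L: "real_Lambda scale s m Y ?R X = sys_Lambda scale s m Y M X"
      by (simp add: real_Lambda_def sys_Lambda_def sel)
    have "lin_form scale (letters s) m ?n s (real_B s ?R) (centred scale s m Y X) =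
        lin_form scale (letters s) m ?n s (\<lambda>\<alpha>. sys_A s Y M \<alpha> * sys_B s Y M) (centred scale s m Y X)"
      by (rule lin_form_cong) (rule B)
    also have "\<dots> = ?l * ?b" by (rule lin_form_mult_amp[OF c(2) c(1) centred_carrier, symmetric])
    finally have lB: "lin_form scale (letters s) m (fm_L ?R) s (real_B s ?R) (centred scale s m Y X) = ?l * ?b"
      unfolding sel .
    have "real_val scale s m Y ?R X = pen_val scale (m * s) M X" if inv: "invertible_mat (pen_at scale (m * s) M X)"
    proof -
      have inv': "invertible_mat (sys_Lambda scale s m Y M X)" using pencil_sys(1)[OF r(1,3,2) X] inv by simp
      define W where "W = minv (sys_Lambda scale s m Y M X)"
      note w = minv_inverse[OF inv' sys_Lambda_carrier, folded W_def]
      have l: "?l \<in> carrier_mat (m * ?n) (m * ?n)" by simp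
      have b: "?b \<in> carrier_mat (m * ?n) (m * s)" using c(2) by simp
      have cc: "amp scale m (sys_C s M) \<in> carrier_mat (m * s) (m * ?n)" using c(3) by simp
      have "W - W * ?l = 1\<^sub>m (m * ?n)"
        using w l unfolding sys_Lambda_def by (simp add: mult_minus_dim mult_one_dim)
      moreover have "(W - W * ?l) + W * ?l = W"
        using w(1) l by (intro eq_matI) (auto simp del: index_mult_mat(1))
      ultimately have W: "1\<^sub>m (m * ?n) + W * ?l = W" by simp
      have "real_val scale s m Y ?R X = amp scale m (sys_C s M * sys_B s Y M) + amp scale m (sys_C s M) * (W * (?l * ?b))"
        unfolding real_val_def L lB W_def by (simp add: pencil_fm_def)
      also have "amp scale m (sys_C s M * sys_B s Y M) = amp scale m (sys_C s M) * (1\<^sub>m (m * ?n) * ?b)"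
        using c b by (simp add: amp_mult one_mult_dim)
      also have "\<dots> + amp scale m (sys_C s M) * (W * (?l * ?b)) = amp scale m (sys_C s M) * ((1\<^sub>m (m * ?n) + W * ?l) * ?b)"
        using w(1) l b cc c(2,3) by (simp add: add_mult_dim mult_add_dim mult_assoc_dim)
      finally show ?thesis unfolding W unfolding pencil_sys(2)[OF r(1,3,2) X inv] W_def .
    qed
    then show "(invertible_mat (real_Lambda scale s m Y ?R X) \<longleftrightarrow> invertible_mat (pen_at scale (m * s) M X)) \<and>
       (invertible_mat (pen_at scale (m * s) M X) \<longrightarrow> real_val scale s m Y ?R X = pen_val scale (m * s) M X)"
      unfolding L pencil_sys(1)[OF r(1,3,2) X] by blast
  qed
qed


subsection \<open>Minimal realizations\<close>

lemma reach_cong: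
  assumes "\<And>\<alpha>. \<alpha> \<in> I \<Longrightarrow> A \<alpha> = A' \<alpha>" "\<And>y. y \<in> H \<Longrightarrow> B y = B' y"
  shows "reach I H n q A B k V \<Longrightarrow> reach I H n q A' B' k V"
proof (induction k V rule: reach.induct)
  case (reach_base y P k)
  then show ?case using reach.reach_base[of y H P q k I n A' B'] assms(2) by simp
next
  case (reach_step \<alpha> k V)
  then show ?case using reach.reach_step[of \<alpha> I H n q A' B' k V] assms(1) by simp
qed (auto intro: reach.intros)

lemma coreach_cong:
  assumes "\<And>\<alpha>. \<alpha> \<in> I \<Longrightarrow> A \<alpha> = A' \<alpha>"
  shows "coreach I n p A C k U \<Longrightarrow> coreach I n p A' C k U"
proof (induction k U rule: coreach.induct)
  case (coreach_step \<alpha> k U)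
  then show ?case using coreach.coreach_step[of \<alpha> I n p A' C k U] assms by simp
qed (auto intro: coreach.intros)

definition reduced :: "nat \<Rightarrow> ('d::finite, 'k::field) fm_realization \<Rightarrow> bool" where
  "reduced s R \<longleftrightarrow> fm_wf s R \<and>
     reach (letters s) (letters s) (fm_L R) s (real_A s R) (real_B s R) (fm_L R) (1\<^sub>m (fm_L R)) \<and>
     coreach (letters s) (fm_L R) s (real_A s R) (fm_C R) (fm_L R) (1\<^sub>m (fm_L R))"

lemma linear_mat_map_mult:
  assumes T: "linear_mat_map s p q T" and K: "K \<in> carrier_mat p' p"
  shows "linear_mat_map s p' q (\<lambda>X. K * T X)"
proof -
  have c: "T X \<in> carrier_mat p q" if "X \<in> carrier_mat s s" for X using T that by (simp add: linear_mat_map_def)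
  show ?thesis
    unfolding linear_mat_map_def
  proof (intro conjI ballI allI)
    fix X :: "'a mat" assume X: "X \<in> carrier_mat s s"
    show "K * T X \<in> carrier_mat p' q" by (rule mult_carrier_mat[OF K c[OF X]])
    show "K * T (h \<cdot>\<^sub>m X) = h \<cdot>\<^sub>m (K * T X)" for h
      using T X mult_smult_distrib[OF K c[OF X], of h] by (simp add: linear_mat_map_def)
    show "K * T (X + Z) = K * T X + K * T Z" if Z: "Z \<in> carrier_mat s s" for Z
      using T X Z mult_add_distrib_mat[OF K c[OF X] c[OF Z]] by (simp add: linear_mat_map_def)
  qed
qed

lemma linear_mat_map_mult_right:
  assumes T: "linear_mat_map s p q T" and J: "J \<in> carrier_mat q q'"
  shows "linear_mat_map s p q' (\<lambda>X. T X * J)"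
proof -
  have c: "T X \<in> carrier_mat p q" if "X \<in> carrier_mat s s" for X using T that by (simp add: linear_mat_map_def)
  show ?thesis
    unfolding linear_mat_map_def
  proof (intro conjI ballI allI)
    fix X :: "'a mat" assume X: "X \<in> carrier_mat s s"
    show "T X * J \<in> carrier_mat p q'" by (rule mult_carrier_mat[OF c[OF X] J])
    show "T (h \<cdot>\<^sub>m X) * J = h \<cdot>\<^sub>m (T X * J)" for h
      using T X mult_smult_assoc_mat[OF c[OF X] J, of h] by (simp add: linear_mat_map_def)
    show "T (X + Z) * J = T X * J + T Z * J" if Z: "Z \<in> carrier_mat s s" for Z
      using T X Z add_mult_distrib_mat[OF c[OF X] c[OF Z] J] by (simp add: linear_mat_map_def)
  qed
qed

lemma linear_mat_map_eqI:
  assumes T: "linear_mat_map s p q T" "linear_mat_map s p q T'"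
    and eq: "\<And>a b. a < s \<Longrightarrow> b < s \<Longrightarrow> T (unit_mat s a b) = T' (unit_mat s a b)" and X: "X \<in> carrier_mat s s"
  shows "T X = T' X"
  unfolding linear_mat_map_units[OF T(1) X] linear_mat_map_units[OF T(2) X] units_map_def
  by (rule matsum_cong) (use eq in auto)

context function_pencil
begin

lemma M_regular: "regular_at s Y M"
  using min by (simp add: minimal_at_def)

lemma Y_tuples: "Y \<in> tuples s"
  using M_regular by (simp add: regular_at_def)

lemma models_realizes:
  assumes wf: "fm_wf s R" and mod: "models (*) s Y M R"
  shows "fm_realizes s Y r R"
    and "m > 0 \<Longrightarrow> rat_dom (s * m) r = fm_Omega s m Y R"
proof -
  show dom: "rat_dom (s * m) r = fm_Omega s m Y R" if "m > 0" for m
    using mod s0 that unfolding fm_Omega_eq[OF wf Y_tuples] by (subst rat_dom_pencil) (auto simp: models_def mult.commute)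
  have "rat_val (s * m) r X = fm_eval s m Y R X" if m: "m > 0" and X: "X \<in> rat_dom (s * m) r" for m X
  proof -
    have "s * m > 0" using m s0 by simp
    note p = rat_dom_pencil[OF this] rat_val_pencil[OF X this]
    have t: "X \<in> tuples (m * s)" "invertible_mat (pen_at (*) (m * s) M X)" using X p(1) by (auto simp: mult.commute)
    then have "invertible_mat (real_Lambda (*) s m Y R X)" "real_val (*) s m Y R X = pen_val (*) (m * s) M X"
      using mod by (auto simp: models_def)
    then show ?thesis using p(2) fm_eval_eq[OF wf Y_tuples, of m X] by (simp add: mult.commute)
  qed
  then show "fm_realizes s Y r R" using wf dom by (simp add: fm_realizes_def)
qed

lemma realizes_word_point:
  assumes R: "fm_realizes s Y r R" and w: "w \<in> lists (letters s)"
  shows "real_val (*) s (Suc (length w)) Y R (word_point s Y w) = rat_val (s * Suc (length w)) r (word_point s Y w)"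
proof -
  let ?m = "Suc (length w)" and ?X = "word_point s Y w"
  have wf: "fm_wf s R" using R by (simp add: fm_realizes_def)
  have "?X \<in> rat_dom (s * ?m) r"
    using pencil_word_point(1)[OF M_regular w] word_point_tuples[of s Y w] s0 by (subst rat_dom_pencil) (auto simp: mult.commute)
  then have "?X \<in> fm_Omega s ?m Y R" "rat_val (s * ?m) r ?X = fm_eval s ?m Y R ?X"
    using R zero_less_Suc unfolding fm_realizes_def by blast+
  then show ?thesis using fm_eval_eq[OF wf Y_tuples] unfolding fm_Omega_eq[OF wf Y_tuples] by auto
qed

text \<open>The constant term \<open>fm_D\<close> occupies diagonal blocks only, so the top right
  block of the value at the word point of a nonempty word is the moment alone.\<close>

lemma realizes_moment:
  assumes R: "fm_realizes s Y r R" and w: "w \<in> lists (letters s)" and \<beta>: "\<beta> \<in> letters s" and ab: "a < s" "b < s"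
  defines "v \<equiv> w @ [\<beta>]"
  shows "(fm_C R * (wprod (fm_L R) (real_A s R) w * real_B s R \<beta>)) $$ (a, b) =
    rat_val (s * Suc (length v)) r (word_point s Y v) $$ (a, length v * s + b)"
proof -
  have wf: "fm_wf s R" using R by (simp add: fm_realizes_def)
  note c = real_carrier[OF wf]
  have v: "v \<in> lists (letters s)" using w \<beta> by (simp add: v_def)
  interpret word_system s "fm_L R" Y "real_A s R" v by unfold_locales (use c v in auto)
  note val = word_value_input[OF c(3), of "real_B s R" s a b w \<beta>, OF c(2) ab meta_eq_to_obj_eq[OF v_def]]
  have cc: "amp (*) m (fm_C R) * (minv \<Lambda> * lin_form (*) (letters s) m (fm_L R) s (real_B s R) (centred (*) s m Y (word_point s Y v))) \<in> carrier_mat (m * s) (m * s)"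
    using c Lambda_word by (intro mult_carrier_mat[of _ _ "m * fm_L R"]) auto
  have l: "a < m * s" "length v * s + b < m * s" using ab block_index_less[OF lessI ab(2), of "length v"] by auto
  have "amp (*) m (fm_D R) $$ (0 * s + a, length v * s + b) = 0"
    unfolding amp_def scalar_mat_field using ab v_def
    by (subst kron_index[OF one_carrier_mat[of m] c(4)]) auto
  moreover have "real_val (*) s m Y R (word_point s Y v) $$ (a, length v * s + b) = amp (*) m (fm_D R) $$ (a, length v * s + b) +
      (amp (*) m (fm_C R) * (minv \<Lambda> * lin_form (*) (letters s) m (fm_L R) s (real_B s R) (centred (*) s m Y (word_point s Y v)))) $$
        (a, length v * s + b)"
    unfolding real_val_def real_Lambda_def by (rule index_add_mat(1)) (simp_all only: carrier_matD[OF cc] l)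
  ultimately have "real_val (*) s m Y R (word_point s Y v) $$ (a, length v * s + b) = (fm_C R * (wprod (fm_L R) (real_A s R) w * real_B s R \<beta>)) $$ (a, b)"
    unfolding val by simp
  then show ?thesis unfolding realizes_word_point[OF R v] ..
qed

text \<open>The empty word gives the centre itself, where the linear form in the input
  vanishes.\<close>

lemma realizes_D:
  assumes R: "fm_realizes s Y r R"
  shows "fm_D R = rat_val (s * 1) r (word_point s Y [])"
proof -
  have wf: "fm_wf s R" using R by (simp add: fm_realizes_def)
  note c = real_carrier[OF wf]
  interpret word_system s "fm_L R" Y "real_A s R" "[]" by unfold_locales (use c in auto)
  have "lin_form (*) (letters s) m (fm_L R) s (real_B s R) (centred (*) s m Y (word_point s Y [])) =
      bmat m m (fm_L R) s (\<lambda>i j. if j = Suc i then real_B s R ([] ! i) else 0\<^sub>m (fm_L R) s)"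
    by (rule lin_form_word_point) (use c in auto)
  also have "\<dots> = 0\<^sub>m (m * fm_L R) (m * s)" by (rule eq_matI) (auto simp: bmat_def)
  finally have z: "lin_form (*) (letters s) m (fm_L R) s (real_B s R) (centred (*) s m Y (word_point s Y [])) = 0\<^sub>m (m * fm_L R) (m * s)" .
  have "real_val (*) s m Y R (word_point s Y []) = amp (*) m (fm_D R)"
    unfolding real_val_def real_Lambda_def z using c Lambda_word
    by (intro eq_matI) (auto simp: mult_zero_dim simp del: index_mult_mat(1))
  also have "\<dots> = fm_D R" by (simp add: amp_def kron_one_left)
  finally show ?thesis using realizes_word_point[OF R, of "[]"] by simp
qed

text \<open>Moments are read off from values of the function at word points, which all realizations
  share.\<close>

lemma realizes_system_pair:
  assumes R: "fm_realizes s Y r R" "reduced s R" and R': "fm_realizes s Y r R'"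
  shows "system_pair (letters s) (letters s) (fm_L R) (fm_L R') s s (real_A s R) (real_A s R') (real_B s R) (real_B s R') (fm_C R) (fm_C R')"
proof -
  have wf: "fm_wf s R" "fm_wf s R'" using R(1) R' by (simp_all add: fm_realizes_def)
  interpret S: linear_system "letters s" "letters s" "fm_L R" s s "real_A s R" "real_B s R" "fm_C R" by (rule real_system[OF wf(1)])
  interpret S': linear_system "letters s" "letters s" "fm_L R'" s s "real_A s R'" "real_B s R'" "fm_C R'" by (rule real_system[OF wf(2)])
  show ?thesis
  proof unfold_locales
    fix w :: "('d \<times> nat \<times> nat) list" and \<beta> :: "'d \<times> nat \<times> nat" assume w: "w \<in> lists (letters s)" and \<beta>: "\<beta> \<in> letters s"
    note c = S.C_car S.wprod_car[OF w] S.B_car[OF \<beta>] S'.C_car S'.wprod_car[OF w] S'.B_car[OF \<beta>]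
    show "fm_C R * (wprod (fm_L R) (real_A s R) w * real_B s R \<beta>) = fm_C R' * (wprod (fm_L R') (real_A s R') w * real_B s R' \<beta>)"
      (is "?l = ?r")
    proof (rule eq_matI)
      fix a b assume "a < dim_row ?r" "b < dim_col ?r"
      then have "a < s" "b < s" using c by auto
      then show "?l $$ (a, b) = ?r $$ (a, b)" using realizes_moment[OF R(1) w \<beta>] realizes_moment[OF R' w \<beta>] by simp
    qed (use c in auto)
  qed (use R(2) in \<open>auto simp: reduced_def\<close>)
qed

text \<open>The realization \<open>pencil_fm\<close> inherits observability from the minimal pencil,
  but its inputs are only the products \<open>A \<alpha>\<close> B, so it may fail to be reachable.
  Compressing it to its reachable states keeps observability and the regular set.\<close>

lemma reduced_exists:
  "\<exists>R. reduced s R \<and> models (*) s Y M R \<and> (\<forall>scale :: 'k \<Rightarrow> 'a::ring_1 \<Rightarrow> 'a. unital_algebra scale \<longrightarrow> models scale s Y M R)"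
proof -
  define F where "F = pencil_fm s Y M"
  note F = pencil_fm_realizes[OF M_regular, folded F_def]
  have L: "fm_L F = pen_N M * s" "fm_C F = sys_C s M" by (simp_all add: F_def pencil_fm_def)
  note c = real_carrier[OF F(1)] and pc = pen_sys_carrier[OF M_wf regular_atD(3)[OF M_regular]]
  interpret S: linear_system "letters s" "letters s" "fm_L F" s s "real_A s F" "real_B s F" "fm_C F" by (rule real_system[OF F(1)])
  interpret P: linear_system "letters s" "UNIV :: unit set" "pen_N M * s" s s "sys_A s Y M" "\<lambda>_. sys_B s Y M" "sys_C s M"
    by (rule pen_system[OF M_regular])
  note MR = minimal_reachable_observable[OF min s0]
  \<comment> \<open>One letter turns the constant input of the pencil into an input of the
    realization; so each letter sends states reachable in the pencil to states reachable in the
    realization.\<close>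
  have step: "\<forall>\<alpha>\<in>letters s. S.rch k (real_A s F \<alpha> * V)" if "P.rch k V" for k V
    using that
  proof (induction k V rule: reach.induct)
    case (reach_zero k)
    have "real_A s F \<alpha> * 0\<^sub>m (pen_N M * s) k = 0\<^sub>m (fm_L F) k" for \<alpha> using c(1)[of \<alpha>] by (simp add: L mult_zero_dim)
    then show ?case by (simp add: reach.reach_zero)
  next
    case (reach_base y Q k)
    have "real_A s F \<alpha> * (sys_B s Y M * Q) = real_B s F \<alpha> * Q" if "\<alpha> \<in> letters s" for \<alpha>
      unfolding F(2,3)[OF that] using pc(1)[of \<alpha>] pc(2) reach_base by (simp add: mult_assoc_dim)
    then show ?case using reach_base(2) by (simp add: reach.reach_base)
  next
    case (reach_step \<beta> k V)
    then show ?case using reach.reach_step F(2)[OF reach_step(1)] by fastforce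
  next
    case (reach_add k V W)
    have "real_A s F \<alpha> * (V + W) = real_A s F \<alpha> * V + real_A s F \<alpha> * W" for \<alpha>
      using c(1)[of \<alpha>] P.rch_carrier[OF reach_add(1)] P.rch_carrier[OF reach_add(2)] by (simp add: L mult_add_dim)
    then show ?case using reach_add(3,4) by (simp add: reach.reach_add)
  qed
  \<comment> \<open>All states of the minimal pencil are reachable, so the full image of every
    coefficient is reachable in the realization. This is the factorization property demanded by
    \<open>compression\<close>.\<close>
  have rA: "S.rch (fm_L F) (real_A s F \<alpha>)" if "\<alpha> \<in> letters s" for \<alpha>
  proof -
    have "S.rch (pen_N M * s) (real_A s F \<alpha> * 1\<^sub>m (pen_N M * s))" using step[OF MR(1)] that by blast
    then show ?thesis using c(1)[of \<alpha>] by (simp add: L mult_one_dim)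
  qed
  have rB: "S.rch s (real_B s F \<alpha>)" if "\<alpha> \<in> letters s" for \<alpha>
    using reach.reach_base[OF that one_carrier_mat[of s], of "letters s" "fm_L F" "real_A s F" "real_B s F"] c(2)[of \<alpha>]
    by (simp add: mult_one_dim)
  obtain d J K where JK: "S.rch d J" "J \<in> carrier_mat (fm_L F) d" "K \<in> carrier_mat d (fm_L F)" "K * J = 1\<^sub>m d"
    "\<And>k V. S.rch k V \<Longrightarrow> J * (K * V) = V" using S.reach_basis by blast
  interpret compression "letters s" "fm_L F" s s "real_A s F" "real_B s F" "fm_C F" d J K
    by unfold_locales (fact JK(2), fact JK(3), fact JK(4), erule JK(5)[OF rA], erule JK(5)[OF rB])
  define R where "R = \<lparr>fm_L = d, fm_D = fm_D F, fm_C = fm_C F * J,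
    fm_A = \<lambda>k X. K * (fm_A F k X * J), fm_B = \<lambda>k X. K * fm_B F k X\<rparr>"
  have sel: "fm_L R = d" "fm_D R = fm_D F" "fm_C R = fm_C F * J" by (simp_all add: R_def)
  have AB: "real_A s R = (\<lambda>\<alpha>. K * (real_A s F \<alpha> * J))" "real_B s R = (\<lambda>\<alpha>. K * real_B s F \<alpha>)"
    by (auto simp: real_A_def real_B_def R_def)
  have lin: "linear_mat_map s (fm_L F) (fm_L F) (fm_A F k)" "linear_mat_map s (fm_L F) s (fm_B F k)" for k
    using F(1) by (simp_all add: fm_wf_def)
  have wf: "fm_wf s R"
    unfolding fm_wf_def sel
  proof (intro conjI allI)
    show "linear_mat_map s d d (fm_A R k)" for k
      using linear_mat_map_mult[OF linear_mat_map_mult_right[OF lin(1) JK(2)] JK(3)] by (simp add: R_def)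
    show "linear_mat_map s d s (fm_B R k)" for k
      using linear_mat_map_mult[OF lin(2) JK(3)] by (simp add: R_def)
    show "fm_D F \<in> carrier_mat s s" "fm_C F * J \<in> carrier_mat s d" using c JK(2) by auto
  qed
  have "coreach (letters s) (fm_L F) s (real_A s F) (fm_C F) (fm_L F) (1\<^sub>m (fm_L F))"
    unfolding L by (rule coreach_cong[OF F(2)[symmetric] MR(2)])
  then have red: "reduced s R"
    unfolding reduced_def sel AB using wf observable_compressed reachable_compressed[OF JK(1)] by blast
  have mod: "models scale s Y M R" if "unital_algebra scale" for scale :: "'k \<Rightarrow> 'b::ring_1 \<Rightarrow> 'b"
    by (rule models_compressed[OF that F(4)[OF that], where J = J and K = K]) (simp_all add: sel AB compression_axioms)
  show ?thesis by (intro exI[of _ R] conjI allI impI red mod[OF unital_algebra_field]) (erule mod)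
qed

lemma minimal_exists: "\<exists>R. fm_minimal s Y r R"
proof -
  obtain R where R: "reduced s R" "models (*) s Y M R" using reduced_exists by blast
  then have real: "fm_realizes s Y r R" by (intro models_realizes(1)) (simp_all add: reduced_def)
  have "fm_L R \<le> fm_L R'" if "fm_realizes s Y r R'" for R'
    by (rule system_pair.dim_le[OF realizes_system_pair[OF real R(1) that]])
  then show ?thesis using real by (auto simp: fm_minimal_def)
qed

text \<open>A minimal realization has the same number of states as a reduced one, hence is similar
  to it. Similarity is the special case of a compression with invertible \<open>J\<close>, so all
  properties of the reduced realization carry over.\<close>

lemma minimal_reduced_models:
  assumes R: "fm_minimal s Y r R"
  shows "reduced s R" "models (*) s Y M R"
    and "unital_algebra scale \<Longrightarrow> models (scale :: 'k \<Rightarrow> 'a::ring_1 \<Rightarrow> 'a) s Y M R"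
proof -
  obtain R' where R': "reduced s R'" "models (*) s Y M R'" "\<And>scale :: 'k \<Rightarrow> 'a \<Rightarrow> 'a. unital_algebra scale \<Longrightarrow> models scale s Y M R'"
    using reduced_exists by blast
  have wf': "fm_wf s R'" using R'(1) by (simp add: reduced_def)
  note real' = models_realizes(1)[OF wf' R'(2)]
  have real: "fm_realizes s Y r R" and wf: "fm_wf s R" using R by (simp_all add: fm_minimal_def fm_realizes_def)
  note c = real_carrier[OF wf] and c' = real_carrier[OF wf']
  interpret SP: system_pair "letters s" "letters s" "fm_L R'" "fm_L R" s s "real_A s R'" "real_A s R" "real_B s R'" "real_B s R" "fm_C R'" "fm_C R"
    by (rule realizes_system_pair[OF real' R'(1) real])
  have n: "fm_L R = fm_L R'" using SP.dim_le R real' by (intro antisym) (auto simp: fm_minimal_def)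
  note sim = SP.same_dim_similar[OF n]
  have T: "SP.T \<in> carrier_mat (fm_L R') (fm_L R')" using SP.T(1) n by simp
  note Ti = minv_inverse[OF sim(1) T]
  define K where "K = minv SP.T"
  have comp: "compression (letters s) (fm_L R') s s (real_A s R') (real_B s R') (fm_C R') (fm_L R) SP.T K"
  proof unfold_locales
    show "SP.T \<in> carrier_mat (fm_L R') (fm_L R)" "K \<in> carrier_mat (fm_L R) (fm_L R')" "K * SP.T = 1\<^sub>m (fm_L R)"
      using T Ti n by (simp_all add: K_def)
    have "SP.T * (K * Z) = Z" if "Z \<in> carrier_mat (fm_L R') q" for Z q
    proof -
      have "SP.T * (K * Z) = (SP.T * K) * Z" using T Ti(1) that by (simp add: K_def mult_assoc_dim)
      then show ?thesis unfolding K_def Ti(2) using that by (simp add: one_mult_dim)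
    qed
    then show "SP.T * (K * real_A s R' \<alpha>) = real_A s R' \<alpha>" "SP.T * (K * real_B s R' \<alpha>) = real_B s R' \<alpha>" for \<alpha>
      using c' by blast+
  qed
  interpret compression "letters s" "fm_L R'" s s "real_A s R'" "real_B s R'" "fm_C R'" "fm_L R" SP.T K by (rule comp)
  have cancel: "K * (SP.T * Z) = Z" if "Z \<in> carrier_mat (fm_L R') q" for Z q
  proof -
    have "K * (SP.T * Z) = (K * SP.T) * Z" using T Ti(1) that by (simp add: K_def mult_assoc_dim)
    then show ?thesis unfolding K_def Ti(3) using that by (simp add: one_mult_dim)
  qed
  have A: "real_A s R \<alpha> = K * (real_A s R' \<alpha> * SP.T)" if "\<alpha> \<in> letters s" for \<alpha>
    unfolding sim(2)[OF that, symmetric] by (rule cancel[symmetric]) (use c(1) n in simp)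
  have B: "real_B s R \<alpha> = K * real_B s R' \<alpha>" if "\<alpha> \<in> letters s" for \<alpha>
    unfolding SP.T_B[OF that, symmetric] by (rule cancel[symmetric]) (use c(2) n in simp)
  have C: "fm_C R = fm_C R' * SP.T" by (rule sim(3))
  have D: "fm_D R = fm_D R'" unfolding realizes_D[OF real] realizes_D[OF real'] ..
  show "models (*) s Y M R" by (rule models_compressed[OF unital_algebra_field R'(2) comp D C A B])
  show "models scale s Y M R" if "unital_algebra scale" for scale :: "'k \<Rightarrow> 'a::ring_1 \<Rightarrow> 'a"
    by (rule models_compressed[OF that R'(3)[OF that] comp D C A B])
  have "SP.S.rch (fm_L R') (1\<^sub>m (fm_L R'))" "SP.S.crch (fm_L R') (1\<^sub>m (fm_L R'))" using R'(1) by (simp_all add: reduced_def)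
  moreover from SP.S.rch_mult[OF this(1) J] have "SP.S.rch (fm_L R) SP.T" using T by (simp add: one_mult_dim)
  ultimately show "reduced s R"
    unfolding reduced_def C using wf A B
    by (blast intro: reach_cong[OF _ _ reachable_compressed] coreach_cong[OF _ observable_compressed] dest: sym)
qed

text \<open>Existence is the inverse of the state map \<open>T\<close>. Uniqueness rests on
  reachability: two similarities differ by a matrix that commutes with the coefficients and fixes
  the inputs, hence fixes every reachable state.\<close>

lemma minimal_uniquely_similar:
  assumes R1: "fm_minimal s Y r R1" and R2: "fm_minimal s Y r R2"
  shows "uniquely_similar s R1 R2"
proof -
  have red: "reduced s R1" "reduced s R2" using minimal_reduced_models(1) R1 R2 by blast+
  have real: "fm_realizes s Y r R1" "fm_realizes s Y r R2" using R1 R2 by (simp_all add: fm_minimal_def)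
  have wf: "fm_wf s R1" "fm_wf s R2" using real by (simp_all add: fm_realizes_def)
  have n: "fm_L R2 = fm_L R1" using R1 R2 real unfolding fm_minimal_def by (meson antisym)
  let ?n = "fm_L R1"
  note c1 = real_carrier[OF wf(1)] and c2 = real_carrier[OF wf(2), unfolded n]
  interpret SP: system_pair "letters s" "letters s" ?n "fm_L R2" s s "real_A s R1" "real_A s R2" "real_B s R1" "real_B s R2" "fm_C R1" "fm_C R2"
    by (rule realizes_system_pair[OF real(1) red(1) real(2)])
  note sim = SP.same_dim_similar[OF n]
  have T: "SP.T \<in> carrier_mat ?n ?n" using SP.T(1) n by simp
  define S where "S = minv SP.T"
  note S = minv_inverse[OF sim(1) T, folded S_def]
  have invS: "invertible_mat S" by (rule invertible_matI[OF S(1) S(3,2)])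
  have mS: "minv S = SP.T" by (rule minv_eqI[OF S(1) T S(3,2)])
  have lin: "linear_mat_map s ?n ?n (fm_A R1 k)" "linear_mat_map s ?n s (fm_B R1 k)"
    "linear_mat_map s ?n ?n (fm_A R2 k)" "linear_mat_map s ?n s (fm_B R2 k)" for k
    using wf n by (simp_all add: fm_wf_def)
  have cancel: "S * (SP.T * Z) = Z" if "Z \<in> carrier_mat ?n q" for Z q
  proof -
    have "S * (SP.T * Z) = (S * SP.T) * Z" using T S(1) that by (simp add: mult_assoc_dim)
    then show ?thesis unfolding S(3) using that by (simp add: one_mult_dim)
  qed
  have A: "real_A s R2 \<alpha> = S * (real_A s R1 \<alpha> * SP.T)" if "\<alpha> \<in> letters s" for \<alpha>
    unfolding sim(2)[OF that, symmetric] by (rule cancel[symmetric]) (rule c2(1))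
  have B: "real_B s R2 \<alpha> = S * real_B s R1 \<alpha>" if "\<alpha> \<in> letters s" for \<alpha>
    unfolding SP.T_B[OF that, symmetric] by (rule cancel[symmetric]) (rule c2(2))
  have ex: "fm_B R2 k X = S * fm_B R1 k X \<and> fm_A R2 k X = S * fm_A R1 k X * minv S" if X: "X \<in> carrier_mat s s" for k X
  proof
    show "fm_B R2 k X = S * fm_B R1 k X"
      by (rule linear_mat_map_eqI[OF lin(4) linear_mat_map_mult[OF lin(2) S(1)] _ X])
        (use B[of "(k, a, b)" for a b] in \<open>auto simp: real_B_def letters_def\<close>)
    have "fm_A R2 k X = S * (fm_A R1 k X * SP.T)"
      by (rule linear_mat_map_eqI[OF lin(3) linear_mat_map_mult[OF linear_mat_map_mult_right[OF lin(1) T] S(1)] _ X])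
        (use A[of "(k, a, b)" for a b] in \<open>auto simp: real_A_def letters_def\<close>)
    moreover have "fm_A R1 k X \<in> carrier_mat ?n ?n" using lin(1)[of k] X by (simp add: linear_mat_map_def)
    ultimately show "fm_A R2 k X = S * fm_A R1 k X * minv S" unfolding mS using S(1) T by (simp add: mult_assoc_dim)
  qed
  have unique: "S' = S" if S': "S' \<in> carrier_mat ?n ?n" "invertible_mat S'"
    and sim': "\<And>k X. X \<in> carrier_mat s s \<Longrightarrow> fm_B R2 k X = S' * fm_B R1 k X \<and> fm_A R2 k X = S' * fm_A R1 k X * minv S'" for S'
  proof -
    note i = minv_inverse[OF S'(2,1)]
    have A': "real_A s R2 \<alpha> * S' = S' * real_A s R1 \<alpha>" and B': "real_B s R2 \<alpha> = S' * real_B s R1 \<alpha>" for \<alpha>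
    proof -
      obtain k a b where \<alpha>: "\<alpha> = (k, a, b)" by (cases \<alpha>)
      show "real_B s R2 \<alpha> = S' * real_B s R1 \<alpha>" using sim'[OF unit_mat_carrier] by (simp add: real_B_def \<alpha>)
      have "real_A s R2 \<alpha> = S' * real_A s R1 \<alpha> * minv S'" using sim'[OF unit_mat_carrier] by (simp add: real_A_def \<alpha>)
      then show "real_A s R2 \<alpha> * S' = S' * real_A s R1 \<alpha>" using S' i c1(1)[of \<alpha>] by (simp add: mult_assoc_dim mult_one_dim)
    qed
    \<comment> \<open>The discrepancy between the competitor \<open>S'\<close> and the inverse of
      \<open>T\<close>; it is shown to be the identity.\<close>
    define P where "P = SP.T * S'"
    have P: "P \<in> carrier_mat ?n ?n" using T S' by (simp add: P_def)
    have PA: "P * real_A s R1 \<alpha> = real_A s R1 \<alpha> * P" if "\<alpha> \<in> letters s" for \<alpha>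
    proof -
      have "P * real_A s R1 \<alpha> = SP.T * (real_A s R2 \<alpha> * S')" unfolding A' P_def using T S' c1(1)[of \<alpha>] by (simp add: mult_assoc_dim)
      also have "\<dots> = (SP.T * real_A s R2 \<alpha>) * S'" using T S' c2(1)[of \<alpha>] by (simp add: mult_assoc_dim)
      also have "\<dots> = real_A s R1 \<alpha> * P" unfolding sim(2)[OF that] P_def using T S' c1(1)[of \<alpha>] by (simp add: mult_assoc_dim)
      finally show ?thesis .
    qed
    have PB: "P * real_B s R1 \<alpha> = real_B s R1 \<alpha>" if "\<alpha> \<in> letters s" for \<alpha>
    proof -
      have "P * real_B s R1 \<alpha> = SP.T * (S' * real_B s R1 \<alpha>)" unfolding P_def using T S' c1(2)[of \<alpha>] by (simp add: mult_assoc_dim)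
      also have "S' * real_B s R1 \<alpha> = real_B s R2 \<alpha>" by (rule B'[symmetric])
      finally show ?thesis unfolding SP.T_B[OF that] .
    qed
    have "P * V = V" if "SP.S.rch k V" for k V
      using that
    proof (induction k V rule: reach.induct)
      case (reach_zero k)
      then show ?case using P by (simp add: mult_zero_dim)
    next
      case (reach_base y Q k)
      have "P * (real_B s R1 y * Q) = (P * real_B s R1 y) * Q" using P c1(2)[of y] reach_base(2) by (simp add: mult_assoc_dim)
      then show ?case unfolding PB[OF reach_base(1)] .
    next
      case (reach_step \<alpha> k V)
      note Vc = SP.S.rch_carrier[OF reach_step(2)]
      have "P * (real_A s R1 \<alpha> * V) = (P * real_A s R1 \<alpha>) * V" using P c1(1)[of \<alpha>] Vc by (simp add: mult_assoc_dim)
      also have "\<dots> = real_A s R1 \<alpha> * (P * V)" unfolding PA[OF reach_step(1)] using P c1(1)[of \<alpha>] Vc by (simp add: mult_assoc_dim)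
      finally show ?case unfolding reach_step(3) .
    next
      case (reach_add k V W)
      then show ?case using P SP.S.rch_carrier[OF reach_add(1)] SP.S.rch_carrier[OF reach_add(2)] by (simp add: mult_add_dim)
    qed
    from this[OF SP.reachable] have "P = 1\<^sub>m ?n" using P by (simp add: mult_one_dim)
    then have "S = S * (SP.T * S')" unfolding P_def using S(1) by (simp add: mult_one_dim)
    then show ?thesis unfolding cancel[OF S'(1)] ..
  qed
  have C: "fm_C R2 = fm_C R1 * minv S" unfolding mS by (rule sim(3))
  have D: "fm_D R1 = fm_D R2" unfolding realizes_D[OF real(1)] realizes_D[OF real(2)] ..
  show ?thesis
    unfolding uniquely_similar_def
  proof (intro conjI ex1I[of _ S])
    fix S' assume "S' \<in> carrier_mat ?n ?n \<and> invertible_mat S' \<and> fm_C R2 = fm_C R1 * minv S' \<and>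
      (\<forall>k. \<forall>X\<in>carrier_mat s s. fm_B R2 k X = S' * fm_B R1 k X \<and> fm_A R2 k X = S' * fm_A R1 k X * minv S')"
    then show "S' = S" by (intro unique) auto
  next
    show "\<forall>k. \<forall>X\<in>carrier_mat s s. fm_B R2 k X = S * fm_B R1 k X \<and> fm_A R2 k X = S * fm_A R1 k X * minv S"
      using ex by blast
  qed (use n D C invS S(1) in auto)
qed

end

subsection \<open>Evaluation at block diagonal tuples\<close>

lemma kron_one_left_invertible:
  fixes A :: "'k::field mat"
  assumes A: "A \<in> carrier_mat n n" and s: "s > 0"
  shows "invertible_mat (kron (1\<^sub>m s) A) \<longleftrightarrow> invertible_mat A"
    and "invertible_mat A \<Longrightarrow> minv (kron (1\<^sub>m s) A) = kron (1\<^sub>m s) (minv A)"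
proof -
  note amp = unital_algebra.amp_invertible[OF unital_algebra_field _ A, of s, unfolded amp_def scalar_mat_field]
  show "invertible_mat A \<Longrightarrow> minv (kron (1\<^sub>m s) A) = kron (1\<^sub>m s) (minv A)" by (rule amp(2))
  show "invertible_mat (kron (1\<^sub>m s) A) \<longleftrightarrow> invertible_mat A"
  proof
    assume inv: "invertible_mat (kron (1\<^sub>m s) A)"
    show "invertible_mat A"
    proof (rule injective_invertible[OF A])
      fix z assume z: "z \<in> carrier_mat n 1" "A * z = 0\<^sub>m n 1"
      have k: "kron (1\<^sub>m s) A \<in> carrier_mat (s * n) (s * n)" "kron (1\<^sub>m s) z \<in> carrier_mat (s * n) (s * 1)"
        using A z(1) by (auto intro!: kron_carrier)
      note w = minv_inverse[OF inv k(1)]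
      have "kron (1\<^sub>m s) A * kron (1\<^sub>m s) z = kron (1\<^sub>m s) (A * z)"
        using A z(1) by (subst kron_mult) (auto simp: one_mult_dim)
      then have "kron (1\<^sub>m s) A * kron (1\<^sub>m s) z = 0\<^sub>m (s * n) (s * 1)" unfolding z(2) by (simp add: kron_zero_right)
      then have "minv (kron (1\<^sub>m s) A) * (kron (1\<^sub>m s) A * kron (1\<^sub>m s) z) = 0\<^sub>m (s * n) (s * 1)"
        using w(1) by (simp add: mult_zero_dim)
      moreover have "minv (kron (1\<^sub>m s) A) * (kron (1\<^sub>m s) A * kron (1\<^sub>m s) z) = (minv (kron (1\<^sub>m s) A) * kron (1\<^sub>m s) A) * kron (1\<^sub>m s) z"
        using w(1) k A z(1) by (intro mult_assoc_dim[symmetric]) auto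
      ultimately have kz: "kron (1\<^sub>m s) z = 0\<^sub>m (s * n) (s * 1)" unfolding w(3) using k(2) z(1) by (simp add: one_mult_dim)
      show "z = 0\<^sub>m n 1" (is "_ = ?r")
      proof (rule eq_matI)
        fix i j assume "i < dim_row ?r" "j < dim_col ?r"
        then have ij: "i < n" "j < 1" by auto
        have "kron (1\<^sub>m s) z $$ (0 * n + i, 0 * 1 + j) = z $$ (i, j)"
          by (subst kron_index[OF one_carrier_mat[of s] z(1) s ij(1) s ij(2)]) (use s in simp)
        moreover have "i < s * n" using block_index_less[OF s ij(1)] by simp
        ultimately show "z $$ (i, j) = ?r $$ (i, j)" unfolding kz using ij s by simp
      qed (use z(1) in auto)
    qed
  qed (rule amp(1))
qed

lemma nc_eval_diagonal:
  fixes X :: "'d \<Rightarrow> 'k::field mat"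
  assumes X: "X \<in> tuples n" and s: "s > 0"
  defines "Z \<equiv> \<lambda>k. kron (1\<^sub>m s) (X k)"
  shows "(nc_defined (s * n) Z e \<longleftrightarrow> nc_defined n X e) \<and> (nc_defined n X e \<longrightarrow> nc_eval (s * n) Z e = kron (1\<^sub>m s) (nc_eval n X e))"
proof (induction e)
  case (Const c)
  have "c \<cdot>\<^sub>m 1\<^sub>m (s * n) = kron (1\<^sub>m s) (c \<cdot>\<^sub>m 1\<^sub>m n)" (is "?l = ?r")
  proof (rule eq_matI)
    fix i j assume "i < dim_row ?r" "j < dim_col ?r"
    then have ij: "i < s * n" "j < s * n" by auto
    then have "i mod n < n" "j mod n < n" using block_div_less by blast+
    moreover have "1\<^sub>m (s * n) $$ (i, j) = kron (1\<^sub>m s) (1\<^sub>m n :: 'k mat) $$ (i, j)" by (simp add: kron_one)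
    ultimately show "?l $$ (i, j) = ?r $$ (i, j)"
      using ij by (simp add: kron_def)
  qed auto
  then show ?case by simp
next
  case (Var k)
  then show ?case by (simp add: Z_def)
next
  case (Add e f)
  have "kron (1\<^sub>m s) E + kron (1\<^sub>m s) F = kron (1\<^sub>m s) (E + F)" if "E \<in> carrier_mat n n" "F \<in> carrier_mat n n" for E F :: "'k mat"
    using that by (intro eq_matI) (auto simp: kron_def distrib_left block_div_less)
  then show ?case using Add nc_eval_carrier[OF X] by auto
next
  case (Mul e f)
  have "kron (1\<^sub>m s) E * kron (1\<^sub>m s) F = kron (1\<^sub>m s) (E * F)" if "E \<in> carrier_mat n n" "F \<in> carrier_mat n n" for E F :: "'k mat"
    using that by (subst kron_mult) (auto simp: one_mult_dim)
  then show ?case using Mul nc_eval_carrier[OF X] by auto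
next
  case (Inv e)
  then show ?case using kron_one_left_invertible[OF nc_eval_carrier[OF X, of e] s] by auto
qed

context function_pencil
begin

text \<open>The same expression serves at X and at I_s \<otimes> X: its inverses exist at both
  points or at neither. This reduces tuples of any size n to those of size s n.\<close>

lemma rat_diagonal:
  assumes n: "n > 0" and X: "X \<in> tuples n"
  shows "(\<lambda>k. kron (1\<^sub>m s) (X k)) \<in> rat_dom (s * n) r \<longleftrightarrow> X \<in> rat_dom n r"
    and "X \<in> rat_dom n r \<Longrightarrow> rat_val (s * n) r (\<lambda>k. kron (1\<^sub>m s) (X k)) = kron (1\<^sub>m s) (rat_val n r X)"
proof -
  let ?Z = "\<lambda>k. kron (1\<^sub>m s) (X k)"
  have Z: "?Z \<in> tuples (s * n)" using X by (auto simp: tuples_def)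
  note d = nc_eval_diagonal[OF X s0]
  show "?Z \<in> rat_dom (s * n) r \<longleftrightarrow> X \<in> rat_dom n r"
    using d X Z by (auto simp: rat_dom_def nc_dom_def)
  assume "X \<in> rat_dom n r"
  then obtain e where e: "e \<in> r" "X \<in> nc_dom n e" by (auto simp: rat_dom_def)
  then have "?Z \<in> nc_dom (s * n) e" using d Z by (simp add: nc_dom_def)
  moreover have "s * n > 0" using n s0 by simp
  ultimately show "rat_val (s * n) r ?Z = kron (1\<^sub>m s) (rat_val n r X)"
    using rat_val_eq[OF e n] rat_val_eq[OF e(1), of ?Z "s * n"] d e(2) by (simp add: nc_dom_def)
qed

theorem minimal_diagonal:
  assumes R: "fm_minimal s Y r R" and n: "n > 0"
  shows "rat_dom n r = {X \<in> tuples n. (\<lambda>k. kron (1\<^sub>m s) (X k)) \<in> fm_Omega s n Y R}"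
    and "X \<in> rat_dom n r \<Longrightarrow> kron (1\<^sub>m s) (rat_val n r X) = fm_eval s n Y R (\<lambda>k. kron (1\<^sub>m s) (X k))"
proof -
  have real: "fm_realizes s Y r R" and wf: "fm_wf s R" using R by (simp_all add: fm_minimal_def fm_realizes_def)
  note om = models_realizes(2)[OF wf minimal_reduced_models(2)[OF R] n, symmetric]
  have t: "X \<in> tuples n" if "X \<in> rat_dom n r" for X using that by (auto simp: rat_dom_def nc_dom_def)
  show "rat_dom n r = {X \<in> tuples n. (\<lambda>k. kron (1\<^sub>m s) (X k)) \<in> fm_Omega s n Y R}"
    unfolding om using rat_diagonal(1)[OF n] t by auto
  assume X: "X \<in> rat_dom n r"
  then show "kron (1\<^sub>m s) (rat_val n r X) = fm_eval s n Y R (\<lambda>k. kron (1\<^sub>m s) (X k))"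
    using rat_diagonal[OF n t[OF X]] real n unfolding fm_realizes_def by auto
qed

text \<open>One inclusion holds because the linearization of any representing expression is
  dominated by \<open>M\<close>. For the other, the expression that inverts the whole pencil
  represents \<open>r\<close> and is defined wherever \<open>M\<close> is invertible.\<close>

theorem minimal_algebra:
  fixes scale :: "'k \<Rightarrow> 'a::ring_1 \<Rightarrow> 'a"
  assumes R: "fm_minimal s Y r R" and alg: "unital_algebra scale" and sf: "stably_finite TYPE('a)"
  shows "alg_rat_dom scale r = {a. (\<lambda>k. a k \<cdot>\<^sub>m 1\<^sub>m s) \<in> alg_Omega scale s Y R}"
    and "a \<in> alg_rat_dom scale r \<Longrightarrow> alg_rat_val scale r a \<cdot>\<^sub>m 1\<^sub>m s = alg_eval scale s Y R (\<lambda>k. a k \<cdot>\<^sub>m 1\<^sub>m s)"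
proof -
  interpret unital_algebra scale by (rule alg)
  have wf: "fm_wf s R" using R by (simp add: fm_minimal_def fm_realizes_def)
  note mod = minimal_reduced_models(3)[OF R alg]
  define x where "x a = (\<lambda>k. mat 1 1 (\<lambda>_. a k))" for a :: "'d \<Rightarrow> 'a"
  have x: "x a \<in> tuples 1" for a by (simp add: x_def tuples_def)
  \<comment> \<open>For 1 \<times> 1 tuples the order of the Kronecker factors is immaterial, so I_s
    \<otimes> a is the inflation used for pencils.\<close>
  have infl: "inflate s (x a) = (\<lambda>k. a k \<cdot>\<^sub>m 1\<^sub>m s)" for a
    by (rule ext, rule eq_matI) (auto simp: inflate_def x_def kron_def)
  have t: "inflate s (x a) \<in> tuples (1 * s)" for a by (rule inflate_tuples[OF x])
  have lam: "invertible_mat (real_Lambda scale s 1 Y R (inflate s (x a))) \<longleftrightarrow> invertible_mat (pen_at scale 1 M (x a))" for a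
  proof -
    have "invertible_mat (real_Lambda scale s 1 Y R (inflate s (x a))) \<longleftrightarrow> invertible_mat (pen_at scale (1 * s) M (inflate s (x a)))"
      using mod t[of a] unfolding models_def by blast
    also have "\<dots> \<longleftrightarrow> invertible_mat (pen_at scale 1 M (x a))"
      unfolding pen_at_inflate[OF M_wf x] by (rule kron_one_invertible_iff[OF pform_carrier s0])
    finally show ?thesis .
  qed
  obtain E where E: "has_size E 1 1"
    "\<And>n X. X \<in> tuples n \<Longrightarrow> invertible_mat (pen_at scale n M X) \<Longrightarrow> mx_defined (\<lambda>c. scale c 1) n X E"
    "\<And>n X. X \<in> tuples n \<Longrightarrow> invertible_mat (pen_at (*) n M X) \<Longrightarrow>
       mx_defined (\<lambda>c. c) n X E \<and> mx_eval (\<lambda>c. c) n X E = pen_val (*) n M X"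
    using pencil_mat_expr[OF M_wf, where 'a = 'a] alg by metis
  have "mx_represents E r"
    unfolding mx_represents_def
  proof (intro conjI allI impI ballI)
    show "\<exists>n>0. mx_dom n E \<noteq> {}"
      using E(3)[OF Y_tuples regular_atD(3)[OF M_regular]] s0 Y_tuples by (auto simp: mx_dom_def)
    fix n X assume n: "n > 0" and "X \<in> mx_dom n E \<inter> rat_dom n r"
    then have X: "X \<in> rat_dom n r" by simp
    then show "mx_eval (\<lambda>c. c) n X E = rat_val n r X"
      using E(3)[of X n] rat_val_pencil[OF X n] unfolding rat_dom_pencil[OF n] by simp
  qed (rule E(1))
  then have dom: "a \<in> alg_rat_dom scale r \<longleftrightarrow> invertible_mat (pen_at scale 1 M (x a))" for a
    using represents_dominated(1)[OF alg sf _ _ x] E(2)[OF x] unfolding alg_rat_dom_def alg_mx_defined_def x_def by blast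
  show "alg_rat_dom scale r = {a. (\<lambda>k. a k \<cdot>\<^sub>m 1\<^sub>m s) \<in> alg_Omega scale s Y R}"
    using dom lam t unfolding alg_Omega_def alg_Lambda_eq[OF wf Y_tuples alg] infl[symmetric] by auto
  assume a: "a \<in> alg_rat_dom scale r"
  then have inv: "invertible_mat (pen_at scale 1 M (x a))" unfolding dom .
  \<comment> \<open>All representing expressions defined at \<open>a\<close> take the value of
    \<open>M\<close>, so the description in \<open>alg_rat_val\<close> has a unique
    solution.\<close>
  have val: "alg_mx_eval scale a e = pen_val scale 1 M (x a)" if "mx_represents e r" "alg_mx_defined scale a e" for e
    using represents_dominated(2)[OF alg sf that(1) _ x, of a] that(2) unfolding alg_mx_defined_def alg_mx_eval_def x_def by simp
  have "alg_rat_val scale r a = pen_val scale 1 M (x a) $$ (0, 0)"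
    unfolding alg_rat_val_def using a val by (intro the_equality) (auto simp: alg_rat_dom_def)
  moreover have "alg_eval scale s Y R (inflate s (x a)) = pen_val scale (1 * s) M (inflate s (x a))"
  proof -
    have "invertible_mat (pen_at scale (1 * s) M (inflate s (x a)))"
      unfolding pen_at_inflate[OF M_wf x] by (rule kron_one_invertible(1)[OF inv pform_carrier])
    then have "real_val scale s 1 Y R (inflate s (x a)) = pen_val scale (1 * s) M (inflate s (x a))"
      using mod t[of a] unfolding models_def by blast
    then show ?thesis using alg_eval_eq[OF wf Y_tuples alg] inv lam by simp
  qed
  moreover have "pen_val scale (1 * s) M (inflate s (x a)) = kron (pen_val scale 1 M (x a)) (1\<^sub>m s)"
    by (rule pen_val_inflate[OF M_wf x inv])
  moreover have "kron (pen_val scale 1 M (x a)) (1\<^sub>m s) = pen_val scale 1 M (x a) $$ (0, 0) \<cdot>\<^sub>m 1\<^sub>m s"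
    using pen_val_carrier[OF M_wf inv] by (intro eq_matI) (auto simp: kron_def)
  ultimately show "alg_rat_val scale r a \<cdot>\<^sub>m 1\<^sub>m s = alg_eval scale s Y R (\<lambda>k. a k \<cdot>\<^sub>m 1\<^sub>m s)"
    unfolding infl by simp
qed

end

theorem theorem3:
  fixes r :: "('d::finite, 'k::field) nc_expr set"
    and s :: nat
    and Y :: "'d \<Rightarrow> 'k mat"
  assumes "r \<in> nc_rat_functions"
    and "s > 0"
    and "Y \<in> rat_dom s r"
  shows "(\<exists>R. fm_minimal s Y r R) \<and>
    (\<forall>R1 R2. fm_minimal s Y r R1 \<and> fm_minimal s Y r R2 \<longrightarrow> uniquely_similar s R1 R2) \<and>
    (\<forall>R. fm_minimal s Y r R \<longrightarrow>
      (\<forall>m>0. rat_dom (s * m) r = fm_Omega s m Y R \<and>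
         (\<forall>X \<in> rat_dom (s * m) r. rat_val (s * m) r X = fm_eval s m Y R X)) \<and>
      (\<forall>n>0. rat_dom n r = {X \<in> tuples n. (\<lambda>k. kron (1\<^sub>m s) (X k)) \<in> fm_Omega s n Y R} \<and>
         (\<forall>X \<in> rat_dom n r.
            kron (1\<^sub>m s) (rat_val n r X) = fm_eval s n Y R (\<lambda>k. kron (1\<^sub>m s) (X k)))) \<and>
      (\<forall>scale :: 'k \<Rightarrow> 'a::ring_1 \<Rightarrow> 'a.
         unital_algebra scale \<and> stably_finite TYPE('a) \<longrightarrow>
         alg_rat_dom scale r = {a. (\<lambda>k. a k \<cdot>\<^sub>m 1\<^sub>m s) \<in> alg_Omega scale s Y R} \<and>
         (\<forall>a \<in> alg_rat_dom scale r.
            alg_rat_val scale r a \<cdot>\<^sub>m 1\<^sub>m s = alg_eval scale s Y R (\<lambda>k. a k \<cdot>\<^sub>m 1\<^sub>m s))))"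
proof -
  obtain M e\<^sub>0 where "function_pencil r s Y M e\<^sub>0" using function_pencil_exists[OF assms] by blast
  then interpret function_pencil r s Y M e\<^sub>0 .
  have "rat_dom (s * m) r = fm_Omega s m Y R" "X \<in> rat_dom (s * m) r \<Longrightarrow> rat_val (s * m) r X = fm_eval s m Y R X"
    if R: "fm_minimal s Y r R" and m: "m > 0" for R m X
    using models_realizes(2)[OF _ minimal_reduced_models(2)[OF R] m] R m by (auto simp: fm_minimal_def fm_realizes_def)
  note fm = this
  show ?thesis
  proof (intro conjI allI impI ballI; (elim conjE)?)
    show "\<exists>R. fm_minimal s Y r R" by (rule minimal_exists)
    show "uniquely_similar s R1 R2" if "fm_minimal s Y r R1" "fm_minimal s Y r R2" for R1 R2
      using that by (rule minimal_uniquely_similar)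
    fix R assume R: "fm_minimal s Y r R"
    show "rat_dom (s * m) r = fm_Omega s m Y R" if "m > 0" for m by (rule fm(1)[OF R that])
    show "rat_val (s * m) r X = fm_eval s m Y R X" if "m > 0" "X \<in> rat_dom (s * m) r" for m X by (rule fm(2)[OF R that])
    show "rat_dom n r = {X \<in> tuples n. (\<lambda>k. kron (1\<^sub>m s) (X k)) \<in> fm_Omega s n Y R}" if "n > 0" for n
      by (rule minimal_diagonal(1)[OF R that])
    show "kron (1\<^sub>m s) (rat_val n r X) = fm_eval s n Y R (\<lambda>k. kron (1\<^sub>m s) (X k))" if "n > 0" "X \<in> rat_dom n r" for n X
      by (rule minimal_diagonal(2)[OF R that])
    fix scale :: "'k \<Rightarrow> 'a \<Rightarrow> 'a" assume scale: "unital_algebra scale" "stably_finite TYPE('a)"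
    show "alg_rat_dom scale r = {a. (\<lambda>k. a k \<cdot>\<^sub>m 1\<^sub>m s) \<in> alg_Omega scale s Y R}" by (rule minimal_algebra(1)[OF R scale])
    show "alg_rat_val scale r a \<cdot>\<^sub>m 1\<^sub>m s = alg_eval scale s Y R (\<lambda>k. a k \<cdot>\<^sub>m 1\<^sub>m s)" if "a \<in> alg_rat_dom scale r" for a
      by (rule minimal_algebra(2)[OF R scale that])
  qed
qed

end
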